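(* Let $\psi$ be the solution on $\mathbb{R}^d\times[0,T]$ of $$i\,\partial_t\psi(x,t)=-\Delta\psi(x,t)+V(x)\psi(x,t)+\theta|\psi(x,t)|^2\psi(x,t),\qquad \psi(x,0)=\psi_0(x),$$ where $\theta\in\mathbb{R}$, $V$ is real-valued and quasiperiodic, and $\psi(\cdot,t)$ is quasiperiodic for $0\le t\le T$, both with projection matrix $P\in\mathbb{R}^{d\times n}$. Let $V_p$ and $\psi_p(\cdot,t)$ be the corresponding parent functions on $\mathbb{T}^n$. Assume that $V$ is a $\mathcal{C}^1_{QP}$-smooth function and that, for some integer $\alpha>\max\{4,n/4\}$, $\|V_p\|_{X_\alpha}\le C_V$, $\psi_p(\cdot,t)\in X_\alpha(\mathbb{T}^n)$ for $0\le t\le T$, and $\sup\{\|\psi_p(\cdot,t)\|_{X_\alpha}:0\le t\le T\}\le C_p$. Let $\tau=T/M$ and $t_m=m\tau$ with $M\ge1$ an integer, let $N\ge 1$ be an integer, and let $\Psi_m$ be defined by the fully discrete Strang splitting projection scheme $$\Psi_0=I_N\psi_0,\qquad \Psi_m=e^{i\frac{\tau}{2}\Delta}\,I_N\Big(e^{-i\tau(V+\theta|\varphi_{m-1}|^2)}\,\varphi_{m-1}\Big),\quad \varphi_{m-1}=e^{i\frac{\tau}{2}\Delta}I_N\Psi_{m-1},\quad 1\le m\le M.$$ Then $$\|\Psi_m-\psi(\cdot,t_m)\|\le C\,(\tau^2+N^{-\alpha}),\qquad 0\le m\le M,$$ where the constant $C>0$ depends on $C_V$, $C_p$, $d$, $\alpha$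 and $T$ (and not on $\tau$, $N$, $m$).
   Context: Fixed data: integers $d,n\ge1$, $\theta\in\mathbb{R}$, $T>0$, and a projection matrix $P=(p_1,\dots,p_n)\in\mathbb{R}^{d\times n}$, i.e. a matrix whose columns are linearly independent over $\mathbb{Q}$. Let $\mathbb{T}^n=\mathbb{R}^n/2\pi\mathbb{Z}^n$. A complex-valued function $\phi$ on $\mathbb{R}^d$ is quasiperiodic (with projection matrix $P$) if $\phi(x)=\phi_p(P^Tx)$ for a periodic function $\phi_p$ on $\mathbb{T}^n$, called the parent function of $\phi$. The parent of a sum or product is the sum or product of parents. The Fourier coefficients are $\hat\phi_{p,k}=\frac{1}{|\mathbb{T}^n|}\int_{\mathbb{T}^n}e^{-ik\cdot y}\phi_p(y)\,dy$, and the Fourier series of $\phi$ is $\sum_{k\in\mathbb{Z}^n}\hat\phi_{p,k}e^{i(Pk)\cdot x}$. $\mathcal{C}^1_{QP}(\mathbb{R}^d)$ is the space of quasiperiodic functions on $\mathbb{R}^d$ with continuous derivatives up to order 1, normed by $\sum_{|m|\le1}\sup_x|\partial_x^m\phi|$. $\|\phi\|$ denotes the $L^2_{QP}$ norm: $\|\phi\|^2=\lim_{R\to\infty}\frac{1}{(2R)^d}\int_{[-R,R]^d}|\phi(x)|^2dx=\sum_{k\in\mathbb{Z}^n}|\hat\phi_{p,k}|^2$. $X_\alpha(\mathbb{T}^n)$ is the space of $U=\sum_k\hat U_ke^{ik\cdot y}\in L^2(\mathbb{T}^n)$ with $\|U\|_{X_\alpha}^2=\sum_{k\in\mathbb{Z}^n}(1+\|k\|^{4\alpha})|\hat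 U_k|^2<\infty$, where $\|k\|$ is the Euclidean norm. $e^{it\Delta}$ acts on quasiperiodic functions by $e^{it\Delta}\sum_kc_ke^{i(Pk)\cdot x}=\sum_ke^{-it\|Pk\|^2}c_ke^{i(Pk)\cdot x}$. Interpolation operator: let $K_N^n=\{k\in\mathbb{Z}^n:-N\le k_j<N\}$ and let $\mathbb{T}^n_N$ be the grid of the $(2N)^n$ points $y_j=\frac{\pi}{N}j$, $j\in\{0,\dots,2N-1\}^n$. For quasiperiodic $\phi$, $I_N\phi(x)=\sum_{k\in K_N^n}\tilde\phi_ke^{i(Pk)\cdot x}$ with $\tilde\phi_k=\frac{1}{(2N)^n}\sum_{y_j\in\mathbb{T}^n_N}\phi_p(y_j)e^{-ik\cdot y_j}$. *)

theory Defs
  imports "HOL-Analysis.Analysis"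
begin

text \<open>The dimensions \<open>d\<close> and \<open>n\<close> are the cardinalities of the finite index types \<open>'d\<close> and \<open>'n\<close>.
  A \<open>d \<times> n\<close> matrix has type \<^typ>\<open>real^'n^'d\<close>, so that \<^term>\<open>P *v k\<close> lies in \<open>\<real>\<^sup>d\<close> and
  \<^term>\<open>transpose P *v x\<close> in \<open>\<real>\<^sup>n\<close>. Functions on the torus are \<open>2\<pi>\<close>-periodic functions on \<open>\<real>\<^sup>n\<close>.\<close>

definition projection_matrix :: "real^'n^'d \<Rightarrow> bool" where
  "projection_matrix P \<longleftrightarrow>
     (\<forall>q :: 'n \<Rightarrow> rat. (\<Sum>j\<in>UNIV. of_rat (q j) *\<^sub>R column j P) = 0 \<longrightarrow> (\<forall>j. q j = 0))"

definition rvec :: "int^'n \<Rightarrow> real^'n" where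
  "rvec k = (\<chi> j. real_of_int (k $ j))"

definition torus_periodic :: "(real^'n \<Rightarrow> complex) \<Rightarrow> bool" where
  "torus_periodic U \<longleftrightarrow> (\<forall>y j. U (y + (2 * pi) *\<^sub>R axis j 1) = U y)"

text \<open>Parent functions are continuous. Without this the parent is not determined by the
  quasiperiodic function: for \<open>d < n\<close> the points \<open>P\<^sup>T x\<close> form a dense null set of the torus.
  For a projection matrix a continuous parent is unique, so the definite description in
  \<open>parent\<close> denotes it.\<close>

definition is_parent :: "real^'n^'d \<Rightarrow> (real^'n \<Rightarrow> complex) \<Rightarrow> (real^'d \<Rightarrow> complex) \<Rightarrow> bool" where
  "is_parent P U \<phi> \<longleftrightarrow>
     continuous_on UNIV U \<and> torus_periodic U \<and> (\<forall>x. \<phi> x = U (transpose P *v x))"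

definition quasiperiodic :: "real^'n^'d \<Rightarrow> (real^'d \<Rightarrow> complex) \<Rightarrow> bool" where
  "quasiperiodic P \<phi> \<longleftrightarrow> (\<exists>U. is_parent P U \<phi>)"

definition parent :: "real^'n^'d \<Rightarrow> (real^'d \<Rightarrow> complex) \<Rightarrow> real^'n \<Rightarrow> complex" where
  "parent P \<phi> = (THE U. is_parent P U \<phi>)"

definition torus_cell :: "(real^'n) set" where
  "torus_cell = cbox 0 (\<chi> j. 2 * pi)"

definition fourier_coeff :: "(real^'n \<Rightarrow> complex) \<Rightarrow> int^'n \<Rightarrow> complex" where
  "fourier_coeff U k =
     of_real (1 / (2 * pi) ^ CARD('n)) *
     (LINT y:torus_cell|lborel. cis (- (rvec k \<bullet> y)) * U y)"

definition X_space :: "nat \<Rightarrow> (real^'n \<Rightarrow> complex) set" where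
  "X_space \<alpha> = {U. torus_periodic U \<and> U \<in> borel_measurable lborel \<and>
     set_integrable lborel torus_cell (\<lambda>y. (cmod (U y))\<^sup>2) \<and>
     (\<lambda>k. (1 + norm (rvec k) ^ (4 * \<alpha>)) * (cmod (fourier_coeff U k))\<^sup>2) summable_on UNIV}"

definition X_norm :: "nat \<Rightarrow> (real^'n \<Rightarrow> complex) \<Rightarrow> real" where
  "X_norm \<alpha> U =
     sqrt (\<Sum>\<^sub>\<infinity>k\<in>UNIV. (1 + norm (rvec k) ^ (4 * \<alpha>)) * (cmod (fourier_coeff U k))\<^sup>2)"

definition qp_norm :: "(real^'d \<Rightarrow> complex) \<Rightarrow> real" where
  "qp_norm \<phi> = sqrt (Lim at_top (\<lambda>R::real.
     1 / (2 * R) ^ CARD('d) * (LINT x:cbox (\<chi> j. - R) (\<chi> j. R)|lborel. (cmod (\<phi> x))\<^sup>2)))"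

definition partial_differentiable :: "'d \<Rightarrow> (real^'d \<Rightarrow> complex) \<Rightarrow> bool" where
  "partial_differentiable j f \<longleftrightarrow> (\<forall>x. (\<lambda>s::real. f (x + s *\<^sub>R axis j 1)) differentiable (at 0))"

definition partial :: "'d \<Rightarrow> (real^'d \<Rightarrow> complex) \<Rightarrow> real^'d \<Rightarrow> complex" where
  "partial j f x = vector_derivative (\<lambda>s::real. f (x + s *\<^sub>R axis j 1)) (at 0)"

definition laplacian :: "(real^'d \<Rightarrow> complex) \<Rightarrow> real^'d \<Rightarrow> complex" where
  "laplacian f x = (\<Sum>j\<in>UNIV. partial j (partial j f) x)"

text \<open>The boundedness clauses say that the \<open>C\<^sup>1\<close> norm is finite.\<close>

definition C1_QP :: "real^'n^'d \<Rightarrow> (real^'d \<Rightarrow> complex) set" where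
  "C1_QP P = {\<phi>. quasiperiodic P \<phi> \<and> bounded (range \<phi>) \<and>
     (\<forall>j. partial_differentiable j \<phi> \<and> continuous_on UNIV (partial j \<phi>) \<and>
          bounded (range (partial j \<phi>)))}"

text \<open>Classical solutions. Time is the first argument: \<open>\<psi> t x\<close> stands for \<open>\<psi>(x,t)\<close>. Time derivatives
  at \<open>0\<close> and \<open>T\<close> are one-sided.\<close>

definition NLS_solution ::
  "real \<Rightarrow> real \<Rightarrow> (real^'d \<Rightarrow> complex) \<Rightarrow> (real^'d \<Rightarrow> complex) \<Rightarrow> (real \<Rightarrow> real^'d \<Rightarrow> complex) \<Rightarrow> bool"
where
  "NLS_solution \<theta> T V \<psi>0 \<psi> \<longleftrightarrow>
     (\<forall>x. \<forall>t\<in>{0..T}. (\<lambda>s. \<psi> s x) differentiable (at t within {0..T})) \<and>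
     continuous_on ({0..T} \<times> UNIV)
       (\<lambda>(t, x). vector_derivative (\<lambda>s. \<psi> s x) (at t within {0..T})) \<and>
     (\<forall>j. \<forall>t\<in>{0..T}. partial_differentiable j (\<psi> t) \<and> partial_differentiable j (partial j (\<psi> t))) \<and>
     (\<forall>j. continuous_on ({0..T} \<times> UNIV) (\<lambda>(t, x). partial j (partial j (\<psi> t)) x)) \<and>
     (\<forall>x. \<forall>t\<in>{0..T}.
        \<i> * vector_derivative (\<lambda>s. \<psi> s x) (at t within {0..T}) =
          - laplacian (\<psi> t) x + V x * \<psi> t x + of_real (\<theta> * (cmod (\<psi> t x))\<^sup>2) * \<psi> t x) \<and>
     (\<forall>x. \<psi> 0 x = \<psi>0 x)"

definition free_flow :: "real^'n^'d \<Rightarrow> real \<Rightarrow> (real^'d \<Rightarrow> complex) \<Rightarrow> real^'d \<Rightarrow> complex" where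
  "free_flow P t \<phi> x =
     (\<Sum>\<^sub>\<infinity>k\<in>UNIV. cis (- t * (norm (P *v rvec k))\<^sup>2) * fourier_coeff (parent P \<phi>) k *
        cis ((P *v rvec k) \<bullet> x))"

definition freq_box :: "nat \<Rightarrow> (int^'n) set" where
  "freq_box N = {k. \<forall>j. - int N \<le> k $ j \<and> k $ j < int N}"

definition grid_index :: "nat \<Rightarrow> (int^'n) set" where
  "grid_index N = {l. \<forall>j. 0 \<le> l $ j \<and> l $ j < 2 * int N}"

definition grid_point :: "nat \<Rightarrow> int^'n \<Rightarrow> real^'n" where
  "grid_point N l = (pi / real N) *\<^sub>R rvec l"

definition discrete_coeff :: "nat \<Rightarrow> (real^'n \<Rightarrow> complex) \<Rightarrow> int^'n \<Rightarrow> complex" where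
  "discrete_coeff N U k =
     of_real (1 / (2 * real N) ^ CARD('n)) *
     (\<Sum>l\<in>grid_index N. U (grid_point N l) * cis (- (rvec k \<bullet> grid_point N l)))"

definition interp :: "real^'n^'d \<Rightarrow> nat \<Rightarrow> (real^'d \<Rightarrow> complex) \<Rightarrow> real^'d \<Rightarrow> complex" where
  "interp P N \<phi> x =
     (\<Sum>k\<in>freq_box N. discrete_coeff N (parent P \<phi>) k * cis ((P *v rvec k) \<bullet> x))"

primrec strang ::
  "real^'n^'d \<Rightarrow> real \<Rightarrow> (real^'d \<Rightarrow> complex) \<Rightarrow> (real^'d \<Rightarrow> complex) \<Rightarrow> real \<Rightarrow> nat \<Rightarrow> nat \<Rightarrow>
   real^'d \<Rightarrow> complex"
where
  "strang P \<theta> V \<psi>0 \<tau> N 0 = interp P N \<psi>0"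
| "strang P \<theta> V \<psi>0 \<tau> N (Suc m) =
     (let \<phi> = free_flow P (\<tau> / 2) (interp P N (strang P \<theta> V \<psi>0 \<tau> N m))
      in free_flow P (\<tau> / 2) (interp P N
           (\<lambda>x. exp (- \<i> * of_real \<tau> * (V x + of_real (\<theta> * (cmod (\<phi> x))\<^sup>2))) * \<phi> x)))"

end

theory Submission
  imports Defs
begin

text \<open>A quasiperiodic function is the restriction of its parent to the orbit \<open>x \<mapsto> P\<^sup>T x\<close>. Since the columns of \<open>P\<close>
  are rationally independent, the orbit is equidistributed in the torus: means along it are means over the
  torus (\<open>cube_mean_tendsto\<close>), parents are unique (\<open>is_parent_unique\<close>), and the norm is the \<open>\<ell>\<^sup>2\<close> norm of the Fourier
  coefficients (\<open>qp_norm_le\<close>). The problem becomes one for sequences on the lattice, where the Laplacian has the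
  symbol \<open>|P k|\<^sup>2\<close>, and \<open>4 \<alpha> > n\<close> makes the coefficients of \<open>X\<^sub>\<alpha>\<close> absolutely summable (\<open>zw_imp_l1\<close>), so that products
  are convolutions.

  The equation. The derivatives of a classical solution may fail to be quasiperiodic or bounded. Testing with
  wide wave packets nevertheless yields the integrated equation for each coefficient (\<open>fourier_ode\<close>), hence
  Duhamel's formula.

  Error in time. Over one step, the midpoint rule applied to Duhamel's integral has an error \<open>O(\<tau>\<^sup>3)\<close> in mean
  square (\<open>midpoint_rule\<close>). It costs four space derivatives, and \<open>X\<^sub>\<alpha>\<close> has \<open>2 \<alpha>\<close> of them; second time derivatives are
  replaced by second differences. Expanding the midpoint value about the half step shows that the exact step
  agrees to second order with multiplication by \<open>exp (- \<i> \<tau> W)\<close>, where \<open>W\<close> is the real potential frozen at the half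
  step (\<open>exact_step_expansion\<close>).

  Error in space. Interpolation reproduces the frequencies in the box and folds the others into it. Since
  \<open>4 \<alpha> > n\<close>, Cauchy--Schwarz in each alias class bounds the folded part by \<open>N\<^sup>-\<^sup>2\<^sup>\<alpha>\<close> (\<open>interp_error_l2\<close>). In each step it
  is multiplied by \<open>\<tau>\<close> (\<open>local_error_l2\<close>).

  Stability. The numerical step is Lipschitz with constant \<open>1 + O(\<tau>)\<close> only among functions that are bounded. The
  bound comes from a second, cruder analysis in the Wiener algebra, where the local error is \<open>\<tau>\<close> times
  \<open>\<tau> powr (1/8) + N powr (- 1/4)\<close> (\<open>local_error_l1\<close>): for small \<open>\<tau>\<close> and large \<open>N\<close> the numerical solution stays within
  distance \<open>1\<close> of the exact one, and a discrete Gronwall argument gives the full rate in mean square. Otherwise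
  \<open>\<tau>\<^sup>2 + N\<^sup>-\<^sup>\<alpha>\<close> is bounded below and it suffices that the scheme does not increase the mass (\<open>num_converges\<close>).

  All constants are uniform over the admissible data, because every estimate is made for a whole family of
  data, times and step sizes at once.\<close>

section \<open>Summable and square-summable sequences\<close>

text \<open>Norm bounds are stated through finite partial sums, so that a bound carries its own summability
  and no side conditions on infinite sums arise.\<close>

definition l1_le :: "('i => 'b::real_normed_vector) => real => bool" where
  "l1_le a r \<longleftrightarrow> (\<forall>F. finite F \<longrightarrow> (\<Sum>k\<in>F. norm (a k)) <= r)"

definition l2_le :: "('i => 'b::real_normed_vector) => real => bool" where
  "l2_le a r \<longleftrightarrow> (\<forall>F. finite F \<longrightarrow> L2_set (%k. norm (a k)) F <= r)"

lemma l1_leD: "l1_le a r ==> finite F ==> (\<Sum>k\<in>F. norm (a k)) <= r"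
  by (simp add: l1_le_def)

lemma l2_leD: "l2_le a r ==> finite F ==> L2_set (%k. norm (a k)) F <= r"
  by (simp add: l2_le_def)

lemma l1_le_nonneg: "l1_le a r ==> 0 <= r"
  using l1_leD[of a r "{}"] by simp

lemma l2_le_nonneg: "l2_le a r ==> 0 <= r"
  using l2_leD[of a r "{}"] by simp

lemma l1_le_mono:
  assumes "l1_le a r" "!!k. norm (b k) <= norm (a k)" "r <= s"
  shows "l1_le b s"
  unfolding l1_le_def
proof (intro allI impI)
  fix F :: "'a set" assume F: "finite F"
  note * = assms l1_leD[OF assms(1) F]
  have "(\<Sum>k\<in>F. norm (b k)) <= (\<Sum>k\<in>F. norm (a k))" by (intro sum_mono *)
  also have "... <= s" using * by force
  finally show "(\<Sum>k\<in>F. norm (b k)) <= s" .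
qed

lemma l2_le_mono:
  assumes "l2_le a r" "!!k. norm (b k) <= norm (a k)" "r <= s"
  shows "l2_le b s"
  unfolding l2_le_def
proof (intro allI impI)
  fix F :: "'a set" assume F: "finite F"
  note * = assms l2_leD[OF assms(1) F]
  have "L2_set (%k. norm (b k)) F <= L2_set (%k. norm (a k)) F" by (intro L2_set_mono *) auto
  also have "... <= s" using * by force
  finally show "L2_set (%k. norm (b k)) F <= s" .
qed

lemma l1_le_le: "l1_le a r ==> r <= s ==> l1_le a s"
  by (erule l1_le_mono) auto

lemma l2_le_le: "l2_le a r ==> r <= s ==> l2_le a s"
  by (erule l2_le_mono) auto

lemma l1_le_norm: "l1_le (%k. norm (a k)) r \<longleftrightarrow> l1_le a r"
  by (simp add: l1_le_def)

lemma l2_le_norm: "l2_le (%k. norm (a k)) r \<longleftrightarrow> l2_le a r"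
  by (simp add: l2_le_def)

lemma l1_le_add: "l1_le a r ==> l1_le b s ==> l1_le (%k. a k + b k) (r + s)"
  unfolding l1_le_def
proof (intro allI impI)
  fix F :: "'a set" assume *: "\<forall>F. finite F \<longrightarrow> (\<Sum>k\<in>F. norm (a k)) <= r"
    "\<forall>F. finite F \<longrightarrow> (\<Sum>k\<in>F. norm (b k)) <= s" "finite F"
  have "(\<Sum>k\<in>F. norm (a k + b k)) <= (\<Sum>k\<in>F. norm (a k) + norm (b k))"
    by (intro sum_mono norm_triangle_ineq)
  also have "... <= r + s" using * by (simp add: sum.distrib add_mono)
  finally show "(\<Sum>k\<in>F. norm (a k + b k)) <= r + s" .
qed

lemma l2_le_add: "l2_le a r ==> l2_le b s ==> l2_le (%k. a k + b k) (r + s)"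
  unfolding l2_le_def
proof (intro allI impI)
  fix F :: "'a set" assume *: "\<forall>F. finite F \<longrightarrow> L2_set (%k. norm (a k)) F <= r"
    "\<forall>F. finite F \<longrightarrow> L2_set (%k. norm (b k)) F <= s" "finite F"
  have "L2_set (%k. norm (a k + b k)) F <= L2_set (%k. norm (a k) + norm (b k)) F"
    by (intro L2_set_mono norm_triangle_ineq) auto
  also have "... <= L2_set (%k. norm (a k)) F + L2_set (%k. norm (b k)) F"
    by (rule L2_set_triangle_ineq)
  also have "... <= r + s" using * by (simp add: add_mono)
  finally show "L2_set (%k. norm (a k + b k)) F <= r + s" .
qed

lemma l1_le_uminus: "l1_le (%k. - a k) r \<longleftrightarrow> l1_le a r"
  by (simp add: l1_le_def)

lemma l2_le_uminus: "l2_le (%k. - a k) r \<longleftrightarrow> l2_le a r"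
  by (simp add: l2_le_def)

lemma l1_le_diff: "l1_le a r ==> l1_le b s ==> l1_le (%k. a k - b k) (r + s)"
  using l1_le_add[of a r "%k. - b k" s] by (simp add: l1_le_uminus)

lemma l2_le_diff: "l2_le a r ==> l2_le b s ==> l2_le (%k. a k - b k) (r + s)"
  using l2_le_add[of a r "%k. - b k" s] by (simp add: l2_le_uminus)

lemma l1_le_cmult:
  fixes a :: "'i => 'b::real_normed_field"
  shows "l1_le a r ==> l1_le (%k. c * a k) (norm c * r)"
  by (auto simp: l1_le_def norm_mult mult_left_mono simp flip: sum_distrib_left)

lemma l2_le_cmult:
  fixes a :: "'i => 'b::real_normed_field"
  shows "l2_le a r ==> l2_le (%k. c * a k) (norm c * r)"
  by (auto simp: l2_le_def norm_mult L2_set_right_distrib[symmetric] mult_left_mono)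

lemma l1_le_imp_l2_le: "l1_le a r ==> l2_le a r"
  unfolding l1_le_def l2_le_def
proof (intro allI impI)
  fix F :: "'a set" assume *: "\<forall>F. finite F \<longrightarrow> (\<Sum>k\<in>F. norm (a k)) <= r" "finite F"
  have "L2_set (%k. norm (a k)) F <= (\<Sum>k\<in>F. norm (a k))" by (rule L2_set_le_sum) auto
  also have "... <= r" using * by blast
  finally show "L2_set (%k. norm (a k)) F <= r" .
qed

lemma l2_le_norm_le: "l2_le a r ==> norm (a k) <= r"
  using l2_leD[of a r "{k}"] by (simp add: L2_set_def)

lemma l1_le_norm_le: "l1_le a r ==> norm (a k) <= r"
  using l1_leD[of a r "{k}"] by simp

lemma l1_le_abs_summable: "l1_le a r ==> (%k. norm (a k)) summable_on A"
  by (rule nonneg_bdd_above_summable_on) (auto intro!: bdd_aboveI2[where M = r] simp: l1_leD)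

lemma l1_le_summable:
  fixes a :: "'i => 'b::banach"
  shows "l1_le a r ==> a summable_on A"
  by (rule abs_summable_summable) (rule l1_le_abs_summable)

lemma l1_le_infsum_norm: "l1_le a r ==> (\<Sum>\<^sub>\<infinity>k\<in>A. norm (a k)) <= r"
  by (intro infsum_le_finite_sums l1_le_abs_summable) (auto simp: l1_leD)

lemma l1_le_norm_infsum:
  fixes a :: "'i => 'b::banach"
  shows "l1_le a r ==> norm (\<Sum>\<^sub>\<infinity>k\<in>A. a k) <= r"
  by (rule order_trans[OF norm_infsum_bound l1_le_infsum_norm]) (rule l1_le_abs_summable)

lemma summable_l2_le:
  assumes "(%k. (norm (a k))\<^sup>2) summable_on UNIV"
  shows "l2_le a (sqrt (\<Sum>\<^sub>\<infinity>k. (norm (a k))\<^sup>2))"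
  unfolding l2_le_def L2_set_def using assms
  by (auto intro!: finite_sum_le_infsum)

lemma l2_le_summable: 
  assumes "l2_le a r" shows "(%k. (norm (a k))\<^sup>2) summable_on A"
    and "(\<Sum>\<^sub>\<infinity>k\<in>A. (norm (a k))\<^sup>2) <= r\<^sup>2"
proof -
  have *: "(\<Sum>k\<in>F. (norm (a k))\<^sup>2) <= r\<^sup>2" if "finite F" for F
    using l2_leD[OF assms that] l2_le_nonneg[OF assms]
    by (simp add: L2_set_def real_le_lsqrt sqrt_le_D)
  show 1: "(%k. (norm (a k))\<^sup>2) summable_on A"
    by (intro nonneg_bdd_above_summable_on bdd_aboveI2[where M = "r\<^sup>2"]) (auto simp: *)
  show "(\<Sum>\<^sub>\<infinity>k\<in>A. (norm (a k))\<^sup>2) <= r\<^sup>2"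
    by (intro infsum_le_finite_sums 1) (auto simp: *)
qed

lemma l2_le_sumI:
  assumes "!!F. finite F ==> (\<Sum>k\<in>F. (norm (a k))\<^sup>2) <= r\<^sup>2" "r >= 0"
  shows "l2_le a r"
  unfolding l2_le_def L2_set_def using assms real_le_lsqrt by auto

lemma l2_le_mult_l1_le:
  fixes a b :: "'i => 'b::real_normed_field"
  assumes "l2_le a r" "l2_le b s"
  shows "l1_le (%k. a k * b k) (r * s)"
  unfolding l1_le_def
proof (intro allI impI)
  fix F :: "'i set" assume F: "finite F"
  have "(\<Sum>k\<in>F. norm (a k * b k)) = (\<Sum>k\<in>F. \<bar>norm (a k)\<bar> * \<bar>norm (b k)\<bar>)" by (simp add: norm_mult)
  also have "... <= L2_set (%k. norm (a k)) F * L2_set (%k. norm (b k)) F"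
    by (rule L2_set_mult_ineq)
  also have "... <= r * s"
    by (intro mult_mono l2_leD[OF assms(1) F] l2_leD[OF assms(2) F] l2_le_nonneg[OF assms(1)]) auto
  finally show "(\<Sum>k\<in>F. norm (a k * b k)) <= r * s" .
qed

lemma l1_le_inj:
  assumes "l1_le a r" "inj h" shows "l1_le (%k. a (h k)) r"
  unfolding l1_le_def
proof (intro allI impI)
  fix F :: "'c set" assume F: "finite F"
  have "(\<Sum>k\<in>F. norm (a (h k))) = (\<Sum>k\<in>h ` F. norm (a k))"
    using assms(2) by (subst sum.reindex) (auto intro: inj_on_subset)
  then show "(\<Sum>k\<in>F. norm (a (h k))) <= r" using l1_leD[OF assms(1), of "h ` F"] F by simp
qed

lemma l2_le_inj:
  assumes "l2_le a r" "inj h" shows "l2_le (%k. a (h k)) r"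
  unfolding l2_le_def
proof (intro allI impI)
  fix F :: "'c set" assume F: "finite F"
  have "L2_set (%k. norm (a (h k))) F = L2_set (%k. norm (a k)) (h ` F)"
    unfolding L2_set_def
    using assms(2) by (subst sum.reindex) (auto intro: inj_on_subset)
  then show "L2_set (%k. norm (a (h k))) F <= r" using l2_leD[OF assms(1), of "h ` F"] F by simp
qed

section \<open>Convolution\<close>

definition conv :: "('i::ab_group_add => 'b::{real_normed_field,banach}) => ('i => 'b) => 'i => 'b" where
  "conv a b k = (\<Sum>\<^sub>\<infinity>l. a l * b (k - l))"

lemma inj_minus_right: "inj (%k. k - l :: 'i::ab_group_add)"
  by (auto intro: injI)

lemma inj_minus_left: "inj (%l. k - l :: 'i::ab_group_add)"
  by (auto intro: injI)

lemma l1_le_mult_bounded: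
  fixes a b :: "'i => 'b::real_normed_field"
  assumes "l1_le a r" "!!k. norm (b k) <= s"
  shows "l1_le (%k. a k * b k) (r * s)"
  unfolding l1_le_def
proof (intro allI impI)
  fix F :: "'i set" assume F: "finite F"
  have s: "0 <= s" using assms(2) norm_ge_zero order_trans by blast
  have "(\<Sum>k\<in>F. norm (a k * b k)) <= (\<Sum>k\<in>F. norm (a k) * s)"
    by (intro sum_mono) (auto simp: norm_mult intro: mult_left_mono assms)
  also have "... <= r * s"
    using l1_leD[OF assms(1) F] s by (simp add: mult_right_mono flip: sum_distrib_right)
  finally show "(\<Sum>k\<in>F. norm (a k * b k)) <= r * s" .
qed

lemma conv_terms_l1:
  fixes a b :: "'i::ab_group_add => 'b::real_normed_field"
  assumes "l1_le a r" "!!k. norm (b k) <= s"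
  shows "l1_le (%l. a l * b (k - l)) (r * s)"
  by (rule l1_le_mult_bounded) (auto intro: assms)

lemma conv_commute: "conv a b = conv b a"
proof
  fix k :: 'a
  have "bij_betw (%l. k - l) UNIV UNIV"
    by (rule bij_betwI[where g = "%l. k - l"]) (auto simp: algebra_simps)
  then show "conv a b k = conv b a k"
    unfolding conv_def
    by (subst infsum_reindex_bij_betw[symmetric, where g = "%l. k - l" and A = UNIV])
       (auto simp: mult.commute)
qed

lemma conv_le:
  fixes a b :: "'i::ab_group_add => 'b::{real_normed_field,banach}" and \<alpha> \<beta> :: "'i => real"
  assumes "!!k. norm (a k) <= \<alpha> k" "!!k. norm (b k) <= \<beta> k" "l1_le \<alpha> r" "!!k. \<beta> k <= s"
  shows "norm (conv a b k) <= conv \<alpha> \<beta> k"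
proof -
  have p: "0 <= \<alpha> k" "0 <= \<beta> k" for k using assms(1,2) norm_ge_zero order_trans by blast+
  have 1: "l1_le (%l. \<alpha> l * \<beta> (k - l)) (r * s)"
    using assms(3,4) p by (intro conv_terms_l1) auto
  have 2: "norm (a l * b (k - l)) <= \<alpha> l * \<beta> (k - l)" for l
    using assms(1,2) p by (auto simp: norm_mult intro: mult_mono)
  have 3: "l1_le (%l. a l * b (k - l)) (r * s)"
    by (rule l1_le_mono[OF 1]) (use 2 p in auto)
  have "norm (conv a b k) <= (\<Sum>\<^sub>\<infinity>l. norm (a l * b (k - l)))"
    unfolding conv_def by (rule norm_infsum_bound[OF l1_le_abs_summable[OF 3]])
  also have "... <= conv \<alpha> \<beta> k"
    unfolding conv_def
    by (rule infsum_mono) (use l1_le_abs_summable[OF 3, of UNIV] l1_le_summable[OF 1, of UNIV] 2 in auto)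
  finally show ?thesis .
qed

text \<open>Young's inequality: on finitely many indices, a convolution is the limit of the combinations
  \<open>\<Sum>\<^sub>l a l *\<^sub>R (translate of b)\<close>, to which the triangle inequality applies.\<close>

lemma conv_tendsto:
  fixes a b :: "'i::ab_group_add => 'b::{real_normed_field,banach}"
  assumes "l1_le a r" "!!k. norm (b k) <= s"
  shows "((%G. \<Sum>l\<in>G. a l * b (k - l)) \<longlongrightarrow> conv a b k) (finite_subsets_at_top UNIV)"
  unfolding conv_def
  by (rule infsum_tendsto) (rule l1_le_summable[OF conv_terms_l1[OF assms]])

lemma finite_sums_limit_le:
  fixes L :: real
  assumes "(X \<longlongrightarrow> L) (finite_subsets_at_top A)" "!!G. finite G ==> X G <= B"
  shows "L <= B"
  by (rule tendsto_upperbound[OF assms(1)])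
     (auto intro!: eventually_finite_subsets_at_top_weakI assms(2))

lemma L2_set_sum_le:
  assumes "finite G"
  shows "L2_set (%k. norm (\<Sum>l\<in>G. f l k)) F <= (\<Sum>l\<in>G. L2_set (%k. norm (f l k)) F)"
using assms
proof (induction G rule: finite_induct)
  case (insert x G)
  have "L2_set (%k. norm (\<Sum>l\<in>insert x G. f l k)) F <= L2_set (%k. norm (f x k) + norm (\<Sum>l\<in>G. f l k)) F"
    using insert by (intro L2_set_mono) (auto simp: norm_triangle_ineq)
  also have "... <= L2_set (%k. norm (f x k)) F + L2_set (%k. norm (\<Sum>l\<in>G. f l k)) F"
    by (rule L2_set_triangle_ineq)
  finally show ?case using insert by simp
qed (simp add: L2_set_def)

lemma conv_l2_le:
  assumes a: "l1_le a r" and b: "l2_le b s"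
  shows "l2_le (conv a b) (r * s)"
  unfolding l2_le_def
proof (intro allI impI)
  fix F :: "'a set" assume F: "finite F"
  have B: "L2_set (%k. norm (\<Sum>l\<in>G. a l * b (k - l))) F <= r * s" if G: "finite G" for G
  proof -
    have "L2_set (%k. norm (\<Sum>l\<in>G. a l * b (k - l))) F <= (\<Sum>l\<in>G. L2_set (%k. norm (a l * b (k - l))) F)"
      by (rule L2_set_sum_le[OF G])
    also have "... = (\<Sum>l\<in>G. norm (a l) * L2_set (%k. norm (b (k - l))) F)"
      by (simp add: norm_mult L2_set_right_distrib)
    also have "... <= (\<Sum>l\<in>G. norm (a l) * s)"
      by (intro sum_mono mult_left_mono l2_leD[OF l2_le_inj[OF b inj_minus_right] F] norm_ge_zero)
    also have "... <= r * s"
      using l1_leD[OF a G] l2_le_nonneg[OF b] by (simp add: mult_right_mono flip: sum_distrib_right)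
    finally show ?thesis .
  qed
  have T: "((%G. L2_set (%k. norm (\<Sum>l\<in>G. a l * b (k - l))) F) \<longlongrightarrow> L2_set (%k. norm (conv a b k)) F)
      (finite_subsets_at_top UNIV)"
    unfolding L2_set_def
    by (rule tendsto_real_sqrt, rule tendsto_sum, rule tendsto_power, rule tendsto_norm,
        rule conv_tendsto[OF a l2_le_norm_le[OF b]])
  show "L2_set (%k. norm (conv a b k)) F <= r * s"
    by (rule finite_sums_limit_le[OF T B])
qed

lemma conv_l1_le:
  assumes a: "l1_le a r" and b: "l1_le b s"
  shows "l1_le (conv a b) (r * s)"
  unfolding l1_le_def
proof (intro allI impI)
  fix F :: "'a set" assume F: "finite F"
  have B: "(\<Sum>k\<in>F. norm (\<Sum>l\<in>G. a l * b (k - l))) <= r * s" if G: "finite G" for G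
  proof -
    have "(\<Sum>k\<in>F. norm (\<Sum>l\<in>G. a l * b (k - l))) <= (\<Sum>k\<in>F. \<Sum>l\<in>G. norm (a l) * norm (b (k - l)))"
      by (intro sum_mono order_trans[OF norm_sum]) (auto simp: norm_mult)
    also have "... = (\<Sum>l\<in>G. norm (a l) * (\<Sum>k\<in>F. norm (b (k - l))))"
      by (subst sum.swap) (simp add: sum_distrib_left)
    also have "... <= (\<Sum>l\<in>G. norm (a l) * s)"
      by (intro sum_mono mult_left_mono l1_leD[OF l1_le_inj[OF b inj_minus_right] F] norm_ge_zero)
    also have "... <= r * s"
      using l1_leD[OF a G] l1_le_nonneg[OF b] by (simp add: mult_right_mono flip: sum_distrib_right)
    finally show ?thesis .
  qed
  have T: "((%G. \<Sum>k\<in>F. norm (\<Sum>l\<in>G. a l * b (k - l))) \<longlongrightarrow> (\<Sum>k\<in>F. norm (conv a b k)))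
      (finite_subsets_at_top UNIV)"
    by (rule tendsto_sum, rule tendsto_norm, rule conv_tendsto[OF a l1_le_norm_le[OF b]])
  show "(\<Sum>k\<in>F. norm (conv a b k)) <= r * s"
    by (rule finite_sums_limit_le[OF T B])
qed

text \<open>A weight that is subadditive up to a constant may be moved onto one of the two factors. Only
  the other factor then has to be summable.\<close>

lemma weight_conv_le:
  fixes \<alpha> \<beta> w :: "'i::ab_group_add => real"
  assumes w: "!!k l. w (k + l) <= K * (w k + w l)"
    and pos: "!!k. 0 <= \<alpha> k" "!!k. 0 <= \<beta> k"
    and l1: "l1_le \<alpha> r" "l1_le \<beta> s"
    and bd: "!!k. \<bar>w k * \<alpha> k\<bar> <= B" "!!k. \<bar>w k * \<beta> k\<bar> <= B"
  shows "w k * conv \<alpha> \<beta> k <= K * (conv (%k. w k * \<alpha> k) \<beta> k + conv \<alpha> (%k. w k * \<beta> k) k)"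
proof -
  have 0: "l1_le (%l. \<alpha> l * \<beta> (k - l)) (r * s)"
    by (rule conv_terms_l1[OF l1(1) l1_le_norm_le[OF l1(2)]])
  have 1: "l1_le (%l. \<alpha> l * (w (k - l) * \<beta> (k - l))) (r * B)"
    by (rule conv_terms_l1[OF l1(1), of "%k. w k * \<beta> k"]) (use bd in auto)
  have "l1_le (%l. \<beta> (k - l) * (w l * \<alpha> l)) (s * B)"
    by (rule l1_le_mult_bounded[OF l1_le_inj[OF l1(2) inj_minus_left]]) (use bd in auto)
  then have 2: "l1_le (%l. w l * \<alpha> l * \<beta> (k - l)) (s * B)" by (simp add: ac_simps)
  have "w k * conv \<alpha> \<beta> k = (\<Sum>\<^sub>\<infinity>l. w k * (\<alpha> l * \<beta> (k - l)))"
    unfolding conv_def by (rule infsum_cmult_right[symmetric]) (use l1_le_summable[OF 0] in auto)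
  also have "... <= (\<Sum>\<^sub>\<infinity>l. K * (w l * \<alpha> l * \<beta> (k - l) + \<alpha> l * (w (k - l) * \<beta> (k - l))))"
  proof (rule infsum_mono)
    show "(%l. w k * (\<alpha> l * \<beta> (k - l))) summable_on UNIV"
      by (intro summable_on_cmult_right l1_le_summable[OF 0])
    show "(%l. K * (w l * \<alpha> l * \<beta> (k - l) + \<alpha> l * (w (k - l) * \<beta> (k - l)))) summable_on UNIV"
      by (intro summable_on_cmult_right summable_on_add l1_le_summable[OF 1] l1_le_summable[OF 2])
    fix l
    have "w k * (\<alpha> l * \<beta> (k - l)) <= K * (w l + w (k - l)) * (\<alpha> l * \<beta> (k - l))"
      using w[of l "k - l"] pos by (intro mult_right_mono) auto
    then show "w k * (\<alpha> l * \<beta> (k - l)) <= K * (w l * \<alpha> l * \<beta> (k - l) + \<alpha> l * (w (k - l) * \<beta> (k - l)))"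
      by (simp add: algebra_simps)
  qed
  also have "... = K * (conv (%k. w k * \<alpha> k) \<beta> k + conv \<alpha> (%k. w k * \<beta> k) k)"
    unfolding conv_def
    by (subst infsum_cmult_right)
       (auto simp: infsum_add l1_le_summable[OF 1] l1_le_summable[OF 2] intro!: summable_on_add)
  finally show ?thesis .
qed

lemma weight_conv_l2_le:
  fixes a b :: "'i::ab_group_add => 'b::{real_normed_field,banach}" and w :: "'i => real"
  assumes w: "!!k l. w (k + l) <= K * (w k + w l)" "!!k. 0 <= w k"
    and K: "0 <= K"
    and a: "l1_le a r" "l2_le (%k. w k * norm (a k)) r'"
    and b: "l1_le b s" "l2_le (%k. w k * norm (b k)) s'"
  shows "l2_le (%k. w k * norm (conv a b k)) (K * (r' * s + r * s'))"
proof -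
  have bd: "\<bar>w k * norm (a k)\<bar> <= max r' s'" "\<bar>w k * norm (b k)\<bar> <= max r' s'" for k
    using l2_le_norm_le[OF a(2), of k] l2_le_norm_le[OF b(2), of k] by auto
  have "l2_le (conv (%k. w k * norm (a k)) (%k. norm (b k))) (r' * s)"
    using conv_l2_le[of "%k. norm (b k)" s, OF _ a(2)] b(1)
    by (simp add: l1_le_norm mult.commute conv_commute[of "%k. norm (b k)"])
  moreover have "l2_le (conv (%k. norm (a k)) (%k. w k * norm (b k))) (r * s')"
    by (rule conv_l2_le[OF _ b(2)]) (simp add: l1_le_norm a)
  ultimately have "l2_le (%k. K * (conv (%k. w k * norm (a k)) (%k. norm (b k)) k +
      conv (%k. norm (a k)) (%k. w k * norm (b k)) k)) (norm K * (r' * s + r * s'))"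
    by (intro l2_le_cmult l2_le_add)
  then show ?thesis
  proof (rule l2_le_mono)
    fix k
    have "norm (conv a b k) <= conv (%k. norm (a k)) (%k. norm (b k)) k"
      by (rule conv_le[where r = r and s = s]) (auto simp: l1_le_norm a intro: l1_le_norm_le[OF b(1)])
    then have "w k * norm (conv a b k) <= w k * conv (%k. norm (a k)) (%k. norm (b k)) k"
      using w(2) by (rule mult_left_mono)
    also have "... <= K * (conv (%k. w k * norm (a k)) (%k. norm (b k)) k +
      conv (%k. norm (a k)) (%k. w k * norm (b k)) k)"
      by (rule weight_conv_le[where r = r and s = s and B = "max r' s'"])
         (use w bd in \<open>auto simp: l1_le_norm a b\<close>)
    finally show "norm (w k * norm (conv a b k)) <= norm (K * (conv (%k. w k * norm (a k)) (%k. norm (b k)) k +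
      conv (%k. norm (a k)) (%k. w k * norm (b k)) k))"
      using w(2)[of k] by simp
  qed (use K in simp)
qed

section \<open>Weights on the integer lattice\<close>

lemma rvec_add: "rvec (k + l) = rvec k + rvec l"
  and rvec_diff: "rvec (k - l) = rvec k - rvec l"
  and rvec_minus: "rvec (- k) = - rvec k"
  and rvec_zero: "rvec 0 = 0"
  by (simp_all add: rvec_def vec_eq_iff)

lemma rvec_nth: "rvec k $ j = real_of_int (k $ j)"
  by (simp add: rvec_def)

lemma sum_box_prod:
  fixes f :: "'n::finite => 'a => 'b::comm_semiring_1"
  assumes "finite A"
  shows "(\<Sum>k\<in>{k :: 'a^'n. \<forall>j. k $ j \<in> A}. \<Prod>j\<in>UNIV. f j (k $ j)) = (\<Prod>j\<in>UNIV. \<Sum>i\<in>A. f j i)"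
proof -
  have "bij_betw (%k j. k $ j) {k :: 'a^'n. \<forall>j. k $ j \<in> A} (PiE UNIV (%_. A))"
    by (rule bij_betwI[where g = "%g. \<chi> j. g j"]) auto
  then have "(\<Sum>k\<in>{k :: 'a^'n. \<forall>j. k $ j \<in> A}. \<Prod>j\<in>UNIV. f j (k $ j)) = (\<Sum>g\<in>PiE UNIV (%_. A). \<Prod>j\<in>UNIV. f j (g j))"
    by (rule sum.reindex_bij_betw)
  also have "... = (\<Prod>j\<in>UNIV. \<Sum>i\<in>A. f j i)"
    by (rule prod_sum_PiE[symmetric]) (use assms in auto)
  finally show ?thesis .
qed

lemma finite_vec_box: "finite A ==> finite {k :: 'a^'n::finite. \<forall>j. k $ j \<in> A}"
proof -
  assume A: "finite A"
  have "{k :: 'a^'n. \<forall>j. k $ j \<in> A} \<subseteq> vec_lambda ` (PiE UNIV (%_. A))"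
    by (auto simp: image_iff intro!: bexI[where x = "%j. _ $ j"])
  then show ?thesis
    by (rule finite_subset) (use A in \<open>auto intro!: finite_PiE\<close>)
qed

lemma card_vec_box: "finite A ==> card {k :: 'a^'n::finite. \<forall>j. k $ j \<in> A} = card A ^ CARD('n)"
  using sum_box_prod[of A "%(_ :: 'n) _. 1 :: nat"] by simp

lemma integer_powr_summable:
  assumes "q > 1"
  shows "(%i::int. (1 + \<bar>real_of_int i\<bar>) powr (- q)) summable_on UNIV"
proof -
  have "summable (%n. real (Suc n) powr (- q))"
    using assms by (subst summable_Suc_iff) (simp add: summable_real_powr_iff)
  then have 1: "(%n. (1 + real n) powr (- q)) summable_on UNIV"
    by (intro norm_summable_imp_summable_on) (simp add: add.commute)
  have "summable (%n. (1 + real (Suc n)) powr (- q))"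
    using summable_on_imp_summable[OF 1] by (subst summable_Suc_iff)
  then have 2: "(%n. (2 + real n) powr (- q)) summable_on UNIV"
    by (intro norm_summable_imp_summable_on) (simp add: add.commute)
  let ?g = "%i::int. (1 + \<bar>real_of_int i\<bar>) powr (- q)"
  have "?g summable_on (int ` UNIV)"
    using 1 by (subst summable_on_reindex) (auto simp: inj_on_def o_def)
  moreover have "?g summable_on ((%n. - int n - 1) ` UNIV)"
    using 2 by (subst summable_on_reindex) (auto simp: inj_on_def o_def algebra_simps)
  moreover have "int ` UNIV \<inter> (%n. - int n - 1) ` UNIV = {}" by auto
  moreover have "int ` UNIV \<union> (%n. - int n - 1) ` UNIV = UNIV"
  proof -
    have "i \<in> int ` UNIV \<union> (%n. - int n - 1) ` UNIV" for i :: int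
    proof (cases "i >= 0")
      case True
      then show ?thesis by (auto intro!: image_eqI[where x = "nat i"])
    next
      case False
      then have "i = - int (nat (- i - 1)) - 1" by simp
      then show ?thesis by blast
    qed
    then show ?thesis by blast
  qed
  ultimately show ?thesis by (metis summable_on_Un_disjoint)
qed

text \<open>The lattice sum converges since \<open>(1 + |k|) powr (- p)\<close> is at most the product over the coordinates of
  the one-dimensional terms \<open>(1 + |k\<^sub>j|) powr (- p / n)\<close>.\<close>

lemma lattice_powr_summable:
  assumes "p > real CARD('n)"
  shows "(%k::int^'n. (1 + norm (rvec k)) powr (- p)) summable_on UNIV"
proof (rule nonneg_bdd_above_summable_on)
  let ?n = "real CARD('n)"
  let ?g = "%i::int. (1 + \<bar>real_of_int i\<bar>) powr (- (p / ?n))"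
  have g: "?g summable_on UNIV"
    by (rule integer_powr_summable) (use assms in \<open>simp add: field_simps\<close>)
  define S where "S = (\<Sum>\<^sub>\<infinity>i. ?g i)"
  have trm: "(1 + norm (rvec k)) powr (- p) <= (\<Prod>j\<in>UNIV. ?g (k $ j))" for k :: "int^'n"
  proof -
    let ?c = "(1 + norm (rvec k)) powr (- (p / ?n))"
    have "(1 + norm (rvec k)) powr (- p) = ?c ^ CARD('n)"
      using add_pos_nonneg[OF zero_less_one norm_ge_zero[of "rvec k"]]
      by (subst powr_realpow[symmetric]) (auto simp: powr_powr)
    also have "... = (\<Prod>j\<in>(UNIV :: 'n set). ?c)" by simp
    also have "... <= (\<Prod>j\<in>UNIV. ?g (k $ j))"
    proof (intro prod_mono conjI)
      fix j :: 'n
      have "\<bar>real_of_int (k $ j)\<bar> <= norm (rvec k)"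
        using component_le_norm_cart[of "rvec k" j] by (simp add: rvec_nth)
      then show "?c <= ?g (k $ j)"
        using assms by (intro powr_mono2') (auto simp: add_pos_nonneg)
    qed auto
    finally show ?thesis .
  qed
  show "bdd_above (sum (%k::int^'n. (1 + norm (rvec k)) powr (- p)) ` {F. F \<subseteq> UNIV \<and> finite F})"
  proof (rule bdd_aboveI2[where M = "S ^ CARD('n)"])
    fix F :: "(int^'n) set" assume "F \<in> {F. F \<subseteq> UNIV \<and> finite F}"
    then have F: "finite F" by simp
    define A where "A = (\<Union>k\<in>F. range (%j. k $ j))"
    have A: "finite A" unfolding A_def using F by auto
    have "(\<Sum>k\<in>F. (1 + norm (rvec k)) powr (- p)) <= (\<Sum>k\<in>F. \<Prod>j\<in>UNIV. ?g (k $ j))"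
      by (intro sum_mono trm)
    also have "... <= (\<Sum>k\<in>{k :: int^'n. \<forall>j. k $ j \<in> A}. \<Prod>j\<in>UNIV. ?g (k $ j))"
      by (rule sum_mono2) (use finite_vec_box[OF A] in \<open>auto simp: A_def intro!: prod_nonneg\<close>)
    also have "... = (\<Prod>j\<in>(UNIV :: 'n set). \<Sum>i\<in>A. ?g i)" by (rule sum_box_prod[OF A])
    also have "... = (\<Sum>i\<in>A. ?g i) ^ CARD('n)" by simp
    also have "... <= S ^ CARD('n)"
      unfolding S_def by (intro power_mono finite_sum_le_infsum g A sum_nonneg) auto
    finally show "(\<Sum>k\<in>F. (1 + norm (rvec k)) powr (- p)) <= S ^ CARD('n)" .
  qed
qed auto

text \<open>The square of \<open>zw\<close> is the weight of the norm of \<open>X\<^sub>\<alpha>\<close>. One factor \<open>brk\<close> stands for two derivatives: up to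
  a constant it dominates the symbol of the Laplacian.\<close>

definition zw :: "nat => int^'n::finite => real" where
  "zw \<alpha> k = sqrt (1 + norm (rvec k) ^ (4 * \<alpha>))"

definition brk :: "int^'n::finite => real" where
  "brk k = 1 + (norm (rvec k))\<^sup>2"

lemma brk_ge_1: "brk k >= 1"
  by (simp add: brk_def)

lemma brk_pos: "brk k > 0" "brk k >= 0"
  using brk_ge_1[of k] by linarith+

lemma zw_ge_1: "zw \<alpha> k >= 1"
  by (simp add: zw_def)

lemma zw_pos: "zw \<alpha> k > 0" "zw \<alpha> k >= 0"
  using zw_ge_1[of \<alpha> k] by linarith+

lemma zw_square: "(zw \<alpha> k)\<^sup>2 = 1 + norm (rvec k) ^ (4 * \<alpha>)"
  by (simp add: zw_def add_nonneg_nonneg)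

lemma zw_minus: "zw \<alpha> (- k) = zw \<alpha> k"
  by (simp add: zw_def rvec_minus)

lemma brk_minus: "brk (- k) = brk k"
  by (simp add: brk_def rvec_minus)

lemma brk_add_le: "brk (k + l) <= 2 * (brk k + brk l)"
proof -
  have "norm (rvec k + rvec l) <= norm (rvec k) + norm (rvec l)" by (rule norm_triangle_ineq)
  then have "(norm (rvec k + rvec l))\<^sup>2 <= (norm (rvec k) + norm (rvec l))\<^sup>2" by (simp add: power_mono)
  also have "... <= 2 * (norm (rvec k))\<^sup>2 + 2 * (norm (rvec l))\<^sup>2"
    using sum_squares_bound[of "norm (rvec k)" "norm (rvec l)"] by (simp add: power2_sum)
  finally show ?thesis by (simp add: brk_def rvec_add)
qed

lemma zw_add_le: "zw \<alpha> (k + l) <= 4 ^ \<alpha> * (zw \<alpha> k + zw \<alpha> l)"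
proof -
  let ?x = "norm (rvec k)" and ?y = "norm (rvec l)"
  have "norm (rvec k + rvec l) <= 2 * max ?x ?y"
    using norm_triangle_ineq[of "rvec k" "rvec l"] by linarith
  then have "norm (rvec k + rvec l) ^ (4 * \<alpha>) <= (2 * max ?x ?y) ^ (4 * \<alpha>)" by (rule power_mono) simp
  also have "... = 2 ^ (4 * \<alpha>) * max ?x ?y ^ (4 * \<alpha>)" by (simp add: power_mult_distrib)
  also have "... <= 2 ^ (4 * \<alpha>) * (?x ^ (4 * \<alpha>) + ?y ^ (4 * \<alpha>))"
    by (intro mult_left_mono) (auto simp: max_def)
  finally have "1 + norm (rvec k + rvec l) ^ (4 * \<alpha>) <= 1 + 2 ^ (4 * \<alpha>) * (?x ^ (4 * \<alpha>) + ?y ^ (4 * \<alpha>))" by simp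
  also have "... <= 2 ^ (4 * \<alpha>) * ((1 + ?x ^ (4 * \<alpha>)) + (1 + ?y ^ (4 * \<alpha>)))"
    using one_le_power[of "2::real" "4 * \<alpha>"] unfolding distrib_left by linarith
  finally have "zw \<alpha> (k + l) <= sqrt (2 ^ (4 * \<alpha>) * ((1 + ?x ^ (4 * \<alpha>)) + (1 + ?y ^ (4 * \<alpha>))))"
    by (simp add: zw_def rvec_add)
  also have "... = 4 ^ \<alpha> * sqrt ((1 + ?x ^ (4 * \<alpha>)) + (1 + ?y ^ (4 * \<alpha>)))"
  proof -
    have "(2::real) ^ (4 * \<alpha>) = (4 ^ \<alpha>)\<^sup>2" by (simp add: power_mult power2_eq_square flip: power_mult_distrib)
    then show ?thesis by (simp add: real_sqrt_mult)
  qed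
  also have "... <= 4 ^ \<alpha> * (zw \<alpha> k + zw \<alpha> l)"
    unfolding zw_def by (intro mult_left_mono sqrt_add_le_add_sqrt) auto
  finally show ?thesis .
qed

lemma norm_power_le_zw: "norm (rvec k) ^ (2 * \<alpha>) <= zw \<alpha> k"
proof -
  have "(norm (rvec k) ^ (2 * \<alpha>))\<^sup>2 = norm (rvec k) ^ (4 * \<alpha>)" by (simp flip: power_mult)
  then show ?thesis unfolding zw_def by (intro real_le_rsqrt) simp
qed

text \<open>The local error costs four derivatives, that is \<open>brk\<^sup>2\<close>.\<close>

lemma brk_square_le_zw:
  assumes "\<alpha> >= 2" shows "(brk k)\<^sup>2 <= 6 * zw \<alpha> k"
proof -
  let ?x = "norm (rvec k)"
  have "?x ^ 4 <= 1 + ?x ^ (2 * \<alpha>)"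
  proof (cases "?x >= 1")
    case True
    then have "?x ^ 4 <= ?x ^ (2 * \<alpha>)" using assms by (intro power_increasing) auto
    then show ?thesis by simp
  next
    case False
    then have "?x ^ 4 <= 1" by (intro power_le_one) auto
    moreover have "0 <= ?x ^ (2 * \<alpha>)" by simp
    ultimately show ?thesis by linarith
  qed
  also have "... <= 2 * zw \<alpha> k" using norm_power_le_zw[of k \<alpha>] zw_ge_1[of \<alpha> k] by linarith
  finally have 1: "?x ^ 4 <= 2 * zw \<alpha> k" .
  have "(brk k)\<^sup>2 = 1 + 2 * ?x\<^sup>2 + ?x ^ 4" by (simp add: brk_def power2_sum algebra_simps flip: power_mult)
  also have "... <= 2 + 2 * ?x ^ 4"
    using sum_squares_bound[of 1 "?x\<^sup>2"] by (simp flip: power_mult)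
  finally show ?thesis using 1 zw_ge_1[of \<alpha> k] by linarith
qed

text \<open>The embedding into the Wiener algebra, with a small power of the weight to spare: for \<open>4 \<alpha> > n\<close>
  the integrality of \<open>\<alpha>\<close> gives \<open>4 \<alpha> \<ge> n + 1\<close>. The spare power turns the smallness of a high-frequency
  tail into an algebraic rate.\<close>

lemma zw_imp_l1:
  assumes "real \<alpha> > real CARD('n) / 4"
  obtains A where "A > 0" "!!(a :: int^'n => 'b::real_normed_vector) r. l2_le (%k. zw \<alpha> k * norm (a k)) r
      ==> l1_le (%k. brk k powr (1/8) * norm (a k)) (A * r)"
proof -
  have n: "real (4 * \<alpha>) - 1/2 > real CARD('n)"
  proof -
    have "4 * \<alpha> > CARD('n)" using assms by linarith
    then show ?thesis by linarith
  qed
  \<comment> \<open>The gap of at least \<open>1\<close> between \<open>4 \<alpha>\<close> and \<open>n\<close>: one half for the square of the spare weight, of order \<open>|k| powr (1/2)\<close>, one half for convergence.\<close>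
  let ?p = "real (4 * \<alpha>) - 1/2"
  have bound: "(brk k powr (1/8) / zw \<alpha> k)\<^sup>2 <= 2 ^ (4 * \<alpha>) * (1 + norm (rvec k)) powr (- ?p)" for k :: "int^'n"
  proof -
    let ?x = "norm (rvec k)"
    have x: "0 < 1 + ?x" "0 <= ?x" by (auto simp: add_pos_nonneg)
    have "(brk k powr (1/8))\<^sup>2 = brk k powr (1/4)"
      using brk_pos(1)[of k] by (subst powr_realpow[symmetric]) (auto simp: powr_powr)
    also have "... <= ((1 + ?x)\<^sup>2) powr (1/4)"
      using brk_pos x by (intro powr_mono2) (auto simp: brk_def power2_sum)
    also have "(1 + ?x)\<^sup>2 = (1 + ?x) powr 2" using x by (simp add: powr_realpow[symmetric])
    also have "((1 + ?x) powr 2) powr (1/4) = (1 + ?x) powr (1/2)" by (subst powr_powr) simp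
    finally have 1: "(brk k powr (1/8))\<^sup>2 <= (1 + ?x) powr (1/2)" .
    have "(1 + ?x) ^ (4 * \<alpha>) <= (2 * max 1 ?x) ^ (4 * \<alpha>)" using x by (intro power_mono) auto
    also have "... = 2 ^ (4 * \<alpha>) * max 1 ?x ^ (4 * \<alpha>)" by (simp add: power_mult_distrib)
    also have "... <= 2 ^ (4 * \<alpha>) * (zw \<alpha> k)\<^sup>2"
      unfolding zw_square by (intro mult_left_mono) (auto simp: max_def)
    finally have 2: "(1 + ?x) ^ (4 * \<alpha>) <= 2 ^ (4 * \<alpha>) * (zw \<alpha> k)\<^sup>2" .
    have "(brk k powr (1/8) / zw \<alpha> k)\<^sup>2 = (brk k powr (1/8))\<^sup>2 / (zw \<alpha> k)\<^sup>2" by (simp add: power_divide)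
    also have "... <= (1 + ?x) powr (1/2) / (zw \<alpha> k)\<^sup>2"
      using 1 by (intro divide_right_mono) auto
    also have "... <= (1 + ?x) powr (1/2) * (2 ^ (4 * \<alpha>) / (1 + ?x) ^ (4 * \<alpha>))"
    proof -
      have aux: "inverse z <= c / d" if "d <= c * z" "z > 0" "d > 0" for c d z :: real
        using that by (simp add: field_simps)
      show ?thesis
        unfolding divide_inverse[of "(1 + ?x) powr (1/2)"]
        using x zw_pos(1)[of \<alpha> k] by (intro mult_left_mono aux 2 zero_less_power x(1)) auto
    qed
    also have "(1 + ?x) ^ (4 * \<alpha>) = (1 + ?x) powr real (4 * \<alpha>)" using x by (simp only: powr_realpow)
    also have "(1 + ?x) powr (1/2) * (2 ^ (4 * \<alpha>) / (1 + ?x) powr real (4 * \<alpha>))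
        = 2 ^ (4 * \<alpha>) * (1 + ?x) powr (- ?p)"
    proof -
      have "(1 + ?x) powr (- ?p) = (1 + ?x) powr (1/2) * (1 + ?x) powr (- real (4 * \<alpha>))"
        by (subst powr_add[symmetric]) simp
      then show ?thesis by (simp only: powr_minus divide_inverse) (simp only: ac_simps)
    qed
    finally show ?thesis .
  qed
  have "(%k::int^'n. 2 ^ (4 * \<alpha>) * (1 + norm (rvec k)) powr (- ?p)) summable_on UNIV"
    by (intro summable_on_cmult_right lattice_powr_summable n)
  then have sm: "(%k::int^'n. (norm (brk k powr (1/8) / zw \<alpha> k))\<^sup>2) summable_on UNIV"
    by (rule summable_on_comparison_test) (use bound in \<open>auto simp: abs_of_nonneg[OF zw_pos(2)]\<close>)
  define A where "A = sqrt (\<Sum>\<^sub>\<infinity>k::int^'n. (norm (brk k powr (1/8) / zw \<alpha> k))\<^sup>2) + 1"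
  have A: "l2_le (%k::int^'n. brk k powr (1/8) / zw \<alpha> k) A"
    unfolding A_def by (rule l2_le_le[OF summable_l2_le[OF sm]]) simp
  show ?thesis
  proof (rule that)
    show "A > 0" unfolding A_def by (intro add_nonneg_pos real_sqrt_ge_zero infsum_nonneg) auto
    fix a :: "int^'n => 'b" and r assume "l2_le (%k. zw \<alpha> k * norm (a k)) r"
    from l2_le_mult_l1_le[OF A this]
    have "l1_le (%k. brk k powr (1/8) / zw \<alpha> k * (zw \<alpha> k * norm (a k))) (A * r)" .
    moreover have "brk k powr (1/8) / zw \<alpha> k * (zw \<alpha> k * norm (a k)) = brk k powr (1/8) * norm (a k)" for k
      using zw_pos(1)[of \<alpha> k] by simp
    ultimately show "l1_le (%k. brk k powr (1/8) * norm (a k)) (A * r)" by simp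
  qed
qed

section \<open>Characters and integrals over boxes\<close>

lemma cis_sum: "finite I ==> cis (sum f I) = (\<Prod>i\<in>I. cis (f i))"
  by (induction I rule: finite_induct) (auto simp: cis_mult[symmetric])

lemma integral_cis_cbox:
  fixes l u a :: "'a::euclidean_space"
  shows "(LINT x:cbox l u|lborel. cis (a \<bullet> x)) =
    (\<Prod>b\<in>Basis. LINT s:{l \<bullet> b..u \<bullet> b}|lborel. cis ((a \<bullet> b) * s))"
proof -
  interpret product_sigma_finite "%_::'a. lborel :: real measure"
    by (simp add: product_sigma_finite_def lborel.sigma_finite_measure_axioms)
  define g where "g b s = indicator {l \<bullet> b..u \<bullet> b} s *\<^sub>R cis ((a \<bullet> b) * s)" for b s
  have g: "integrable lborel (g b)" for b
    unfolding g_def by (intro borel_integrable_compact continuous_intros) auto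
  have *: "indicator (cbox l u) x *\<^sub>R cis (a \<bullet> x) = (\<Prod>b\<in>Basis. g b (x \<bullet> b))" for x
  proof (cases "x \<in> cbox l u")
    case True
    then have "(\<Prod>b\<in>Basis. g b (x \<bullet> b)) = (\<Prod>b\<in>Basis. cis ((a \<bullet> b) * (x \<bullet> b)))"
      by (intro prod.cong) (auto simp: g_def mem_box)
    also have "... = cis (a \<bullet> x)" by (simp add: cis_sum[symmetric] euclidean_inner[of a x])
    finally show ?thesis using True by simp
  next
    case False
    then obtain b where "b \<in> Basis" "x \<bullet> b \<notin> {l \<bullet> b..u \<bullet> b}" by (auto simp: mem_box)
    then have "g b (x \<bullet> b) = 0" by (simp add: g_def)
    then have "(\<Prod>b\<in>Basis. g b (x \<bullet> b)) = 0" using \<open>b \<in> Basis\<close> by (auto intro!: prod_zero)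
    then show ?thesis using False by simp
  qed
  have "(LINT x:cbox l u|lborel. cis (a \<bullet> x)) = (LINT x|lborel. (\<Prod>b\<in>Basis. g b (x \<bullet> b)))"
    unfolding set_lebesgue_integral_def * ..
  also have "... = (LINT f|(\<Pi>\<^sub>M b\<in>Basis. lborel). (\<Prod>b\<in>Basis. g b ((\<Sum>b\<in>Basis. f b *\<^sub>R b) \<bullet> b)))"
  proof (subst lborel_eq, subst integral_distr)
    show "(%x. \<Prod>b\<in>Basis. g b (x \<bullet> b)) \<in> borel_measurable borel"
      unfolding *[symmetric]
      by (intro borel_measurable_scaleR borel_measurable_indicator borel_measurable_continuous_onI
          continuous_intros) auto
  qed (auto intro!: arg_cong2[where f = "integral\<^sup>L"])
  also have "... = (LINT f|(\<Pi>\<^sub>M b\<in>Basis. lborel). (\<Prod>b\<in>Basis. g b (f b)))"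
    by (intro Bochner_Integration.integral_cong refl prod.cong) (auto simp: inner_sum_left_Basis)
  also have "... = (\<Prod>b\<in>Basis. integral\<^sup>L lborel (g b))"
    by (rule product_integral_prod) (auto intro: g)
  finally show ?thesis by (simp add: g_def[abs_def] set_lebesgue_integral_def)
qed

lemma integral_cis_interval:
  fixes a l u :: real
  assumes "a \<noteq> 0" "l <= u"
  shows "(LINT s:{l..u}|lborel. cis (a * s)) = (cis (a * u) - cis (a * l)) / (\<i> * a)"
proof -
  have "((%s. cis (a * s) / (\<i> * a)) has_vector_derivative cis (a * x)) (at x within {l..u})" for x
  proof -
    have ii: "- (\<i> * (z * \<i>)) = z" for z by (simp add: mult.commute)
    show ?thesis
      unfolding cis_conv_exp using assms
      by (auto intro!: derivative_eq_intros has_vector_derivative_real_field simp: ii)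
  qed
  then show ?thesis
    unfolding set_lebesgue_integral_def
    by (subst integral_FTC_atLeastAtMost[where F = "%s. cis (a * s) / (\<i> * a)"])
       (auto intro!: continuous_intros assms simp: diff_divide_distrib)
qed

lemma norm_integral_cbox_le:
  fixes f :: "'a::euclidean_space => 'b::euclidean_space"
  assumes "continuous_on (cbox l u) f" "!!x. x \<in> cbox l u ==> norm (f x) <= B" "0 <= B"
  shows "norm (LINT x:cbox l u|lborel. f x) <= B * measure lborel (cbox l u)"
proof -
  have "set_integrable lborel (cbox l u) f"
    unfolding set_integrable_def by (rule borel_integrable_compact) (auto intro: assms)
  then show ?thesis
    using assms by (simp add: set_borel_integral_eq_integral(2) Henstock_Kurzweil_Integration.integrable_bound integrable_continuous)
qed

definition chr :: "int^'n => real^'n => complex" where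
  "chr k y = cis (rvec k \<bullet> y)"

lemma norm_chr [simp]: "norm (chr k y) = 1"
  by (simp add: chr_def)

lemma chr_add: "chr (k + l) y = chr k y * chr l y"
  by (simp add: chr_def rvec_add inner_add_left cis_mult)

lemma chr_minus: "chr (- k) y = cnj (chr k y)"
  by (simp add: chr_def rvec_minus cis_cnj)

lemma chr_zero [simp]: "chr 0 y = 1"
  by (simp add: chr_def rvec_zero)

lemma chr_mult_cnj [simp]: "chr k y * cnj (chr k y) = 1" "cnj (chr k y) * chr k y = 1"
  by (simp_all flip: chr_minus chr_add)

lemma continuous_on_chr [continuous_intros]:
  "continuous_on S f ==> continuous_on S (%x. chr k (f x))"
  unfolding chr_def by (intro continuous_intros)

lemma torus_periodic_chr: "torus_periodic (chr k :: real^'n => complex)"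
  unfolding torus_periodic_def
proof (intro allI)
  fix y :: "real^'n" and j
  have "rvec k \<bullet> (y + (2 * pi) *\<^sub>R axis j 1) = rvec k \<bullet> y + 2 * pi * real_of_int (k $ j)"
    by (simp add: inner_add_right inner_axis rvec_nth)
  then show "chr k (y + (2 * pi) *\<^sub>R axis j 1) = chr k y"
    by (simp add: chr_def cis_mult[symmetric])
qed

text \<open>Parents are stored as periodic functions on \<open>\<real>\<^sup>n\<close>; they are the continuous functions on a compact
  space.\<close>

definition torus_continuous :: "(real^'n => complex) => bool" where
  "torus_continuous U \<longleftrightarrow> continuous_on UNIV U \<and> torus_periodic U"

lemma torus_continuousD: "torus_continuous U ==> continuous_on S U"
  unfolding torus_continuous_def by (blast intro: continuous_on_subset)

lemma torus_continuous_chr: "torus_continuous (chr k)"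
  by (simp add: torus_continuous_def torus_periodic_chr continuous_on_chr)

lemma torus_continuous_const: "torus_continuous (%_. c)"
  by (simp add: torus_continuous_def torus_periodic_def)

lemma torus_continuous_add: "torus_continuous U ==> torus_continuous W ==> torus_continuous (%y. U y + W y)"
  and torus_continuous_diff: "torus_continuous U ==> torus_continuous W ==> torus_continuous (%y. U y - W y)"
  and torus_continuous_mult: "torus_continuous U ==> torus_continuous W ==> torus_continuous (%y. U y * W y)"
  by (auto simp: torus_continuous_def torus_periodic_def intro!: continuous_intros)

lemma torus_continuous_compose:
  "torus_continuous U ==> continuous_on UNIV g ==> torus_continuous (%y. g (U y))"
  unfolding torus_continuous_def torus_periodic_def
  by (auto intro: continuous_on_compose2[of UNIV g])

lemma torus_continuous_cnj: "torus_continuous U ==> torus_continuous (%y. cnj (U y))"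
  by (rule torus_continuous_compose) (auto intro: continuous_intros)

lemma torus_continuous_sum:
  "(!!i. i \<in> I ==> torus_continuous (f i)) ==> torus_continuous (%y. \<Sum>i\<in>I. f i y)"
  by (induction I rule: infinite_finite_induct) (auto intro: torus_continuous_const torus_continuous_add)

text \<open>The coordinatewise exponential maps \<open>\<real>\<^sup>n\<close> onto the torus as a compact set in \<open>\<complex>\<^sup>n\<close>.\<close>

definition torus_map :: "real^'n => complex^'n" where
  "torus_map y = (\<chi> j. cis (y $ j))"

lemma torus_periodic_shift:
  assumes "torus_periodic U" shows "U (y + (2 * pi) *\<^sub>R rvec k) = U y"
proof -
  have 1: "U (y + (2 * pi * of_int m) *\<^sub>R axis j 1) = U y" for m y j
  proof (induction m rule: int_induct[where k = 0])
    case (step1 i)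
    have "U (y + (2 * pi * of_int (i + 1)) *\<^sub>R axis j 1) =
        U ((y + (2 * pi * of_int i) *\<^sub>R axis j 1) + (2 * pi) *\<^sub>R axis j 1)"
      by (simp add: algebra_simps)
    then show ?case using step1 assms by (simp add: torus_periodic_def)
  next
    case (step2 i)
    have "U (y + (2 * pi * of_int i) *\<^sub>R axis j 1) =
        U ((y + (2 * pi * of_int (i - 1)) *\<^sub>R axis j 1) + (2 * pi) *\<^sub>R axis j 1)"
      by (simp add: algebra_simps)
    then show ?case using step2 assms by (simp add: torus_periodic_def)
  qed simp
  have "U (y + (\<Sum>j\<in>J. (2 * pi * of_int (k $ j)) *\<^sub>R axis j 1)) = U y" if "finite J" for J
    using that
  proof (induction J rule: finite_induct)
    case (insert j J)
    have "U (y + (\<Sum>j\<in>insert j J. (2 * pi * of_int (k $ j)) *\<^sub>R axis j 1)) =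
       U ((y + (\<Sum>j\<in>J. (2 * pi * of_int (k $ j)) *\<^sub>R axis j 1)) + (2 * pi * of_int (k $ j)) *\<^sub>R axis j 1)"
      using insert by (simp add: algebra_simps)
    then show ?case using insert 1 by simp
  qed simp
  moreover have "(2 * pi) *\<^sub>R rvec k = (\<Sum>j\<in>UNIV. (2 * pi * of_int (k $ j)) *\<^sub>R axis j 1)"
    by (simp add: vec_eq_iff rvec_nth axis_def if_distrib sum.delta cong: if_cong)
  ultimately show ?thesis by simp
qed

lemma torus_map_eq_imp:
  assumes "torus_periodic U" "torus_map y = torus_map z" shows "U y = U z"
proof -
  have "\<exists>m. y $ j = z $ j + 2 * pi * of_int m" for j
  proof -
    have "cis (y $ j) = cis (z $ j)" using assms(2) by (simp add: torus_map_def vec_eq_iff)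
    then have "sin (y $ j) = sin (z $ j) \<and> cos (y $ j) = cos (z $ j)" by (simp add: complex_eq_iff)
    then show ?thesis unfolding sin_cos_eq_iff by (auto simp: ac_simps)
  qed
  then obtain m where m: "!!j. y $ j = z $ j + 2 * pi * of_int (m j)" by metis
  have "y = z + (2 * pi) *\<^sub>R rvec (\<chi> j. m j)" by (simp add: vec_eq_iff m rvec_nth)
  then show ?thesis using torus_periodic_shift[OF assms(1)] by simp
qed

lemma torus_cell_repr: "\<exists>y'\<in>torus_cell. torus_map y' = torus_map y"
proof -
  define y' :: "real^'a" where "y' = y + (2 * pi) *\<^sub>R rvec (\<chi> j. - \<lfloor>y $ j / (2 * pi)\<rfloor>)"
  have "0 <= y' $ j \<and> y' $ j <= 2 * pi" for j
  proof -
    let ?f = "\<lfloor>y $ j / (2 * pi)\<rfloor>"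
    have "of_int ?f <= y $ j / (2 * pi)" "y $ j / (2 * pi) <= of_int ?f + 1" by linarith+
    from this[THEN mult_left_mono[of _ _ "2 * pi"]]
    have "2 * pi * of_int ?f <= y $ j" "y $ j <= 2 * pi * (of_int ?f + 1)" by simp_all
    then show ?thesis by (simp add: y'_def rvec_nth algebra_simps)
  qed
  moreover have "torus_map y' = torus_map y"
  proof -
    have "cis (y $ j - 2 * pi * of_int \<lfloor>y $ j / (2 * pi)\<rfloor>) = cis (y $ j)" for j
      using cis_multiple_2pi[of "- of_int \<lfloor>y $ j / (2 * pi)\<rfloor>"]
        cis_mult[of "y $ j" "- (2 * pi * of_int \<lfloor>y $ j / (2 * pi)\<rfloor>)"] by simp
    then show ?thesis by (simp add: torus_map_def y'_def rvec_nth vec_eq_iff)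
  qed
  ultimately show ?thesis by (auto simp: torus_cell_def mem_box_cart)
qed

lemma torus_continuous_bounded:
  fixes U :: "real^'n => complex"
  assumes "torus_continuous U" obtains B where "B > 0" "!!y. norm (U y) <= B"
proof -
  have "compact (U ` torus_cell)"
    unfolding torus_cell_def by (intro compact_continuous_image torus_continuousD[OF assms] compact_cbox)
  then obtain B where B: "B > 0" "!!y. y \<in> torus_cell ==> norm (U y) <= B"
    using compact_imp_bounded bounded_pos by (metis imageI)
  show ?thesis
  proof (rule that[OF B(1)])
    fix y :: "real^'n"
    obtain y' where "y' \<in> torus_cell" "torus_map y' = torus_map y" using torus_cell_repr by blast
    then show "norm (U y) <= B"
      using torus_map_eq_imp[of U y' y] assms B(2)[of y'] by (simp add: torus_continuous_def)
  qed
qed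

section \<open>Fourier coefficients of continuous functions on the torus\<close>

lemma box_ne_empty_cart: "(!!j. l $ j <= u $ j) ==> cbox l u \<noteq> ({} :: (real^'n) set)"
  by (auto simp: cbox_def box_ne_empty Basis_vec_def inner_axis)

lemma measure_torus_cell: "measure lborel (torus_cell :: (real^'n) set) = (2 * pi) ^ CARD('n)"
  unfolding torus_cell_def by (subst content_cbox_cart) (auto simp: box_ne_empty_cart)

lemma torus_cell_integrable:
  fixes f :: "real^'n => complex"
  assumes "continuous_on UNIV f" shows "set_integrable lborel torus_cell f"
  unfolding set_integrable_def torus_cell_def
  by (rule borel_integrable_compact) (auto intro: continuous_on_subset[OF assms])

lemma fourier_coeff_shift:
  "fourier_coeff U k = fourier_coeff (%y. chr (- k) y * U y) 0"
  by (simp add: fourier_coeff_def chr_def rvec_minus rvec_zero)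

lemma fourier_coeff_terms_integrable:
  "torus_continuous U ==> set_integrable lborel torus_cell (%y. cis (- (rvec k \<bullet> y)) * U y)"
  by (intro torus_cell_integrable continuous_intros torus_continuousD)

lemma fourier_coeff_add:
  "torus_continuous U ==> torus_continuous W ==>
    fourier_coeff (%y. U y + W y) k = fourier_coeff U k + fourier_coeff W k"
  by (simp add: fourier_coeff_def distrib_left set_integral_add fourier_coeff_terms_integrable)

lemma fourier_coeff_cmult: "fourier_coeff (%y. c * U y) k = c * fourier_coeff U k"
  by (simp add: fourier_coeff_def mult.left_commute)

lemma fourier_coeff_diff:
  assumes "torus_continuous U" "torus_continuous W"
  shows "fourier_coeff (%y. U y - W y) k = fourier_coeff U k - fourier_coeff W k"
  using assms by (simp add: fourier_coeff_def right_diff_distrib set_integral_diff fourier_coeff_terms_integrable)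

lemma fourier_coeff_norm_le:
  fixes U :: "real^'n => complex"
  assumes "torus_continuous U" "!!y. norm (U y) <= B"
  shows "norm (fourier_coeff U k) <= B"
proof -
  have B: "0 <= B" using assms(2)[of 0] norm_ge_zero order_trans by blast
  have "norm (LINT y:torus_cell|lborel. cis (- (rvec k \<bullet> y)) * U y) <= B * measure lborel (torus_cell :: (real^'n) set)"
    unfolding torus_cell_def
    by (rule norm_integral_cbox_le)
       (auto simp: norm_mult assms B intro!: continuous_intros torus_continuousD[OF assms(1)])
  then show ?thesis
    unfolding fourier_coeff_def measure_torus_cell norm_mult[of "of_real _"] norm_of_real
    by (simp add: divide_le_eq)
qed

lemma fourier_coeff_chr: "fourier_coeff (chr l :: real^'n => complex) k = (if k = l then 1 else 0)"
proof -
  have eq: "cis (- (rvec k \<bullet> y)) * chr l y = cis (rvec (l - k) \<bullet> y)" for y :: "real^'n"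
    by (simp add: chr_def cis_mult rvec_diff inner_diff_left)
  have "(LINT y:torus_cell|lborel. cis (rvec m \<bullet> y)) = (if m = 0 then of_real ((2 * pi) ^ CARD('n)) else 0)"
    for m :: "int^'n"
  proof (cases "m = 0")
    case True
    then have "(LINT y:torus_cell|lborel. cis (rvec m \<bullet> y)) = of_real (measure lborel (torus_cell :: (real^'n) set))"
      by (simp add: rvec_zero set_lebesgue_integral_def torus_cell_def scaleR_conv_of_real)
    then show ?thesis using True measure_torus_cell[where 'n = 'n] by simp
  next
    case False
    then obtain j where j: "m $ j \<noteq> 0" by (auto simp: vec_eq_iff)
    have b: "axis j 1 \<in> (Basis :: (real^'n) set)" by (simp add: axis_in_Basis_iff)
    have "(LINT s:{0 \<bullet> axis j 1..(\<chi> j. 2 * pi) \<bullet> axis j 1}|lborel. cis ((rvec m \<bullet> axis j 1) * s)) = 0"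
      using j cis_multiple_2pi[of "of_int (m $ j)"]
      by (simp add: inner_axis rvec_nth integral_cis_interval mult.commute[of _ "2 * pi"])
    then show ?thesis
      using False unfolding torus_cell_def integral_cis_cbox
      by (simp add: prod_zero_iff) (use b in blast)
  qed
  then show ?thesis by (simp add: fourier_coeff_def eq)
qed

section \<open>Density of trigonometric polynomials\<close>

inductive trig_poly :: "(real^'n => complex) => bool" where
  chr: "trig_poly (%y. c * chr k y)"
| add: "trig_poly f ==> trig_poly g ==> trig_poly (%y. f y + g y)"

lemma trig_poly_const: "trig_poly (%_. c)"
  using trig_poly.chr[of c 0] by simp

lemma trig_poly_chr_mult: "trig_poly g ==> trig_poly (%y. c * chr k y * g y)"
proof (induction rule: trig_poly.induct)
  case (chr d l)
  have "(%y. c * chr k y * (d * chr l y)) = (%y. (c * d) * chr (k + l) y)"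
    by (simp add: fun_eq_iff chr_add)
  then show ?case by (metis trig_poly.chr)
next
  case (add f g)
  then show ?case by (simp add: distrib_left trig_poly.add)
qed

lemma trig_poly_mult: "trig_poly f ==> trig_poly g ==> trig_poly (%y. f y * g y)"
proof (induction rule: trig_poly.induct)
  case (chr c k)
  then show ?case by (rule trig_poly_chr_mult)
next
  case (add f h)
  then show ?case by (simp add: distrib_right trig_poly.add)
qed

lemma trig_poly_torus_continuous: "trig_poly f ==> torus_continuous f"
  by (induction rule: trig_poly.induct)
     (intro torus_continuous_mult torus_continuous_const torus_continuous_chr torus_continuous_add; assumption)+

lemma compact_range_torus_map: "compact (range (torus_map :: real^'n => complex^'n))"
proof -
  have "range (torus_map :: real^'n => complex^'n) = torus_map ` torus_cell"
    by (auto simp: image_iff) (metis torus_cell_repr)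
  moreover have "compact (torus_map ` torus_cell :: (complex^'n) set)"
    unfolding torus_cell_def torus_map_def
    by (intro compact_continuous_image compact_cbox continuous_on_vec_lambda continuous_intros)
  ultimately show ?thesis by simp
qed

text \<open>Continuity of the factor is a matter of compactness: preimages of closed sets are images of compact
  subsets of the cell.\<close>

lemma torus_continuous_factor:
  fixes U :: "real^'n => complex"
  assumes U: "torus_continuous U"
  obtains g where "continuous_on (range torus_map) g" "!!y. g (torus_map y) = U y"
proof -
  define g where "g z = U (SOME y. torus_map y = z)" for z
  have g: "g (torus_map y) = U y" for y
    unfolding g_def
    by (rule torus_map_eq_imp[of U]) (use U in \<open>auto simp: torus_continuous_def intro: someI\<close>)
  have cm: "continuous_on S (torus_map :: real^'n => complex^'n)" for S
    unfolding torus_map_def by (intro continuous_on_vec_lambda continuous_intros)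
  have "closed (g -` B \<inter> range torus_map)" if B: "closed B" for B
  proof -
    have "g -` B \<inter> range torus_map = torus_map ` (U -` B \<inter> torus_cell)"
    proof safe
      fix y assume "g (torus_map y) \<in> B"
      then show "torus_map y \<in> torus_map ` (U -` B \<inter> torus_cell)"
        using torus_cell_repr[of y] by (metis IntI g imageI vimageI)
    qed (auto simp: g)
    moreover have "compact (U -` B \<inter> torus_cell)"
      unfolding torus_cell_def
      by (intro closed_Int_compact compact_cbox closed_vimage B torus_continuousD U)
    ultimately show ?thesis using cm by (metis compact_continuous_image compact_imp_closed)
  qed
  then have "continuous_on (range torus_map) g"
    using compact_range_torus_map by (subst continuous_on_closed_vimage) (auto intro: compact_imp_closed)
  then show ?thesis using that g by blast
qed

text \<open>Stone--Weierstrass on the compact image of the torus map, to which continuous functions on the torus descend.\<close>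

lemma trig_poly_dense:
  fixes U :: "real^'n => complex"
  assumes U: "torus_continuous U" and \<epsilon>: "\<epsilon> > 0"
  obtains p where "trig_poly p" "!!y. norm (U y - p y) < \<epsilon>"
proof -
  define R where "R = {f :: complex^'n => real. continuous_on UNIV f \<and> trig_poly (%y. of_real (f (torus_map y)))}"
  interpret function_ring_on R "range torus_map"
  proof
    show "compact (range (torus_map :: real^'n => complex^'n))" by (rule compact_range_torus_map)
    show "continuous_on (range torus_map) f" if "f \<in> R" for f
      using that by (auto simp: R_def intro: continuous_on_subset)
    show "(%x. f x + g x) \<in> R" "(%x. f x * g x) \<in> R" if "f \<in> R" "g \<in> R" for f g
      using that by (auto simp: R_def intro!: continuous_intros trig_poly.add trig_poly_mult)
    show "(%_. c) \<in> R" for c by (auto simp: R_def trig_poly_const)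
    show "\<exists>f\<in>R. f x \<noteq> f y" if xy: "x \<in> range torus_map" "y \<in> range torus_map" "x \<noteq> y" for x y
    proof -
      obtain j where j: "x $ j \<noteq> y $ j" using xy by (auto simp: vec_eq_iff)
      let ?e = "axis j 1 :: int^'n"
      have re: "rvec ?e \<bullet> z = z $ j" for z
      proof -
        have "rvec ?e = axis j 1" by (simp add: vec_eq_iff rvec_nth axis_def)
        then show ?thesis by (simp add: inner_axis inner_commute)
      qed
      have "(%z. complex_of_real (cos (z $ j))) = (%z :: real^'n. (1/2) * chr ?e z + (1/2) * chr (- ?e) z)"
        "(%z. complex_of_real (sin (z $ j))) = (%z :: real^'n. (- \<i>/2) * chr ?e z + (\<i>/2) * chr (- ?e) z)"
        by (simp_all add: fun_eq_iff chr_def re rvec_minus complex_eq_iff)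
      moreover have "trig_poly (%z. (1/2) * chr ?e z + (1/2) * chr (- ?e) z)"
        "trig_poly (%z. (- \<i>/2) * chr ?e z + (\<i>/2) * chr (- ?e) z)"
        by (rule trig_poly.add; rule trig_poly.chr)+
      ultimately have "trig_poly (%z :: real^'n. complex_of_real (cos (z $ j)))"
        "trig_poly (%z :: real^'n. complex_of_real (sin (z $ j)))" by simp_all
      then have R: "(%z. Re (z $ j)) \<in> R" "(%z. Im (z $ j)) \<in> R"
        by (auto simp: R_def torus_map_def intro!: continuous_intros)
      show ?thesis
      proof (cases "Re (x $ j) = Re (y $ j)")
        case True
        then have "Im (x $ j) \<noteq> Im (y $ j)" using j by (auto simp: complex_eq_iff)
        then show ?thesis by (rule bexI[OF _ R(2)])
      next
        case False
        then show ?thesis by (rule bexI[OF _ R(1)])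
      qed
    qed
  qed
  obtain g where g: "continuous_on (range torus_map) g" "!!y. g (torus_map y) = U y"
    by (rule torus_continuous_factor[OF U]) blast
  have c: "continuous_on (range torus_map) (%z. Re (g z))" "continuous_on (range torus_map) (%z. Im (g z))"
    by (intro continuous_intros g)+
  obtain f1 where f1: "f1 \<in> R" "\<forall>x\<in>range torus_map. \<bar>Re (g x) - f1 x\<bar> < \<epsilon> / 2"
    using Stone_Weierstrass_basic[OF c(1), of "\<epsilon> / 2"] \<epsilon> by auto
  obtain f2 where f2: "f2 \<in> R" "\<forall>x\<in>range torus_map. \<bar>Im (g x) - f2 x\<bar> < \<epsilon> / 2"
    using Stone_Weierstrass_basic[OF c(2), of "\<epsilon> / 2"] \<epsilon> by auto
  define p where "p y = of_real (f1 (torus_map y)) + \<i> * of_real (f2 (torus_map y))" for y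
  show ?thesis
  proof (rule that)
    have "trig_poly (%y. of_real (f1 (torus_map y)))" "trig_poly (%y. of_real (f2 (torus_map y)))"
      using f1(1) f2(1) by (auto simp: R_def)
    then show "trig_poly p"
      unfolding p_def by (intro trig_poly.add trig_poly_mult trig_poly_const)
    fix y
    have "norm (U y - p y) <= \<bar>Re (U y - p y)\<bar> + \<bar>Im (U y - p y)\<bar>" by (rule cmod_le)
    also have "... < \<epsilon>"
      using f1(2) f2(2) by (auto simp: p_def g(2) intro!: add_strict_mono[of _ "\<epsilon>/2" _ "\<epsilon>/2", simplified])
    finally show "norm (U y - p y) < \<epsilon>" .
  qed
qed

section \<open>Absolutely convergent Fourier series\<close>

lemma torus_continuous_zeroI:
  fixes U :: "real^'n => complex"
  assumes U: "torus_continuous U" and 0: "fourier_coeff (%y. U y * cnj (U y)) 0 = 0"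
  shows "U y = 0"
proof -
  have si: "set_integrable lborel torus_cell (%y. (cmod (U y))\<^sup>2)"
    unfolding set_integrable_def torus_cell_def
    by (rule borel_integrable_compact) (auto intro!: continuous_intros torus_continuousD[OF U])
  have "(LINT y:torus_cell|lborel. complex_of_real ((cmod (U y))\<^sup>2)) = 0"
    unfolding complex_norm_square using 0 by (simp add: fourier_coeff_def rvec_zero)
  then have "complex_of_real (LINT y:torus_cell|lborel. (cmod (U y))\<^sup>2) = 0"
    by (simp only: set_integral_complex_of_real)
  then have "(LINT y:torus_cell|lborel. (cmod (U y))\<^sup>2) = 0" by simp
  then have i0: "integral torus_cell (%y. (cmod (U y))\<^sup>2) = 0"
    by (simp only: set_borel_integral_eq_integral(2)[OF si])
  have ne: "box (0 :: real^'n) (\<chi> j. 2 * pi) \<noteq> {}"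
    by (auto simp: box_ne_empty Basis_vec_def inner_axis)
  have z: "U y' = 0" if "y' \<in> torus_cell" for y'
  proof -
    have "continuous_on (cbox 0 (\<chi> j. 2 * pi)) (%y. (cmod (U y))\<^sup>2)"
      by (intro continuous_intros torus_continuousD[OF U])
    from integral_cbox_eq_0_iff[OF this ne] i0 that show ?thesis
      by (auto simp: torus_cell_def)
  qed
  obtain y' where "y' \<in> torus_cell" "torus_map y' = torus_map y" using torus_cell_repr by blast
  then show ?thesis using z torus_map_eq_imp[of U y' y] U by (simp add: torus_continuous_def)
qed

text \<open>If all coefficients vanish, \<open>U\<close> is orthogonal to all trigonometric polynomials; approximating \<open>U\<close> itself
  by one makes the mean of \<open>|U|\<^sup>2\<close> vanish.\<close>

lemma fourier_coeff_zero_imp: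
  fixes U :: "real^'n => complex"
  assumes U: "torus_continuous U" and 0: "!!k. fourier_coeff U k = 0"
  shows "U y = 0"
proof (rule torus_continuous_zeroI[OF U])
  obtain B where B: "B > 0" "!!y. norm (U y) <= B" by (rule torus_continuous_bounded[OF U]) blast
  have p0: "fourier_coeff (%y. U y * cnj (p y)) 0 = 0" if "trig_poly p" for p
    using that
  proof (induction rule: trig_poly.induct)
    case (chr c k)
    have "(%y. U y * cnj (c * chr k y)) = (%y. cnj c * (chr (- k) y * U y))"
      by (simp add: fun_eq_iff chr_minus)
    then show ?case using 0[of k] by (simp add: fourier_coeff_cmult flip: fourier_coeff_shift)
  next
    case (add f g)
    then have "torus_continuous f" "torus_continuous g" by (auto intro: trig_poly_torus_continuous)
    then show ?case using add
      by (simp add: distrib_left fourier_coeff_add torus_continuous_mult U torus_continuous_cnj)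
  qed
  have le: "norm (fourier_coeff (%y. U y * cnj (U y)) 0) <= B * \<epsilon>" if \<epsilon>: "\<epsilon> > 0" for \<epsilon>
  proof -
    obtain p where p: "trig_poly p" "!!y. norm (U y - p y) < \<epsilon>" by (rule trig_poly_dense[OF U \<epsilon>]) blast
    have tc: "torus_continuous (%y. U y * cnj (U y))" "torus_continuous (%y. U y * cnj (p y))"
      by (intro torus_continuous_mult U torus_continuous_cnj trig_poly_torus_continuous p)+
    have "fourier_coeff (%y. U y * cnj (U y)) 0 = fourier_coeff (%y. U y * cnj (U y) - U y * cnj (p y)) 0"
      using p0[OF p(1)] by (simp add: fourier_coeff_diff[OF tc])
    also have "norm \<dots> <= B * \<epsilon>"
    proof (rule fourier_coeff_norm_le[OF torus_continuous_diff[OF tc]])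
      fix y
      have "norm (U y * cnj (U y) - U y * cnj (p y)) = norm (U y) * norm (U y - p y)"
        by (metis complex_cnj_diff complex_mod_cnj norm_mult right_diff_distrib)
      also have "... <= B * \<epsilon>" using B(2) p(2)[of y] B(1) by (intro mult_mono) auto
      finally show "norm (U y * cnj (U y) - U y * cnj (p y)) <= B * \<epsilon>" .
    qed
    finally show ?thesis .
  qed
  have "norm (fourier_coeff (%y. U y * cnj (U y)) 0) <= 0"
  proof (rule field_le_epsilon)
    fix e :: real assume "e > 0"
    then show "norm (fourier_coeff (%y. U y * cnj (U y)) 0) <= 0 + e"
      using le[of "e / B"] B(1) by simp
  qed
  then show "fourier_coeff (%y. U y * cnj (U y)) 0 = 0" by simp
qed

definition trig_series :: "(int^'n => complex) => real^'n => complex" where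
  "trig_series a y = (\<Sum>\<^sub>\<infinity>k. a k * chr k y)"

lemma trig_series_terms_l1: "l1_le a r ==> l1_le (%k. a k * chr k y) r"
  by (erule l1_le_mono) (auto simp: norm_mult)

lemma trig_series_norm_le: "l1_le a r ==> norm (trig_series a y) <= r"
  unfolding trig_series_def by (intro l1_le_norm_infsum trig_series_terms_l1)

lemma trig_series_uniform:
  "l1_le a r ==> uniform_limit UNIV (%F y. \<Sum>k\<in>F. a k * chr k y) (trig_series a) (finite_subsets_at_top UNIV)"
  unfolding trig_series_def[abs_def]
  by (rule Weierstrass_m_test_general[where M = "%k. norm (a k)"])
     (auto simp: norm_mult intro: l1_le_abs_summable)

lemma torus_continuous_trig_series:
  assumes "l1_le a r" shows "torus_continuous (trig_series a)"
proof -
  have "continuous_on UNIV (trig_series a)"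
    by (rule uniform_limit_theorem[OF _ trig_series_uniform[OF assms]])
       (auto intro!: always_eventually continuous_intros)
  moreover have "torus_periodic (trig_series a)"
    unfolding torus_periodic_def trig_series_def
    by (intro allI infsum_cong arg_cong2[where f = "(*)"] refl)
       (rule torus_periodic_chr[unfolded torus_periodic_def, rule_format])
  ultimately show ?thesis by (simp add: torus_continuous_def)
qed

lemma torus_continuous_finite_series: "torus_continuous (%y. \<Sum>k\<in>F. a k * chr k y)"
  by (intro torus_continuous_sum torus_continuous_mult torus_continuous_const torus_continuous_chr)

lemma fourier_coeff_finite_series:
  assumes "finite F"
  shows "fourier_coeff (%y. \<Sum>l\<in>F. a l * chr l y) k = (if k \<in> F then a k else 0)"
  using assms
proof (induction F rule: finite_induct)
  case empty
  then show ?case by (simp add: fourier_coeff_def)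
next
  case (insert l F)
  then have "fourier_coeff (%y. \<Sum>l\<in>insert l F. a l * chr l y) k =
      a l * fourier_coeff (chr l) k + fourier_coeff (%y. \<Sum>l\<in>F. a l * chr l y) k"
    by (simp add: fourier_coeff_add torus_continuous_mult torus_continuous_const torus_continuous_chr
        torus_continuous_finite_series fourier_coeff_cmult)
  then show ?case using insert by (auto simp: fourier_coeff_chr)
qed

lemma fourier_coeff_trig_series:
  assumes a: "l1_le a r" shows "fourier_coeff (trig_series a) k = a k"
proof -
  have "norm (fourier_coeff (trig_series a) k - a k) <= 0"
  proof (rule field_le_epsilon)
    fix e :: real assume e: "e > 0"
    have "\<forall>\<^sub>F F in finite_subsets_at_top UNIV. \<forall>y\<in>UNIV. dist (\<Sum>k\<in>F. a k * chr k y) (trig_series a y) < e"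
      by (rule uniform_limitD[OF trig_series_uniform[OF a] e])
    moreover have "\<forall>\<^sub>F F in finite_subsets_at_top UNIV. finite F \<and> k \<in> F"
      by (subst eventually_finite_subsets_at_top) (rule exI[where x = "{k}"], auto)
    ultimately have "\<forall>\<^sub>F F in finite_subsets_at_top UNIV. finite F \<and> k \<in> F \<and>
        (\<forall>y. dist (\<Sum>k\<in>F. a k * chr k y) (trig_series a y) < e)"
      by eventually_elim auto
    from eventually_happens[OF this] obtain F
      where F: "finite F" "k \<in> F" "!!y. dist (\<Sum>k\<in>F. a k * chr k y) (trig_series a y) < e"
      by auto
    have "norm (fourier_coeff (%y. trig_series a y - (\<Sum>k\<in>F. a k * chr k y)) k) <= e"
    proof (rule fourier_coeff_norm_le)
      show "norm (trig_series a y - (\<Sum>k\<in>F. a k * chr k y)) <= e" for y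
        using F(3)[of y] by (simp add: dist_norm norm_minus_commute)
    qed (intro torus_continuous_diff torus_continuous_trig_series[OF a] torus_continuous_finite_series)
    then show "norm (fourier_coeff (trig_series a) k - a k) <= 0 + e"
      using F(1,2) by (simp add: fourier_coeff_diff torus_continuous_trig_series[OF a]
          torus_continuous_finite_series fourier_coeff_finite_series)
  qed
  then show ?thesis by simp
qed

text \<open>Both sides are continuous and have the same coefficients.\<close>

lemma fourier_inversion:
  assumes U: "torus_continuous U" and r: "l1_le (fourier_coeff U) r"
  shows "trig_series (fourier_coeff U) y = U y"
proof -
  have "torus_continuous (%y. trig_series (fourier_coeff U) y - U y)"
    by (intro torus_continuous_diff torus_continuous_trig_series[OF r] U)
  moreover have "fourier_coeff (%y. trig_series (fourier_coeff U) y - U y) k = 0" for k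
    by (simp add: fourier_coeff_diff torus_continuous_trig_series[OF r] U fourier_coeff_trig_series[OF r])
  ultimately have "trig_series (fourier_coeff U) y - U y = 0"
    by (rule fourier_coeff_zero_imp)
  then show ?thesis by simp
qed

text \<open>The Wiener algebra, the natural home of products: in it the Fourier coefficients of a product
  are the convolution of the coefficients.\<close>

definition wiener :: "(real^'n => complex) => bool" where
  "wiener U \<longleftrightarrow> torus_continuous U \<and> (\<exists>r. l1_le (fourier_coeff U) r)"

lemma wienerI: "torus_continuous U ==> l1_le (fourier_coeff U) r ==> wiener U"
  by (auto simp: wiener_def)

lemma wiener_torus_continuous: "wiener U ==> torus_continuous U"
  by (simp add: wiener_def)

lemma wiener_trig_series:
  assumes "l1_le a r"
  shows "wiener (trig_series a)" "fourier_coeff (trig_series a) = a"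
proof -
  show eq: "fourier_coeff (trig_series a) = a"
    by (rule ext) (rule fourier_coeff_trig_series[OF assms])
  show "wiener (trig_series a)"
    by (rule wienerI[OF torus_continuous_trig_series[OF assms]]) (unfold eq, rule assms)
qed

lemma wiener_eq_trig_series: "wiener U ==> U = trig_series (fourier_coeff U)"
  unfolding wiener_def by (rule ext) (auto simp: fourier_inversion)

lemma wiener_norm_le:
  assumes "wiener U" "l1_le (fourier_coeff U) r" shows "norm (U y) <= r"
  using wiener_eq_trig_series[OF assms(1)] trig_series_norm_le[OF assms(2), of y] by metis

lemma wiener_add:
  assumes "wiener U" "wiener W"
  shows "wiener (%y. U y + W y)"
    and "fourier_coeff (%y. U y + W y) = (%k. fourier_coeff U k + fourier_coeff W k)"
proof -
  obtain r s where rs: "l1_le (fourier_coeff U) r" "l1_le (fourier_coeff W) s"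
    and U: "torus_continuous U" and W: "torus_continuous W"
    using assms by (auto simp: wiener_def)
  show eq: "fourier_coeff (%y. U y + W y) = (%k. fourier_coeff U k + fourier_coeff W k)"
    by (rule ext) (rule fourier_coeff_add[OF U W])
  show "wiener (%y. U y + W y)"
    by (rule wienerI[OF torus_continuous_add[OF U W]]) (unfold eq, rule l1_le_add[OF rs])
qed

lemma wiener_diff:
  assumes "wiener U" "wiener W"
  shows "wiener (%y. U y - W y)"
    and "fourier_coeff (%y. U y - W y) = (%k. fourier_coeff U k - fourier_coeff W k)"
proof -
  obtain r s where rs: "l1_le (fourier_coeff U) r" "l1_le (fourier_coeff W) s"
    and U: "torus_continuous U" and W: "torus_continuous W"
    using assms by (auto simp: wiener_def)
  show eq: "fourier_coeff (%y. U y - W y) = (%k. fourier_coeff U k - fourier_coeff W k)"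
    by (rule ext) (rule fourier_coeff_diff[OF U W])
  show "wiener (%y. U y - W y)"
    by (rule wienerI[OF torus_continuous_diff[OF U W]]) (unfold eq, rule l1_le_diff[OF rs])
qed

lemma wiener_cmult:
  assumes "wiener U"
  shows "wiener (%y. c * U y)" "fourier_coeff (%y. c * U y) = (%k. c * fourier_coeff U k)"
proof -
  obtain r where r: "l1_le (fourier_coeff U) r" and U: "torus_continuous U"
    using assms by (auto simp: wiener_def)
  show eq: "fourier_coeff (%y. c * U y) = (%k. c * fourier_coeff U k)"
    by (rule ext) (rule fourier_coeff_cmult)
  show "wiener (%y. c * U y)"
    by (rule wienerI[OF torus_continuous_mult[OF torus_continuous_const U]]) (unfold eq, rule l1_le_cmult[OF r])
qed

lemma fourier_coeff_const: "fourier_coeff (%_::real^'n. c) k = (if k = 0 then c else 0)"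
  using fourier_coeff_cmult[of c "chr 0" k] by (simp add: fourier_coeff_chr)

lemma wiener_const: "wiener (%_. c)" and const_l1_le: "l1_le (fourier_coeff (%_. c)) (norm c)"
proof -
  show "l1_le (fourier_coeff (%_. c)) (norm c)"
    by (auto simp: l1_le_def fourier_coeff_const if_distrib[of norm] sum.delta cong: if_cong)
  then show "wiener (%_. c)" by (rule wienerI[OF torus_continuous_const])
qed

lemma wiener_cnj:
  assumes "wiener U"
  shows "wiener (%y. cnj (U y))"
    and "fourier_coeff (%y. cnj (U y)) = (%k. cnj (fourier_coeff U (- k)))"
proof -
  obtain r where r: "l1_le (fourier_coeff U) r" using assms by (auto simp: wiener_def)
  have *: "fourier_coeff (%y. cnj (U y)) k = cnj (fourier_coeff U (- k))" for k
  proof -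
    have "(LINT y:torus_cell|lborel. cis (- (rvec k \<bullet> y)) * cnj (U y)) =
        (LINT y:torus_cell|lborel. cnj (cis (- (rvec (- k) \<bullet> y)) * U y))"
      by (simp add: rvec_minus cis_cnj)
    also have "... = cnj (LINT y:torus_cell|lborel. cis (- (rvec (- k) \<bullet> y)) * U y)"
      unfolding set_lebesgue_integral_def
      by (subst Bochner_Integration.integral_cnj[symmetric], rule Bochner_Integration.integral_cong) auto
    finally show ?thesis by (simp add: fourier_coeff_def)
  qed
  then show "fourier_coeff (%y. cnj (U y)) = (%k. cnj (fourier_coeff U (- k)))" by blast
  have "l1_le (%k. fourier_coeff U (- k)) r" by (rule l1_le_inj[OF r]) (auto intro: injI)
  then have "l1_le (fourier_coeff (%y. cnj (U y))) r" by (rule l1_le_mono) (auto simp: *)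
  then show "wiener (%y. cnj (U y))"
    using assms by (auto simp: wiener_def intro: torus_continuous_cnj)
qed

lemma trig_series_mult:
  assumes a: "l1_le a r" and b: "l1_le b s"
  shows "trig_series a y * trig_series b y = trig_series (conv a b) y"
proof -
  let ?f = "%l k. a l * b (k - l) * chr k y"
  have r: "r >= 0" by (rule l1_le_nonneg[OF a])
  have sm: "(%(l, k). ?f l k) summable_on UNIV \<times> UNIV"
  proof (rule l1_le_summable[of _ "r * s"], unfold l1_le_def, intro allI impI)
    fix F :: "((int^'a) \<times> (int^'a)) set" assume F: "finite F"
    have "(\<Sum>p\<in>F. norm (case p of (l, k) => ?f l k)) <= (\<Sum>p\<in>fst ` F \<times> snd ` F. norm (case p of (l, k) => ?f l k))"
      by (rule sum_mono2) (use F in \<open>auto intro!: rev_image_eqI\<close>)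
    also have "... = (\<Sum>l\<in>fst ` F. norm (a l) * (\<Sum>k\<in>snd ` F. norm (b (k - l))))"
      by (simp add: sum_distrib_left sum.cartesian_product norm_mult case_prod_unfold)
    also have "... <= (\<Sum>l\<in>fst ` F. norm (a l) * s)"
      using F by (intro sum_mono mult_left_mono l1_leD[OF l1_le_inj[OF b inj_minus_right]]) auto
    also have "... <= r * s"
      using l1_leD[OF a, of "fst ` F"] F l1_le_nonneg[OF b] by (simp add: mult_right_mono flip: sum_distrib_right)
    finally show "(\<Sum>p\<in>F. norm (case p of (l, k) => ?f l k)) <= r * s" .
  qed
  have inner: "(\<Sum>\<^sub>\<infinity>k. b (k - l) * chr k y) = chr l y * trig_series b y" for l
  proof -
    have "bij_betw (%k. k + l) UNIV UNIV" by (rule bij_betwI[where g = "%k. k - l"]) auto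
    then have "(\<Sum>\<^sub>\<infinity>k. b (k - l) * chr k y) = (\<Sum>\<^sub>\<infinity>k. b k * chr (k + l) y)"
      by (subst infsum_reindex_bij_betw[symmetric, where g = "%k. k + l" and A = UNIV]) auto
    also have "... = (\<Sum>\<^sub>\<infinity>k. chr l y * (b k * chr k y))" by (simp add: chr_add ac_simps)
    also have "... = chr l y * trig_series b y"
      unfolding trig_series_def
      by (rule infsum_cmult_right) (use l1_le_summable[OF trig_series_terms_l1[OF b]] in auto)
    finally show ?thesis .
  qed
  have "trig_series (conv a b) y = (\<Sum>\<^sub>\<infinity>k. \<Sum>\<^sub>\<infinity>l. ?f l k)"
    unfolding trig_series_def conv_def
    by (intro infsum_cong infsum_cmult_left[symmetric] l1_le_summable[OF conv_terms_l1[OF a l1_le_norm_le[OF b]]])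
  also have "... = (\<Sum>\<^sub>\<infinity>l. \<Sum>\<^sub>\<infinity>k. ?f l k)"
    by (rule infsum_swap_banach[symmetric]) (use sm in simp)
  also have "... = (\<Sum>\<^sub>\<infinity>l. a l * chr l y * trig_series b y)"
  proof (rule infsum_cong)
    fix l
    have "(\<Sum>\<^sub>\<infinity>k. ?f l k) = (\<Sum>\<^sub>\<infinity>k. a l * (b (k - l) * chr k y))" by (simp add: ac_simps)
    also have "... = a l * (\<Sum>\<^sub>\<infinity>k. b (k - l) * chr k y)"
      by (rule infsum_cmult_right)
         (use l1_le_summable[OF l1_le_mult_bounded[OF l1_le_inj[OF b inj_minus_right], of "%k. chr k y" 1]] in auto)
    finally show "(\<Sum>\<^sub>\<infinity>k. ?f l k) = a l * chr l y * trig_series b y" by (simp add: inner)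
  qed
  also have "... = trig_series a y * trig_series b y"
    unfolding trig_series_def[of a]
    by (rule infsum_cmult_left) (use l1_le_summable[OF trig_series_terms_l1[OF a]] in auto)
  finally show ?thesis ..
qed

lemma wiener_mult:
  assumes "wiener U" "wiener W"
  shows "wiener (%y. U y * W y)"
    and "fourier_coeff (%y. U y * W y) = conv (fourier_coeff U) (fourier_coeff W)"
proof -
  obtain r s where rs: "l1_le (fourier_coeff U) r" "l1_le (fourier_coeff W) s"
    using assms by (auto simp: wiener_def)
  have eq: "(%y. U y * W y) = trig_series (conv (fourier_coeff U) (fourier_coeff W))"
    by (subst (1) wiener_eq_trig_series[OF assms(1)], subst (1) wiener_eq_trig_series[OF assms(2)])
       (rule ext, rule trig_series_mult[OF rs])
  show "wiener (%y. U y * W y)"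
    "fourier_coeff (%y. U y * W y) = conv (fourier_coeff U) (fourier_coeff W)"
    unfolding eq by (rule wiener_trig_series[OF conv_l1_le[OF rs]])+
qed

section \<open>Means along the orbit\<close>

declare transpose_matrix_vector [simp del]

lemma inner_orbit: "rvec k \<bullet> (transpose P *v x) = (P *v rvec k) \<bullet> x"
  for P :: "real^'n^'d"
  by (metis dot_lmul_matrix inner_commute transpose_matrix_vector)

lemma chr_orbit: "chr k (transpose P *v x) = cis ((P *v rvec k) \<bullet> x)"
  for P :: "real^'n^'d"
  unfolding chr_def inner_orbit ..

text \<open>This is where rational independence enters: no frequency of the torus becomes constant on the orbit.\<close>

lemma projection_matrix_nonzero:
  fixes P :: "real^'n^'d"
  assumes "projection_matrix P" "k \<noteq> 0" shows "P *v rvec k \<noteq> 0"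
proof
  assume "P *v rvec k = 0"
  then have "(\<Sum>j\<in>UNIV. of_rat (of_int (k $ j)) *\<^sub>R column j P) = 0"
    by (simp add: matrix_mult_sum rvec_nth scalar_mult_eq_scaleR)
  from assms(1)[unfolded projection_matrix_def, rule_format, OF this]
  show False using assms(2) by (auto simp: vec_eq_iff)
qed

lemma continuous_on_orbit:
  fixes P :: "real^'n^'d"
  shows "continuous_on S (%x. transpose P *v x)"
  by (rule linear_continuous_on) (rule matrix_vector_mul_bounded_linear)

lemma continuous_on_torus_orbit:
  fixes P :: "real^'n^'d"
  assumes "torus_continuous U"
  shows "continuous_on S (%x. U (transpose P *v x))"
  by (rule continuous_on_compose2[of UNIV U]) (auto intro: torus_continuousD assms continuous_on_orbit)

text \<open>Weyl equidistribution: an averaging kernel that kills every non-constant character computes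
  the mean over the torus, by linearity for trigonometric polynomials and then by density.\<close>

lemma kernel_mean_tendsto:
  fixes P :: "real^'n^'d" and K :: "real => real^'d => real" and U :: "real^'n => complex"
  assumes P: "projection_matrix P"
    and int: "!!R. R > 0 ==> integrable lborel (K R)"
    and nonneg: "!!R x. R > 0 ==> 0 <= K R x"
    and pos: "!!R. R > 0 ==> integral\<^sup>L lborel (K R) > 0"
    and char: "!!a. a \<noteq> 0 ==>
      ((%R. (LINT x|lborel. K R x *\<^sub>R cis (a \<bullet> x)) / of_real (integral\<^sup>L lborel (K R))) \<longlongrightarrow> 0) at_top"
    and U: "torus_continuous U"
  shows "((%R. (LINT x|lborel. K R x *\<^sub>R U (transpose P *v x)) / of_real (integral\<^sup>L lborel (K R)))
    \<longlongrightarrow> fourier_coeff U 0) at_top"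
proof -
  define m where "m W R = (LINT x|lborel. K R x *\<^sub>R W (transpose P *v x)) / of_real (integral\<^sup>L lborel (K R))"
    for W :: "real^'n => complex" and R
  have intW: "integrable lborel (%x. K R x *\<^sub>R W (transpose P *v x))" if W: "torus_continuous W" "R > 0" for W R
  proof -
    obtain B where B: "B > 0" "!!y. norm (W y) <= B" by (rule torus_continuous_bounded[OF W(1)]) blast
    show ?thesis
    proof (rule Bochner_Integration.integrable_bound[where f = "%x. B * K R x"])
      show "integrable lborel (%x. B * K R x)" using int[OF W(2)] by simp
      show "(%x. K R x *\<^sub>R W (transpose P *v x)) \<in> borel_measurable lborel"
        using borel_measurable_integrable[OF int[OF W(2)]]
          borel_measurable_continuous_onI[OF continuous_on_torus_orbit[OF W(1), of UNIV P]]
        by (intro borel_measurable_scaleR) auto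
      show "AE x in lborel. norm (K R x *\<^sub>R W (transpose P *v x)) <= norm (B * K R x)"
        using nonneg[OF W(2)] B by (intro AE_I2) (simp add: mult.commute[of B] mult_left_mono)
    qed
  qed
  have bound: "norm (m W R - m Q R) <= \<epsilon>"
    if "torus_continuous W" "torus_continuous Q" "R > 0" "!!y. norm (W y - Q y) <= \<epsilon>" for W Q R \<epsilon>
  proof -
    have "m W R - m Q R = (LINT x|lborel. K R x *\<^sub>R (W (transpose P *v x) - Q (transpose P *v x))) / of_real (integral\<^sup>L lborel (K R))"
      unfolding m_def using intW that by (simp add: scaleR_diff_right diff_divide_distrib)
    moreover have "norm (LINT x|lborel. K R x *\<^sub>R (W (transpose P *v x) - Q (transpose P *v x))) <= (LINT x|lborel. K R x * \<epsilon>)"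
    proof (rule order_trans[OF integral_norm_bound integral_mono])
      show "integrable lborel (%x. norm (K R x *\<^sub>R (W (transpose P *v x) - Q (transpose P *v x))))"
        using intW that by (simp add: scaleR_diff_right)
      show "integrable lborel (%x. K R x * \<epsilon>)" using int that by simp
    qed (use nonneg that in \<open>auto intro!: mult_left_mono\<close>)
    ultimately show ?thesis
      using pos[OF that(3)] by (simp add: norm_divide divide_le_eq mult.commute)
  qed
  have poly: "(m p \<longlongrightarrow> fourier_coeff p 0) at_top" if "trig_poly p" for p
    using that
  proof (induction rule: trig_poly.induct)
    case (chr c k)
    have eq: "m (%y. c * chr k y) R = c * ((LINT x|lborel. K R x *\<^sub>R cis ((P *v rvec k) \<bullet> x)) / of_real (integral\<^sup>L lborel (K R)))" for R
      by (simp add: m_def chr_orbit flip: mult_scaleR_right)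
    show ?case
    proof (cases "k = 0")
      case True
      have "\<forall>\<^sub>F R in at_top. m (%y. c * chr k y) R = c"
        using eventually_gt_at_top[of "0::real"]
      proof eventually_elim
        case (elim R)
        then show ?case
          using pos[OF elim] int[OF elim] unfolding eq
          by (simp add: True rvec_zero scaleR_conv_of_real)
      qed
      then have "(m (%y. c * chr k y) \<longlongrightarrow> c) at_top" by (rule tendsto_eventually)
      then show ?thesis using True by (simp add: fourier_coeff_const)
    next
      case False
      have "(m (%y. c * chr k y) \<longlongrightarrow> c * 0) at_top"
        unfolding eq by (intro tendsto_mult_left char projection_matrix_nonzero[OF P False])
      then show ?thesis using False by (simp add: fourier_coeff_cmult fourier_coeff_chr)
    qed
  next
    case (add f g)
    have fg: "torus_continuous f" "torus_continuous g" using add trig_poly_torus_continuous by auto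
    have "\<forall>\<^sub>F R in at_top. m f R + m g R = m (%y. f y + g y) R"
      using eventually_gt_at_top[of "0::real"]
      by eventually_elim (use intW fg in \<open>simp add: m_def scaleR_add_right add_divide_distrib\<close>)
    moreover have "((%R. m f R + m g R) \<longlongrightarrow> fourier_coeff f 0 + fourier_coeff g 0) at_top"
      by (intro tendsto_add add)
    ultimately show ?case
      unfolding fourier_coeff_add[OF fg] by (rule Lim_transform_eventually[rotated])
  qed
  have "(m U \<longlongrightarrow> fourier_coeff U 0) at_top"
  proof (rule tendstoI)
    fix e :: real assume e: "e > 0"
    then obtain p where p: "trig_poly p" "!!y. norm (U y - p y) < e / 3"
      using trig_poly_dense[OF U, of "e / 3"] by auto
    have tp: "torus_continuous p" by (rule trig_poly_torus_continuous[OF p(1)])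
    have le: "norm (U y - p y) <= e / 3" for y using p(2)[of y] by simp
    have "\<forall>\<^sub>F R in at_top. dist (m p R) (fourier_coeff p 0) < e / 3"
      by (rule tendstoD[OF poly[OF p(1)]]) (use e in simp)
    with eventually_gt_at_top[of "0::real"]
    show "\<forall>\<^sub>F R in at_top. dist (m U R) (fourier_coeff U 0) < e"
    proof eventually_elim
      case (elim R)
      have 1: "dist (m U R) (m p R) <= e / 3"
        using bound[OF U tp elim(1) le] by (simp add: dist_norm)
      have "dist (fourier_coeff p 0) (fourier_coeff U 0) <= e / 3"
        using fourier_coeff_norm_le[OF torus_continuous_diff[OF U tp] le, of 0]
        by (simp add: dist_norm fourier_coeff_diff[OF U tp] norm_minus_commute)
      then show ?case
        using 1 elim(2) dist_triangle[of "m U R" "fourier_coeff U 0" "m p R"]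
          dist_triangle[of "m p R" "fourier_coeff U 0" "fourier_coeff p 0"] by linarith
    qed
  qed
  then show ?thesis by (simp add: m_def[abs_def])
qed

definition cube :: "real => (real^'d) set" where
  "cube R = cbox (\<chi> j. - R) (\<chi> j. R)"

lemma measure_cube: "R >= 0 ==> measure lborel (cube R :: (real^'d) set) = (2 * R) ^ CARD('d)"
  unfolding cube_def by (subst content_cbox_cart) (auto intro!: box_ne_empty_cart)

lemma integral_indicator_cube:
  "R >= 0 ==> (LINT x|lborel. indicator (cube R :: (real^'d) set) x) = (2 * R) ^ CARD('d)"
  by (simp add: measure_cube)

lemma integrable_indicator_cube: "integrable lborel (indicator (cube R) :: real^'d => real)"
  unfolding cube_def using borel_integrable_compact[OF compact_cbox, of _ _ "%_. 1 :: real"] by simp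

text \<open>The integral factors over the coordinates. A coordinate in which \<open>a\<close> does not vanish contributes a bounded
  factor, the others at most \<open>2 R\<close>.\<close>

lemma cube_char_mean_tendsto:
  fixes a :: "real^'d"
  assumes "a \<noteq> 0"
  shows "((%R. (LINT x|lborel. indicator (cube R) x *\<^sub>R cis (a \<bullet> x)) / of_real ((2 * R) ^ CARD('d))) \<longlongrightarrow> 0) at_top"
proof -
  obtain c where c: "c \<in> Basis" "a \<bullet> c \<noteq> 0" using assms by (metis euclidean_all_zero_iff)
  have le: "norm (LINT s:{- R..R}|lborel. cis (t * s)) <= 2 * R" if "R > 0" for t R :: real
  proof -
    have "norm (LINT s:cbox (- R) R|lborel. cis (t * s)) <= 1 * measure lborel (cbox (- R) R)"
      by (rule norm_integral_cbox_le) (auto intro!: continuous_intros)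
    then show ?thesis using that by simp
  qed
  have le2: "norm (LINT s:{- R..R}|lborel. cis (t * s)) <= 2 / \<bar>t\<bar>" if "R > 0" "t \<noteq> 0" for t R :: real
  proof -
    have "norm (cis (t * R) - cis (t * - R)) <= 2"
      using norm_triangle_ineq4[of "cis (t * R)" "cis (t * - R)"] by simp
    then show ?thesis
      using that by (simp add: integral_cis_interval norm_divide norm_mult divide_right_mono)
  qed
  have bound: "norm ((LINT x|lborel. indicator (cube R) x *\<^sub>R cis (a \<bullet> x)) / of_real ((2 * R) ^ CARD('d))) <= (1 / \<bar>a \<bullet> c\<bar>) / R"
    if R: "R > 0" for R
  proof -
    have eq: "(LINT x|lborel. indicator (cube R) x *\<^sub>R cis (a \<bullet> x)) =
        (\<Prod>b\<in>Basis. LINT s:{- R..R}|lborel. cis ((a \<bullet> b) * s))"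
      using integral_cis_cbox[of "\<chi> j. - R" "\<chi> j. R" a]
      unfolding set_lebesgue_integral_def cube_def
      by (simp cong: prod.cong add: Basis_vec_def inner_axis)
         (auto intro!: prod.cong simp: inner_axis)
    have "norm (LINT x|lborel. indicator (cube R) x *\<^sub>R cis (a \<bullet> x)) =
        norm (LINT s:{- R..R}|lborel. cis ((a \<bullet> c) * s)) * (\<Prod>b\<in>Basis - {c}. norm (LINT s:{- R..R}|lborel. cis ((a \<bullet> b) * s)))"
      unfolding eq prod_norm[symmetric] using c(1) by (subst prod.remove[of _ c]) auto
    also have "... <= 2 / \<bar>a \<bullet> c\<bar> * (\<Prod>b\<in>(Basis :: (real^'d) set) - {c}. 2 * R)"
      by (intro mult_mono le2 prod_mono conjI le prod_nonneg R c) auto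
    also have "(\<Prod>b\<in>(Basis :: (real^'d) set) - {c}. 2 * R) = (2 * R) ^ (CARD('d) - 1)"
      using c(1) by (simp add: card_Diff_singleton)
    finally have num: "norm (LINT x|lborel. indicator (cube R) x *\<^sub>R cis (a \<bullet> x)) <= 2 / \<bar>a \<bullet> c\<bar> * (2 * R) ^ (CARD('d) - 1)" .
    have "norm ((LINT x|lborel. indicator (cube R) x *\<^sub>R cis (a \<bullet> x)) / of_real ((2 * R) ^ CARD('d)))
        <= 2 / \<bar>a \<bullet> c\<bar> * (2 * R) ^ (CARD('d) - 1) / (2 * R) ^ CARD('d)"
    proof -
      have n: "norm (complex_of_real ((2 * R) ^ CARD('d))) = (2 * R) ^ CARD('d)"
        using R by (simp only: norm_of_real) simp
      show ?thesis
        unfolding norm_divide n by (rule divide_right_mono[OF num]) (use R in simp)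
    qed
    also have "... = (1 / \<bar>a \<bullet> c\<bar>) / R"
    proof -
      have "(2 * R) ^ CARD('d) = 2 * R * (2 * R) ^ (CARD('d) - 1)"
        by (metis One_nat_def Suc_pred power_Suc zero_less_card_finite)
      then show ?thesis using R by (simp del: power_mult_distrib)
    qed
    finally show ?thesis .
  qed
  show ?thesis
  proof (rule tendsto_0_le[where K = 1])
    show "((%R. (1 / \<bar>a \<bullet> c\<bar>) / R) \<longlongrightarrow> 0) at_top"
      by (intro tendsto_divide_0[OF tendsto_const] filterlim_at_top_imp_at_infinity filterlim_ident)
    show "\<forall>\<^sub>F R in at_top. norm ((LINT x|lborel. indicator (cube R) x *\<^sub>R cis (a \<bullet> x)) / of_real ((2 * R) ^ CARD('d)))
        <= norm ((1 / \<bar>a \<bullet> c\<bar>) / R) * 1"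
      using eventually_gt_at_top[of "0::real"]
    proof eventually_elim
      case (elim R)
      then show ?case using bound[OF elim] by simp
    qed
  qed
qed

lemma cube_mean_tendsto:
  fixes P :: "real^'n^'d"
  assumes P: "projection_matrix P" and U: "torus_continuous U"
  shows "((%R. (LINT x:cube R|lborel. U (transpose P *v x)) / of_real ((2 * R) ^ CARD('d))) \<longlongrightarrow> fourier_coeff U 0) at_top"
proof -
  have "((%R. (LINT x|lborel. indicator (cube R) x *\<^sub>R U (transpose P *v x)) /
      of_real (LINT x|lborel. indicator (cube R :: (real^'d) set) x)) \<longlongrightarrow> fourier_coeff U 0) at_top"
  proof (rule kernel_mean_tendsto[OF P _ _ _ _ U])
    fix a :: "real^'d" assume "a \<noteq> 0"
    from cube_char_mean_tendsto[OF this]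
    show "((%R. (LINT x|lborel. indicator (cube R) x *\<^sub>R cis (a \<bullet> x)) /
      of_real (LINT x|lborel. indicator (cube R :: (real^'d) set) x)) \<longlongrightarrow> 0) at_top"
      by (rule Lim_transform_eventually)
         (use eventually_ge_at_top[of 0] in \<open>eventually_elim, simp only: integral_indicator_cube\<close>)
  qed (auto simp: integrable_indicator_cube integral_indicator_cube simp del: Bochner_Integration.integral_indicator)
  then show ?thesis
    unfolding set_lebesgue_integral_def
    by (rule Lim_transform_eventually)
       (use eventually_ge_at_top[of 0] in \<open>eventually_elim, simp only: integral_indicator_cube\<close>)
qed

section \<open>Parent functions\<close>

text \<open>The difference of two parents vanishes along the orbit, and the mean of its square along the orbit is the
  mean over the torus.\<close>

lemma is_parent_unique:
  fixes P :: "real^'n^'d"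
  assumes P: "projection_matrix P" and U: "is_parent P U \<phi>" and W: "is_parent P W \<phi>"
  shows "U = W"
proof
  fix y
  let ?D = "%y. U y - W y"
  have D: "torus_continuous ?D"
    using U W by (intro torus_continuous_diff) (auto simp: is_parent_def torus_continuous_def)
  have D0: "?D (transpose P *v x) = 0" for x using U W by (simp add: is_parent_def)
  have "((%R. (LINT x:cube R|lborel. ?D (transpose P *v x) * cnj (?D (transpose P *v x))) / of_real ((2 * R) ^ CARD('d)))
      \<longlongrightarrow> fourier_coeff (%y. ?D y * cnj (?D y)) 0) at_top"
    by (rule cube_mean_tendsto[OF P]) (intro torus_continuous_mult torus_continuous_cnj D)
  then have "((%R :: real. 0) \<longlongrightarrow> fourier_coeff (%y. ?D y * cnj (?D y)) 0) at_top"
    unfolding D0 by simp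
  then have "fourier_coeff (%y. ?D y * cnj (?D y)) 0 = 0"
    using tendsto_unique[OF trivial_limit_at_top_linorder _ tendsto_const] by blast
  from torus_continuous_zeroI[OF D this, of y] show "U y = W y" by simp
qed

lemma parent_eq:
  assumes "projection_matrix P" "is_parent P U \<phi>" shows "parent P \<phi> = U"
  unfolding parent_def using assms is_parent_unique[OF assms(1)] by (intro the_equality) auto

lemma is_parentI:
  assumes "torus_continuous U" "!!x. \<phi> x = U (transpose P *v x)" shows "is_parent P U \<phi>"
  using assms by (simp add: is_parent_def torus_continuous_def)

lemma parent_orbit:
  assumes "projection_matrix P" "torus_continuous U"
  shows "parent P (%x. U (transpose P *v x)) = U"
  by (rule parent_eq[OF assms(1)]) (rule is_parentI[OF assms(2)], simp)

lemma quasiperiodic_parent: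
  assumes P: "projection_matrix P" and q: "quasiperiodic P \<phi>"
  shows "torus_continuous (parent P \<phi>)" "\<phi> x = parent P \<phi> (transpose P *v x)"
proof -
  obtain U where U: "is_parent P U \<phi>" using q by (auto simp: quasiperiodic_def)
  from parent_eq[OF P U] U
  show "torus_continuous (parent P \<phi>)" "\<phi> x = parent P \<phi> (transpose P *v x)"
    by (auto simp: is_parent_def torus_continuous_def)
qed

text \<open>The defining mean of \<open>qp_norm\<close> is a mean over the torus by equidistribution, hence a sum of squares by
  Parseval.\<close>

lemma qp_norm_le:
  fixes P :: "real^'n^'d"
  assumes P: "projection_matrix P" and W: "wiener W" and r: "l2_le (fourier_coeff W) r"
  shows "qp_norm (%x. W (transpose P *v x)) <= r"
proof -
  have c: "wiener (%y. cnj (W y))" by (rule wiener_cnj(1)[OF W])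
  define S where "S = (\<Sum>\<^sub>\<infinity>k. (norm (fourier_coeff W k))\<^sup>2)"
  have "fourier_coeff (%y. W y * cnj (W y)) 0 = (\<Sum>\<^sub>\<infinity>l. fourier_coeff W l * cnj (fourier_coeff W l))"
    by (simp add: wiener_mult(2)[OF W c] wiener_cnj(2)[OF W] conv_def)
  also have "... = (\<Sum>\<^sub>\<infinity>l. of_real ((norm (fourier_coeff W l))\<^sup>2))"
    by (simp only: complex_norm_square)
  also have "... = of_real S"
    unfolding S_def
    by (rule infsumI) (simp only: has_sum_of_real_iff has_sum_infsum[OF l2_le_summable(1)[OF r]])
  finally have coeff: "fourier_coeff (%y. W y * cnj (W y)) 0 = of_real S" .
  have "((%R. (LINT x:cube R|lborel. W (transpose P *v x) * cnj (W (transpose P *v x))) / of_real ((2 * R) ^ CARD('d)))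
      \<longlongrightarrow> of_real S) at_top"
    using cube_mean_tendsto[OF P torus_continuous_mult[OF wiener_torus_continuous[OF W] wiener_torus_continuous[OF c]]]
    by (simp add: coeff)
  then have "((%R. complex_of_real (1 / (2 * R) ^ CARD('d) * (LINT x:cube R|lborel. (cmod (W (transpose P *v x)))\<^sup>2))) \<longlongrightarrow> of_real S) at_top"
    by (simp add: complex_norm_square[symmetric] set_integral_complex_of_real del: of_real_power)
  then have "((%R. 1 / (2 * R) ^ CARD('d) * (LINT x:cube R|lborel. (cmod (W (transpose P *v x)))\<^sup>2)) \<longlongrightarrow> S) at_top"
    by (simp only: tendsto_of_real_iff)
  then have "Lim at_top (%R. 1 / (2 * R) ^ CARD('d) * (LINT x:cube R|lborel. (cmod (W (transpose P *v x)))\<^sup>2)) = S"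
    by (intro tendsto_Lim) auto
  then have "qp_norm (%x. W (transpose P *v x)) = sqrt S"
    by (simp add: qp_norm_def cube_def)
  also have "... <= r"
    unfolding S_def using l2_le_summable(2)[OF r, of UNIV] l2_le_nonneg[OF r]
    by (simp add: real_le_lsqrt real_sqrt_le_iff sqrt_le_D real_sqrt_le_mono)
  finally show ?thesis .
qed

section \<open>The interpolation operator\<close>

definition torus_interp :: "nat => (real^'n => complex) => real^'n => complex" where
  "torus_interp N U y = (\<Sum>k\<in>freq_box N. discrete_coeff N U k * chr k y)"

definition interp_coeff :: "nat => (real^'n => complex) => int^'n => complex" where
  "interp_coeff N U k = (if k \<in> freq_box N then discrete_coeff N U k else 0)"

definition cutoff :: "nat => (int^'n => 'b::zero) => int^'n => 'b" where
  "cutoff N a k = (if k \<in> freq_box N then a k else 0)"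

lemma finite_freq_box [simp]: "finite (freq_box N)"
  using finite_vec_box[of "{- int N..<int N}"] by (simp add: freq_box_def)

lemma finite_grid_index [simp]: "finite (grid_index N)"
  using finite_vec_box[of "{0..<2 * int N}"] by (simp add: grid_index_def)

lemma card_grid_index: "card (grid_index N :: (int^'n) set) = (2 * N) ^ CARD('n)"
  using card_vec_box[of "{0..<2 * int N}", where 'n = 'n]
  by (simp add: grid_index_def nat_mult_distrib power_mult_distrib)

lemma l1_le_cutoff: "l1_le a r ==> l1_le (cutoff N a) r"
  by (erule l1_le_mono) (auto simp: cutoff_def)

lemma interp_eq_torus_interp:
  fixes P :: "real^'n^'d"
  shows "interp P N \<phi> x = torus_interp N (parent P \<phi>) (transpose P *v x)"
  by (simp add: interp_def torus_interp_def chr_orbit)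

lemma finite_support_l1_le:
  assumes "finite F" shows "l1_le (%k. if k \<in> F then a k else 0) (\<Sum>k\<in>F. norm (a k))"
  unfolding l1_le_def
proof (intro allI impI)
  fix G :: "'a set" assume G: "finite G"
  have "(\<Sum>k\<in>G. norm (if k \<in> F then a k else 0)) = (\<Sum>k\<in>G \<inter> F. norm (a k))"
    using G by (simp add: sum.inter_restrict if_distrib cong: if_cong)
  also have "... <= (\<Sum>k\<in>F. norm (a k))" by (rule sum_mono2) (use assms in auto)
  finally show "(\<Sum>k\<in>G. norm (if k \<in> F then a k else 0)) <= (\<Sum>k\<in>F. norm (a k))" .
qed

lemma trig_series_finite_support:
  assumes "finite F"
  shows "trig_series (%k. if k \<in> F then a k else 0) y = (\<Sum>k\<in>F. a k * chr k y)"
proof -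
  have "trig_series (%k. if k \<in> F then a k else 0) y = (\<Sum>\<^sub>\<infinity>k\<in>F. a k * chr k y)"
    unfolding trig_series_def by (rule infsum_cong_neutral) auto
  then show ?thesis using assms by simp
qed

lemma wiener_torus_interp:
  shows "wiener (torus_interp N U)" "fourier_coeff (torus_interp N U) = interp_coeff N U"
proof -
  have eq: "torus_interp N U = trig_series (%k. if k \<in> freq_box N then discrete_coeff N U k else 0)"
    by (rule ext) (simp add: torus_interp_def trig_series_finite_support)
  show "wiener (torus_interp N U)" "fourier_coeff (torus_interp N U) = interp_coeff N U"
    unfolding eq using wiener_trig_series[OF finite_support_l1_le[OF finite_freq_box]]
    by (auto simp: interp_coeff_def[abs_def])
qed

text \<open>Characters with frequencies congruent modulo \<open>2 N\<close> coincide on the grid, all others are orthogonal on it.\<close>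

definition aliased :: "nat => int^'n => int^'n => bool" where
  "aliased N l k \<longleftrightarrow> (\<forall>j. 2 * int N dvd l $ j - k $ j)"

lemma cis_eq_1_imp: "cis t = 1 ==> \<exists>n::int. t = 2 * pi * of_int n"
  using sin_cos_eq_iff[of t 0] by (simp add: complex_eq_iff)

lemma sum_cis_grid:
  assumes N: "N >= 1"
  shows "(\<Sum>i\<in>{0..<2 * int N}. cis (pi / real N * of_int m * of_int i)) =
    (if 2 * int N dvd m then of_nat (2 * N) else 0)"
proof -
  define z where "z = cis (pi / real N * of_int m)"
  have "(\<Sum>i\<in>{0..<2 * int N}. cis (pi / real N * of_int m * of_int i)) = (\<Sum>i<2 * N. z ^ i)"
  proof (rule sum.reindex_bij_witness[where i = int and j = nat])
    fix i assume "i \<in> {0..<2 * int N}"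
    then have "real (nat i) = real_of_int i" by simp
    then show "z ^ nat i = cis (pi / real N * of_int m * of_int i)"
      unfolding z_def Complex.DeMoivre by (simp only: mult.commute)
  qed auto
  also have "... = (if z = 1 then of_nat (2 * N) else (1 - z ^ (2 * N)) / (1 - z))"
    by (rule sum_gp_strict)
  also have "z ^ (2 * N) = 1"
    using N cis_multiple_2pi[of "of_int m"] by (simp add: z_def Complex.DeMoivre field_simps)
  also have "(z = 1) = (2 * int N dvd m)"
  proof
    assume "z = 1"
    then obtain n :: int where "pi / real N * of_int m = 2 * pi * of_int n"
      using cis_eq_1_imp unfolding z_def by blast
    then have "real_of_int m = of_int (2 * int N * n)" using N by (simp add: field_simps)
    then have "m = 2 * int N * n" by (simp only: of_int_eq_iff)
    then show "2 * int N dvd m" by simp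
  next
    assume "2 * int N dvd m"
    then obtain n where "m = 2 * int N * n" by (elim dvdE)
    then have "pi / real N * of_int m = 2 * pi * of_int n" using N by (simp add: field_simps)
    then show "z = 1" using cis_multiple_2pi[of "of_int n"] by (simp add: z_def)
  qed
  finally show ?thesis by simp
qed

lemma sum_chr_grid:
  fixes m :: "int^'n"
  assumes N: "N >= 1"
  shows "(\<Sum>l\<in>grid_index N. chr m (grid_point N l)) = (if aliased N m 0 then of_nat ((2 * N) ^ CARD('n)) else 0)"
proof -
  have "chr m (grid_point N l) = (\<Prod>j\<in>UNIV. cis (pi / real N * of_int (m $ j) * of_int (l $ j)))" for l
    unfolding chr_def
    by (simp add: cis_sum[symmetric] inner_vec_def grid_point_def rvec_nth) (simp add: ac_simps)
  then have "(\<Sum>l\<in>grid_index N. chr m (grid_point N l)) =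
    (\<Sum>l\<in>{l. \<forall>j. l $ j \<in> {0..<2 * int N}}. \<Prod>j\<in>UNIV. cis (pi / real N * of_int (m $ j) * of_int (l $ j)))"
    by (simp add: grid_index_def)
  also have "... = (\<Prod>j\<in>UNIV. \<Sum>i\<in>{0..<2 * int N}. cis (pi / real N * of_int (m $ j) * of_int i))"
    by (rule sum_box_prod) simp
  also have "... = (\<Prod>j\<in>(UNIV :: 'n set). if 2 * int N dvd m $ j then of_nat (2 * N) else 0)"
    by (simp only: sum_cis_grid[OF N])
  also have "... = (if aliased N m 0 then of_nat ((2 * N) ^ CARD('n)) else 0)"
  proof (cases "aliased N m 0")
    case True
    then show ?thesis by (simp add: aliased_def)
  next
    case False
    then obtain j where "\<not> 2 * int N dvd m $ j" by (auto simp: aliased_def)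
    then have "(\<Prod>j\<in>(UNIV :: 'n set). if 2 * int N dvd m $ j then of_nat (2 * N) else 0) = (0 :: complex)"
      by (intro prod_zero) auto
    then show ?thesis using False by simp
  qed
  finally show ?thesis .
qed

lemma discrete_coeff_chr_form:
  "discrete_coeff N U k =
    of_real (1 / (2 * real N) ^ CARD('n)) * (\<Sum>l\<in>grid_index N. U (grid_point N l) * chr (- k) (grid_point N l))"
  for U :: "real^'n => complex"
  by (simp add: discrete_coeff_def chr_def rvec_minus)

lemma discrete_coeff_chr:
  fixes l k :: "int^'n"
  assumes N: "N >= 1"
  shows "discrete_coeff N (chr l) k = (if aliased N l k then 1 else 0)"
proof -
  have "discrete_coeff N (chr l) k =
      of_real (1 / (2 * real N) ^ CARD('n)) * (\<Sum>j\<in>grid_index N. chr (l - k) (grid_point N j))"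
    unfolding discrete_coeff_chr_form by (simp flip: chr_add)
  also have "... = (if aliased N l k then 1 else 0)"
    using N by (simp add: sum_chr_grid) (simp add: aliased_def)
  finally show ?thesis .
qed

lemma alias_freq_box_eq:
  assumes "aliased N l k" "l \<in> freq_box N" "k \<in> freq_box N" shows "l = k"
proof -
  have "l $ j = k $ j" for j
  proof -
    have b: "- int N <= l $ j" "l $ j < int N" "- int N <= k $ j" "k $ j < int N"
      using assms(2,3) by (auto simp: freq_box_def)
    obtain c where c: "l $ j - k $ j = 2 * int N * c" using assms(1) by (auto simp: aliased_def elim: dvdE)
    have "\<bar>2 * int N * c\<bar> < 2 * int N" using b c by linarith
    then have "2 * int N * \<bar>c\<bar> < 2 * int N * 1" by (simp add: abs_mult)
    moreover have "0 < 2 * int N" using b by linarith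
    ultimately have "\<bar>c\<bar> < 1" by (simp only: mult_less_cancel_left_pos)
    then show ?thesis using c by simp
  qed
  then show ?thesis by (simp add: vec_eq_iff)
qed

lemma alias_sym: "aliased N l k \<longleftrightarrow> aliased N k l"
  unfolding aliased_def by (simp add: dvd_diff_commute)

lemma alias_trans: "aliased N l k ==> aliased N k m ==> aliased N l m"
  unfolding aliased_def
proof
  fix j
  assume "\<forall>j. 2 * int N dvd l $ j - k $ j" "\<forall>j. 2 * int N dvd k $ j - m $ j"
  then have "2 * int N dvd (l $ j - k $ j) + (k $ j - m $ j)" by (intro dvd_add) auto
  then show "2 * int N dvd l $ j - m $ j" by simp
qed

lemma alias_unique_rep:
  assumes "aliased N l k" "aliased N l k'" "k \<in> freq_box N" "k' \<in> freq_box N" shows "k = k'"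
proof -
  have "aliased N k l" using assms(1) alias_sym by blast
  then have "aliased N k k'" by (rule alias_trans) (rule assms(2))
  then show ?thesis by (rule alias_freq_box_eq) (rule assms)+
qed

definition grid_mean :: "nat => (real^'n => 'b::real_normed_field) => 'b" where
  "grid_mean N U = of_real (1 / (2 * real N) ^ CARD('n)) * (\<Sum>l\<in>grid_index N. U (grid_point N l))"

lemma discrete_coeff_grid_mean: "discrete_coeff N U k = grid_mean N (%y. U y * cnj (chr k y))"
  by (simp add: grid_mean_def discrete_coeff_chr_form chr_minus)

lemma grid_mean_sum: "grid_mean N (%y. \<Sum>i\<in>I. f i y) = (\<Sum>i\<in>I. grid_mean N (f i))"
  unfolding grid_mean_def by (subst sum.swap) (simp add: sum_distrib_left)

lemma grid_mean_cmult: "grid_mean N (%y. c * f y) = c * grid_mean N f"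
  unfolding grid_mean_def by (simp add: sum_distrib_left mult.left_commute)

lemma grid_mean_diff: "grid_mean N (%y. f y - g y) = grid_mean N f - grid_mean N g"
  unfolding grid_mean_def by (simp add: sum_subtractf right_diff_distrib)

lemma grid_mean_cnj: "grid_mean N (%y. cnj (f y)) = cnj (grid_mean N f)"
  unfolding grid_mean_def by simp

lemma grid_mean_mono:
  fixes f g :: "real^'n => real"
  shows "(!!l. l \<in> grid_index N ==> f (grid_point N l) <= g (grid_point N l)) ==> grid_mean N f <= grid_mean N g"
  unfolding grid_mean_def by (intro mult_left_mono sum_mono) auto

lemma grid_mean_const: "N >= 1 ==> grid_mean N (%_::real^'n. c) = c"
  by (simp add: grid_mean_def card_grid_index)

lemma grid_mean_of_real: "grid_mean N (%y. of_real (f y)) = of_real (grid_mean N f)"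
  by (simp add: grid_mean_def)

lemma grid_mean_chr_chr:
  "N >= 1 ==> grid_mean N (%y. chr k y * cnj (chr l y)) = (if aliased N k l then 1 else 0)"
  by (simp add: discrete_coeff_chr flip: discrete_coeff_grid_mean)

text \<open>The characters of the frequency box are orthonormal for the mean over the grid.\<close>

lemma grid_parseval:
  fixes a :: "int^'n => complex"
  assumes N: "N >= 1"
  shows "grid_mean N (%y. (norm (\<Sum>k\<in>freq_box N. a k * chr k y))\<^sup>2) = (\<Sum>k\<in>freq_box N. (norm (a k))\<^sup>2)"
proof -
  have "complex_of_real (grid_mean N (%y. (norm (\<Sum>k\<in>freq_box N. a k * chr k y))\<^sup>2)) =
      grid_mean N (%y. (\<Sum>k\<in>freq_box N. a k * chr k y) * cnj (\<Sum>l\<in>freq_box N. a l * chr l y))"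
    unfolding grid_mean_of_real[symmetric] complex_norm_square ..
  also have "... = grid_mean N (%y. \<Sum>k\<in>freq_box N. \<Sum>l\<in>freq_box N. (a k * cnj (a l)) * (chr k y * cnj (chr l y)))"
    by (simp add: sum_product ac_simps)
  also have "... = (\<Sum>k\<in>freq_box N. \<Sum>l\<in>freq_box N. (a k * cnj (a l)) * (if aliased N k l then 1 else 0))"
    unfolding grid_mean_sum grid_mean_cmult grid_mean_chr_chr[OF N] ..
  also have "... = (\<Sum>k\<in>freq_box N. \<Sum>l\<in>freq_box N. if k = l then a k * cnj (a l) else 0)"
  proof (intro sum.cong refl)
    fix k l :: "int^'n" assume "k \<in> freq_box N" "l \<in> freq_box N"
    then show "a k * cnj (a l) * (if aliased N k l then 1 else 0) = (if k = l then a k * cnj (a l) else 0)"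
      using alias_freq_box_eq[of N k l] by (auto simp: aliased_def)
  qed
  also have "... = of_real (\<Sum>k\<in>freq_box N. (norm (a k))\<^sup>2)"
    by (simp add: complex_norm_square del: of_real_power)
  finally show ?thesis by (simp only: of_real_eq_iff)
qed

lemma grid_bessel:
  fixes U :: "real^'n => complex"
  assumes N: "N >= 1"
  shows "(\<Sum>k\<in>freq_box N. (norm (discrete_coeff N U k))\<^sup>2) <= grid_mean N (%y. (norm (U y))\<^sup>2)"
proof -
  let ?c = "discrete_coeff N U"
  let ?I = "%y. \<Sum>k\<in>freq_box N. ?c k * chr k y"
  let ?S = "\<Sum>k\<in>freq_box N. (norm (?c k))\<^sup>2"
  have cross: "grid_mean N (%y. U y * cnj (?I y)) = of_real ?S"
  proof -
    have "(%y. U y * cnj (?I y)) = (%y. \<Sum>k\<in>freq_box N. cnj (?c k) * (U y * cnj (chr k y)))"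
      by (simp add: sum_distrib_left ac_simps)
    then have "grid_mean N (%y. U y * cnj (?I y)) = (\<Sum>k\<in>freq_box N. cnj (?c k) * ?c k)"
      unfolding discrete_coeff_grid_mean by (simp only: grid_mean_sum grid_mean_cmult)
    also have "... = of_real ?S" by (simp add: complex_norm_square mult.commute del: of_real_power)
    finally show ?thesis .
  qed
  have pt: "complex_of_real ((norm (U y - ?I y))\<^sup>2) =
      (of_real ((norm (U y))\<^sup>2) - U y * cnj (?I y)) - (cnj (U y * cnj (?I y)) - of_real ((norm (?I y))\<^sup>2))" for y
    unfolding complex_norm_square by (simp add: algebra_simps)
  have "complex_of_real (grid_mean N (%y. (norm (U y - ?I y))\<^sup>2)) =
      of_real (grid_mean N (%y. (norm (U y))\<^sup>2)) - of_real ?S - (of_real ?S - of_real ?S)"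
    unfolding grid_mean_of_real[symmetric] pt grid_mean_diff grid_mean_cnj cross
    unfolding grid_mean_of_real grid_parseval[OF N] by simp
  then have "complex_of_real (grid_mean N (%y. (norm (U y - ?I y))\<^sup>2)) =
      of_real (grid_mean N (%y. (norm (U y))\<^sup>2) - ?S)" by simp
  then have "grid_mean N (%y. (norm (U y - ?I y))\<^sup>2) = grid_mean N (%y. (norm (U y))\<^sup>2) - ?S"
    by (simp only: of_real_eq_iff)
  moreover have "0 <= grid_mean N (%y. (norm (U y - ?I y))\<^sup>2)"
    unfolding grid_mean_def by (intro mult_nonneg_nonneg sum_nonneg) auto
  ultimately show ?thesis by linarith
qed

lemma interp_coeff_l2_le:
  assumes N: "N >= 1" and le: "grid_mean N (%y. (norm (U y))\<^sup>2) <= r\<^sup>2" and r: "r >= 0"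
  shows "l2_le (interp_coeff N U) r"
proof (rule l2_le_sumI[OF _ r])
  fix F :: "(int^'a) set" assume F: "finite F"
  have "(\<Sum>k\<in>F. (norm (interp_coeff N U k))\<^sup>2) = (\<Sum>k\<in>F \<inter> freq_box N. (norm (discrete_coeff N U k))\<^sup>2)"
    using F by (simp add: interp_coeff_def sum.inter_restrict if_distrib[of norm] if_distrib[of "%x. x\<^sup>2"] cong: if_cong)
  also have "... <= (\<Sum>k\<in>freq_box N. (norm (discrete_coeff N U k))\<^sup>2)"
    by (rule sum_mono2) auto
  also have "... <= r\<^sup>2" using grid_bessel[OF N, of U] le by linarith
  finally show "(\<Sum>k\<in>F. (norm (interp_coeff N U k))\<^sup>2) <= r\<^sup>2" .
qed

lemma interp_coeff_diff: "interp_coeff N (%y. U y - W y) k = interp_coeff N U k - interp_coeff N W k"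
  by (simp add: interp_coeff_def discrete_coeff_grid_mean left_diff_distrib grid_mean_diff)

lemma interp_coeff_add: "interp_coeff N (%y. U y + W y) k = interp_coeff N U k + interp_coeff N W k"
  using interp_coeff_diff[of N "%y. U y + W y" W k] by simp

lemma interp_coeff_cmult: "interp_coeff N (%y. c * U y) k = c * interp_coeff N U k"
  by (simp add: interp_coeff_def discrete_coeff_grid_mean mult.assoc grid_mean_cmult)

lemma interp_coeff_sup:
  fixes U :: "real^'n => complex"
  assumes N: "N >= 1" and le: "!!y. norm (U y) <= r"
  shows "l2_le (interp_coeff N U) r"
proof (rule interp_coeff_l2_le[OF N])
  show r: "0 <= r" using le[of 0] norm_ge_zero order_trans by blast
  have "grid_mean N (%y. (norm (U y))\<^sup>2) <= grid_mean N (%_::real^'n. r\<^sup>2)"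
    by (rule grid_mean_mono, rule power_mono, rule le) simp
  then show "grid_mean N (%y. (norm (U y))\<^sup>2) <= r\<^sup>2" by (simp add: grid_mean_const[OF N])
qed

lemma grid_mean_cutoff:
  fixes a :: "int^'n => complex"
  assumes N: "N >= 1" and a: "l2_le a r"
  shows "grid_mean N (%y. (norm (trig_series (cutoff N a) y))\<^sup>2) <= r\<^sup>2"
proof -
  have "trig_series (cutoff N a) y = (\<Sum>k\<in>freq_box N. a k * chr k y)" for y
    unfolding cutoff_def[abs_def] by (rule trig_series_finite_support) simp
  then have "grid_mean N (%y. (norm (trig_series (cutoff N a) y))\<^sup>2) = (\<Sum>k\<in>freq_box N. (norm (a k))\<^sup>2)"
    by (simp add: grid_parseval[OF N])
  also have "... <= r\<^sup>2"
    using l2_leD[OF a finite_freq_box] l2_le_nonneg[OF a] unfolding L2_set_def by (simp add: sqrt_le_D)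
  finally show ?thesis .
qed

lemma interp_coeff_trig_cutoff:
  assumes N: "N >= 1"
  shows "interp_coeff N (trig_series (cutoff N a)) = cutoff N a"
proof
  fix k
  have eq: "trig_series (cutoff N a) = (%y. \<Sum>l\<in>freq_box N. a l * chr l y)"
    unfolding cutoff_def[abs_def] by (rule ext) (rule trig_series_finite_support, simp)
  show "interp_coeff N (trig_series (cutoff N a)) k = cutoff N a k"
  proof (cases "k \<in> freq_box N")
    case True
    have "discrete_coeff N (trig_series (cutoff N a)) k = grid_mean N (%y. \<Sum>l\<in>freq_box N. a l * (chr l y * cnj (chr k y)))"
      unfolding discrete_coeff_grid_mean eq by (simp add: sum_distrib_right mult.assoc)
    also have "... = (\<Sum>l\<in>freq_box N. a l * (if aliased N l k then 1 else 0))"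
      unfolding grid_mean_sum grid_mean_cmult grid_mean_chr_chr[OF N] ..
    also have "... = (\<Sum>l\<in>freq_box N. if l = k then a l else 0)"
      using alias_freq_box_eq[of N _ k] True by (intro sum.cong) (auto simp: aliased_def)
    also have "... = a k" using True by simp
    finally show ?thesis using True by (simp add: interp_coeff_def cutoff_def)
  qed (simp add: interp_coeff_def cutoff_def)
qed

section \<open>Aliasing errors\<close>

lemma interp_coeff_tendsto:
  fixes a :: "int^'n => complex"
  assumes N: "N >= 1" and a: "l1_le a r"
  shows "((%G. \<Sum>l\<in>G. if aliased N l k \<and> k \<in> freq_box N then a l else 0) \<longlongrightarrow> interp_coeff N (trig_series a) k)
    (finite_subsets_at_top UNIV)"
proof (cases "k \<in> freq_box N")
  case True
  have "((%G. \<Sum>l\<in>G. a l * chr l y) \<longlongrightarrow> trig_series a y) (finite_subsets_at_top UNIV)" for y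
    unfolding trig_series_def
    by (rule infsum_tendsto) (rule l1_le_summable[OF trig_series_terms_l1[OF a]])
  then have "((%G. grid_mean N (%y. (\<Sum>l\<in>G. a l * chr l y) * cnj (chr k y))) \<longlongrightarrow> discrete_coeff N (trig_series a) k)
    (finite_subsets_at_top UNIV)"
    unfolding discrete_coeff_grid_mean grid_mean_def by (intro tendsto_intros)
  moreover have "grid_mean N (%y. (\<Sum>l\<in>G. a l * chr l y) * cnj (chr k y)) = (\<Sum>l\<in>G. if aliased N l k \<and> k \<in> freq_box N then a l else 0)" for G
  proof -
    have "grid_mean N (%y. (\<Sum>l\<in>G. a l * chr l y) * cnj (chr k y)) = grid_mean N (%y. \<Sum>l\<in>G. a l * (chr l y * cnj (chr k y)))"
      by (simp add: sum_distrib_right mult.assoc)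
    also have "... = (\<Sum>l\<in>G. a l * (if aliased N l k then 1 else 0))"
      unfolding grid_mean_sum grid_mean_cmult grid_mean_chr_chr[OF N] ..
    also have "... = (\<Sum>l\<in>G. if aliased N l k \<and> k \<in> freq_box N then a l else 0)"
      using True by (intro sum.cong) auto
    finally show ?thesis .
  qed
  ultimately show ?thesis using True by (simp add: interp_coeff_def)
qed (simp add: interp_coeff_def)

text \<open>Interpolation moves each frequency to its alias in the box, which cannot increase the sum of the moduli.\<close>

lemma interp_coeff_l1_le:
  fixes a :: "int^'n => complex"
  assumes N: "N >= 1" and a: "l1_le a r"
  shows "l1_le (interp_coeff N (trig_series a)) r"
  unfolding l1_le_def
proof (intro allI impI)
  fix F :: "(int^'n) set" assume F: "finite F"
  let ?x = "%l k. if aliased N l k \<and> k \<in> freq_box N then a l else 0"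
  have T: "((%G. \<Sum>k\<in>F. norm (\<Sum>l\<in>G. ?x l k)) \<longlongrightarrow> (\<Sum>k\<in>F. norm (interp_coeff N (trig_series a) k))) (finite_subsets_at_top UNIV)"
    by (intro tendsto_sum tendsto_norm interp_coeff_tendsto[OF N a])
  have B: "(\<Sum>k\<in>F. norm (\<Sum>l\<in>G. ?x l k)) <= r" if G: "finite G" for G
  proof -
    have "(\<Sum>k\<in>F. norm (\<Sum>l\<in>G. ?x l k)) <= (\<Sum>k\<in>F. \<Sum>l\<in>G. norm (?x l k))"
      by (intro sum_mono norm_sum)
    also have "... = (\<Sum>l\<in>G. \<Sum>k\<in>F. norm (?x l k))" by (rule sum.swap)
    also have "... <= (\<Sum>l\<in>G. norm (a l))"
    proof (rule sum_mono)
      fix l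
      show "(\<Sum>k\<in>F. norm (?x l k)) <= norm (a l)"
      proof (cases "\<exists>k0. aliased N l k0 \<and> k0 \<in> freq_box N")
        case True
        then obtain k0 where k0: "aliased N l k0" "k0 \<in> freq_box N" by blast
        have "(\<Sum>k\<in>F. norm (?x l k)) <= (\<Sum>k\<in>F. if k = k0 then norm (a l) else 0)"
          using alias_unique_rep[OF _ k0(1) _ k0(2)] by (intro sum_mono) auto
        also have "... <= norm (a l)" using F by simp
        finally show ?thesis .
      next
        case False
        then have "(\<Sum>k\<in>F. norm (?x l k)) = 0" by (intro sum.neutral) auto
        then show ?thesis by simp
      qed
    qed
    also have "... <= r" by (rule l1_leD[OF a G])
    finally show ?thesis .
  qed
  show "(\<Sum>k\<in>F. norm (interp_coeff N (trig_series a) k)) <= r"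
    by (rule finite_sums_limit_le[OF T B])
qed

text \<open>The interpolation error comes from the tail only, because \<open>I\<^sub>N\<close> reproduces the frequencies in the
  box.\<close>

lemma interp_error_tail:
  fixes a :: "int^'n => complex"
  assumes N: "N >= 1" and a: "l1_le a r"
  shows "interp_coeff N (trig_series a) k - cutoff N a k =
    interp_coeff N (trig_series (%k. if k \<in> freq_box N then 0 else a k)) k"
proof -
  let ?t = "%k. if k \<in> freq_box N then 0 else a k"
  have t: "l1_le ?t r" by (rule l1_le_mono[OF a]) auto
  have "trig_series a = (%y. trig_series (cutoff N a) y + trig_series ?t y)"
  proof
    fix y
    have "trig_series (cutoff N a) y + trig_series ?t y = (\<Sum>\<^sub>\<infinity>k. cutoff N a k * chr k y + ?t k * chr k y)"
      unfolding trig_series_def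
      by (rule infsum_add[symmetric]) (rule l1_le_summable[OF trig_series_terms_l1] l1_le_cutoff a t)+
    also have "... = trig_series a y"
      unfolding trig_series_def by (rule infsum_cong) (auto simp: cutoff_def)
    finally show "trig_series a y = trig_series (cutoff N a) y + trig_series ?t y" ..
  qed
  then show ?thesis by (simp add: interp_coeff_add interp_coeff_trig_cutoff[OF N])
qed

lemma norm_ge_outside_freq_box:
  assumes "k \<notin> freq_box N" shows "real N <= norm (rvec k)"
proof -
  obtain j where "k $ j < - int N \<or> int N <= k $ j" using assms by (auto simp: freq_box_def not_le not_less)
  then have "int N <= \<bar>k $ j\<bar>" by linarith
  then have "real N <= \<bar>rvec k $ j\<bar>" unfolding rvec_nth by linarith
  also have "... <= norm (rvec k)" by (rule component_le_norm_cart)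
  finally show ?thesis .
qed

text \<open>Outside the box the frequency has norm at least \<open>N\<close>, and \<open>zw\<close> is at least \<open>N\<close> to the power \<open>2 \<alpha>\<close>.\<close>

lemma tail_l2_le:
  fixes a :: "int^'n => complex"
  assumes N: "N >= 1" and a: "l2_le (%k. zw \<alpha> k * norm (a k)) r"
  shows "l2_le (%k. if k \<in> freq_box N then 0 else a k) (r / real N ^ (2 * \<alpha>))"
proof -
  have "l2_le (%k. (1 / real N ^ (2 * \<alpha>)) * (zw \<alpha> k * norm (a k))) (norm (1 / real N ^ (2 * \<alpha>)) * r)"
    by (rule l2_le_cmult[OF a])
  then show ?thesis
  proof (rule l2_le_mono)
    fix k :: "int^'n"
    show "norm (if k \<in> freq_box N then 0 else a k) <= norm ((1 / real N ^ (2 * \<alpha>)) * (zw \<alpha> k * norm (a k)))"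
    proof (cases "k \<in> freq_box N")
      case False
      have "real N ^ (2 * \<alpha>) <= norm (rvec k) ^ (2 * \<alpha>)"
        by (rule power_mono[OF norm_ge_outside_freq_box[OF False]]) simp
      also have "... <= zw \<alpha> k" by (rule norm_power_le_zw)
      finally have "real N ^ (2 * \<alpha>) * norm (a k) <= zw \<alpha> k * norm (a k)" by (rule mult_right_mono) simp
      then show ?thesis using False N zw_pos[of \<alpha> k] by (simp add: abs_mult field_simps)
    qed simp
  qed simp
qed

lemma tail_l1_le:
  fixes a :: "int^'n => complex"
  assumes N: "N >= 1" and a: "l1_le (%k. brk k powr (1/8) * norm (a k)) r"
  shows "l1_le (%k. if k \<in> freq_box N then 0 else a k) (r * real N powr (- 1/4))"
proof -
  have "l1_le (%k. real N powr (- 1/4) * (brk k powr (1/8) * norm (a k))) (norm (real N powr (- 1/4)) * r)"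
    by (rule l1_le_cmult[OF a])
  then show ?thesis
  proof (rule l1_le_mono)
    fix k :: "int^'n"
    show "norm (if k \<in> freq_box N then 0 else a k) <= norm (real N powr (- 1/4) * (brk k powr (1/8) * norm (a k)))"
    proof (cases "k \<in> freq_box N")
      case False
      have "(real N)\<^sup>2 <= (norm (rvec k))\<^sup>2"
        by (rule power_mono[OF norm_ge_outside_freq_box[OF False]]) simp
      also have "... <= brk k" by (simp add: brk_def)
      finally have "((real N)\<^sup>2) powr (1/8) <= brk k powr (1/8)" by (intro powr_mono2) auto
      also have "(real N)\<^sup>2 = real N powr 2" using N by simp
      also have "(real N powr 2) powr (1/8) = real N powr (1/4)" by (subst powr_powr) simp
      finally have "real N powr (- 1/4) * real N powr (1/4) <= real N powr (- 1/4) * brk k powr (1/8)"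
        by (rule mult_left_mono) simp
      moreover have "real N powr (- 1/4) * real N powr (1/4) = 1" using N by (simp flip: powr_add)
      ultimately have "1 * norm (a k) <= (real N powr (- 1/4) * brk k powr (1/8)) * norm (a k)"
        by (intro mult_right_mono) auto
      then show ?thesis using False by (simp add: abs_mult mult.assoc)
    qed simp
  qed (simp add: mult.commute)
qed

lemma interp_error_l1:
  fixes a :: "int^'n => complex"
  assumes N: "N >= 1" and a0: "l1_le a s" and a: "l1_le (%k. brk k powr (1/8) * norm (a k)) r"
  shows "l1_le (%k. interp_coeff N (trig_series a) k - cutoff N a k) (r * real N powr (- 1/4))"
  unfolding interp_error_tail[OF N a0]
  by (rule interp_coeff_l1_le[OF N tail_l1_le[OF N a]])

text \<open>The frequencies aliased to \<open>k\<close> are \<open>k + 2 N m\<close> with \<open>m\<close> in the lattice, and their norm is at least of the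
  order of \<open>N (1 + |m|)\<close> unless \<open>m = 0\<close>. The remaining lattice sum converges since \<open>4 \<alpha> > n\<close>.\<close>

lemma alias_class_sum:
  assumes "real \<alpha> > real CARD('n) / 4"
  obtains C where "C > 0"
    "!!N (k :: int^'n) G. N >= 1 ==> k \<in> freq_box N ==> finite G ==>
      (\<Sum>l\<in>{l\<in>G. aliased N l k \<and> l \<notin> freq_box N}. (1 / norm (rvec l) ^ (2 * \<alpha>))\<^sup>2) <= (C / real N ^ (2 * \<alpha>))\<^sup>2"
proof -
  let ?n = "real CARD('n)"
  have sm: "(%m::int^'n. (1 + norm (rvec m)) powr (- real (4 * \<alpha>))) summable_on UNIV"
    by (rule lattice_powr_summable) (use assms in simp)
  define S where "S = (\<Sum>\<^sub>\<infinity>m::int^'n. (1 + norm (rvec m)) powr (- real (4 * \<alpha>)))"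
  have S: "S >= 0" unfolding S_def by (rule infsum_nonneg) auto
  define C where "C = sqrt ((?n + 1) ^ (4 * \<alpha>) * S) + 1"
  have C: "(?n + 1) ^ (4 * \<alpha>) * S <= C\<^sup>2"
  proof -
    have nn: "0 <= (?n + 1) ^ (4 * \<alpha>) * S" using S by (intro mult_nonneg_nonneg) auto
    have "(sqrt ((?n + 1) ^ (4 * \<alpha>) * S))\<^sup>2 <= C\<^sup>2"
      unfolding C_def using nn by (intro power_mono) auto
    then show ?thesis using nn by simp
  qed
  show ?thesis
  proof (rule that)
    show "C > 0" unfolding C_def using S by (intro add_nonneg_pos real_sqrt_ge_zero mult_nonneg_nonneg) auto
    fix N :: nat and k :: "int^'n" and G :: "(int^'n) set"
    assume N: "N >= 1" and k: "k \<in> freq_box N" and G: "finite G"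
    define A where "A = {l\<in>G. aliased N l k \<and> l \<notin> freq_box N}"
    define q where "q l = (\<chi> j. (l $ j - k $ j) div (2 * int N))" for l :: "int^'n"
    have A: "finite A" using G by (simp add: A_def)
    have lq: "l $ j = k $ j + 2 * int N * q l $ j" if "l \<in> A" for l j
      using that N by (simp add: A_def aliased_def q_def)
    have inj: "inj_on q A"
    proof (rule inj_onI)
      fix x y assume "x \<in> A" "y \<in> A" "q x = q y"
      then show "x = y" using lq[of x] lq[of y] by (simp add: vec_eq_iff)
    qed
    have le: "(1 / norm (rvec l) ^ (2 * \<alpha>))\<^sup>2 <= (?n + 1) ^ (4 * \<alpha>) / real N ^ (4 * \<alpha>) * (1 + norm (rvec (q l))) powr (- real (4 * \<alpha>))"
      if l: "l \<in> A" for l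
    proof -
      obtain i where i: "!!j. \<bar>q l $ j\<bar> <= \<bar>q l $ i\<bar>"
      proof -
        have "Max (range (%j. \<bar>q l $ j\<bar>)) \<in> range (%j. \<bar>q l $ j\<bar>)" by (rule Max_in) auto
        then obtain i where "Max (range (%j. \<bar>q l $ j\<bar>)) = \<bar>q l $ i\<bar>" by (elim imageE)
        then have "\<bar>q l $ j\<bar> <= \<bar>q l $ i\<bar>" for j
          using Max_ge[of "range (%j. \<bar>q l $ j\<bar>)" "\<bar>q l $ j\<bar>"] by simp
        then show ?thesis by (rule that)
      qed
      have "q l $ i \<noteq> 0"
      proof
        assume "q l $ i = 0"
        then have "q l $ j = 0" for j using i[of j] by simp
        then have "l = k" using lq[OF l] by (simp add: vec_eq_iff)
        then show False using l k by (simp add: A_def)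
      qed
      then have qi: "\<bar>q l $ i\<bar> >= 1" by linarith
      have "norm (rvec (q l)) <= (\<Sum>j\<in>UNIV. \<bar>rvec (q l) $ j\<bar>)" by (rule norm_le_l1_cart)
      also have "... <= (\<Sum>j\<in>(UNIV :: 'n set). real_of_int \<bar>q l $ i\<bar>)"
        by (intro sum_mono) (simp only: rvec_nth of_int_abs[symmetric] of_int_le_iff i)
      finally have "norm (rvec (q l)) <= ?n * real_of_int \<bar>q l $ i\<bar>" by simp
      then have q1: "1 + norm (rvec (q l)) <= (?n + 1) * real_of_int \<bar>q l $ i\<bar>"
        using qi by (simp add: algebra_simps)
      have "- int N <= k $ i" "k $ i < int N" using k by (auto simp: freq_box_def)
      then have kb: "\<bar>k $ i\<bar> <= int N" by linarith
      have "int N * \<bar>q l $ i\<bar> <= \<bar>l $ i\<bar>"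
      proof -
        have "\<bar>2 * int N * q l $ i\<bar> <= \<bar>l $ i\<bar> + \<bar>k $ i\<bar>" using lq[OF l, of i] by linarith
        then have "2 * (int N * \<bar>q l $ i\<bar>) <= \<bar>l $ i\<bar> + int N" using kb by (simp add: abs_mult)
        moreover have "int N * 1 <= int N * \<bar>q l $ i\<bar>" using qi by (intro mult_left_mono) auto
        ultimately show ?thesis by linarith
      qed
      then have "real_of_int (int N * \<bar>q l $ i\<bar>) <= real_of_int \<bar>l $ i\<bar>" by (simp only: of_int_le_iff)
      then have "real N * real_of_int \<bar>q l $ i\<bar> <= \<bar>rvec l $ i\<bar>" by (simp add: rvec_nth)
      also have "... <= norm (rvec l)" by (rule component_le_norm_cart)
      finally have big: "real N * real_of_int \<bar>q l $ i\<bar> <= norm (rvec l)" .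
      have x0: "0 < 1 + norm (rvec (q l))" by (rule add_pos_nonneg) auto
      have "real N * (1 + norm (rvec (q l))) <= real N * ((?n + 1) * real_of_int \<bar>q l $ i\<bar>)"
        by (rule mult_left_mono[OF q1]) simp
      also have "... = (?n + 1) * (real N * real_of_int \<bar>q l $ i\<bar>)" by simp
      also have "... <= (?n + 1) * norm (rvec l)" by (rule mult_left_mono[OF big]) simp
      finally have fin: "real N * (1 + norm (rvec (q l))) <= (?n + 1) * norm (rvec l)" .
      have pos: "0 < real N * (1 + norm (rvec (q l)))" using N x0 by simp
      have nl: "0 < norm (rvec l)" using fin pos zero_less_mult_pos[of "?n + 1" "norm (rvec l)"] by linarith
      have "(real N * (1 + norm (rvec (q l)))) ^ (4 * \<alpha>) <= ((?n + 1) * norm (rvec l)) ^ (4 * \<alpha>)"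
        by (rule power_mono[OF fin]) (use pos in simp)
      then have "1 / norm (rvec l) ^ (4 * \<alpha>) <= (?n + 1) ^ (4 * \<alpha>) / (real N * (1 + norm (rvec (q l)))) ^ (4 * \<alpha>)"
        using nl zero_less_power[OF pos, of "4 * \<alpha>"] zero_less_power[OF nl, of "4 * \<alpha>"]
        by (simp add: divide_simps power_mult_distrib mult.commute)
      also have "... = (?n + 1) ^ (4 * \<alpha>) / real N ^ (4 * \<alpha>) * (1 + norm (rvec (q l))) powr (- real (4 * \<alpha>))"
        using x0 by (simp only: powr_minus powr_realpow power_mult_distrib divide_inverse inverse_mult_distrib mult.assoc)
      also have "1 / norm (rvec l) ^ (4 * \<alpha>) = (1 / norm (rvec l) ^ (2 * \<alpha>))\<^sup>2"
        by (simp add: power_divide flip: power_mult)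
      finally show ?thesis .
    qed
    have "(\<Sum>l\<in>A. (1 / norm (rvec l) ^ (2 * \<alpha>))\<^sup>2) \<le>
        (\<Sum>l\<in>A. (?n + 1) ^ (4 * \<alpha>) / real N ^ (4 * \<alpha>) * (1 + norm (rvec (q l))) powr (- real (4 * \<alpha>)))"
      by (intro sum_mono le)
    also have "... = (?n + 1) ^ (4 * \<alpha>) / real N ^ (4 * \<alpha>) * (\<Sum>m\<in>q ` A. (1 + norm (rvec m)) powr (- real (4 * \<alpha>)))"
      using inj by (simp add: sum.reindex sum_distrib_left)
    also have "... <= (?n + 1) ^ (4 * \<alpha>) / real N ^ (4 * \<alpha>) * S"
      unfolding S_def using A by (intro mult_left_mono finite_sum_le_infsum sm) auto
    also have "... <= C\<^sup>2 / real N ^ (4 * \<alpha>)"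
      using C N by (simp add: divide_right_mono)
    also have "... = (C / real N ^ (2 * \<alpha>))\<^sup>2" by (simp add: power_divide flip: power_mult)
    finally show "(\<Sum>l\<in>{l\<in>G. aliased N l k \<and> l \<notin> freq_box N}. (1 / norm (rvec l) ^ (2 * \<alpha>))\<^sup>2) <= (C / real N ^ (2 * \<alpha>))\<^sup>2"
      by (simp add: A_def)
  qed
qed

text \<open>Cauchy--Schwarz in each alias class; the classes are disjoint, so that the weighted squares add up to at
  most \<open>r\<^sup>2\<close>.\<close>

lemma interp_error_l2:
  assumes "real \<alpha> > real CARD('n) / 4"
  obtains C where "C > 0"
    "!!N (a :: int^'n => complex) s r. N >= 1 ==> l1_le a s ==> l2_le (%k. zw \<alpha> k * norm (a k)) r ==>
      l2_le (%k. interp_coeff N (trig_series a) k - cutoff N a k) (C * r / real N ^ (2 * \<alpha>))"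
proof -
  obtain C where C: "C > 0"
    "!!N (k :: int^'n) G. N >= 1 ==> k \<in> freq_box N ==> finite G ==>
      (\<Sum>l\<in>{l\<in>G. aliased N l k \<and> l \<notin> freq_box N}. (1 / norm (rvec l) ^ (2 * \<alpha>))\<^sup>2) <= (C / real N ^ (2 * \<alpha>))\<^sup>2"
    by (rule alias_class_sum[OF assms]) (rule that)
  show ?thesis
  proof (rule that[OF C(1)])
    fix N :: nat and a :: "int^'n => complex" and s r :: real
    assume N: "N >= 1" and a: "l1_le a s" and w: "l2_le (%k. zw \<alpha> k * norm (a k)) r"
    define t where "t k = (if k \<in> freq_box N then 0 else a k)" for k
    define D where "D = C / real N ^ (2 * \<alpha>)"
    have D: "D >= 0" using C(1) by (simp add: D_def)
    have r: "r >= 0" by (rule l2_le_nonneg[OF w])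
    have t: "l1_le t s" unfolding t_def by (rule l1_le_mono[OF a]) auto
    have "l2_le (interp_coeff N (trig_series t)) (D * r)"
    proof (rule l2_le_sumI)
      show "0 <= D * r" using D r by simp
      fix F :: "(int^'n) set" assume F: "finite F"
      let ?x = "%l k. if aliased N l k \<and> k \<in> freq_box N then t l else 0"
      have T: "((%G. \<Sum>k\<in>F. (norm (\<Sum>l\<in>G. ?x l k))\<^sup>2) \<longlongrightarrow> (\<Sum>k\<in>F. (norm (interp_coeff N (trig_series t) k))\<^sup>2)) (finite_subsets_at_top UNIV)"
        by (intro tendsto_sum tendsto_power tendsto_norm interp_coeff_tendsto[OF N t])
      have B: "(\<Sum>k\<in>F. (norm (\<Sum>l\<in>G. ?x l k))\<^sup>2) <= (D * r)\<^sup>2" if G: "finite G" for G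
      proof -
        let ?A = "%k. {l\<in>G. aliased N l k \<and> l \<notin> freq_box N}"
        let ?w = "%l. norm (rvec l) ^ (2 * \<alpha>) * norm (a l)"
        have one: "(norm (\<Sum>l\<in>G. ?x l k))\<^sup>2 <= D\<^sup>2 * (\<Sum>l\<in>G. if aliased N l k \<and> k \<in> freq_box N then (?w l)\<^sup>2 else 0)" for k
        proof (cases "k \<in> freq_box N")
          case True
          have "norm (\<Sum>l\<in>G. ?x l k) <= (\<Sum>l\<in>G. norm (?x l k))" by (rule norm_sum)
          also have "... = (\<Sum>l\<in>?A k. norm (a l))"
            using G True by (intro sum.mono_neutral_cong_right) (auto simp: t_def)
          also have "... = (\<Sum>l\<in>?A k. \<bar>1 / norm (rvec l) ^ (2 * \<alpha>)\<bar> * \<bar>?w l\<bar>)"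
          proof (intro sum.cong refl)
            fix l assume "l \<in> ?A k"
            then have "real N <= norm (rvec l)" by (auto intro: norm_ge_outside_freq_box)
            then have "norm (rvec l) > 0" using N by linarith
            then show "norm (a l) = \<bar>1 / norm (rvec l) ^ (2 * \<alpha>)\<bar> * \<bar>?w l\<bar>" by (simp add: abs_mult)
          qed
          also have "... <= L2_set (%l. 1 / norm (rvec l) ^ (2 * \<alpha>)) (?A k) * L2_set ?w (?A k)"
            by (rule L2_set_mult_ineq)
          also have "... <= D * L2_set ?w (?A k)"
          proof (rule mult_right_mono)
            show "L2_set (%l. 1 / norm (rvec l) ^ (2 * \<alpha>)) (?A k) <= D"
              unfolding L2_set_def using C(2)[OF N True G] D by (simp add: D_def real_le_lsqrt)
          qed simp
          finally have "(norm (\<Sum>l\<in>G. ?x l k))\<^sup>2 <= (D * L2_set ?w (?A k))\<^sup>2" by (rule power_mono) simp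
          also have "... = D\<^sup>2 * (\<Sum>l\<in>?A k. (?w l)\<^sup>2)"
            by (simp add: power_mult_distrib L2_set_def sum_nonneg)
          also have "... <= D\<^sup>2 * (\<Sum>l\<in>G. if aliased N l k \<and> k \<in> freq_box N then (?w l)\<^sup>2 else 0)"
          proof (rule mult_left_mono)
            have "(\<Sum>l\<in>?A k. (?w l)\<^sup>2) = (\<Sum>l\<in>?A k. if aliased N l k \<and> k \<in> freq_box N then (?w l)\<^sup>2 else 0)"
              using True by (intro sum.cong) auto
            also have "... <= (\<Sum>l\<in>G. if aliased N l k \<and> k \<in> freq_box N then (?w l)\<^sup>2 else 0)"
              by (rule sum_mono2[OF G]) auto
            finally show "(\<Sum>l\<in>?A k. (?w l)\<^sup>2) <= (\<Sum>l\<in>G. if aliased N l k \<and> k \<in> freq_box N then (?w l)\<^sup>2 else 0)" .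
          qed simp
          finally show ?thesis .
        qed simp
        have "(\<Sum>k\<in>F. (norm (\<Sum>l\<in>G. ?x l k))\<^sup>2) <= (\<Sum>k\<in>F. D\<^sup>2 * (\<Sum>l\<in>G. if aliased N l k \<and> k \<in> freq_box N then (?w l)\<^sup>2 else 0))"
          by (intro sum_mono one)
        also have "... = D\<^sup>2 * (\<Sum>l\<in>G. \<Sum>k\<in>F. if aliased N l k \<and> k \<in> freq_box N then (?w l)\<^sup>2 else 0)"
          by (subst sum.swap) (simp add: sum_distrib_left)
        also have "... <= D\<^sup>2 * (\<Sum>l\<in>G. (norm (zw \<alpha> l * norm (a l)))\<^sup>2)"
        proof (intro mult_left_mono sum_mono)
          fix l
          have w2: "(?w l)\<^sup>2 <= (norm (zw \<alpha> l * norm (a l)))\<^sup>2"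
            using norm_power_le_zw[of l \<alpha>] zw_pos[of \<alpha> l] by (intro power_mono) (auto simp: abs_mult intro: mult_right_mono)
          show "(\<Sum>k\<in>F. if aliased N l k \<and> k \<in> freq_box N then (?w l)\<^sup>2 else 0) <= (norm (zw \<alpha> l * norm (a l)))\<^sup>2"
          proof (cases "\<exists>k0. aliased N l k0 \<and> k0 \<in> freq_box N")
            case True
            then obtain k0 where k0: "aliased N l k0" "k0 \<in> freq_box N" by blast
            have "(\<Sum>k\<in>F. if aliased N l k \<and> k \<in> freq_box N then (?w l)\<^sup>2 else 0) <= (\<Sum>k\<in>F. if k = k0 then (?w l)\<^sup>2 else 0)"
              using alias_unique_rep[OF _ k0(1) _ k0(2)] by (intro sum_mono) auto
            also have "... <= (?w l)\<^sup>2" using F by simp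
            finally show ?thesis using w2 by linarith
          next
            case False
            then have "(\<Sum>k\<in>F. if aliased N l k \<and> k \<in> freq_box N then (?w l)\<^sup>2 else 0) = 0"
              by (intro sum.neutral) auto
            then show ?thesis by simp
          qed
        qed simp
        also have "... <= D\<^sup>2 * r\<^sup>2"
        proof (rule mult_left_mono)
          show "(\<Sum>l\<in>G. (norm (zw \<alpha> l * norm (a l)))\<^sup>2) <= r\<^sup>2"
            using l2_leD[OF w G] unfolding L2_set_def by (rule sqrt_le_D)
        qed simp
        finally show ?thesis by (simp add: power_mult_distrib)
      qed
      show "(\<Sum>k\<in>F. (norm (interp_coeff N (trig_series t) k))\<^sup>2) <= (D * r)\<^sup>2"
        by (rule finite_sums_limit_le[OF T B])
    qed
    then show "l2_le (%k. interp_coeff N (trig_series a) k - cutoff N a k) (C * r / real N ^ (2 * \<alpha>))"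
      unfolding interp_error_tail[OF N a] t_def[abs_def] D_def by simp
  qed
qed

section \<open>Integration by parts along a coordinate\<close>

lemma partial_has_vector_derivative:
  assumes "partial_differentiable j f"
  shows "((%s. f (x + s *\<^sub>R axis j 1)) has_vector_derivative partial j f (x + s0 *\<^sub>R axis j 1)) (at s0)"
proof -
  let ?h = "%s::real. f ((x + s0 *\<^sub>R axis j 1) + s *\<^sub>R axis j 1)"
  have "(?h has_vector_derivative partial j f (x + s0 *\<^sub>R axis j 1)) (at 0)"
    using assms unfolding partial_differentiable_def partial_def by (simp add: vector_derivative_works)
  then have "(?h has_vector_derivative partial j f (x + s0 *\<^sub>R axis j 1)) (at (s0 - s0) within (%s. s - s0) ` UNIV)"
    by (auto intro: has_vector_derivative_at_within)
  then have "((?h \<circ> (%s. s - s0)) has_vector_derivative (1 *\<^sub>R partial j f (x + s0 *\<^sub>R axis j 1))) (at s0)"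
    by (intro vector_diff_chain_within) (auto intro!: derivative_eq_intros)
  moreover have "(?h \<circ> (%s. s - s0)) = (%s. f (x + s *\<^sub>R axis j 1))"
    by (simp add: fun_eq_iff algebra_simps)
  ultimately show ?thesis by simp
qed

lemma interval_derivative_bound:
  fixes f :: "real => 'a::real_normed_vector"
  assumes "!!s. s \<in> {0..h} ==> (f has_vector_derivative f' s) (at s within {0..h})"
    and "!!s. s \<in> {0..h} ==> norm (f' s) <= B" and s: "s \<in> {0..h}"
  shows "norm (f s - f 0) <= B * s"
proof -
  have "norm (f s - f 0) <= B * norm (s - 0)"
  proof (rule differentiable_bound[where f' = "%s t. t *\<^sub>R f' s"])
    show "onorm (%t. t *\<^sub>R f' x) <= B" if "x \<in> {0..h}" for x
      by (intro onorm_le) (auto simp: mult.commute[of B] intro!: mult_left_mono assms(2)[OF that])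
  qed (use assms in \<open>auto simp: has_vector_derivative_def\<close>)
  then show ?thesis using s by simp
qed

lemma second_difference_le:
  fixes f f' f'' :: "real => complex"
  assumes f: "!!s. (f has_vector_derivative f' s) (at s)"
    and f': "!!s. (f' has_vector_derivative f'' s) (at s)"
    and h: "0 < h" and \<epsilon>: "!!s. \<bar>s\<bar> <= h ==> norm (f'' s - L) <= \<epsilon>"
  shows "norm (f h + f (- h) - 2 * f 0 - of_real (h\<^sup>2) * L) <= 2 * \<epsilon> * h\<^sup>2"
proof -
  have m: "((%s. g (- s)) has_vector_derivative - g' (- s)) (at s)"
    if "!!s. (g has_vector_derivative g' s) (at s)" for g g' :: "real => complex" and s
  proof -
    have "((g \<circ> uminus) has_vector_derivative (- 1) *\<^sub>R g' (- s)) (at s)"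
      by (rule vector_diff_chain_at) (auto intro!: derivative_eq_intros that)
    then show ?thesis by (simp add: o_def)
  qed
  have e0: "0 <= \<epsilon>" using order_trans[OF norm_ge_zero \<epsilon>[of 0]] h by simp
  define r1 where "r1 s = f' s - f' (- s) - 2 * of_real s * L" for s
  define r where "r s = f s + f (- s) - 2 * f 0 - of_real (s\<^sup>2) * L" for s
  have d1: "(r1 has_vector_derivative f'' s + f'' (- s) - 2 * L) (at s within {0..h})" for s
    unfolding r1_def
    by (rule has_vector_derivative_at_within) (auto intro!: derivative_eq_intros f' m[OF f'])
  have sq: "((%x. (complex_of_real x)\<^sup>2) has_vector_derivative complex_of_real s * 2) (at s)" for s
    unfolding power2_eq_square by (auto intro!: derivative_eq_intros)
  have d0: "(r has_vector_derivative r1 s) (at s within {0..h})" for s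
    unfolding r_def r1_def
    by (rule has_vector_derivative_at_within)
       (auto intro!: derivative_eq_intros f m[OF f] sq simp: algebra_simps)
  have b1: "norm (f'' s + f'' (- s) - 2 * L) <= 2 * \<epsilon>" if "s \<in> {0..h}" for s
  proof -
    have "f'' s + f'' (- s) - 2 * L = (f'' s - L) + (f'' (- s) - L)" by simp
    also have "norm \<dots> <= \<epsilon> + \<epsilon>" using that by (intro order_trans[OF norm_triangle_ineq] add_mono \<epsilon>) auto
    finally show ?thesis by simp
  qed
  have r1: "norm (r1 s) <= 2 * \<epsilon> * h" if s: "s \<in> {0..h}" for s
  proof -
    have "norm (r1 s - r1 0) <= 2 * \<epsilon> * s"
      by (rule interval_derivative_bound[OF d1 b1 s])
    also have "... <= 2 * \<epsilon> * h" using s e0 by (intro mult_left_mono) auto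
    finally show ?thesis by (simp add: r1_def)
  qed
  have "norm (r h - r 0) <= 2 * \<epsilon> * h * h"
    by (rule interval_derivative_bound[OF d0 r1]) (use h in auto)
  then show ?thesis using h by (simp add: r_def power2_eq_square)
qed

lemma lborel_integral_shift:
  fixes F :: "'a::euclidean_space => 'b::{banach, second_countable_topology}"
  assumes "F \<in> borel_measurable borel"
  shows "(LINT x|lborel. F (x + v)) = (LINT x|lborel. F x)"
proof -
  have "(LINT x|lborel. F x) = (LINT x|distr lborel borel ((+) v). F x)" by (simp add: lborel_distr_plus)
  also have "... = (LINT x|lborel. F (v + x))" by (rule integral_distr) (use assms in auto)
  finally show ?thesis by (simp add: add.commute)
qed

lemma integrable_supported_cube:
  fixes F :: "real^'d => complex"
  assumes "continuous_on UNIV F" "!!x. x \<notin> cube r ==> F x = 0"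
  shows "integrable lborel F" "(LINT x|lborel. F x) = (LINT x:cube r|lborel. F x)"
proof -
  have eq: "F x = indicator (cube r) x *\<^sub>R F x" for x using assms(2)[of x] by (auto simp: indicator_def)
  have "integrable lborel (%x. indicator (cube r) x *\<^sub>R F x)"
    unfolding cube_def by (rule borel_integrable_compact) (auto intro: continuous_on_subset[OF assms(1)])
  then show "integrable lborel F" by (subst (asm) eq[symmetric])
  show "(LINT x|lborel. F x) = (LINT x:cube r|lborel. F x)"
    unfolding set_lebesgue_integral_def by (simp flip: eq)
qed

lemma mem_cube: "x \<in> cube R \<longleftrightarrow> (\<forall>i. \<bar>x $ i\<bar> <= R)"
  unfolding cube_def mem_box_cart abs_le_iff by (auto simp: minus_le_iff)

definition second_quotient :: "'d => real => (real^'d => complex) => real^'d => complex" where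
  "second_quotient j h f x = (f (x + h *\<^sub>R axis j 1) + f (x - h *\<^sub>R axis j 1) - 2 * f x) / of_real (h\<^sup>2)"

lemma second_quotient_tendsto:
  fixes g F :: "real^'d => complex"
  assumes g: "partial_differentiable j g" "partial_differentiable j (partial j g)"
    and c: "continuous_on UNIV (partial j (partial j g))" and cg: "continuous_on UNIV g"
    and F: "continuous_on UNIV F" and r: "r >= 0"
  shows "((%h. LINT x:cube r|lborel. second_quotient j h g x * F x) \<longlongrightarrow>
    (LINT x:cube r|lborel. partial j (partial j g) x * F x)) (at_right 0)"
proof (rule tendstoI)
  fix e :: real assume e: "e > 0"
  have cp: "compact (cube s :: (real^'d) set)" for s by (simp add: cube_def)
  have "bounded (F ` cube r)"
    by (intro compact_imp_bounded compact_continuous_image cp continuous_on_subset[OF F] subset_UNIV)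
  then obtain B where B: "B > 0" "!!x. x \<in> cube r ==> norm (F x) <= B" by (auto simp: bounded_pos)
  let ?m = "measure lborel (cube r :: (real^'d) set)"
  define \<epsilon> where "\<epsilon> = e / (2 * (2 * B * ?m + 1))"
  have d: "0 < 2 * B * ?m + 1" using B(1) by (intro add_nonneg_pos) auto
  have \<epsilon>: "\<epsilon> > 0" using e d by (simp add: \<epsilon>_def)
  have "uniformly_continuous_on (cube (r + 1)) (partial j (partial j g))"
    by (intro compact_uniformly_continuous cp continuous_on_subset[OF c]) auto
  then obtain \<delta> where \<delta>: "\<delta> > 0" "!!x y. x \<in> cube (r + 1) ==> y \<in> cube (r + 1) ==> dist y x < \<delta> ==>
      dist (partial j (partial j g) y) (partial j (partial j g) x) < \<epsilon>"
    unfolding uniformly_continuous_on_def using \<epsilon> by (elim allE[where x = \<epsilon>]) auto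
  have "\<forall>\<^sub>F h in at_right 0. 0 < h \<and> h < min 1 \<delta>"
    using eventually_at_right_real[of 0 "min 1 \<delta>"] \<delta>(1) by (auto elim!: eventually_mono)
  then show "\<forall>\<^sub>F h in at_right 0. dist (LINT x:cube r|lborel. second_quotient j h g x * F x)
      (LINT x:cube r|lborel. partial j (partial j g) x * F x) < e"
  proof eventually_elim
    case (elim h)
    have cq: "continuous_on UNIV (second_quotient j h g)"
      unfolding second_quotient_def
      by (intro continuous_intros continuous_on_compose2[OF cg]) (use elim in auto)
    have le: "norm ((second_quotient j h g x - partial j (partial j g) x) * F x) <= 2 * \<epsilon> * B" if x: "x \<in> cube r" for x
    proof -
      have in1: "x + s *\<^sub>R axis j 1 \<in> cube (r + 1)" if "\<bar>s\<bar> <= h" for s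
      proof -
        have "\<bar>x $ i + s * axis j 1 $ i\<bar> <= r + 1" for i
        proof -
          have "\<bar>x $ i\<bar> <= r" using x by (simp add: mem_cube)
          moreover have "\<bar>s * axis j 1 $ i\<bar> <= 1" using that elim by (auto simp: axis_def)
          ultimately show ?thesis by linarith
        qed
        then show ?thesis by (simp add: mem_cube)
      qed
      have "norm (g (x + h *\<^sub>R axis j 1) + g (x + (- h) *\<^sub>R axis j 1) - 2 * g (x + 0 *\<^sub>R axis j 1)
          - of_real (h\<^sup>2) * partial j (partial j g) x) <= 2 * \<epsilon> * h\<^sup>2"
      proof (rule second_difference_le[OF partial_has_vector_derivative[OF g(1)] partial_has_vector_derivative[OF g(2)]])
        fix s assume s: "\<bar>s\<bar> <= h"
        have "dist (x + s *\<^sub>R axis j 1) x < \<delta>" using s elim by (simp add: dist_norm norm_axis_1)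
        then show "norm (partial j (partial j g) (x + s *\<^sub>R axis j 1) - partial j (partial j g) x) <= \<epsilon>"
          using \<delta>(2)[of x "x + s *\<^sub>R axis j 1"] in1[OF s] in1[of 0] elim by (simp add: dist_norm)
      qed (use elim in simp)
      moreover have "(second_quotient j h g x - partial j (partial j g) x) * of_real (h\<^sup>2) =
          g (x + h *\<^sub>R axis j 1) + g (x + (- h) *\<^sub>R axis j 1) - 2 * g (x + 0 *\<^sub>R axis j 1)
          - of_real (h\<^sup>2) * partial j (partial j g) x"
      proof -
        have "(A / z - L) * z = A - z * L" if "z \<noteq> 0" for A z L :: complex
          using that by (simp add: field_simps)
        from this[of "of_real (h\<^sup>2)"] show ?thesis using elim by (simp add: second_quotient_def)
      qed
      ultimately have "norm ((second_quotient j h g x - partial j (partial j g) x) * of_real (h\<^sup>2)) <= 2 * \<epsilon> * h\<^sup>2"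
        by simp
      then have "norm (second_quotient j h g x - partial j (partial j g) x) <= 2 * \<epsilon>"
        using elim by (simp add: norm_mult norm_power power2_eq_square)
      then show ?thesis using B(2)[OF x] \<epsilon> by (simp add: norm_mult mult_mono)
    qed
    have si: "set_integrable lborel (cube r) (%x. G x * F x)" if "continuous_on UNIV G" for G :: "real^'d => complex"
      unfolding set_integrable_def cube_def
      by (rule borel_integrable_compact) (auto intro!: continuous_intros continuous_on_subset[OF F] continuous_on_subset[OF that])
    have "dist (LINT x:cube r|lborel. second_quotient j h g x * F x) (LINT x:cube r|lborel. partial j (partial j g) x * F x)
        = norm (LINT x:cube r|lborel. (second_quotient j h g x - partial j (partial j g) x) * F x)"
      unfolding dist_norm left_diff_distrib by (simp add: set_integral_diff(2) si cq c)
    also have "... <= 2 * \<epsilon> * B * ?m"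
      unfolding cube_def
    proof (rule norm_integral_cbox_le)
      show "continuous_on (cbox (\<chi> j. - r) (\<chi> j. r)) (%x. (second_quotient j h g x - partial j (partial j g) x) * F x)"
        by (intro continuous_intros continuous_on_subset[OF F] continuous_on_subset[OF cq] continuous_on_subset[OF c]) auto
    qed (use le \<epsilon> B in \<open>auto simp: cube_def\<close>)
    also have "... <= \<epsilon> * (2 * B * ?m + 1)" using \<epsilon> by (simp add: algebra_simps)
    also have "... = e / 2"
    proof -
      have "e / (2 * D) * D = e / 2" if "D > 0" for D using that by simp
      from this[OF d] show ?thesis by (simp only: \<epsilon>_def)
    qed
    also have "... < e" using e by simp
    finally show ?case .
  qed
qed

text \<open>Two integrations by parts without Fubini: second difference quotients are symmetric by translation
  invariance, and they converge locally uniformly.\<close>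

lemma second_partial_by_parts:
  fixes f \<zeta> :: "real^'d => complex"
  assumes f: "partial_differentiable j f" "partial_differentiable j (partial j f)"
      "continuous_on UNIV (partial j (partial j f))" "continuous_on UNIV f"
    and z: "partial_differentiable j \<zeta>" "partial_differentiable j (partial j \<zeta>)"
      "continuous_on UNIV (partial j (partial j \<zeta>))" "continuous_on UNIV \<zeta>"
    and supp: "!!x. x \<notin> cube R ==> \<zeta> x = 0" and R: "R >= 0"
  shows "(LINT x:cube (R + 1)|lborel. partial j (partial j f) x * \<zeta> x) =
    (LINT x:cube (R + 1)|lborel. partial j (partial j \<zeta>) x * f x)"
proof -
  have sub: "cube R \<subseteq> (cube (R + 1) :: (real^'d) set)"
    unfolding cube_def by (rule subset_box_imp) (auto simp: Basis_vec_def inner_axis)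
  have shift: "x + v \<notin> cube R" if "x \<notin> cube (R + 1)" "v = h *\<^sub>R axis j 1" "\<bar>h\<bar> <= 1" for x v :: "real^'d" and h
  proof
    assume a: "x + v \<in> cube R"
    have "\<bar>x $ i\<bar> <= R + 1" for i
    proof -
      have "\<bar>x $ i + h * axis j 1 $ i\<bar> <= R" using a that(2) by (simp add: mem_cube)
      moreover have "\<bar>h * axis j 1 $ i\<bar> <= 1" using that(3) by (auto simp: axis_def)
      ultimately show ?thesis by linarith
    qed
    then show False using that(1) by (simp add: mem_cube)
  qed
  have sym: "(LINT x:cube (R + 1)|lborel. second_quotient j h f x * \<zeta> x) =
      (LINT x:cube (R + 1)|lborel. second_quotient j h \<zeta> x * f x)" if h: "0 < h" "h < 1" for h
  proof -
    let ?v = "h *\<^sub>R axis j (1::real)"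
    have cc: "continuous_on UNIV (%x. f (x + v))" "continuous_on UNIV (%x. \<zeta> (x + v))" for v
      by (intro continuous_on_compose2[OF f(4)] continuous_on_compose2[OF z(4)] continuous_intros; simp)+
    have z0: "\<zeta> (x + v) = 0" if "x \<notin> cube (R + 1)" "v = ?v \<or> v = - ?v \<or> v = 0" for x v
      using shift[OF that(1), of v h] shift[OF that(1), of v "- h"] shift[OF that(1), of v 0] that(2) supp h by auto
    have I1: "integrable lborel (%x. f (x + v) * \<zeta> x)" for v
      using integrable_supported_cube(1)[of "%x. f (x + v) * \<zeta> x" R] supp
      by (simp add: cc continuous_on_mult z(4))
    have I2: "integrable lborel (%x. f x * \<zeta> (x + v))" if "v = ?v \<or> v = - ?v \<or> v = 0" for v
      using integrable_supported_cube(1)[of "%x. f x * \<zeta> (x + v)" "R + 1"] z0 that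
      by (simp add: cc continuous_on_mult f(4))
    have tr: "(LINT x|lborel. f (x + v) * \<zeta> x) = (LINT x|lborel. f x * \<zeta> (x - v))" for v
      using lborel_integral_shift[of "%x. f x * \<zeta> (x - v)" v] cc(2)[of "- v"]
      by (simp add: borel_measurable_continuous_onI continuous_on_mult f(4))
    have "(LINT x:cube (R + 1)|lborel. second_quotient j h f x * \<zeta> x) = (LINT x|lborel. second_quotient j h f x * \<zeta> x)"
      using supp sub h unfolding second_quotient_def
      by (intro integrable_supported_cube(2)[symmetric])
         (auto intro!: continuous_intros continuous_on_compose2[OF f(4)] z(4))
    also have "... = (LINT x|lborel. (f (x + ?v) * \<zeta> x + f (x + - ?v) * \<zeta> x - 2 * (f (x + 0) * \<zeta> x)) / of_real (h\<^sup>2))"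
      by (simp add: second_quotient_def algebra_simps)
    also have "... = ((LINT x|lborel. f (x + ?v) * \<zeta> x) + (LINT x|lborel. f (x + - ?v) * \<zeta> x) - 2 * (LINT x|lborel. f (x + 0) * \<zeta> x)) / of_real (h\<^sup>2)"
      using I1[of ?v] I1[of "- ?v"] I1[of 0] by simp
    also have "... = ((LINT x|lborel. f x * \<zeta> (x + - ?v)) + (LINT x|lborel. f x * \<zeta> (x + ?v)) - 2 * (LINT x|lborel. f x * \<zeta> (x + 0))) / of_real (h\<^sup>2)"
      unfolding tr by simp
    also have "... = (LINT x|lborel. (f x * \<zeta> (x + - ?v) + f x * \<zeta> (x + ?v) - 2 * (f x * \<zeta> (x + 0))) / of_real (h\<^sup>2))"
      using I2[of ?v] I2[of "- ?v"] I2[of 0] by simp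
    also have "... = (LINT x|lborel. second_quotient j h \<zeta> x * f x)"
      by (simp add: second_quotient_def algebra_simps)
    also have "... = (LINT x:cube (R + 1)|lborel. second_quotient j h \<zeta> x * f x)"
      using z0[of _ 0] z0[of _ ?v] z0[of _ "- ?v"] h unfolding second_quotient_def
      by (intro integrable_supported_cube(2))
         (auto intro!: continuous_intros continuous_on_compose2[OF z(4)] f(4))
    finally show ?thesis .
  qed
  have lim: "((%h. LINT x:cube (R + 1)|lborel. second_quotient j h f x * \<zeta> x) \<longlongrightarrow>
      (LINT x:cube (R + 1)|lborel. partial j (partial j f) x * \<zeta> x)) (at_right 0)"
    by (rule second_quotient_tendsto) (use f z R in auto)
  have "((%h. LINT x:cube (R + 1)|lborel. second_quotient j h \<zeta> x * f x) \<longlongrightarrow>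
      (LINT x:cube (R + 1)|lborel. partial j (partial j \<zeta>) x * f x)) (at_right 0)"
    by (rule second_quotient_tendsto) (use f z R in auto)
  moreover have "\<forall>\<^sub>F h in at_right 0. (LINT x:cube (R + 1)|lborel. second_quotient j h \<zeta> x * f x) =
      (LINT x:cube (R + 1)|lborel. second_quotient j h f x * \<zeta> x)"
    using eventually_at_right_real[of 0 1] by (auto elim!: eventually_mono simp: sym)
  ultimately have "((%h. LINT x:cube (R + 1)|lborel. second_quotient j h f x * \<zeta> x) \<longlongrightarrow>
      (LINT x:cube (R + 1)|lborel. partial j (partial j \<zeta>) x * f x)) (at_right 0)"
    by (rule Lim_transform_eventually)
  then show ?thesis using tendsto_unique[OF trivial_limit_at_right_real lim] by simp
qed

section \<open>A smooth averaging kernel\<close>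

lemma max_power_has_derivative:
  fixes u :: real
  shows "((%u. max 0 u ^ (n + 2)) has_real_derivative real (n + 2) * max 0 u ^ (n + 1)) (at u)"
proof -
  consider "u > 0" | "u < 0" | "u = 0" by linarith
  then show ?thesis
  proof cases
    case 1
    have "((%u. u ^ (n + 2)) has_real_derivative real (n + 2) * max 0 u ^ (n + 1)) (at u)"
      using DERIV_pow[of "n + 2" u UNIV] 1 by simp
    then show ?thesis
      by (rule has_field_derivative_transform_within_open[where S = "{0<..}"]) (use 1 in auto)
  next
    case 2
    have "((%u. 0) has_real_derivative real (n + 2) * max 0 u ^ (n + 1)) (at u)"
      using 2 by (auto intro!: derivative_eq_intros)
    then show ?thesis
      by (rule has_field_derivative_transform_within_open[where S = "{..<0}"]) (use 2 in auto)
  next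
    case 3
    have "((%y::real. max 0 y ^ (n + 2) / y) \<longlongrightarrow> 0) (at 0)"
    proof (rule Lim_null_comparison)
      show "((%y::real. \<bar>y\<bar> ^ (n + 1)) \<longlongrightarrow> 0) (at 0)" by (auto intro!: tendsto_eq_intros)
      have "norm (max 0 y ^ (n + 2) / y) <= \<bar>y\<bar> ^ (n + 1)" if "y \<noteq> 0" for y :: real
      proof (cases "y > 0")
        case True
        then show ?thesis by (simp add: max_absorb2 power_add power2_eq_square)
      next
        case False
        then have "norm (max 0 y ^ (n + 2) / y) = 0" by simp
        also have "... <= \<bar>y\<bar> ^ (n + 1)" by (rule zero_le_power) simp
        finally show ?thesis .
      qed
      then show "\<forall>\<^sub>F y::real in at 0. norm (max 0 y ^ (n + 2) / y) <= \<bar>y\<bar> ^ (n + 1)"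
        by (auto simp: eventually_at_filter)
    qed
    then show ?thesis using 3 by (simp add: has_field_derivative_iff)
  qed
qed

lemma has_vector_derivative_of_realI:
  "(g has_real_derivative g') (at s) ==> ((%s. complex_of_real (g s)) has_vector_derivative of_real g') (at s)"
  using bounded_linear.has_vector_derivative[OF bounded_linear_of_real, of g g' "at s"]
  by (simp add: has_real_derivative_iff_has_vector_derivative)

lemma cis_affine_has_vector_derivative:
  "((%s. cis (b + s * c)) has_vector_derivative \<i> * of_real c * cis (b + s * c)) (at s)"
proof -
  have "((%s. cos (b + s * c)) has_real_derivative - sin (b + s * c) * c) (at s)"
    "((%s. sin (b + s * c)) has_real_derivative cos (b + s * c) * c) (at s)"
    by (auto intro!: derivative_eq_intros)
  from this[THEN has_vector_derivative_of_realI]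
  have "((%s. complex_of_real (cos (b + s * c)) + \<i> * complex_of_real (sin (b + s * c))) has_vector_derivative
      of_real (- sin (b + s * c) * c) + \<i> * of_real (cos (b + s * c) * c)) (at s)"
    by (intro has_vector_derivative_add has_vector_derivative_mult_right)
  moreover have "complex_of_real (cos t) + \<i> * complex_of_real (sin t) = cis t" for t
    by (simp add: complex_eq_iff)
  moreover have "of_real (- sin (b + s * c) * c) + \<i> * of_real (cos (b + s * c) * c) = \<i> * of_real c * cis (b + s * c)"
    by (simp add: complex_eq_iff)
  ultimately show ?thesis by (simp only:)
qed

lemma partial_eqI:
  assumes "!!x. ((%s. f (x + s *\<^sub>R axis j 1)) has_vector_derivative D x) (at 0)"
  shows "partial_differentiable j f" "partial j f = D"
proof -
  show "partial_differentiable j f"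
    unfolding partial_differentiable_def by (intro allI differentiableI_vector[OF assms])
  show "partial j f = D"
    by (rule ext) (simp add: partial_def vector_derivative_at[OF assms])
qed

text \<open>The cube of \<open>bump\<close> is twice continuously differentiable with support in a ball, which is as smooth as
  two integrations by parts require.\<close>

definition bump :: "real => real^'d => real" where
  "bump R x = max 0 (1 - (x \<bullet> x) / R\<^sup>2)"

definition wave_packet :: "real => real^'d => real^'d => complex" where
  "wave_packet R a x = of_real (bump R x ^ 3) * cis (- (a \<bullet> x))"

text \<open>The terms of \<open>\<partial>\<^sub>j\<^sup>2\<close> of the wave packet in which the cut-off is differentiated; they are of size
  \<open>1 / R\<close>.\<close>

definition packet_error :: "real => real^'d => 'd => real^'d => complex" where
  "packet_error R a j x = (of_real (- 6 / R\<^sup>2 * bump R x ^ 2 + 24 * (x $ j)\<^sup>2 / R ^ 4 * bump R x)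
     + \<i> * of_real (12 * a $ j * x $ j / R\<^sup>2 * bump R x ^ 2)) * cis (- (a \<bullet> x))"

lemma bump_nonneg: "0 <= bump R x" and bump_le_1: "bump R x <= 1"
  by (simp_all add: bump_def)

lemma cube_mono:
  assumes "r <= s" shows "cube r \<subseteq> cube s"
proof
  fix x assume x: "x \<in> cube r"
  have "\<bar>x $ i\<bar> <= s" for i
    by (rule order_trans[OF _ assms]) (use x in \<open>simp add: mem_cube\<close>)
  then show "x \<in> cube s" by (simp add: mem_cube)
qed

lemma bump_zero_outside:
  assumes "R > 0" "x \<notin> cube R" shows "bump R x = 0"
proof -
  have "\<exists>i. \<bar>x $ i\<bar> > R" using assms by (simp add: mem_cube not_le)
  then obtain i where "\<bar>x $ i\<bar> > R" ..
  then have "R < norm x" using component_le_norm_cart[of x i] by linarith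
  then have "R\<^sup>2 <= (norm x)\<^sup>2" using assms(1) by (intro power_mono) auto
  then have "1 <= (x \<bullet> x) / R\<^sup>2" using assms(1) by (simp add: power2_norm_eq_inner)
  then show ?thesis by (simp add: bump_def)
qed

lemma continuous_on_bump [continuous_intros]: "continuous_on S (bump R)"
  unfolding bump_def divide_inverse by (intro continuous_intros)

lemma bump_line_derivative:
  "((%s. bump R (x + s *\<^sub>R axis j 1) ^ (n + 2)) has_real_derivative
     real (n + 2) * bump R x ^ (n + 1) * (- 2 * x $ j / R\<^sup>2)) (at 0)"
proof -
  have "((%s. 1 - (x \<bullet> x + 2 * s * x $ j + s\<^sup>2) / R\<^sup>2) has_real_derivative - 2 * x $ j / R\<^sup>2) (at 0)"
    unfolding divide_inverse by (auto intro!: derivative_eq_intros)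
  moreover have "(x + s *\<^sub>R axis j 1) \<bullet> (x + s *\<^sub>R axis j 1) = x \<bullet> x + 2 * s * x $ j + s\<^sup>2" for s
  proof -
    have "x \<bullet> axis j 1 = x $ j" "axis j 1 \<bullet> x = x $ j" "axis j 1 \<bullet> (axis j 1 :: real^'a) = 1"
      by (simp_all add: inner_axis inner_axis' )
    then show ?thesis by (simp add: inner_add_left inner_add_right power2_eq_square algebra_simps)
  qed
  ultimately have "((%s. 1 - ((x + s *\<^sub>R axis j 1) \<bullet> (x + s *\<^sub>R axis j 1)) / R\<^sup>2) has_real_derivative - 2 * x $ j / R\<^sup>2) (at 0)"
    by (simp only:)
  from DERIV_chain2[OF max_power_has_derivative this, of n]
  show ?thesis by (simp add: bump_def)
qed

lemma bump_cube_line_derivative: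
  "((%s. bump R (x + s *\<^sub>R axis j 1) ^ 3) has_real_derivative 3 * bump R x ^ 2 * (- 2 * x $ j / R\<^sup>2)) (at 0)"
  using bump_line_derivative[of R x j 1] by (simp add: eval_nat_numeral)

lemma bump_square_line_derivative:
  "((%s. bump R (x + s *\<^sub>R axis j 1) ^ 2) has_real_derivative 2 * bump R x * (- 2 * x $ j / R\<^sup>2)) (at 0)"
  using bump_line_derivative[of R x j 0] by (simp add: power2_eq_square)

lemma cis_line_derivative:
  "((%s. cis (- (a \<bullet> (x + s *\<^sub>R axis j 1)))) has_vector_derivative - \<i> * of_real (a $ j) * cis (- (a \<bullet> x))) (at 0)"
proof -
  have "- (a \<bullet> (x + s *\<^sub>R axis j 1)) = - (a \<bullet> x) + s * (- (a $ j))" for s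
    by (simp add: inner_add_right inner_axis)
  then show ?thesis using cis_affine_has_vector_derivative[of "- (a \<bullet> x)" "- (a $ j)" 0] by simp
qed

lemma wave_packet_partial:
  "partial_differentiable j (wave_packet R a)"
  "partial j (wave_packet R a) = (%x. (of_real (- 6 / R\<^sup>2 * (x $ j * bump R x ^ 2)) - \<i> * of_real (a $ j) * of_real (bump R x ^ 3)) * cis (- (a \<bullet> x)))"
proof -
  have "((%s. wave_packet R a (x + s *\<^sub>R axis j 1)) has_vector_derivative
      (of_real (- 6 / R\<^sup>2 * (x $ j * bump R x ^ 2)) - \<i> * of_real (a $ j) * of_real (bump R x ^ 3)) * cis (- (a \<bullet> x))) (at 0)" for x
    unfolding wave_packet_def
    by (rule has_vector_derivative_eq_rhs[OF has_vector_derivative_mult[OF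
          has_vector_derivative_of_realI[OF bump_cube_line_derivative] cis_line_derivative]])
       (simp add: algebra_simps)
  from partial_eqI[OF this] show "partial_differentiable j (wave_packet R a)"
    "partial j (wave_packet R a) = (%x. (of_real (- 6 / R\<^sup>2 * (x $ j * bump R x ^ 2)) - \<i> * of_real (a $ j) * of_real (bump R x ^ 3)) * cis (- (a \<bullet> x)))"
    by blast+
qed

lemma wave_packet_second_partial:
  "partial_differentiable j (partial j (wave_packet R a))"
  "partial j (partial j (wave_packet R a)) = (%x. packet_error R a j x - of_real ((a $ j)\<^sup>2) * wave_packet R a x)"
proof -
  have "((%s. partial j (wave_packet R a) (x + s *\<^sub>R axis j 1)) has_vector_derivative
      packet_error R a j x - of_real ((a $ j)\<^sup>2) * wave_packet R a x) (at 0)" for x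
  proof -
    have 1: "((%s. (x + s *\<^sub>R axis j 1) $ j) has_real_derivative 1) (at 0)"
      by (auto intro!: derivative_eq_intros simp: axis_def)
    have 2: "((%s. - 6 / R\<^sup>2 * ((x + s *\<^sub>R axis j 1) $ j * bump R (x + s *\<^sub>R axis j 1) ^ 2)) has_real_derivative
        - 6 / R\<^sup>2 * bump R x ^ 2 + 24 * (x $ j)\<^sup>2 / R ^ 4 * bump R x) (at 0)"
      by (rule DERIV_cong[OF DERIV_cmult[OF DERIV_mult[OF 1 bump_square_line_derivative]]])
         (simp add: algebra_simps power2_eq_square eval_nat_numeral)
    note 3 = bump_cube_line_derivative[of R x j]
    show ?thesis
      unfolding wave_packet_partial(2)
      by (rule has_vector_derivative_eq_rhs[OF has_vector_derivative_mult[OF has_vector_derivative_diff[OF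
            has_vector_derivative_of_realI[OF 2] has_vector_derivative_mult_right[OF has_vector_derivative_of_realI[OF 3]]] cis_line_derivative[of a x j]]])
         (simp add: packet_error_def wave_packet_def algebra_simps power2_eq_square)
  qed
  from partial_eqI[OF this] show "partial_differentiable j (partial j (wave_packet R a))"
    "partial j (partial j (wave_packet R a)) = (%x. packet_error R a j x - of_real ((a $ j)\<^sup>2) * wave_packet R a x)"
    by blast+
qed

lemma continuous_wave_packet: "continuous_on S (wave_packet R a)"
  unfolding wave_packet_def by (intro continuous_intros)

lemma continuous_packet_error: "continuous_on S (packet_error R a j)"
  unfolding packet_error_def divide_inverse by (intro continuous_intros)

lemma norm_packet_error_le:
  assumes R: "R >= 1" shows "norm (packet_error R a j x) <= (30 + 12 * norm a) / R"
proof (cases "x \<in> cube R")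
  case True
  have xj: "\<bar>x $ j\<bar> <= R" using True by (simp add: mem_cube)
  have aj: "\<bar>a $ j\<bar> <= norm a" by (rule component_le_norm_cart)
  have m: "0 <= bump R x" "bump R x <= 1" "bump R x ^ 2 <= 1"
    using bump_nonneg[of R x] bump_le_1[of R x] by (auto simp: power_le_one)
  have R2: "1 / R\<^sup>2 <= 1 / R" using R by (simp add: field_simps power2_eq_square)
  have x2: "(x $ j)\<^sup>2 / R ^ 4 <= 1 / R\<^sup>2"
  proof -
    have "(x $ j)\<^sup>2 <= R\<^sup>2" using power_mono[OF xj, of 2] by simp
    then have "(x $ j)\<^sup>2 / R ^ 4 <= R\<^sup>2 / R ^ 4" by (rule divide_right_mono) simp
    also have "... = 1 / R\<^sup>2" using R by (simp add: field_simps eval_nat_numeral)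
    finally show ?thesis .
  qed
  have t1: "6 / R\<^sup>2 * bump R x ^ 2 <= 6 / R"
    using mult_mono[of "6 / R\<^sup>2" "6 / R" "bump R x ^ 2" 1] R2 m R by simp
  have t2: "24 * (x $ j)\<^sup>2 / R ^ 4 * bump R x <= 24 / R"
    using mult_mono[of "24 * (x $ j)\<^sup>2 / R ^ 4" "24 / R" "bump R x" 1] x2 R2 m R by simp
  have t3: "12 * \<bar>a $ j\<bar> * \<bar>x $ j\<bar> / R\<^sup>2 * bump R x ^ 2 <= 12 * norm a / R"
  proof -
    have "12 * \<bar>a $ j\<bar> * \<bar>x $ j\<bar> / R\<^sup>2 <= 12 * norm a * R / R\<^sup>2"
      by (intro divide_right_mono mult_mono aj xj) auto
    also have "... = 12 * norm a / R" using R by (simp add: power2_eq_square)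
    finally show ?thesis
      using mult_mono[of "12 * \<bar>a $ j\<bar> * \<bar>x $ j\<bar> / R\<^sup>2" "12 * norm a / R" "bump R x ^ 2" 1] m R by simp
  qed
  have "norm (packet_error R a j x) <= \<bar>- 6 / R\<^sup>2 * bump R x ^ 2 + 24 * (x $ j)\<^sup>2 / R ^ 4 * bump R x\<bar>
      + \<bar>12 * a $ j * x $ j / R\<^sup>2 * bump R x ^ 2\<bar>"
    unfolding packet_error_def norm_mult norm_cis
    by (rule order_trans[OF eq_refl[OF mult_1_right] order_trans[OF norm_triangle_ineq]]) (simp add: norm_mult del: of_real_add of_real_mult of_real_divide)
  also have "... <= 6 / R\<^sup>2 * bump R x ^ 2 + 24 * (x $ j)\<^sup>2 / R ^ 4 * bump R x + 12 * \<bar>a $ j\<bar> * \<bar>x $ j\<bar> / R\<^sup>2 * bump R x ^ 2"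
  proof -
    have "0 <= 6 / R\<^sup>2 * bump R x ^ 2" "0 <= 24 * (x $ j)\<^sup>2 / R ^ 4 * bump R x" using m R by simp_all
    moreover have "\<bar>12 * a $ j * x $ j / R\<^sup>2 * bump R x ^ 2\<bar> = 12 * \<bar>a $ j\<bar> * \<bar>x $ j\<bar> / R\<^sup>2 * bump R x ^ 2"
      by (simp add: abs_mult)
    moreover have "- 6 / R\<^sup>2 * bump R x ^ 2 = - (6 / R\<^sup>2 * bump R x ^ 2)" by simp
    ultimately show ?thesis by linarith
  qed
  also have "... <= 6 / R + 24 / R + 12 * norm a / R" by (intro add_mono t1 t2 t3)
  also have "... = (30 + 12 * norm a) / R" by (simp add: add_divide_distrib)
  finally show ?thesis .
next
  case False
  then have "bump R x = 0" using R by (intro bump_zero_outside) auto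
  then show ?thesis using R by (simp add: packet_error_def)
qed

lemma integrable_bump3: "R > 0 ==> integrable lborel (%x::real^'d. bump R x ^ 3)"
proof -
  assume R: "R > 0"
  have "integrable lborel (%x::real^'d. complex_of_real (bump R x ^ 3))"
    by (rule integrable_supported_cube(1)[where r = R])
       (auto intro!: continuous_intros simp: bump_zero_outside R)
  then show ?thesis by (simp only: complex_of_real_integrable_eq)
qed

definition bump_mass :: "'d::finite itself => real => real" where
  "bump_mass i R = (LINT x|lborel. bump R (x :: real^'d) ^ 3)"

lemma bump_mass_ge:
  assumes R: "R > 0"
  shows "(1/4) * (R / CARD('d)) ^ CARD('d) <= bump_mass TYPE('d::finite) R"
proof -
  define r where "r = R / (2 * CARD('d))"
  have r: "r > 0" using R by (simp add: r_def)
  have "(LINT x|lborel. (1/4) * indicator (cube r :: (real^'d) set) x) <= bump_mass TYPE('d) R"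
    unfolding bump_mass_def
  proof (rule integral_mono)
    show "integrable lborel (%x::real^'d. (1/4) * indicator (cube r) x :: real)"
      by (intro integrable_mult_right integrable_indicator_cube)
    show "integrable lborel (%x::real^'d. bump R x ^ 3)" by (rule integrable_bump3[OF R])
    fix x :: "real^'d"
    show "(1/4) * indicator (cube r) x <= bump R x ^ 3"
    proof (cases "x \<in> cube r")
      case True
      have "norm x <= (\<Sum>i\<in>UNIV. \<bar>x $ i\<bar>)" by (rule norm_le_l1_cart)
      also have "... <= (\<Sum>i\<in>(UNIV :: 'd set). r)" using True by (intro sum_mono) (simp add: mem_cube)
      also have "... = R / 2" by (simp add: r_def)
      finally have "(norm x)\<^sup>2 <= (R / 2)\<^sup>2" by (intro power_mono) auto
      then have "x \<bullet> x <= R\<^sup>2 / 4" by (simp add: power2_norm_eq_inner power_divide)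
      then have "(x \<bullet> x) / R\<^sup>2 <= (R\<^sup>2 / 4) / R\<^sup>2" by (rule divide_right_mono) simp
      also have "... = 1/4" using R by simp
      finally have "(x \<bullet> x) / R\<^sup>2 <= 1/4" .
      then have "3/4 <= 1 - (x \<bullet> x) / R\<^sup>2" by linarith
      then have "3/4 <= bump R x" unfolding bump_def by (rule max.coboundedI2)
      then have "(3/4) ^ 3 <= bump R x ^ 3" by (intro power_mono) auto
      then show ?thesis using True by (simp add: eval_nat_numeral)
    qed (use bump_nonneg[of R x] in simp)
  qed
  moreover have "(LINT x|lborel. (1/4) * indicator (cube r :: (real^'d) set) x) = (1/4) * (2 * r) ^ CARD('d)"
    using integral_indicator_cube[of r, where 'd = 'd] r by simp
  moreover have "2 * r = R / CARD('d)" by (simp add: r_def)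
  ultimately show ?thesis by simp
qed

lemma bump_mass_pos:
  assumes "R > 0" shows "0 < bump_mass TYPE('d::finite) R"
proof -
  have "0 < (1/4) * (R / CARD('d)) ^ CARD('d)" using assms by simp
  then show ?thesis using bump_mass_ge[OF assms, where 'd = 'd] by linarith
qed

lemma cube_volume_le_bump_mass:
  assumes "R >= 1" "0 <= r" "r <= 2 * R"
  shows "measure lborel (cube r :: (real^'d) set) <= 4 * (4 * CARD('d)) ^ CARD('d) * bump_mass TYPE('d::finite) R"
proof -
  have "measure lborel (cube r :: (real^'d) set) = (2 * r) ^ CARD('d)" by (rule measure_cube[OF assms(2)])
  also have "... <= (4 * R) ^ CARD('d)" using assms by (intro power_mono) auto
  also have "... = 4 * (4 * CARD('d)) ^ CARD('d) * ((1/4) * (R / CARD('d)) ^ CARD('d))"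
    by (simp add: power_mult_distrib power_divide)
  also have "... <= 4 * (4 * CARD('d)) ^ CARD('d) * bump_mass TYPE('d) R"
    by (intro mult_left_mono bump_mass_ge) (use assms in auto)
  finally show ?thesis .
qed

text \<open>The bump averages out every non-constant character: translating by a half period of the character
  changes its sign but hardly changes the bump.\<close>

lemma bump_char_mean_tendsto:
  fixes a :: "real^'d"
  assumes a: "a \<noteq> 0"
  shows "((%R. (LINT x|lborel. bump R x ^ 3 *\<^sub>R cis (a \<bullet> x)) / of_real (bump_mass TYPE('d) R)) \<longlongrightarrow> 0) at_top"
proof -
  define h where "h = (pi / (a \<bullet> a)) *\<^sub>R a"
  have ah: "a \<bullet> h = pi" using a by (simp add: h_def)
  define K where "K = 4 * (4 * CARD('d)) ^ CARD('d)"
  define H where "H = norm h"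
  have K: "K > 0" by (simp add: K_def)
  have bound: "norm ((LINT x|lborel. bump R x ^ 3 *\<^sub>R cis (a \<bullet> x)) / of_real (bump_mass TYPE('d) R)) <= 15 * H * K / R"
    if R: "R >= max 1 H" for R
  proof -
    have R1: "R >= 1" "R >= H" "R > 0" using R by auto
    let ?F = "%x. bump R x ^ 3 *\<^sub>R cis (a \<bullet> x)"
    let ?G = "%x. bump R (x + h) ^ 3 *\<^sub>R cis (a \<bullet> x)"
    have cb: "continuous_on UNIV (%x. bump R (x + h))"
      by (rule continuous_on_compose2[OF continuous_on_bump]) (auto intro: continuous_intros)
    have bh0: "bump R (x + h) = 0" if "x \<notin> cube (2 * R)" for x
    proof (rule bump_zero_outside[OF R1(3)])
      have "\<exists>i. \<bar>x $ i\<bar> > 2 * R" using that by (simp add: mem_cube not_le)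
      then obtain i where i: "\<bar>x $ i\<bar> > 2 * R" ..
      have "\<bar>h $ i\<bar> <= H" unfolding H_def by (rule component_le_norm_cart)
      then have "R < \<bar>x $ i + h $ i\<bar>" using i R1 by linarith
      then show "x + h \<notin> cube R" unfolding mem_cube by (metis not_le vector_add_component)
    qed
    have b0: "bump R x = 0" if "x \<notin> cube (2 * R)" for x
    proof (rule bump_zero_outside[OF R1(3)])
      show "x \<notin> cube R"
        using that R1 cube_mono[of R "2 * R"] by auto
    qed
    have iF: "integrable lborel ?F" "integrable lborel ?G"
      by (rule integrable_supported_cube(1)[where r = "2 * R"], (intro continuous_intros cb), simp add: b0 bh0)+
    have "(LINT x|lborel. ?F x) = (LINT x|lborel. ?F (x + h))"
      by (rule lborel_integral_shift[symmetric]) (intro borel_measurable_continuous_onI continuous_intros)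
    also have "... = - (LINT x|lborel. ?G x)"
      by (simp add: inner_add_right ah cis_mult[symmetric])
    finally have "2 * (LINT x|lborel. ?F x) = (LINT x|lborel. ?F x) - (LINT x|lborel. ?G x)" by simp
    also have "... = (LINT x|lborel. ?F x - ?G x)" using iF by simp
    also have "... = (LINT x:cube (2 * R)|lborel. ?F x - ?G x)"
      by (rule integrable_supported_cube(2), (intro continuous_intros cb), simp add: b0 bh0)
    finally have eq: "2 * (LINT x|lborel. ?F x) = (LINT x:cube (2 * R)|lborel. ?F x - ?G x)" .
    have le: "norm (?F x - ?G x) <= 30 * H / R" for x
    proof (cases "norm x <= 2 * R")
      case True
      have lip: "\<bar>bump R x - bump R (x + h)\<bar> <= \<bar>(x + h) \<bullet> (x + h) - x \<bullet> x\<bar> / R\<^sup>2"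
      proof -
        have "\<bar>bump R x - bump R (x + h)\<bar> <= \<bar>((x + h) \<bullet> (x + h)) / R\<^sup>2 - (x \<bullet> x) / R\<^sup>2\<bar>"
          unfolding bump_def by linarith
        then show ?thesis by (simp flip: diff_divide_distrib)
      qed
      have "\<bar>(x + h) \<bullet> (x + h) - x \<bullet> x\<bar> = \<bar>2 * (x \<bullet> h) + h \<bullet> h\<bar>"
        by (simp add: inner_add_left inner_add_right inner_commute)
      also have "... <= 2 * (norm x * norm h) + norm h * norm h"
        using Cauchy_Schwarz_ineq2[of x h] Cauchy_Schwarz_ineq2[of h h] by linarith
      also have "... <= 2 * (2 * R * H) + R * H"
        unfolding H_def[symmetric] using True R1 by (intro add_mono mult_mono mult_left_mono mult_right_mono) (auto simp: H_def)
      finally have "\<bar>(x + h) \<bullet> (x + h) - x \<bullet> x\<bar> <= 5 * R * H" by (simp add: mult.commute mult.left_commute)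
      then have "\<bar>bump R x - bump R (x + h)\<bar> <= 5 * R * H / R\<^sup>2"
        by (intro order_trans[OF lip] divide_right_mono) auto
      also have "... = 5 * H / R" using R1 by (simp add: power2_eq_square)
      finally have d: "\<bar>bump R x - bump R (x + h)\<bar> <= 5 * H / R" .
      have "\<bar>bump R x ^ 3 - bump R (x + h) ^ 3\<bar> = \<bar>(bump R x - bump R (x + h)) * (bump R x ^ 2 + bump R x * bump R (x + h) + bump R (x + h) ^ 2)\<bar>"
        by (simp add: algebra_simps eval_nat_numeral)
      also have "... <= 5 * H / R * 6"
        unfolding abs_mult
      proof (rule mult_mono[OF d])
        have "bump R x ^ 2 <= 1" "bump R x * bump R (x + h) <= 1" "bump R (x + h) ^ 2 <= 1"
          using bump_nonneg[of R x] bump_le_1[of R x] bump_nonneg[of R "x + h"] bump_le_1[of R "x + h"]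
          by (auto simp: power_le_one mult_le_one)
        moreover have "0 <= bump R x ^ 2" "0 <= bump R x * bump R (x + h)" "0 <= bump R (x + h) ^ 2"
          using bump_nonneg[of R x] bump_nonneg[of R "x + h"] by auto
        ultimately show "\<bar>bump R x ^ 2 + bump R x * bump R (x + h) + bump R (x + h) ^ 2\<bar> <= 6" by linarith
      qed (use R1 in \<open>auto simp: H_def\<close>)
      finally have "\<bar>bump R x ^ 3 - bump R (x + h) ^ 3\<bar> <= 30 * H / R" by simp
      then show ?thesis by (simp flip: scaleR_diff_left)
    next
      case False
      have "bump R y = 0" if "R < norm y" for y :: "real^'d"
      proof -
        have "R\<^sup>2 <= (norm y)\<^sup>2" using that R1 by (intro power_mono) auto
        then show ?thesis using R1 by (simp add: bump_def power2_norm_eq_inner)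
      qed
      moreover have "R < norm x" using False R1 by linarith
      moreover have "R < norm (x + h)"
        using False R1 norm_triangle_ineq4[of "x + h" h] by (simp add: H_def)
      ultimately show ?thesis using R1 by (simp add: H_def)
    qed
    have "norm (2 * (LINT x|lborel. ?F x)) <= 30 * H / R * measure lborel (cube (2 * R) :: (real^'d) set)"
      unfolding eq cube_def
      by (rule norm_integral_cbox_le) (use le R1 in \<open>auto intro!: continuous_intros continuous_on_subset[OF cb] simp: H_def\<close>)
    also have "... <= 30 * H / R * (K * bump_mass TYPE('d) R)"
      unfolding K_def by (intro mult_left_mono cube_volume_le_bump_mass) (use R1 in \<open>auto simp: H_def\<close>)
    finally have "norm (LINT x|lborel. ?F x) <= 15 * H * K / R * bump_mass TYPE('d) R"
      by (simp add: norm_mult mult.assoc)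
    then show ?thesis
      using bump_mass_pos[OF R1(3), where 'd = 'd] by (simp add: norm_divide divide_le_eq abs_of_pos)
  qed
  show ?thesis
  proof (rule Lim_null_comparison)
    show "((%R. 15 * H * K / R) \<longlongrightarrow> 0) at_top"
      by (intro tendsto_divide_0[OF tendsto_const] filterlim_at_top_imp_at_infinity filterlim_ident)
    show "\<forall>\<^sub>F R in at_top. norm ((LINT x|lborel. bump R x ^ 3 *\<^sub>R cis (a \<bullet> x)) / of_real (bump_mass TYPE('d) R)) <= 15 * H * K / R"
      using eventually_ge_at_top[of "max 1 H"] by eventually_elim (rule bound)
  qed
qed

lemma wave_packet_mean_tendsto:
  fixes P :: "real^'n^'d"
  assumes P: "projection_matrix P" and U: "torus_continuous U"
  shows "((%R. (LINT x:cube (R + 1)|lborel. wave_packet R (P *v rvec k) x * U (transpose P *v x)) / of_real (bump_mass TYPE('d) R))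
    \<longlongrightarrow> fourier_coeff U k) at_top"
proof -
  have "((%R. (LINT x|lborel. bump R x ^ 3 *\<^sub>R (chr (- k) (transpose P *v x) * U (transpose P *v x))) / of_real (bump_mass TYPE('d) R))
    \<longlongrightarrow> fourier_coeff (%y. chr (- k) y * U y) 0) at_top"
    unfolding bump_mass_def
  proof (rule kernel_mean_tendsto[OF P])
    show "((%R. (LINT x|lborel. bump R x ^ 3 *\<^sub>R cis (a \<bullet> x)) / of_real (LINT x|lborel. bump R (x :: real^'d) ^ 3)) \<longlongrightarrow> 0) at_top"
      if "a \<noteq> 0" for a :: "real^'d"
      using bump_char_mean_tendsto[OF that] by (simp add: bump_mass_def)
    show "0 < (LINT x|lborel. bump R (x :: real^'d) ^ 3)" if "R > 0" for R
      using bump_mass_pos[OF that, where 'd = 'd] by (simp add: bump_mass_def)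
  qed (auto intro: integrable_bump3 bump_nonneg torus_continuous_mult torus_continuous_chr U)
  then show ?thesis
    unfolding fourier_coeff_shift[of U k]
  proof (rule Lim_transform_eventually)
    show "\<forall>\<^sub>F R in at_top. (LINT x|lborel. bump R x ^ 3 *\<^sub>R (chr (- k) (transpose P *v x) * U (transpose P *v x))) / of_real (bump_mass TYPE('d) R)
        = (LINT x:cube (R + 1)|lborel. wave_packet R (P *v rvec k) x * U (transpose P *v x)) / of_real (bump_mass TYPE('d) R)"
      using eventually_gt_at_top[of "0::real"]
    proof eventually_elim
      case (elim R)
      have eq: "bump R x ^ 3 *\<^sub>R (chr (- k) (transpose P *v x) * U (transpose P *v x)) = wave_packet R (P *v rvec k) x * U (transpose P *v x)" for x
        by (simp add: chr_orbit rvec_minus wave_packet_def scaleR_conv_of_real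
            linear_neg[OF matrix_vector_mul_linear])
      have "(LINT x|lborel. wave_packet R (P *v rvec k) x * U (transpose P *v x)) =
          (LINT x:cube (R + 1)|lborel. wave_packet R (P *v rvec k) x * U (transpose P *v x))"
      proof (rule integrable_supported_cube(2))
        show "continuous_on UNIV (%x. wave_packet R (P *v rvec k) x * U (transpose P *v x))"
          by (intro continuous_intros continuous_wave_packet continuous_on_torus_orbit U)
        fix x :: "real^'d" assume "x \<notin> cube (R + 1)"
        then have "x \<notin> cube R" using cube_mono[of R "R + 1"] by auto
        then show "wave_packet R (P *v rvec k) x * U (transpose P *v x) = 0"
          using elim by (simp add: wave_packet_def bump_zero_outside)
      qed
      then show ?case unfolding eq by simp
    qed
  qed
qed

section \<open>The equation for the Fourier coefficients\<close>

text \<open>The time derivative and the Laplacian of a classical solution need not be bounded or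
  quasiperiodic in space. Testing against wave packets moves the Laplacian onto the test function; the
  limit of wide packets is the equation for one Fourier coefficient, in integrated form.\<close>

lemma fourier_ode:
  fixes P :: "real^'n^'d" and \<psi> :: "real => real^'d => complex" and u g :: "real => real^'n => complex"
  assumes P: "projection_matrix P"
    and u: "!!s. s \<in> {0..T} ==> torus_continuous (u s)" "!!s x. s \<in> {0..T} ==> \<psi> s x = u s (transpose P *v x)"
      "!!s y. s \<in> {0..T} ==> norm (u s y) <= B"
    and g: "!!s. s \<in> {0..T} ==> torus_continuous (g s)" "!!s y. s \<in> {0..T} ==> norm (g s y) <= G"
    and dt: "!!x s. s \<in> {0..T} ==> (%s. \<psi> s x) differentiable (at s within {0..T})"
    and dtc: "continuous_on ({0..T} \<times> UNIV) (%(t, x). vector_derivative (%s. \<psi> s x) (at t within {0..T}))"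
    and pd: "!!j s. s \<in> {0..T} ==> partial_differentiable j (\<psi> s)" "!!j s. s \<in> {0..T} ==> partial_differentiable j (partial j (\<psi> s))"
      "!!j s. s \<in> {0..T} ==> continuous_on UNIV (partial j (partial j (\<psi> s)))"
    and eq: "!!x s. s \<in> {0..T} ==> \<i> * vector_derivative (%s. \<psi> s x) (at s within {0..T}) =
      - laplacian (\<psi> s) x + g s (transpose P *v x)"
    and t: "t \<in> {0..T}"
  shows "((%s. - \<i> * (of_real ((norm (P *v rvec k))\<^sup>2) * fourier_coeff (u s) k + fourier_coeff (g s) k))
    has_integral (fourier_coeff (u t) k - fourier_coeff (u 0) k)) {0..t}"
proof -
  define a where "a = P *v rvec k"
  define D where "D s x = vector_derivative (%s. \<psi> s x) (at s within {0..T})" for s x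
  define W where "W R = wave_packet R a" for R
  let ?g = "%s x. g s (transpose P *v x)"
  \<comment> \<open>One layer around the support of the wave packet leaves room for difference quotients.\<close>
  let ?q = "%R F. LINT x:cube (R + 1)|lborel. W R x * F x"
  let ?E = "real CARD('d) * (30 + 12 * norm a)"
  define Z where "Z R = bump_mass TYPE('d) R" for R
  define K where "K = 4 * (4 * real CARD('d)) ^ CARD('d)"
  have T0: "0 \<in> {0..T}" using t by auto
  have K: "K > 0" by (simp add: K_def)
  have B: "0 <= B" using u(3)[OF t, of 0] norm_ge_zero[of "u t 0"] by linarith
  have G: "0 <= G" using g(2)[OF t, of 0] norm_ge_zero[of "g t 0"] by linarith
  have Z: "Z R > 0" if "R >= 1" for R using bump_mass_pos[of R, where 'd = 'd] that by (simp add: Z_def)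
  have vol: "measure lborel (cube (R + 1) :: (real^'d) set) <= K * Z R" if "R >= 1" for R
    using cube_volume_le_bump_mass[of R "R + 1", where 'd = 'd] that by (simp add: K_def Z_def)
  have cW: "continuous_on S (W R)" for S R unfolding W_def by (rule continuous_wave_packet)
  have W1: "norm (W R x) <= 1" for R x
    using bump_nonneg[of R x] bump_le_1[of R x] by (simp only: W_def wave_packet_def norm_mult norm_of_real norm_cis) (simp add: power_le_one)
  have cpsi: "continuous_on S (\<psi> s)" if "s \<in> {0..T}" for s S
  proof -
    have "\<psi> s = (%x. u s (transpose P *v x))" using u(2)[OF that] by blast
    then show ?thesis using continuous_on_torus_orbit[OF u(1)[OF that]] by simp
  qed
  have cg: "continuous_on S (%x. ?g s x)" if "s \<in> {0..T}" for s S
    by (rule continuous_on_torus_orbit[OF g(1)[OF that]])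
  have cD: "continuous_on UNIV (D s)" if "s \<in> {0..T}" for s
    using continuous_on_compose2[OF dtc, of UNIV "%x. (s, x)"] that
    by (simp add: D_def[abs_def] continuous_on_Pair image_subset_iff)
  have si: "set_integrable lborel (cube r) F" if "continuous_on UNIV F" for F :: "real^'d => complex" and r
    unfolding set_integrable_def cube_def
    by (rule borel_integrable_compact) (auto intro: continuous_on_subset[OF that])
  have nle: "norm (LINT x:cube (R + 1)|lborel. F x) <= b * (K * Z R)"
    if "continuous_on UNIV F" "!!x. norm (F x) <= b" "R >= 1" for F :: "real^'d => complex" and b R
  proof -
    have b: "0 <= b" using that(2)[of 0] norm_ge_zero[of "F 0"] by linarith
    have "norm (LINT x:cube (R + 1)|lborel. F x) <= b * measure lborel (cube (R + 1) :: (real^'d) set)"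
      unfolding cube_def by (rule norm_integral_cbox_le) (use that b in \<open>auto intro: continuous_on_subset\<close>)
    also have "... <= b * (K * Z R)" by (rule mult_left_mono[OF vol[OF that(3)] b])
    finally show ?thesis .
  qed
  define e where "e R s = (\<Sum>j\<in>UNIV. LINT x:cube (R + 1)|lborel. packet_error R a j x * \<psi> s x)" for R s
  define h where "h R s = (LINT x:cube (R + 1)|lborel. W R x * D s x)" for R s
  have h_eq: "h R s = \<i> * (e R s - of_real ((norm a)\<^sup>2) * (?q R (\<psi> s)))
      - \<i> * (?q R (?g s))"
    if s: "s \<in> {0..T}" and R: "R >= 1" for R s
  proof -
    let ?L = "%F. LINT x:cube (R + 1)|lborel. F x"
    have "W R x * D s x = (\<Sum>j\<in>UNIV. \<i> * (partial j (partial j (\<psi> s)) x * W R x)) - \<i> * (W R x * ?g s x)" for x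
    proof -
      have "D s x = - \<i> * (\<i> * D s x)" by simp
      also have "\<i> * D s x = - laplacian (\<psi> s) x + ?g s x" using eq[OF s, of x] by (simp add: D_def)
      finally have D: "D s x = \<i> * laplacian (\<psi> s) x - \<i> * ?g s x"
        by (simp add: algebra_simps)
      have "W R x * D s x = \<i> * (laplacian (\<psi> s) x * W R x) - \<i> * (W R x * ?g s x)"
        unfolding D by (simp add: algebra_simps)
      then show ?thesis by (simp add: laplacian_def sum_distrib_left sum_distrib_right)
    qed
    then have "h R s = ?L (%x. (\<Sum>j\<in>UNIV. \<i> * (partial j (partial j (\<psi> s)) x * W R x)) - \<i> * (W R x * ?g s x))"
      by (simp add: h_def)
    also have "... = ?L (%x. \<Sum>j\<in>UNIV. \<i> * (partial j (partial j (\<psi> s)) x * W R x)) - ?L (%x. \<i> * (W R x * ?g s x))"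
      by (rule set_integral_diff(2)) (intro si continuous_intros cW cg[OF s] pd(3)[OF s])+
    also have "?L (%x. \<Sum>j\<in>UNIV. \<i> * (partial j (partial j (\<psi> s)) x * W R x)) = (\<Sum>j\<in>UNIV. ?L (%x. \<i> * (partial j (partial j (\<psi> s)) x * W R x)))"
      unfolding set_lebesgue_integral_def scaleR_sum_right
      by (rule Bochner_Integration.integral_sum)
         (use si[of "%x. \<i> * (partial _ (partial _ (\<psi> s)) x * W R x)"] in
           \<open>auto simp: set_integrable_def[symmetric] intro!: si continuous_intros cW pd(3)[OF s]\<close>)
    also have "... = (\<Sum>j\<in>UNIV. \<i> * (?L (%x. packet_error R a j x * \<psi> s x) - of_real ((a $ j)\<^sup>2) * ?L (%x. W R x * \<psi> s x)))"
    proof (intro sum.cong refl)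
      fix j
      have "?L (%x. partial j (partial j (\<psi> s)) x * W R x) = ?L (%x. partial j (partial j (W R)) x * \<psi> s x)"
        unfolding W_def
      proof (rule second_partial_by_parts[where R = R])
        show "continuous_on UNIV (partial j (partial j (wave_packet R a)))"
          unfolding wave_packet_second_partial(2)
          by (intro continuous_intros continuous_packet_error continuous_wave_packet)
        show "wave_packet R a x = 0" if "x \<notin> cube R" for x
          using that R by (simp add: wave_packet_def bump_zero_outside)
      qed (use R in \<open>auto intro: pd[OF s] cpsi[OF s] wave_packet_partial(1) wave_packet_second_partial(1) continuous_wave_packet\<close>)
      also have "... = ?L (%x. packet_error R a j x * \<psi> s x - of_real ((a $ j)\<^sup>2) * (W R x * \<psi> s x))"
        unfolding W_def wave_packet_second_partial(2) by (simp add: left_diff_distrib mult.assoc)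
      also have "... = ?L (%x. packet_error R a j x * \<psi> s x) - ?L (%x. of_real ((a $ j)\<^sup>2) * (W R x * \<psi> s x))"
        by (rule set_integral_diff(2)) (intro si continuous_intros cW continuous_packet_error cpsi[OF s])+
      finally show "?L (%x. \<i> * (partial j (partial j (\<psi> s)) x * W R x)) =
          \<i> * (?L (%x. packet_error R a j x * \<psi> s x) - of_real ((a $ j)\<^sup>2) * ?L (%x. W R x * \<psi> s x))"
        by simp
    qed
    also have "... = \<i> * (e R s - of_real ((norm a)\<^sup>2) * ?L (%x. W R x * \<psi> s x))"
    proof -
      have "(norm a)\<^sup>2 = (\<Sum>j\<in>UNIV. (a $ j)\<^sup>2)" unfolding power2_norm_eq_inner inner_vec_def by (simp add: power2_eq_square)
      then show ?thesis
        by (simp add: e_def sum_subtractf sum_distrib_left[symmetric] sum_distrib_right[symmetric])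
    qed
    finally show ?thesis by simp
  qed
  have e_le: "norm (e R s) <= (?E * B * K) / R * Z R" if s: "s \<in> {0..T}" and R: "R >= 1" for R s
  proof -
    have "norm (e R s) <= (\<Sum>j\<in>(UNIV :: 'd set). (30 + 12 * norm a) / R * B * (K * Z R))"
      unfolding e_def
    proof (intro order_trans[OF norm_sum] sum_mono nle R)
      fix j x
      show "continuous_on UNIV (%x. packet_error R a j x * \<psi> s x)"
        by (intro continuous_intros continuous_packet_error cpsi[OF s])
      show "norm (packet_error R a j x * \<psi> s x) <= (30 + 12 * norm a) / R * B"
        unfolding norm_mult using u(2,3)[OF s] R
        by (intro mult_mono norm_packet_error_le) auto
    qed
    then show ?thesis by (simp add: field_simps)
  qed
  have Wpsi: "norm (?q R (\<psi> s)) <= B * (K * Z R)"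
    and Wg: "norm (?q R (?g s)) <= G * (K * Z R)"
    if s: "s \<in> {0..T}" and R: "R >= 1" for R s
  proof -
    show "norm (?q R (\<psi> s)) <= B * (K * Z R)"
    proof (rule nle[OF _ _ R])
      show "continuous_on UNIV (%x. W R x * \<psi> s x)" by (intro continuous_intros cW cpsi[OF s])
      show "norm (W R x * \<psi> s x) <= B" for x
        unfolding norm_mult using mult_mono[OF W1[of R x], of "norm (\<psi> s x)" B] u(2,3)[OF s] B by simp
    qed
    show "norm (?q R (?g s)) <= G * (K * Z R)"
    proof (rule nle[OF _ _ R])
      show "continuous_on UNIV (%x. W R x * ?g s x)" by (intro continuous_intros cW cg[OF s])
      show "norm (W R x * ?g s x) <= G" for x
        unfolding norm_mult using mult_mono[OF W1[of R x], of "norm (?g s x)" G] g(2)[OF s] G by simp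
    qed
  qed
  define M where "M = ?E * B * K + (norm a)\<^sup>2 * (B * K) + G * K"
  have h_le: "norm (h R s / of_real (Z R)) <= M" if s: "s \<in> {0..T}" and R: "R >= 1" for R s
  proof -
    let ?A = "?q R (\<psi> s)" and ?Bg = "?q R (?g s)"
    have "norm (h R s) <= norm (e R s) + (norm a)\<^sup>2 * norm ?A + norm ?Bg"
    proof -
      have "norm (h R s) <= norm (\<i> * (e R s - of_real ((norm a)\<^sup>2) * ?A)) + norm (\<i> * ?Bg)"
        unfolding h_eq[OF s R] by (rule norm_triangle_ineq4)
      also have "norm (\<i> * (e R s - of_real ((norm a)\<^sup>2) * ?A)) <= norm (e R s) + (norm a)\<^sup>2 * norm ?A"
        using norm_triangle_ineq4[of "e R s" "of_real ((norm a)\<^sup>2) * ?A"] by (simp add: norm_mult norm_power)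
      finally show ?thesis by (simp add: norm_mult)
    qed
    also have "... <= (?E * B * K) * Z R + (norm a)\<^sup>2 * (B * (K * Z R)) + G * (K * Z R)"
    proof (intro add_mono mult_left_mono Wpsi[OF s R] Wg[OF s R] order_trans[OF e_le[OF s R]])
      have "(?E * B * K) / R <= (?E * B * K) / 1"
        using R B K by (intro divide_left_mono mult_nonneg_nonneg add_nonneg_nonneg) auto
      then show "(?E * B * K) / R * Z R <= (?E * B * K) * Z R"
        using Z[OF R] by (intro mult_right_mono) auto
    qed auto
    also have "... = M * Z R" by (simp add: M_def algebra_simps)
    finally show ?thesis using Z[OF R] by (simp add: norm_divide divide_le_eq)
  qed
  have lim: "((%R. h R s / of_real (Z R)) \<longlongrightarrow> - \<i> * (of_real ((norm a)\<^sup>2) * fourier_coeff (u s) k + fourier_coeff (g s) k)) at_top"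
    if s: "s \<in> {0..T}" for s
  proof -
    have 1: "((%R. (?q R (\<psi> s)) / of_real (Z R)) \<longlongrightarrow> fourier_coeff (u s) k) at_top"
      using wave_packet_mean_tendsto[OF P u(1)[OF s], of k] by (simp add: W_def Z_def a_def u(2)[OF s])
    have 2: "((%R. (?q R (?g s)) / of_real (Z R)) \<longlongrightarrow> fourier_coeff (g s) k) at_top"
      using wave_packet_mean_tendsto[OF P g(1)[OF s], of k] by (simp add: W_def Z_def a_def)
    have 3: "((%R. e R s / of_real (Z R)) \<longlongrightarrow> 0) at_top"
    proof (rule Lim_null_comparison)
      show "((%R. (?E * B * K) / R) \<longlongrightarrow> 0) at_top"
        by (intro tendsto_divide_0[OF tendsto_const] filterlim_at_top_imp_at_infinity filterlim_ident)
      show "\<forall>\<^sub>F R in at_top. norm (e R s / of_real (Z R)) <= (?E * B * K) / R"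
        using eventually_ge_at_top[of "1::real"]
      proof eventually_elim
        case (elim R)
        show ?case using e_le[OF s elim] Z[OF elim] by (simp add: norm_divide divide_le_eq)
      qed
    qed
    have "((%R. \<i> * (e R s / of_real (Z R) - of_real ((norm a)\<^sup>2) * ((?q R (\<psi> s)) / of_real (Z R)))
      - \<i> * ((?q R (?g s)) / of_real (Z R))) \<longlongrightarrow>
      \<i> * (0 - of_real ((norm a)\<^sup>2) * fourier_coeff (u s) k) - \<i> * fourier_coeff (g s) k) at_top"
      by (intro tendsto_intros 1 2 3)
    then have "((%R. h R s / of_real (Z R)) \<longlongrightarrow> \<i> * (0 - of_real ((norm a)\<^sup>2) * fourier_coeff (u s) k) - \<i> * fourier_coeff (g s) k) at_top"
      by (rule Lim_transform_eventually)
         (use eventually_ge_at_top[of "1::real"] in \<open>eventually_elim, simp add: h_eq[OF s] diff_divide_distrib right_diff_distrib\<close>)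
    moreover have "\<i> * (0 - N * c) - \<i> * f = - \<i> * (N * c + f)" for N c f :: complex
      by (simp add: algebra_simps)
    ultimately show ?thesis by (simp only:)
  qed
  have ftc: "((%s. D s x) has_integral (\<psi> t x - \<psi> 0 x)) {0..t}" for x
  proof (rule fundamental_theorem_of_calculus)
    show "0 <= t" using t by simp
    fix s assume "s \<in> {0..t}"
    then have "s \<in> {0..T}" using t by simp
    then have "((%s. \<psi> s x) has_vector_derivative D s x) (at s within {0..T})"
      using dt[of s x] unfolding D_def by (simp add: vector_derivative_works)
    then show "((%s. \<psi> s x) has_vector_derivative D s x) (at s within {0..t})"
      by (rule has_vector_derivative_within_subset) (use t in auto)
  qed
  have tsub: "{0..t} \<subseteq> {0..T}" using t by auto
  have lint: "(LINT x:cube r|lborel. F x) = integral (cube r) F" if "continuous_on UNIV F" for F :: "real^'d => complex" and r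
    by (rule set_borel_integral_eq_integral(2)[OF si[OF that]])
  have cWD: "continuous_on ({0..t} \<times> cube r) (%(s, x). W R x * D s x)" for R r
  proof -
    have "continuous_on ({0..t} \<times> cube r) (%p. W R (snd p) * (case p of (s, x) => D s x))"
      unfolding D_def
      by (intro continuous_intros continuous_on_compose2[OF cW[of UNIV R]] continuous_on_subset[OF dtc] continuous_on_snd continuous_on_id)
         (use tsub in auto)
    then show ?thesis by (simp add: case_prod_unfold)
  qed
  have h_int: "h R s = integral (cube (R + 1)) (%x. W R x * D s x)" if "s \<in> {0..T}" for R s
    unfolding h_def by (rule lint) (intro continuous_intros cW cD[OF that])
  have hc: "continuous_on {0..t} (%s. h R s / of_real (Z R))" for R
  proof -
    have "continuous_on {0..t} (%s. integral (cube (R + 1)) (%x. W R x * D s x))"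
      unfolding cube_def by (rule integral_continuous_on_param) (use cWD[of "R + 1" R] in \<open>simp add: cube_def\<close>)
    then have "continuous_on {0..t} (h R)"
      by (rule continuous_on_eq) (use h_int tsub in auto)
    then show ?thesis unfolding divide_inverse by (intro continuous_intros)
  qed
  have hi: "integral {0..t} (%s. h R s / of_real (Z R)) =
      (?q R (\<psi> t)) / of_real (Z R) - (?q R (\<psi> 0)) / of_real (Z R)" for R
  proof -
    have "integral {0..t} (h R) = integral {0..t} (%s. integral (cube (R + 1)) (%x. W R x * D s x))"
      by (rule Henstock_Kurzweil_Integration.integral_cong) (use h_int tsub in auto)
    also have "... = integral (cube (R + 1)) (%x. integral {0..t} (%s. W R x * D s x))"
      using integral_swap_continuous[of 0 "\<chi> j. - (R + 1)" t "\<chi> j. R + 1" "%s x. W R x * D s x"] cWD[of "R + 1" R]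
      by (simp add: cube_def cbox_Pair_eq)
    also have "... = integral (cube (R + 1)) (%x. W R x * \<psi> t x - W R x * \<psi> 0 x)"
      by (simp add: integral_unique[OF ftc] right_diff_distrib)
    also have "... = (LINT x:cube (R + 1)|lborel. W R x * \<psi> t x - W R x * \<psi> 0 x)"
      by (rule lint[symmetric]) (intro continuous_intros cW cpsi t T0)
    also have "... = (?q R (\<psi> t)) - (?q R (\<psi> 0))"
      by (rule set_integral_diff(2)) (intro si continuous_intros cW cpsi t T0)+
    finally show ?thesis by (simp add: diff_divide_distrib)
  qed
  let ?r = "%m. real (Suc m)"
  have fl: "filterlim ?r at_top sequentially"
    by (rule filterlim_compose[OF filterlim_real_sequentially filterlim_Suc])
  let ?l = "%s. - \<i> * (of_real ((norm a)\<^sup>2) * fourier_coeff (u s) k + fourier_coeff (g s) k)"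
  have pr: "(%s. h (?r m) s / of_real (Z (?r m))) integrable_on {0..t}" for m
    by (rule integrable_continuous_interval[OF hc])
  have prM: "(%_::real. M) integrable_on {0..t}" by (rule integrable_const_ivl)
  have prle: "norm (h (?r m) s / of_real (Z (?r m))) <= M" if "s \<in> {0..t}" for m s
    by (rule h_le) (use that tsub in auto)
  have prlim: "(%m. h (?r m) s / of_real (Z (?r m))) \<longlonglongrightarrow> ?l s" if "s \<in> {0..t}" for s
    by (rule filterlim_compose[OF lim fl]) (use that tsub in auto)
  note dom = dominated_convergence[OF pr prM prle prlim]
  have L: "((%R. (?q R (\<psi> s)) / of_real (Z R)) \<longlongrightarrow> fourier_coeff (u s) k) at_top"
    if "s \<in> {0..T}" for s
    using wave_packet_mean_tendsto[OF P u(1)[OF that], of k] by (simp add: W_def Z_def a_def u(2)[OF that])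
  have "(%m. integral {0..t} (%s. h (?r m) s / of_real (Z (?r m)))) \<longlonglongrightarrow> fourier_coeff (u t) k - fourier_coeff (u 0) k"
    unfolding hi by (intro tendsto_diff filterlim_compose[OF L[OF t] fl] filterlim_compose[OF L[OF T0] fl])
  then have "integral {0..t} ?l = fourier_coeff (u t) k - fourier_coeff (u 0) k"
    using LIMSEQ_unique[OF dom(2)] by blast
  then show ?thesis using dom(1) by (simp add: has_integral_integrable_integral a_def)
qed

lemma integral_equation_continuous:
  fixes c w :: "real => complex"
  assumes "!!t. t \<in> {0..T} ==> (w has_integral (c t - c 0)) {0..t}" and T: "0 <= T"
  shows "continuous_on {0..T} c"
proof -
  have "w integrable_on {0..T}" using assms(1)[of T] T by auto
  then have "continuous_on {0..T} (%t. c 0 + integral {0..t} w)"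
    by (intro continuous_intros indefinite_integral_continuous_1)
  then show ?thesis
    by (rule continuous_on_eq) (use assms(1)[THEN integral_unique] in auto)
qed

text \<open>The integrating factor \<open>cis (s lm)\<close> turns the equation into an exact derivative.\<close>

lemma duhamel_scalar:
  fixes c f :: "real => complex" and lm :: real
  assumes ode: "!!t. t \<in> {0..T} ==> ((%s. - \<i> * (of_real lm * c s + f s)) has_integral (c t - c 0)) {0..t}"
    and f: "continuous_on {0..T} f"
    and t: "0 <= t0" "t0 <= t1" "t1 <= T"
  shows "((%s. - \<i> * cis (- (t1 - s) * lm) * f s) has_integral (c t1 - cis (- (t1 - t0) * lm) * c t0)) {t0..t1}"
proof -
  let ?w = "%s. - \<i> * (of_real lm * c s + f s)"
  have T: "0 <= T" using t by linarith
  have c: "continuous_on {0..T} c" by (rule integral_equation_continuous[OF ode T])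
  have w: "continuous_on {0..T} ?w" by (intro continuous_intros c f)
  have dc: "(c has_vector_derivative ?w s) (at s within {0..T})" if "s \<in> {0..T}" for s
  proof -
    have "((%t. integral {0..t} ?w) has_vector_derivative ?w s) (at s within {0..T})"
      by (rule integral_has_vector_derivative[OF w that])
    from has_vector_derivative_add[OF has_vector_derivative_const this, of "c 0"]
    have "((%t. c 0 + integral {0..t} ?w) has_vector_derivative ?w s) (at s within {0..T})" by simp
    then show ?thesis
      by (rule has_vector_derivative_transform[OF that, rotated]) (use ode[THEN integral_unique] in auto)
  qed
  have "((%s. - \<i> * cis (s * lm) * f s) has_integral (cis (t1 * lm) * c t1 - cis (t0 * lm) * c t0)) {t0..t1}"
  proof (rule fundamental_theorem_of_calculus[OF t(2)])
    fix s assume s: "s \<in> {t0..t1}"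
    have "((%s. cis (0 + s * lm)) has_vector_derivative \<i> * of_real lm * cis (0 + s * lm)) (at s within {t0..t1})"
      by (rule has_vector_derivative_at_within[OF cis_affine_has_vector_derivative])
    moreover have "(c has_vector_derivative ?w s) (at s within {t0..t1})"
      by (rule has_vector_derivative_within_subset[OF dc]) (use s t in auto)
    ultimately have "((%s. cis (0 + s * lm) * c s) has_vector_derivative
        cis (0 + s * lm) * ?w s + \<i> * of_real lm * cis (0 + s * lm) * c s) (at s within {t0..t1})"
      by (rule has_vector_derivative_mult)
    then show "((%s. cis (s * lm) * c s) has_vector_derivative - \<i> * cis (s * lm) * f s) (at s within {t0..t1})"
      by (simp add: algebra_simps)
  qed
  from has_integral_mult_right[OF this, of "cis (- t1 * lm)"]
  have "((%s. cis (- t1 * lm) * (- \<i> * cis (s * lm) * f s)) has_integral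
      cis (- t1 * lm) * (cis (t1 * lm) * c t1 - cis (t0 * lm) * c t0)) {t0..t1}" .
  moreover have "cis (- t1 * lm) * (- \<i> * cis (s * lm) * f s) = - \<i> * cis (- (t1 - s) * lm) * f s" for s
  proof -
    have "cis (- (t1 - s) * lm) = cis (- t1 * lm) * cis (s * lm)" by (simp add: cis_mult algebra_simps)
    then show ?thesis by simp
  qed
  moreover have "cis (- t1 * lm) * (cis (t1 * lm) * c t1 - cis (t0 * lm) * c t0) = c t1 - cis (- (t1 - t0) * lm) * c t0"
  proof -
    have "cis (- t1 * lm) * cis (t1 * lm) = 1" "cis (- t1 * lm) * cis (t0 * lm) = cis (- (t1 - t0) * lm)"
      by (simp_all add: cis_mult algebra_simps)
    then show ?thesis by (simp add: right_diff_distrib mult.assoc[symmetric])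
  qed
  ultimately show ?thesis by (simp only:)
qed

section \<open>Bounds that are uniform over a family\<close>

text \<open>All constants of the error analysis must be uniform in the data. A bound is therefore stated for
  a family of sequences indexed by a parameter set \<open>Q\<close>, in the manner of a Landau symbol: the norm is
  at most a constant times the gauge \<open>s\<close>.\<close>

definition bnd1 :: "'q set => ('q => 'i => 'b::real_normed_vector) => ('q => real) => bool" where
  "bnd1 Q a s \<longleftrightarrow> (\<exists>C\<ge>0. \<forall>q\<in>Q. l1_le (a q) (C * s q))"

definition bnd2 :: "'q set => ('q => 'i => 'b::real_normed_vector) => ('q => real) => bool" where
  "bnd2 Q a s \<longleftrightarrow> (\<exists>C\<ge>0. \<forall>q\<in>Q. l2_le (a q) (C * s q))"

lemma bnd1I: "C >= 0 ==> (!!q. q \<in> Q ==> l1_le (a q) (C * s q)) ==> bnd1 Q a s"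
  by (auto simp: bnd1_def)

lemma bnd2I: "C >= 0 ==> (!!q. q \<in> Q ==> l2_le (a q) (C * s q)) ==> bnd2 Q a s"
  by (auto simp: bnd2_def)

lemma bnd1E:
  assumes "bnd1 Q a s" obtains C where "C >= 0" "!!q. q \<in> Q ==> l1_le (a q) (C * s q)"
  using assms unfolding bnd1_def by auto

lemma bnd2E:
  assumes "bnd2 Q a s" obtains C where "C >= 0" "!!q. q \<in> Q ==> l2_le (a q) (C * s q)"
  using assms unfolding bnd2_def by auto

lemma bnd1_add: 
  assumes "bnd1 Q a s" "bnd1 Q b s" shows "bnd1 Q (%q k. a q k + b q k) s"
proof -
  obtain C where C: "C >= 0" "!!q. q \<in> Q ==> l1_le (a q) (C * s q)" using assms(1) by (rule bnd1E) (rule that)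
  obtain D where D: "D >= 0" "!!q. q \<in> Q ==> l1_le (b q) (D * s q)" using assms(2) by (rule bnd1E) (rule that)
  show ?thesis
  proof (rule bnd1I)
    show "l1_le (%k. a q k + b q k) ((C + D) * s q)" if "q \<in> Q" for q
      using l1_le_add[OF C(2)[OF that] D(2)[OF that]] by (simp add: distrib_right)
  qed (use C D in simp)
qed

lemma bnd2_add: 
  assumes "bnd2 Q a s" "bnd2 Q b s" shows "bnd2 Q (%q k. a q k + b q k) s"
proof -
  obtain C where C: "C >= 0" "!!q. q \<in> Q ==> l2_le (a q) (C * s q)" using assms(1) by (rule bnd2E) (rule that)
  obtain D where D: "D >= 0" "!!q. q \<in> Q ==> l2_le (b q) (D * s q)" using assms(2) by (rule bnd2E) (rule that)
  show ?thesis
  proof (rule bnd2I)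
    show "l2_le (%k. a q k + b q k) ((C + D) * s q)" if "q \<in> Q" for q
      using l2_le_add[OF C(2)[OF that] D(2)[OF that]] by (simp add: distrib_right)
  qed (use C D in simp)
qed

lemma bnd1_dom:
  assumes "bnd1 Q a s" "!!q k. q \<in> Q ==> norm (b q k) <= c q * norm (a q k)" "!!q. q \<in> Q ==> 0 <= c q"
  shows "bnd1 Q b (%q. c q * s q)"
proof -
  obtain C where C: "C >= 0" "!!q. q \<in> Q ==> l1_le (a q) (C * s q)" using assms(1) by (rule bnd1E) (rule that)
  show ?thesis
  proof (rule bnd1I[OF C(1)])
    fix q assume q: "q \<in> Q"
    have "l1_le (%k. c q * norm (a q k)) (norm (c q) * (C * s q))"
      by (rule l1_le_cmult) (simp add: l1_le_norm C(2)[OF q])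
    then show "l1_le (b q) (C * (c q * s q))"
      by (rule l1_le_mono) (use assms(2,3)[OF q] in \<open>auto simp: abs_mult\<close>)
  qed
qed

lemma bnd2_dom:
  assumes "bnd2 Q a s" "!!q k. q \<in> Q ==> norm (b q k) <= c q * norm (a q k)" "!!q. q \<in> Q ==> 0 <= c q"
  shows "bnd2 Q b (%q. c q * s q)"
proof -
  obtain C where C: "C >= 0" "!!q. q \<in> Q ==> l2_le (a q) (C * s q)" using assms(1) by (rule bnd2E) (rule that)
  show ?thesis
  proof (rule bnd2I[OF C(1)])
    fix q assume q: "q \<in> Q"
    have "l2_le (%k. c q * norm (a q k)) (norm (c q) * (C * s q))"
      by (rule l2_le_cmult) (simp add: l2_le_norm C(2)[OF q])
    then show "l2_le (b q) (C * (c q * s q))"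
      by (rule l2_le_mono) (use assms(2,3)[OF q] in \<open>auto simp: abs_mult\<close>)
  qed
qed

lemma bnd1_mono:
  assumes "bnd1 Q a s" "!!q. q \<in> Q ==> s q <= K * t q" "0 <= K"
  shows "bnd1 Q a t"
proof -
  obtain C where C: "C >= 0" "!!q. q \<in> Q ==> l1_le (a q) (C * s q)" using assms(1) by (rule bnd1E) (rule that)
  show ?thesis
  proof (rule bnd1I)
    show "l1_le (a q) (C * K * t q)" if "q \<in> Q" for q
      by (rule l1_le_le[OF C(2)[OF that]]) (use mult_left_mono[OF assms(2)[OF that] C(1)] in \<open>simp add: mult.assoc\<close>)
  qed (use C assms in simp)
qed

lemma bnd2_mono:
  assumes "bnd2 Q a s" "!!q. q \<in> Q ==> s q <= K * t q" "0 <= K"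
  shows "bnd2 Q a t"
proof -
  obtain C where C: "C >= 0" "!!q. q \<in> Q ==> l2_le (a q) (C * s q)" using assms(1) by (rule bnd2E) (rule that)
  show ?thesis
  proof (rule bnd2I)
    show "l2_le (a q) (C * K * t q)" if "q \<in> Q" for q
      by (rule l2_le_le[OF C(2)[OF that]]) (use mult_left_mono[OF assms(2)[OF that] C(1)] in \<open>simp add: mult.assoc\<close>)
  qed (use C assms in simp)
qed

lemma bnd1_le:
  assumes "bnd1 Q a s" "!!q k. q \<in> Q ==> norm (b q k) <= norm (a q k)" shows "bnd1 Q b s"
  using bnd1_dom[OF assms(1), of b "%_. 1"] assms(2) by simp

lemma bnd2_le:
  assumes "bnd2 Q a s" "!!q k. q \<in> Q ==> norm (b q k) <= norm (a q k)" shows "bnd2 Q b s"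
  using bnd2_dom[OF assms(1), of b "%_. 1"] assms(2) by simp

lemma bnd1_imp_bnd2: "bnd1 Q a s ==> bnd2 Q a s"
  unfolding bnd1_def bnd2_def using l1_le_imp_l2_le by blast

lemma bnd1_conv:
  assumes "bnd1 Q a s" "bnd1 Q b t" shows "bnd1 Q (%q. conv (a q) (b q)) (%q. s q * t q)"
proof -
  obtain C where C: "C >= 0" "!!q. q \<in> Q ==> l1_le (a q) (C * s q)" using assms(1) by (rule bnd1E) (rule that)
  obtain D where D: "D >= 0" "!!q. q \<in> Q ==> l1_le (b q) (D * t q)" using assms(2) by (rule bnd1E) (rule that)
  show ?thesis
  proof (rule bnd1I)
    show "l1_le (conv (a q) (b q)) (C * D * (s q * t q))" if "q \<in> Q" for q
      using conv_l1_le[OF C(2)[OF that] D(2)[OF that]] by (simp add: ac_simps)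
  qed (use C D in simp)
qed

lemma bnd2_conv:
  assumes "bnd1 Q a s" "bnd2 Q b t" shows "bnd2 Q (%q. conv (a q) (b q)) (%q. s q * t q)"
proof -
  obtain C where C: "C >= 0" "!!q. q \<in> Q ==> l1_le (a q) (C * s q)" using assms(1) by (rule bnd1E) (rule that)
  obtain D where D: "D >= 0" "!!q. q \<in> Q ==> l2_le (b q) (D * t q)" using assms(2) by (rule bnd2E) (rule that)
  show ?thesis
  proof (rule bnd2I)
    show "l2_le (conv (a q) (b q)) (C * D * (s q * t q))" if "q \<in> Q" for q
      using conv_l2_le[OF C(2)[OF that] D(2)[OF that]] by (simp add: ac_simps)
  qed (use C D in simp)
qed

text \<open>Minkowski's integral inequality, by testing the integral against itself.\<close>

lemma l2_le_integral:
  fixes x :: "real => 'i => complex"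
  assumes ab: "a <= b" and x: "!!t. t \<in> {a..b} ==> l2_le (x t) r"
    and int: "!!k. ((%t. x t k) has_integral y k) {a..b}"
  shows "l2_le y ((b - a) * r)"
  unfolding l2_le_def
proof (intro allI impI)
  fix F :: "'i set" assume F: "finite F"
  define S where "S = L2_set (%k. norm (y k)) F"
  have r: "0 <= r" using x[of a] ab l2_le_nonneg by auto
  have S: "0 <= S" by (simp add: S_def)
  have "((%t. \<Sum>k\<in>F. cnj (y k) * x t k) has_integral (\<Sum>k\<in>F. cnj (y k) * y k)) {a..b}"
    by (intro has_integral_sum F has_integral_mult_right int)
  moreover have "norm (\<Sum>k\<in>F. cnj (y k) * x t k) <= S * r" if "t \<in> {a..b}" for t
  proof -
    have "norm (\<Sum>k\<in>F. cnj (y k) * x t k) <= (\<Sum>k\<in>F. \<bar>norm (y k)\<bar> * \<bar>norm (x t k)\<bar>)"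
      by (rule order_trans[OF norm_sum]) (simp add: norm_mult)
    also have "... <= S * L2_set (%k. norm (x t k)) F" unfolding S_def by (rule L2_set_mult_ineq)
    also have "... <= S * r" by (rule mult_left_mono[OF l2_leD[OF x[OF that] F] S])
    finally show ?thesis .
  qed
  ultimately have "norm (\<Sum>k\<in>F. cnj (y k) * y k) <= S * r * (b - a)"
    using has_integral_bound_real[where S = "{}" and B = "S * r" and f = "%t. \<Sum>k\<in>F. cnj (y k) * x t k" and a = a and b = b] ab S r by (auto simp: content_real)
  moreover have "(\<Sum>k\<in>F. cnj (y k) * y k) = of_real (S\<^sup>2)"
  proof -
    have "cnj (y k) * y k = of_real ((norm (y k))\<^sup>2)" for k by (simp only: complex_norm_square mult.commute)
    then show ?thesis by (simp add: S_def L2_set_def sum_nonneg del: of_real_power)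
  qed
  ultimately have "S * S <= S * ((b - a) * r)" by (simp add: power2_eq_square ac_simps norm_mult)
  then show "L2_set (%k. norm (y k)) F <= (b - a) * r"
    using S r ab unfolding S_def[symmetric] by (cases "S = 0") auto
qed

lemma l1_le_integral:
  fixes x :: "real => 'i => complex"
  assumes ab: "a <= b" and x: "!!t. t \<in> {a..b} ==> l1_le (x t) r"
    and int: "!!k. ((%t. x t k) has_integral y k) {a..b}"
  shows "l1_le y ((b - a) * r)"
  unfolding l1_le_def
proof (intro allI impI)
  fix F :: "'i set" assume F: "finite F"
  have r: "0 <= r" using x[of a] ab l1_le_nonneg by auto
  have "((%t. \<Sum>k\<in>F. cnj (sgn (y k)) * x t k) has_integral (\<Sum>k\<in>F. cnj (sgn (y k)) * y k)) {a..b}"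
    by (intro has_integral_sum F has_integral_mult_right int)
  moreover have "norm (\<Sum>k\<in>F. cnj (sgn (y k)) * x t k) <= r" if "t \<in> {a..b}" for t
  proof -
    have "norm (\<Sum>k\<in>F. cnj (sgn (y k)) * x t k) <= (\<Sum>k\<in>F. norm (x t k))"
      by (rule order_trans[OF norm_sum sum_mono]) (simp add: norm_mult norm_sgn)
    also have "... <= r" by (rule l1_leD[OF x[OF that] F])
    finally show ?thesis .
  qed
  ultimately have "norm (\<Sum>k\<in>F. cnj (sgn (y k)) * y k) <= r * (b - a)"
    using has_integral_bound_real[where S = "{}" and B = r and f = "%t. \<Sum>k\<in>F. cnj (sgn (y k)) * x t k" and a = a and b = b] ab r by (auto simp: content_real)
  moreover have "(\<Sum>k\<in>F. cnj (sgn (y k)) * y k) = of_real (\<Sum>k\<in>F. norm (y k))"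
  proof -
    have "cnj (sgn (y k)) * y k = of_real (norm (y k))" for k
    proof (cases "y k = 0")
      case False
      have "cnj (sgn (y k)) * y k = (y k * cnj (y k)) / of_real (norm (y k))" by (simp add: sgn_div_norm scaleR_conv_of_real divide_inverse)
      also have "... = of_real (norm (y k))"
        using False by (simp add: complex_norm_square[symmetric] power2_eq_square)
      finally show ?thesis .
    qed simp
    then show ?thesis by simp
  qed
  ultimately show "(\<Sum>k\<in>F. norm (y k)) <= (b - a) * r"
    by (simp add: sum_nonneg mult.commute del: of_real_sum)
qed

text \<open>The tame product estimate: two first-order derivatives that fall on different factors are
  controlled by two derivatives on one of them, since \<open>2 xy \<le> x\<^sup>2 + y\<^sup>2\<close> for the two weights.\<close>

lemma tame_conv:
  fixes c d :: "int^'n => 'b::{real_normed_field,banach}" and a b :: "int^'n => real"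
  assumes c: "!!k. norm (c k) <= brk k * a k" and d: "!!k. norm (d k) <= brk k * b k"
    and pos: "!!k. 0 <= a k" "!!k. 0 <= b k"
    and l1: "l1_le a r1" "l1_le b s1" and l2: "l2_le (%k. (brk k)\<^sup>2 * a k) r2" "l2_le (%k. (brk k)\<^sup>2 * b k) s2"
    and cl1: "l1_le c r0"
  shows "l2_le (conv c d) (r2 * s1 + r1 * s2)"
proof -
  let ?a2 = "%k. (brk k)\<^sup>2 * a k" and ?b2 = "%k. (brk k)\<^sup>2 * b k"
  have "l2_le (conv b ?a2) (s1 * r2)" by (rule conv_l2_le[OF l1(2) l2(1)])
  then have A: "l2_le (conv ?a2 b) (r2 * s1)" by (simp add: conv_commute[of b] mult.commute)
  have B: "l2_le (conv a ?b2) (r1 * s2)" by (rule conv_l2_le[OF l1(1) l2(2)])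
  have bd: "brk k * b k <= s2" for k
  proof -
    have "brk k * b k <= (brk k)\<^sup>2 * b k"
      using brk_ge_1[of k] pos(2)[of k] by (intro mult_right_mono) (auto simp: power2_eq_square)
    also have "... <= s2" using l2_le_norm_le[OF l2(2), of k] by simp
    finally show ?thesis .
  qed
  from l2_le_add[OF A B] show ?thesis
  proof (rule l2_le_mono)
    fix k
    have s0: "l1_le (%l. norm (c l) * norm (d (k - l))) (r0 * s2)"
      using cl1 bd order_trans[OF d bd] by (intro conv_terms_l1) (auto simp: l1_le_norm)
    have "l1_le (%l. b (k - l) * ?a2 l) (s1 * r2)"
      by (rule l1_le_mult_bounded[OF l1_le_inj[OF l1(2) inj_minus_left]]) (use l2_le_norm_le[OF l2(1)] in auto)
    then have sA: "l1_le (%l. ?a2 l * b (k - l)) (s1 * r2)" by (simp add: mult.commute)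
    have sB: "l1_le (%l. a l * ?b2 (k - l)) (r1 * s2)"
      by (rule conv_terms_l1[OF l1(1)]) (use l2_le_norm_le[OF l2(2)] in auto)
    have "norm (conv c d k) <= (\<Sum>\<^sub>\<infinity>l. norm (c l * d (k - l)))"
      unfolding conv_def by (rule norm_infsum_bound) (use l1_le_abs_summable[OF s0, of UNIV] in \<open>simp add: norm_mult\<close>)
    also have "... <= (\<Sum>\<^sub>\<infinity>l. ?a2 l * b (k - l) + a l * ?b2 (k - l))"
    proof (rule infsum_mono)
      show "(%l. norm (c l * d (k - l))) summable_on UNIV"
        using l1_le_abs_summable[OF s0, of UNIV] by (simp add: norm_mult)
      show "(%l. ?a2 l * b (k - l) + a l * ?b2 (k - l)) summable_on UNIV"
        by (intro summable_on_add l1_le_summable[OF sA] l1_le_summable[OF sB])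
      fix l
      have "norm (c l * d (k - l)) <= (brk l * a l) * (brk (k - l) * b (k - l))"
        unfolding norm_mult using brk_pos pos by (intro mult_mono c d mult_nonneg_nonneg) auto
      also have "... = (brk l * brk (k - l)) * (a l * b (k - l))" by simp
      also have "... <= ((brk l)\<^sup>2 + (brk (k - l))\<^sup>2) * (a l * b (k - l))"
      proof (rule mult_right_mono)
        have "0 <= brk l * brk (k - l)" using brk_pos by (intro mult_nonneg_nonneg) auto
        then show "brk l * brk (k - l) <= (brk l)\<^sup>2 + (brk (k - l))\<^sup>2"
          using sum_squares_bound[of "brk l" "brk (k - l)"] by linarith
      qed (use pos in simp)
      finally show "norm (c l * d (k - l)) <= ?a2 l * b (k - l) + a l * ?b2 (k - l)" by (simp add: algebra_simps)
    qed
    also have "... = conv ?a2 b k + conv a ?b2 k"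
      unfolding conv_def by (rule infsum_add[OF l1_le_summable[OF sA] l1_le_summable[OF sB]])
    finally show "norm (conv c d k) <= norm (conv ?a2 b k + conv a ?b2 k)" by simp
  qed simp
qed

lemma cis_diff_le: "norm (cis x - 1) <= \<bar>x\<bar>"
proof -
  have "norm (cis x - 1) = 2 * \<bar>sin (x / 2)\<bar>" by (simp add: cis_conv_exp dist_exp_i_1)
  also have "... <= \<bar>x\<bar>" using abs_sin_x_le_abs_x[of "x / 2"] by simp
  finally show ?thesis .
qed

lemma cis_second_difference_le: "norm (cis x + cis (- x) - 2) <= x\<^sup>2"
proof -
  have "cis x + cis (- x) - 2 = of_real (2 * cos x - 2)" by (simp add: complex_eq_iff)
  then have "norm (cis x + cis (- x) - 2) = \<bar>2 * cos x - 2\<bar>" by (simp only: norm_of_real)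
  also have "... = 4 * (sin (x / 2))\<^sup>2"
    using cos_double_sin[of "x / 2"] by simp
  also have "... <= 4 * (x / 2)\<^sup>2"
    using power_mono[OF abs_sin_x_le_abs_x[of "x / 2"], of 2] by (simp add: power_divide)
  finally show ?thesis by (simp add: power_divide)
qed

lemma cis_diff_le_powr: "norm (cis x - 1) <= 2 * \<bar>x\<bar> powr (1/8)"
proof (cases "\<bar>x\<bar> <= 1")
  case True
  have "norm (cis x - 1) <= \<bar>x\<bar> powr 1" using cis_diff_le[of x] by simp
  also have "... <= \<bar>x\<bar> powr (1/8)" using True by (intro powr_mono') auto
  finally show ?thesis
    using powr_ge_zero[of "\<bar>x\<bar>" "1/8"] by linarith
next
  case False
  have "norm (cis x - 1) <= 2" using norm_triangle_ineq4[of "cis x" 1] by simp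
  also have "... <= 2 * \<bar>x\<bar> powr (1/8)" using False ge_one_powr_ge_zero[of "\<bar>x\<bar>" "1/8"] by linarith
  finally show ?thesis .
qed

section \<open>Classes of functions on the torus\<close>

locale nls_setting =
  fixes P :: "real^'n^'d" and \<alpha> :: nat and \<theta> T :: real
  assumes proj: "projection_matrix P" and alpha: "real \<alpha> > max 4 (real CARD('n) / 4)" and T: "T > 0"
begin

abbreviation (input) FC :: "(real^'n => complex) => int^'n => complex" where "FC \<equiv> fourier_coeff"

definition lam :: "int^'n => real" where "lam k = (norm (P *v rvec k))\<^sup>2"

definition cP :: real where "cP = (onorm ((*v) P))\<^sup>2"

lemma lam_nonneg: "0 <= lam k" and cP_nonneg: "0 <= cP"
  by (simp_all add: lam_def cP_def)

lemma lam_le: "lam k <= cP * brk k"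
proof -
  have "norm (P *v rvec k) <= onorm ((*v) P) * norm (rvec k)"
    by (rule onorm[OF matrix_vector_mul_bounded_linear])
  then have "lam k <= (onorm ((*v) P) * norm (rvec k))\<^sup>2" unfolding lam_def by (rule power_mono) simp
  also have "... = cP * (norm (rvec k))\<^sup>2" by (simp add: cP_def power_mult_distrib)
  also have "... <= cP * brk k" by (rule mult_left_mono[OF _ cP_nonneg]) (simp add: brk_def)
  finally show ?thesis .
qed

lemma alpha_quarter: "real \<alpha> > real CARD('n) / 4" and alpha_ge_2: "\<alpha> >= 2"
  using alpha by auto

definition bndz :: "'q set => ('q => int^'n => 'b::real_normed_vector) => ('q => real) => bool" where
  "bndz Q a s \<longleftrightarrow> bnd2 Q (%q k. zw \<alpha> k * norm (a q k)) s"

lemma bndz_brk_powr: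
  fixes a :: "'q => int^'n => 'b::real_normed_vector"
  assumes "bndz Q a s" shows "bnd1 Q (%q k. brk k powr (1/8) * norm (a q k)) s"
proof -
  obtain E where E: "E > 0" "!!(a :: int^'n => 'b) r. l2_le (%k. zw \<alpha> k * norm (a k)) r
      ==> l1_le (%k. brk k powr (1/8) * norm (a k)) (E * r)"
    by (rule zw_imp_l1[OF alpha_quarter]) (rule that)
  obtain C where C: "C >= 0" "!!q. q \<in> Q ==> l2_le (%k. zw \<alpha> k * norm (a q k)) (C * s q)"
    using assms unfolding bndz_def by (rule bnd2E) (rule that)
  show ?thesis
  proof (rule bnd1I)
    show "l1_le (%k. brk k powr (1/8) * norm (a q k)) (E * C * s q)" if "q \<in> Q" for q
      using E(2)[OF C(2)[OF that]] by (simp add: mult.assoc)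
  qed (use E C in simp)
qed

lemma bndz_imp_bnd1:
  fixes a :: "'q => int^'n => 'b::real_normed_vector"
  assumes "bndz Q a s" shows "bnd1 Q a s"
proof (rule bnd1_le[OF bndz_brk_powr[OF assms]])
  fix q :: 'q and k :: "int^'n"
  have "1 <= brk k powr (1/8)" using brk_ge_1[of k] by (intro ge_one_powr_ge_zero) auto
  then have "1 * norm (a q k) <= brk k powr (1/8) * norm (a q k)" by (rule mult_right_mono) simp
  then show "norm (a q k) <= norm (brk k powr (1/8) * norm (a q k))" by simp
qed

lemma bndz_brk_square:
  assumes "bndz Q a s" shows "bnd2 Q (%q k. (brk k)\<^sup>2 * norm (a q k)) s"
proof -
  have "bnd2 Q (%q k. (brk k)\<^sup>2 * norm (a q k)) (%q. 6 * s q)"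
  proof (rule bnd2_dom)
    show "bnd2 Q (%q k. zw \<alpha> k * norm (a q k)) s" using assms by (simp add: bndz_def)
    show "norm ((brk k)\<^sup>2 * norm (a q k)) <= 6 * norm (zw \<alpha> k * norm (a q k))" for q k
      using mult_right_mono[OF brk_square_le_zw[OF alpha_ge_2, of k], of "norm (a q k)"] zw_pos[of \<alpha> k] by (simp add: abs_mult)
  qed simp
  then show ?thesis by (rule bnd2_mono[where K = 6]) auto
qed

lemma bndz_conv:
  fixes a b :: "'q => int^'n => complex"
  assumes a: "bndz Q a s" and b: "bndz Q b t"
  shows "bndz Q (%q. conv (a q) (b q)) (%q. s q * t q)"
proof -
  obtain A where A: "A >= 0" "!!q. q \<in> Q ==> l2_le (%k. zw \<alpha> k * norm (a q k)) (A * s q)"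
    using a unfolding bndz_def by (rule bnd2E) (rule that)
  obtain B where B: "B >= 0" "!!q. q \<in> Q ==> l2_le (%k. zw \<alpha> k * norm (b q k)) (B * t q)"
    using b unfolding bndz_def by (rule bnd2E) (rule that)
  obtain A' where A': "A' >= 0" "!!q. q \<in> Q ==> l1_le (a q) (A' * s q)" using bndz_imp_bnd1[OF a] by (rule bnd1E) (rule that)
  obtain B' where B': "B' >= 0" "!!q. q \<in> Q ==> l1_le (b q) (B' * t q)" using bndz_imp_bnd1[OF b] by (rule bnd1E) (rule that)
  show ?thesis
    unfolding bndz_def
  proof (rule bnd2I)
    show "l2_le (%k. zw \<alpha> k * norm (conv (a q) (b q) k)) (4 ^ \<alpha> * (A * B' + A' * B) * (s q * t q))" if q: "q \<in> Q" for q
      using weight_conv_l2_le[OF zw_add_le zw_pos(2) _ A'(2)[OF q] A(2)[OF q] B'(2)[OF q] B(2)[OF q]]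
      by (simp add: algebra_simps)
  qed (use A B A' B' in simp)
qed

text \<open>The classes follow the norms: \<open>W1\<close> the Wiener norm with its gauge, \<open>W2\<close> the mean square with its gauge, and
  \<open>WZ\<close> boundedness in \<open>X\<^sub>\<alpha>\<close>.\<close>

definition W1 :: "'q set => ('q => real^'n => complex) => ('q => real) => bool" where
  "W1 Q g s \<longleftrightarrow> (\<forall>q\<in>Q. wiener (g q)) \<and> bnd1 Q (%q. FC (g q)) s"

definition W2 :: "'q set => ('q => real^'n => complex) => ('q => real) => bool" where
  "W2 Q g s \<longleftrightarrow> (\<forall>q\<in>Q. wiener (g q)) \<and> bnd2 Q (%q. FC (g q)) s"

definition WZ :: "'q set => ('q => real^'n => complex) => bool" where
  "WZ Q g \<longleftrightarrow> (\<forall>q\<in>Q. wiener (g q)) \<and> bndz Q (%q. FC (g q)) (%_. 1)"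

text \<open>Increments \<open>u (t + s) - u t\<close> of a solution cost two derivatives. In high dimension twice
  differentiated solutions have no absolutely convergent Fourier series, so a norm bound would be too
  weak for products of increments; a pointwise bound on the coefficients is kept instead.\<close>

definition WD :: "'q set => ('q => real^'n => complex) => ('q => real) => bool" where
  "WD Q g s \<longleftrightarrow> (\<forall>q\<in>Q. wiener (g q)) \<and>
    (\<exists>\<beta> :: 'q => int^'n => real. (\<forall>q\<in>Q. \<forall>k. 0 <= \<beta> q k \<and> norm (FC (g q) k) <= s q * (brk k * \<beta> q k)) \<and> bndz Q \<beta> (%_. 1))"

lemma W1D: "W1 Q g s ==> q \<in> Q ==> wiener (g q)" and W2D: "W2 Q g s ==> q \<in> Q ==> wiener (g q)"
  and WZD: "WZ Q g ==> q \<in> Q ==> wiener (g q)" and WDD: "WD Q g s ==> q \<in> Q ==> wiener (g q)"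
  by (simp_all add: W1_def W2_def WZ_def WD_def)

lemma W1I:
  assumes "!!q. q \<in> Q ==> wiener (g q)" "!!q. q \<in> Q ==> FC (g q) = a q" "bnd1 Q a s"
  shows "W1 Q g s"
  using assms by (simp add: W1_def bnd1_def)

lemma W2I:
  assumes "!!q. q \<in> Q ==> wiener (g q)" "!!q. q \<in> Q ==> FC (g q) = a q" "bnd2 Q a s"
  shows "W2 Q g s"
  using assms by (simp add: W2_def bnd2_def)

lemma WZI:
  assumes "!!q. q \<in> Q ==> wiener (g q)" "!!q. q \<in> Q ==> FC (g q) = a q" "bndz Q a (%_. 1)"
  shows "WZ Q g"
  using assms by (simp add: WZ_def bndz_def bnd2_def)

lemma W1_bnd: "W1 Q g s ==> bnd1 Q (%q. FC (g q)) s" and W2_bnd: "W2 Q g s ==> bnd2 Q (%q. FC (g q)) s"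
  and WZ_bnd: "WZ Q g ==> bndz Q (%q. FC (g q)) (%_. 1)"
  by (simp_all add: W1_def W2_def WZ_def)

lemma W1_add:
  assumes "W1 Q g s" "W1 Q h s" shows "W1 Q (%q y. g q y + h q y) s"
  by (rule W1I[OF wiener_add bnd1_add[OF W1_bnd W1_bnd, OF assms]]) (auto intro: W1D[OF assms(1)] W1D[OF assms(2)])

lemma W2_add:
  assumes "W2 Q g s" "W2 Q h s" shows "W2 Q (%q y. g q y + h q y) s"
  by (rule W2I[OF wiener_add bnd2_add[OF W2_bnd W2_bnd, OF assms]]) (auto intro: W2D[OF assms(1)] W2D[OF assms(2)])

lemma bndz_add:
  assumes "bndz Q a s" "bndz Q b s" shows "bndz Q (%q k. a q k + b q k) s"
  unfolding bndz_def
proof (rule bnd2_le[OF bnd2_add[OF assms[unfolded bndz_def]]])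
  fix q k
  show "norm (zw \<alpha> k * norm (a q k + b q k)) <= norm (zw \<alpha> k * norm (a q k) + zw \<alpha> k * norm (b q k))"
    using mult_left_mono[OF norm_triangle_ineq[of "a q k" "b q k"] zw_pos(2)[of \<alpha> k]] zw_pos(2)[of \<alpha> k]
    by (simp add: distrib_left[symmetric] abs_mult)
qed

lemma WZ_add:
  assumes "WZ Q g" "WZ Q h" shows "WZ Q (%q y. g q y + h q y)"
  by (rule WZI[OF wiener_add bndz_add[OF WZ_bnd WZ_bnd, OF assms]]) (auto intro: WZD[OF assms(1)] WZD[OF assms(2)])

lemma W1_cmult:
  assumes "W1 Q g s" shows "W1 Q (%q y. c q * g q y) (%q. norm (c q) * s q)"
  by (rule W1I[OF wiener_cmult bnd1_dom[OF W1_bnd[OF assms]]]) (auto simp: norm_mult intro: W1D[OF assms])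

lemma W2_cmult:
  assumes "W2 Q g s" shows "W2 Q (%q y. c q * g q y) (%q. norm (c q) * s q)"
  by (rule W2I[OF wiener_cmult bnd2_dom[OF W2_bnd[OF assms]]]) (auto simp: norm_mult intro: W2D[OF assms])

lemma W1_mono:
  assumes "W1 Q g s" "!!q. q \<in> Q ==> s q <= K * t q" "0 <= K" shows "W1 Q g t"
  using assms(1) bnd1_mono[OF W1_bnd[OF assms(1)] assms(2,3)] by (simp add: W1_def)

lemma W2_mono:
  assumes "W2 Q g s" "!!q. q \<in> Q ==> s q <= K * t q" "0 <= K" shows "W2 Q g t"
  using assms(1) bnd2_mono[OF W2_bnd[OF assms(1)] assms(2,3)] by (simp add: W2_def)

lemma W1_const_cmult: 
  assumes "W1 Q g s" shows "W1 Q (%q y. c * g q y) s"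
  by (rule W1_mono[OF W1_cmult[OF assms], of "%_. c" "norm c"]) auto

lemma W2_const_cmult: 
  assumes "W2 Q g s" shows "W2 Q (%q y. c * g q y) s"
  by (rule W2_mono[OF W2_cmult[OF assms], of "%_. c" "norm c"]) auto

lemma WZ_const_cmult:
  assumes "WZ Q g" shows "WZ Q (%q y. c * g q y)"
proof -
  have "bnd2 Q (%q k. zw \<alpha> k * norm (c * FC (g q) k)) (%q. norm c * 1)"
    by (rule bnd2_dom[OF WZ_bnd[OF assms, unfolded bndz_def]]) (auto simp: norm_mult abs_mult)
  then have "bndz Q (%q k. c * FC (g q) k) (%_. 1)"
    unfolding bndz_def by (rule bnd2_mono[where K = "norm c"]) auto
  then show ?thesis
    by (rule WZI[OF wiener_cmult, rotated 2]) (auto intro: WZD[OF assms])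
qed

lemma W1_mult:
  assumes "W1 Q g s" "W1 Q h t" shows "W1 Q (%q y. g q y * h q y) (%q. s q * t q)"
  by (rule W1I[OF wiener_mult bnd1_conv[OF W1_bnd W1_bnd, OF assms]]) (auto intro: W1D[OF assms(1)] W1D[OF assms(2)])

lemma W2_mult:
  assumes "W1 Q g s" "W2 Q h t" shows "W2 Q (%q y. g q y * h q y) (%q. s q * t q)"
  by (rule W2I[OF wiener_mult bnd2_conv[OF W1_bnd W2_bnd, OF assms]]) (auto intro: W1D[OF assms(1)] W2D[OF assms(2)])

lemma WZ_mult:
  assumes "WZ Q g" "WZ Q h" shows "WZ Q (%q y. g q y * h q y)"
proof -
  have "bndz Q (%q. conv (FC (g q)) (FC (h q))) (%_. 1)"
    using bndz_conv[OF WZ_bnd WZ_bnd, OF assms] by simp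
  then show ?thesis by (rule WZI[OF wiener_mult, rotated 4]) (auto intro: WZD[OF assms(1)] WZD[OF assms(2)])
qed

lemma inj_uminus_vec: "inj (uminus :: int^'n => int^'n)"
  by (rule injI) simp

lemma W1_cnj:
  assumes "W1 Q g s" shows "W1 Q (%q y. cnj (g q y)) s"
proof -
  obtain C where C: "C >= 0" "!!q. q \<in> Q ==> l1_le (FC (g q)) (C * s q)" using W1_bnd[OF assms] by (rule bnd1E) (rule that)
  have "bnd1 Q (%q k. cnj (FC (g q) (- k))) s"
  proof (rule bnd1I[OF C(1)])
    show "l1_le (%k. cnj (FC (g q) (- k))) (C * s q)" if "q \<in> Q" for q
      using l1_le_inj[OF C(2)[OF that] inj_uminus_vec] by (rule l1_le_mono) auto
  qed
  then show ?thesis by (rule W1I[OF wiener_cnj, rotated 2]) (auto intro: W1D[OF assms])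
qed

lemma W2_cnj:
  assumes "W2 Q g s" shows "W2 Q (%q y. cnj (g q y)) s"
proof -
  obtain C where C: "C >= 0" "!!q. q \<in> Q ==> l2_le (FC (g q)) (C * s q)" using W2_bnd[OF assms] by (rule bnd2E) (rule that)
  have "bnd2 Q (%q k. cnj (FC (g q) (- k))) s"
  proof (rule bnd2I[OF C(1)])
    show "l2_le (%k. cnj (FC (g q) (- k))) (C * s q)" if "q \<in> Q" for q
      using l2_le_inj[OF C(2)[OF that] inj_uminus_vec] by (rule l2_le_mono) auto
  qed
  then show ?thesis by (rule W2I[OF wiener_cnj, rotated 2]) (auto intro: W2D[OF assms])
qed

lemma bndz_reflect:
  fixes a :: "'q => int^'n => 'b::real_normed_vector"
  assumes "bndz Q a s" shows "bndz Q (%q k. a q (- k)) s"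
proof -
  obtain C where C: "C >= 0" "!!q. q \<in> Q ==> l2_le (%k. zw \<alpha> k * norm (a q k)) (C * s q)"
    using assms unfolding bndz_def by (rule bnd2E) (rule that)
  show ?thesis
    unfolding bndz_def
  proof (rule bnd2I[OF C(1)])
    show "l2_le (%k. zw \<alpha> k * norm (a q (- k))) (C * s q)" if "q \<in> Q" for q
      using l2_le_inj[OF C(2)[OF that] inj_uminus_vec] by (simp add: zw_minus)
  qed
qed

lemma WZ_cnj:
  assumes "WZ Q g" shows "WZ Q (%q y. cnj (g q y))"
proof -
  have "bndz Q (%q k. FC (g q) (- k)) (%_. 1)" by (rule bndz_reflect[OF WZ_bnd[OF assms]])
  then have "bndz Q (%q k. cnj (FC (g q) (- k))) (%_. 1)" by (simp add: bndz_def)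
  then show ?thesis by (rule WZI[OF wiener_cnj, rotated 2]) (auto intro: WZD[OF assms])
qed

lemma WDE:
  assumes "WD Q g s"
  obtains \<beta> where "!!q k. q \<in> Q ==> 0 <= \<beta> q k"
    "!!q k. q \<in> Q ==> norm (FC (g q) k) <= s q * (brk k * \<beta> q k)" "bndz Q \<beta> (%_. 1)"
  using assms unfolding WD_def by auto

lemma WDI:
  fixes \<beta> :: "'q => int^'n => real"
  assumes "!!q. q \<in> Q ==> wiener (g q)" "!!q k. q \<in> Q ==> 0 <= \<beta> q k"
    "!!q k. q \<in> Q ==> norm (FC (g q) k) <= s q * (brk k * \<beta> q k)" "bndz Q \<beta> (%_. 1)"
  shows "WD Q g s"
  unfolding WD_def using assms by (intro conjI exI[where x = \<beta>]) auto

lemma WD_cnj: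
  assumes "WD Q g s" shows "WD Q (%q y. cnj (g q y)) s"
proof -
  obtain \<beta> where b: "!!q k. q \<in> Q ==> 0 <= \<beta> q k"
    "!!q k. q \<in> Q ==> norm (FC (g q) k) <= s q * (brk k * \<beta> q k)" "bndz Q \<beta> (%_. 1)"
    using assms by (rule WDE) (rule that)
  show ?thesis
  proof (rule WDI)
    fix q k assume q: "q \<in> Q"
    note w = WDD[OF assms q]
    show "wiener (%y. cnj (g q y))" by (rule wiener_cnj(1)[OF w])
    show "0 <= \<beta> q (- k)" by (rule b(1)[OF q])
    show "norm (FC (%y. cnj (g q y)) k) <= s q * (brk k * \<beta> q (- k))"
      using b(2)[OF q, of "- k"] by (simp add: wiener_cnj(2)[OF w] brk_minus)
  qed (rule bndz_reflect[OF b(3)])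
qed

lemma WZ_W1: "WZ Q g ==> W1 Q g (%_. 1)"
  by (simp add: WZ_def W1_def bndz_imp_bnd1)

lemma W1_W2: "W1 Q g s ==> W2 Q g s"
  by (simp add: W1_def W2_def bnd1_imp_bnd2)

lemma W2_mult1: "W1 Q g (%_. 1) ==> W2 Q h t ==> W2 Q (%q y. g q y * h q y) t"
  using W2_mult[of Q g "%_. 1" h t] by simp

lemma W1_mult1: "W1 Q g (%_. 1) ==> W1 Q h t ==> W1 Q (%q y. g q y * h q y) t"
  using W1_mult[of Q g "%_. 1" h t] by simp

lemma WD_brk:
  assumes "WD Q g s" "!!q. q \<in> Q ==> 0 <= s q"
  shows "bnd2 Q (%q k. brk k * norm (FC (g q) k)) s"
proof -
  obtain \<beta> where b: "!!q k. q \<in> Q ==> 0 <= \<beta> q k"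
    "!!q k. q \<in> Q ==> norm (FC (g q) k) <= s q * (brk k * \<beta> q k)" "bndz Q \<beta> (%_. 1)"
    using assms(1) by (rule WDE) (rule that)
  have "bnd2 Q (%q k. brk k * norm (FC (g q) k)) (%q. s q * 1)"
  proof (rule bnd2_dom[OF bndz_brk_square[OF b(3)] _ assms(2)])
    fix q k assume q: "q \<in> Q"
    have "brk k * norm (FC (g q) k) <= brk k * (s q * (brk k * \<beta> q k))"
      by (rule mult_left_mono[OF b(2)[OF q] brk_pos(2)])
    then show "norm (brk k * norm (FC (g q) k)) <= s q * norm ((brk k)\<^sup>2 * norm (\<beta> q k))"
      using b(1)[OF q, of k] brk_pos[of k] by (simp add: abs_mult power2_eq_square ac_simps)
  qed
  then show ?thesis by simp
qed

lemma WD_W2: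
  assumes "WD Q g s" "!!q. q \<in> Q ==> 0 <= s q" shows "W2 Q g s"
proof -
  have "bnd2 Q (%q. FC (g q)) s"
  proof (rule bnd2_le[OF WD_brk[OF assms]])
    fix q k
    show "norm (FC (g q) k) <= norm (brk k * norm (FC (g q) k))"
      using mult_right_mono[OF brk_ge_1[of k], of "norm (FC (g q) k)"] brk_pos[of k] by (simp add: abs_mult)
  qed
  then show ?thesis using assms(1) by (simp add: W2_def WD_def)
qed

lemma WD_mult_WD:
  assumes g: "WD Q g s" and h: "WD Q h t" and s: "!!q. q \<in> Q ==> 0 <= s q" "!!q. q \<in> Q ==> 0 <= t q"
  shows "W2 Q (%q y. g q y * h q y) (%q. s q * t q)"
proof -
  obtain \<beta> where b: "!!q k. q \<in> Q ==> 0 <= \<beta> q k"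
    "!!q k. q \<in> Q ==> norm (FC (g q) k) <= s q * (brk k * \<beta> q k)" "bndz Q \<beta> (%_. 1)"
    using g by (rule WDE) (rule that)
  obtain \<gamma> where c: "!!q k. q \<in> Q ==> 0 <= \<gamma> q k"
    "!!q k. q \<in> Q ==> norm (FC (h q) k) <= t q * (brk k * \<gamma> q k)" "bndz Q \<gamma> (%_. 1)"
    using h by (rule WDE) (rule that)
  obtain A where A: "A >= 0" "!!q. q \<in> Q ==> l1_le (\<beta> q) (A * 1)" using bndz_imp_bnd1[OF b(3)] by (rule bnd1E) (rule that)
  obtain B where B: "B >= 0" "!!q. q \<in> Q ==> l1_le (\<gamma> q) (B * 1)" using bndz_imp_bnd1[OF c(3)] by (rule bnd1E) (rule that)
  obtain A2 where A2: "A2 >= 0" "!!q. q \<in> Q ==> l2_le (%k. (brk k)\<^sup>2 * norm (\<beta> q k)) (A2 * 1)" using bndz_brk_square[OF b(3)] by (rule bnd2E) (rule that)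
  obtain B2 where B2: "B2 >= 0" "!!q. q \<in> Q ==> l2_le (%k. (brk k)\<^sup>2 * norm (\<gamma> q k)) (B2 * 1)" using bndz_brk_square[OF c(3)] by (rule bnd2E) (rule that)
  have "bnd2 Q (%q. conv (FC (g q)) (FC (h q))) (%q. s q * t q)"
  proof (rule bnd2I)
    fix q assume q: "q \<in> Q"
    obtain r where r: "l1_le (FC (g q)) r" using WDD[OF g q] by (auto simp: wiener_def)
    have "l2_le (conv (FC (g q)) (FC (h q))) ((s q * A2) * (t q * B) + (s q * A) * (t q * B2))"
    proof (rule tame_conv[where a = "%k. s q * \<beta> q k" and b = "%k. t q * \<gamma> q k", OF _ _ _ _ _ _ _ _ r])
      show "norm (FC (g q) k) <= brk k * (s q * \<beta> q k)" "norm (FC (h q) k) <= brk k * (t q * \<gamma> q k)"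
        "0 <= s q * \<beta> q k" "0 <= t q * \<gamma> q k" for k
        using b(1,2)[OF q, of k] c(1,2)[OF q, of k] s[OF q] by (auto simp: ac_simps)
      show "l1_le (%k. s q * \<beta> q k) (s q * A)" "l1_le (%k. t q * \<gamma> q k) (t q * B)"
        using l1_le_cmult[OF A(2)[OF q], of "s q"] l1_le_cmult[OF B(2)[OF q], of "t q"] s[OF q] by auto
      show "l2_le (%k. (brk k)\<^sup>2 * (s q * \<beta> q k)) (s q * A2)" "l2_le (%k. (brk k)\<^sup>2 * (t q * \<gamma> q k)) (t q * B2)"
        using l2_le_cmult[OF A2(2)[OF q], of "s q"] l2_le_cmult[OF B2(2)[OF q], of "t q"] s[OF q] b(1)[OF q] c(1)[OF q]
        by (simp_all add: ac_simps)
    qed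
    then show "l2_le (conv (FC (g q)) (FC (h q))) ((A2 * B + A * B2) * (s q * t q))" by (simp add: algebra_simps)
  qed (use A B A2 B2 in simp)
  then show ?thesis by (rule W2I[OF wiener_mult, rotated 4]) (use WDD[OF g] WDD[OF h] in auto)
qed

text \<open>The weight of the product is shared between the factors. If it falls on \<open>h\<close>, the regular \<open>g\<close> is summable;
  if it falls on \<open>g\<close>, the tame estimate applies.\<close>

lemma WZ_mult_WD_brk:
  assumes g: "WZ Q g" and h: "WD Q h s" and s: "!!q. q \<in> Q ==> 0 <= s q"
  shows "bnd2 Q (%q k. brk k * norm (FC (%y. g q y * h q y) k)) s"
proof -
  obtain \<beta> where b: "!!q k. q \<in> Q ==> 0 <= \<beta> q k"
    "!!q k. q \<in> Q ==> norm (FC (h q) k) <= s q * (brk k * \<beta> q k)" "bndz Q \<beta> (%_. 1)"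
    using h by (rule WDE) (rule that)
  have gz: "bndz Q (%q. FC (g q)) (%_. 1)" using g by (simp add: WZ_def)
  obtain G where G: "G >= 0" "!!q. q \<in> Q ==> l1_le (FC (g q)) (G * 1)" using bndz_imp_bnd1[OF gz] by (rule bnd1E) (rule that)
  obtain G2 where G2: "G2 >= 0" "!!q. q \<in> Q ==> l2_le (%k. (brk k)\<^sup>2 * norm (FC (g q) k)) (G2 * 1)" using bndz_brk_square[OF gz] by (rule bnd2E) (rule that)
  obtain B where B: "B >= 0" "!!q. q \<in> Q ==> l1_le (\<beta> q) (B * 1)" using bndz_imp_bnd1[OF b(3)] by (rule bnd1E) (rule that)
  obtain B2 where B2: "B2 >= 0" "!!q. q \<in> Q ==> l2_le (%k. (brk k)\<^sup>2 * norm (\<beta> q k)) (B2 * 1)" using bndz_brk_square[OF b(3)] by (rule bnd2E) (rule that)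
  obtain D where D: "D >= 0" "!!q. q \<in> Q ==> l2_le (%k. brk k * norm (FC (h q) k)) (D * s q)" using WD_brk[of Q h s, OF h] s by (auto elim: bnd2E)
  show ?thesis
  proof (rule bnd2I)
    fix q assume q: "q \<in> Q"
    obtain r where r: "l1_le (FC (h q)) r" using WDD[OF h q] by (auto simp: wiener_def)
    have m2: "l2_le (conv (%k. norm (FC (g q) k)) (%k. brk k * norm (FC (h q) k))) (G * (D * s q))"
      by (rule conv_l2_le[OF _ D(2)[OF q]]) (use G(2)[OF q] in \<open>simp add: l1_le_norm\<close>)
    have wg: "wiener (g q)" "wiener (h q)" by (rule WZD[OF g q], rule WDD[OF h q])
    have "l2_le (conv (%k. norm (FC (h q) k)) (%k. brk k * norm (FC (g q) k))) ((s q * B2) * G + (s q * B) * G2)"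
    proof (rule tame_conv[where a = "%k. s q * \<beta> q k" and b = "%k. norm (FC (g q) k)"])
      show "norm (norm (FC (h q) k)) <= brk k * (s q * \<beta> q k)" "norm (brk k * norm (FC (g q) k)) <= brk k * norm (FC (g q) k)"
        "0 <= s q * \<beta> q k" "0 <= norm (FC (g q) k)" for k
        using b(1,2)[OF q, of k] s[OF q] brk_pos[of k] by (auto simp: ac_simps abs_mult)
      show "l1_le (%k. s q * \<beta> q k) (s q * B)" "l1_le (%k. norm (FC (g q) k)) G"
        using l1_le_cmult[OF B(2)[OF q], of "s q"] G(2)[OF q] s[OF q] by (auto simp: l1_le_norm)
      show "l2_le (%k. (brk k)\<^sup>2 * (s q * \<beta> q k)) (s q * B2)" "l2_le (%k. (brk k)\<^sup>2 * norm (FC (g q) k)) G2"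
        using l2_le_cmult[OF B2(2)[OF q], of "s q"] G2(2)[OF q] s[OF q] b(1)[OF q] by (simp_all add: ac_simps)
      show "l1_le (%k. norm (FC (h q) k)) r" using r by (simp add: l1_le_norm)
    qed
    then have m1': "l2_le (conv (%k. brk k * norm (FC (g q) k)) (%k. norm (FC (h q) k))) ((s q * B2) * G + (s q * B) * G2)"
      by (simp add: conv_commute)
    have key: "l2_le (%k. 2 * (conv (%k. brk k * norm (FC (g q) k)) (%k. norm (FC (h q) k)) k
        + conv (%k. norm (FC (g q) k)) (%k. brk k * norm (FC (h q) k)) k))
        (norm (2::real) * (((s q * B2) * G + (s q * B) * G2) + G * (D * s q)))"
      by (intro l2_le_cmult l2_le_add m1' m2)
    have "l2_le (%k. brk k * norm (FC (%y. g q y * h q y) k)) (norm (2::real) * (((s q * B2) * G + (s q * B) * G2) + G * (D * s q)))"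
    proof (rule l2_le_mono[OF key])
      fix k
      have "norm (FC (%y. g q y * h q y) k) <= conv (%k. norm (FC (g q) k)) (%k. norm (FC (h q) k)) k"
        unfolding wiener_mult(2)[OF wg]
        by (rule conv_le[where r = G and s = r]) (use G(2)[OF q] l1_le_norm_le[OF r] in \<open>auto simp: l1_le_norm\<close>)
      then have "brk k * norm (FC (%y. g q y * h q y) k) <= brk k * conv (%k. norm (FC (g q) k)) (%k. norm (FC (h q) k)) k"
        by (rule mult_left_mono) (simp add: brk_pos)
      also have "... <= 2 * (conv (%k. brk k * norm (FC (g q) k)) (%k. norm (FC (h q) k)) k
          + conv (%k. norm (FC (g q) k)) (%k. brk k * norm (FC (h q) k)) k)"
      proof (rule weight_conv_le[OF brk_add_le])
        show "l1_le (%k. norm (FC (g q) k)) G" "l1_le (%k. norm (FC (h q) k)) r"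
          using G(2)[OF q] r by (simp_all add: l1_le_norm)
        fix k
        have "brk k * norm (FC (g q) k) <= (brk k)\<^sup>2 * norm (FC (g q) k)"
          using brk_ge_1[of k] by (intro mult_right_mono) (auto simp: power2_eq_square)
        then show "\<bar>brk k * norm (FC (g q) k)\<bar> <= max G2 (D * s q)"
          using l2_le_norm_le[OF G2(2)[OF q], of k] brk_pos[of k] by (simp add: abs_mult)
        show "\<bar>brk k * norm (FC (h q) k)\<bar> <= max G2 (D * s q)"
          using l2_le_norm_le[OF D(2)[OF q], of k] by simp
      qed auto
      finally show "norm (brk k * norm (FC (%y. g q y * h q y) k)) <= norm (2 * (conv (%k. brk k * norm (FC (g q) k)) (%k. norm (FC (h q) k)) k
          + conv (%k. norm (FC (g q) k)) (%k. brk k * norm (FC (h q) k)) k))"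
        using brk_pos(2)[of k] by simp
    qed simp
    then show "l2_le (%k. brk k * norm (FC (%y. g q y * h q y) k)) (2 * (B2 * G + B * G2 + G * D) * s q)"
      by (simp add: algebra_simps)
  qed (use G G2 B B2 D in simp)
qed

end

section \<open>Multipliers and the nonlinearity\<close>

lemma has_integral_between:
  fixes F w :: "real => complex"
  assumes "!!t. t \<in> {0..T} ==> (w has_integral (F t - F 0)) {0..t}" and ab: "0 <= a" "a <= b" "b <= T"
  shows "(w has_integral (F b - F a)) {a..b}"
proof -
  have b: "(w has_integral (F b - F 0)) {0..b}" and a: "(w has_integral (F a - F 0)) {0..a}"
    using assms by auto
  have "w integrable_on {a..b}"
    by (rule integrable_subinterval_real[of w 0 b]) (use b ab in auto)
  then have i: "(w has_integral integral {a..b} w) {a..b}" by (rule integrable_integral)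
  have "(w has_integral (F a - F 0 + integral {a..b} w)) {0..b}"
    by (rule has_integral_combine[OF ab(1,2) a i])
  then have "F a - F 0 + integral {a..b} w = F b - F 0" using b by (rule has_integral_unique)
  then have "F b - F a = integral {a..b} w" by (simp add: algebra_simps)
  then show ?thesis using i by simp
qed

lemma has_integral_shift_from:
  fixes w :: "real => complex"
  assumes "(w has_integral I) {m..m + s}" shows "((%r. w (m + r)) has_integral I) {0..s}"
  using assms has_integral_shift_Icc_real[of w m I 0 s] by (simp add: o_def add.commute)

lemma has_integral_reflect_from:
  fixes w :: "real => complex"
  assumes "(w has_integral I) {m - s..m}" shows "((%r. w (m - r)) has_integral I) {0..s}"
proof -
  have "((%r. w (m + r)) has_integral I) {- s..0}"
    using assms has_integral_shift_Icc_real[of w m I "- s" 0] by (simp add: o_def add.commute)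
  then show ?thesis using has_integral_reflect_real[of "%r. w (m - r)" I s 0] by simp
qed

lemma has_integral_fold:
  fixes w :: "real => complex"
  assumes "(w has_integral I) {m - s..m + s}" and s: "0 <= s"
  shows "((%r. w (m + r) + w (m - r)) has_integral I) {0..s}"
proof -
  have iw: "w integrable_on {m - s..m + s}" using assms(1) by auto
  have i1: "w integrable_on {m - s..m}" and i2: "w integrable_on {m..m + s}"
    by (rule integrable_subinterval_real[OF iw], use s in simp)+
  have "(w has_integral (integral {m - s..m} w + integral {m..m + s} w)) {m - s..m + s}"
    by (rule has_integral_combine[where c = m]) (use s i1 i2 integrable_integral in auto)
  then have I: "I = integral {m..m + s} w + integral {m - s..m} w"
    using has_integral_unique[OF assms(1)] by (simp add: add.commute)
  show ?thesis
    unfolding I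
    by (intro has_integral_add has_integral_shift_from has_integral_reflect_from integrable_integral i1 i2)
qed

context nls_setting begin

lemma W1_diff:
  assumes "W1 Q g s" "W1 Q h s" shows "W1 Q (%q y. g q y - h q y) s"
  using W1_add[OF assms(1) W1_const_cmult[OF assms(2), of "-1"]] by simp

lemma W2_diff:
  assumes "W2 Q g s" "W2 Q h s" shows "W2 Q (%q y. g q y - h q y) s"
  using W2_add[OF assms(1) W2_const_cmult[OF assms(2), of "-1"]] by simp

lemma WZ_reindex: "WZ R g ==> (!!q. q \<in> Q ==> h q \<in> R) ==> WZ Q (%q. g (h q))"
  unfolding WZ_def bndz_def bnd2_def by auto

lemma WZ_brk: assumes "WZ Q g" shows "bnd2 Q (%q k. brk k * norm (FC (g q) k)) (%_. 1)"
proof (rule bnd2_le[OF bndz_brk_square[OF WZ_bnd[OF assms]]])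
  fix q and k :: "int^'n"
  have "brk k * norm (FC (g q) k) <= (brk k)\<^sup>2 * norm (FC (g q) k)"
    using brk_ge_1[of k] by (intro mult_right_mono) (auto simp: power2_eq_square)
  then show "norm (brk k * norm (FC (g q) k)) <= norm ((brk k)\<^sup>2 * norm (FC (g q) k))"
    using brk_pos(2)[of k] by (simp add: abs_mult)
qed

lemma brk_add:
  assumes w: "!!q. q \<in> Q ==> wiener (g q)" "!!q. q \<in> Q ==> wiener (h q)"
    and b: "bnd2 Q (%q k. brk k * norm (FC (g q) k)) s" "bnd2 Q (%q k. brk k * norm (FC (h q) k)) s"
  shows "bnd2 Q (%q k. brk k * norm (FC (%y. g q y + h q y) k)) s"
proof -
  have eq: "FC (%y. g q y + h q y) k = FC (g q) k + FC (h q) k" if "q \<in> Q" for q k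
    using wiener_add(2)[OF w(1)[OF that] w(2)[OF that]] by simp
  have "bnd2 Q (%q k. 1 * (brk k * norm (FC (g q) k) + brk k * norm (FC (h q) k))) (%q. 1 * s q)"
    by (rule bnd2_dom[OF bnd2_add[OF b]]) auto
  then have "bnd2 Q (%q k. brk k * norm (FC (%y. g q y + h q y) k)) (%q. 1 * (1 * s q))"
  proof (rule bnd2_dom)
    fix q and k :: "int^'n" assume q: "q \<in> Q"
    have "brk k * norm (FC (g q) k + FC (h q) k) <= brk k * (norm (FC (g q) k) + norm (FC (h q) k))"
      by (intro mult_left_mono norm_triangle_ineq brk_pos)
    then show "norm (brk k * norm (FC (%y. g q y + h q y) k))
        <= 1 * norm (1 * (brk k * norm (FC (g q) k) + brk k * norm (FC (h q) k)))"
      using brk_pos(2)[of k] by (simp add: eq[OF q] distrib_left)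
  qed simp
  then show ?thesis by simp
qed

definition flow :: "real => (real^'n => complex) => real^'n => complex" where
  "flow t U = trig_series (%k. cis (- t * lam k) * FC U k)"

lemma flow:
  assumes "wiener U"
  shows wiener_flow: "wiener (flow t U)" and FC_flow: "FC (flow t U) = (%k. cis (- t * lam k) * FC U k)"
proof -
  obtain r where r: "l1_le (FC U) r" using assms by (auto simp: wiener_def)
  have "l1_le (%k. cis (- t * lam k) * FC U k) r" by (rule l1_le_mono[OF r]) (simp_all add: norm_mult)
  from wiener_trig_series[OF this]
  show "wiener (flow t U)" "FC (flow t U) = (%k. cis (- t * lam k) * FC U k)" by (simp_all add: flow_def)
qed

lemma WZ_flow:
  assumes "WZ Q g" shows "WZ Q (%q. flow (t q) (g q))"
proof -
  have "bndz Q (%q k. cis (- t q * lam k) * FC (g q) k) (%_. 1)"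
    using WZ_bnd[OF assms] by (simp add: bndz_def norm_mult)
  then show ?thesis by (rule WZI[OF flow, rotated 2]) (auto intro: WZD[OF assms])
qed

lemma W1_flow:
  assumes "W1 Q g s" shows "W1 Q (%q. flow (t q) (g q)) s"
proof -
  have "bnd1 Q (%q k. cis (- t q * lam k) * FC (g q) k) s"
    by (rule bnd1_le[OF W1_bnd[OF assms]]) (simp add: norm_mult)
  then show ?thesis by (rule W1I[OF flow, rotated 2]) (auto intro: W1D[OF assms])
qed

lemma FC_flow_diff:
  assumes "wiener U"
  shows "FC (%y. flow t U y - U y) = (%k. (cis (- t * lam k) - 1) * FC U k)"
  using wiener_diff(2)[OF wiener_flow[OF assms] assms, of t] by (simp add: FC_flow[OF assms] algebra_simps)

lemma flow_diff_brk:
  assumes w: "!!q. q \<in> Q ==> wiener (g q)" and b: "bnd2 Q (%q k. brk k * norm (FC (g q) k)) s"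
  shows "W2 Q (%q y. flow (t q) (g q) y - g q y) (%q. \<bar>t q\<bar> * s q)"
proof (rule W2I)
  show "wiener (%y. flow (t q) (g q) y - g q y)" "FC (%y. flow (t q) (g q) y - g q y) = (%k. (cis (- t q * lam k) - 1) * FC (g q) k)"
    if "q \<in> Q" for q
    using wiener_diff(1)[OF wiener_flow[OF w[OF that]] w[OF that]] FC_flow_diff[OF w[OF that]] by auto
  have "bnd2 Q (%q k. (cis (- t q * lam k) - 1) * FC (g q) k) (%q. (\<bar>t q\<bar> * cP) * s q)"
  proof (rule bnd2_dom[OF b])
    fix q and k :: "int^'n" assume "q \<in> Q"
    have "norm (cis (- t q * lam k) - 1) <= \<bar>t q\<bar> * lam k"
      using cis_diff_le[of "- t q * lam k"] lam_nonneg[of k] by (simp add: abs_mult)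
    also have "... <= \<bar>t q\<bar> * (cP * brk k)" by (rule mult_left_mono[OF lam_le]) simp
    finally have "norm (cis (- t q * lam k) - 1) * norm (FC (g q) k) <= \<bar>t q\<bar> * (cP * brk k) * norm (FC (g q) k)"
      by (rule mult_right_mono) simp
    then show "norm ((cis (- t q * lam k) - 1) * FC (g q) k) <= (\<bar>t q\<bar> * cP) * norm (brk k * norm (FC (g q) k))"
      using brk_pos(2)[of k] by (simp add: norm_mult abs_mult ac_simps)
  qed (use cP_nonneg in simp)
  then show "bnd2 Q (%q k. (cis (- t q * lam k) - 1) * FC (g q) k) (%q. \<bar>t q\<bar> * s q)"
    by (rule bnd2_mono[where K = cP]) (use cP_nonneg in auto)
qed

lemma flow_diff_W2:
  assumes "WZ Q g" shows "W2 Q (%q y. flow (t q) (g q) y - g q y) (%q. \<bar>t q\<bar>)"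
  using flow_diff_brk[OF WZD[OF assms] WZ_brk[OF assms], where t = t] by simp

text \<open>In the Wiener algebra only the spare power \<open>1/8\<close> of \<open>brk\<close> is available, whence Hoelder continuity in time
  with this exponent.\<close>

lemma flow_diff_W1:
  assumes "WZ Q g"
  shows "W1 Q (%q y. flow (t q) (g q) y - g q y) (%q. \<bar>t q\<bar> powr (1/8))"
proof (rule W1I)
  note w = WZD[OF assms]
  show "wiener (%y. flow (t q) (g q) y - g q y)" "FC (%y. flow (t q) (g q) y - g q y) = (%k. (cis (- t q * lam k) - 1) * FC (g q) k)"
    if "q \<in> Q" for q
    using wiener_diff(1)[OF wiener_flow[OF w[OF that]] w[OF that]] FC_flow_diff[OF w[OF that]] by auto
  have "bnd1 Q (%q k. (cis (- t q * lam k) - 1) * FC (g q) k) (%q. (2 * \<bar>t q\<bar> powr (1/8) * cP powr (1/8)) * 1)"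
  proof (rule bnd1_dom[OF bndz_brk_powr[OF WZ_bnd[OF assms]]])
    fix q and k :: "int^'n" assume "q \<in> Q"
    have "norm (cis (- t q * lam k) - 1) <= 2 * (\<bar>t q\<bar> * lam k) powr (1/8)"
      using cis_diff_le_powr[of "- t q * lam k"] lam_nonneg[of k] by (simp add: abs_mult)
    also have "... <= 2 * (\<bar>t q\<bar> * (cP * brk k)) powr (1/8)"
      using lam_nonneg[of k] by (intro mult_left_mono powr_mono2 lam_le) auto
    also have "... = 2 * \<bar>t q\<bar> powr (1/8) * cP powr (1/8) * brk k powr (1/8)"
      using cP_nonneg brk_pos[of k] by (simp add: powr_mult)
    finally have "norm (cis (- t q * lam k) - 1) * norm (FC (g q) k)
        <= 2 * \<bar>t q\<bar> powr (1/8) * cP powr (1/8) * brk k powr (1/8) * norm (FC (g q) k)"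
      by (rule mult_right_mono) simp
    then show "norm ((cis (- t q * lam k) - 1) * FC (g q) k)
        <= (2 * \<bar>t q\<bar> powr (1/8) * cP powr (1/8)) * norm (brk k powr (1/8) * norm (FC (g q) k))"
      by (simp add: norm_mult abs_mult ac_simps)
  qed simp
  then show "bnd1 Q (%q k. (cis (- t q * lam k) - 1) * FC (g q) k) (%q. \<bar>t q\<bar> powr (1/8))"
    by (rule bnd1_mono[where K = "2 * cP powr (1/8)"]) (auto simp: ac_simps)
qed

lemma flow_second_difference:
  assumes "WZ Q g"
  shows "W2 Q (%q y. (flow (t q) (g q) y - g q y) + (flow (- t q) (g q) y - g q y)) (%q. (t q)\<^sup>2)"
proof (rule W2I)
  note w = WZD[OF assms]
  let ?a = "%q k. (cis (t q * lam k) + cis (- (t q * lam k)) - 2) * FC (g q) k"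
  show "wiener (%y. (flow (t q) (g q) y - g q y) + (flow (- t q) (g q) y - g q y))"
    "FC (%y. (flow (t q) (g q) y - g q y) + (flow (- t q) (g q) y - g q y)) = ?a q"
    if "q \<in> Q" for q
  proof -
    note wd = wiener_diff(1)[OF wiener_flow[OF w[OF that]] w[OF that]]
    show "wiener (%y. (flow (t q) (g q) y - g q y) + (flow (- t q) (g q) y - g q y))"
      by (intro wiener_add wd)
    show "FC (%y. (flow (t q) (g q) y - g q y) + (flow (- t q) (g q) y - g q y)) = ?a q"
      unfolding wiener_add(2)[OF wd wd] FC_flow_diff[OF w[OF that]] by (simp add: fun_eq_iff algebra_simps)
  qed
  have "bnd2 Q ?a (%q. ((t q)\<^sup>2 * cP\<^sup>2) * 1)"
  proof (rule bnd2_dom[OF bndz_brk_square[OF WZ_bnd[OF assms]]])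
    fix q and k :: "int^'n" assume "q \<in> Q"
    have "norm (cis (t q * lam k) + cis (- (t q * lam k)) - 2) <= (t q)\<^sup>2 * (lam k)\<^sup>2"
      using cis_second_difference_le[of "t q * lam k"] by (simp add: power_mult_distrib)
    also have "... <= (t q)\<^sup>2 * (cP * brk k)\<^sup>2"
      using lam_nonneg[of k] by (intro mult_left_mono power_mono lam_le) auto
    finally have "norm (cis (t q * lam k) + cis (- (t q * lam k)) - 2) * norm (FC (g q) k) <= (t q)\<^sup>2 * (cP * brk k)\<^sup>2 * norm (FC (g q) k)"
      by (rule mult_right_mono) simp
    then show "norm (?a q k) <= ((t q)\<^sup>2 * cP\<^sup>2) * norm ((brk k)\<^sup>2 * norm (FC (g q) k))"
      by (simp add: norm_mult abs_mult power_mult_distrib ac_simps)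
  qed simp
  then show "bnd2 Q ?a (%q. (t q)\<^sup>2)" by (rule bnd2_mono[where K = "cP\<^sup>2"]) auto
qed

definition pot :: "(real^'n => complex) => (real^'n => complex) => real^'n => complex" where
  "pot v w y = v y + of_real \<theta> * (w y * cnj (w y))"

definition nl :: "(real^'n => complex) => (real^'n => complex) => real^'n => complex" where
  "nl v w y = pot v w y * w y"

lemma WZ_pot: "WZ Q v ==> WZ Q w ==> WZ Q (%q. pot (v q) (w q))"
  unfolding pot_def[abs_def] by (intro WZ_add WZ_const_cmult WZ_mult WZ_cnj)

lemma WZ_nl: "WZ Q v ==> WZ Q w ==> WZ Q (%q. nl (v q) (w q))"
  unfolding nl_def[abs_def] by (intro WZ_mult WZ_pot)

lemma W1_pot: "W1 Q v (%_. 1) ==> W1 Q w (%_. 1) ==> W1 Q (%q. pot (v q) (w q)) (%_. 1)"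
  unfolding pot_def[abs_def] by (intro W1_add W1_const_cmult W1_mult1 W1_cnj)

lemma wiener_pot: "wiener v ==> wiener w ==> wiener (pot v w)"
  unfolding pot_def[abs_def] by (intro wiener_add wiener_cmult wiener_mult wiener_cnj)

lemma wiener_nl: "wiener v ==> wiener w ==> wiener (nl v w)"
  unfolding nl_def[abs_def] by (intro wiener_mult wiener_pot)

lemma pot_diff:
  "pot v w' y - pot v w y = of_real \<theta> * (w' y * cnj (w' y - w y)) + of_real \<theta> * (cnj (w y) * (w' y - w y))"
  by (simp add: pot_def algebra_simps)

lemma nl_diff:
  "nl v w' y - nl v w y = (v y + of_real \<theta> * (w' y * cnj (w' y) + w y * cnj (w y))) * (w' y - w y)
    + of_real \<theta> * (w y * w' y) * cnj (w' y - w y)"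
  by (simp add: nl_def pot_def algebra_simps)

lemma nl_W1:
  assumes "W1 Q v (%_. 1)" "W1 Q w (%_. 1)" "W1 Q w' (%_. 1)" "W1 Q (%q y. w' q y - w q y) s"
  shows "W1 Q (%q y. nl (v q) (w' q) y - nl (v q) (w q) y) s"
  unfolding nl_diff by (intro W1_add W1_mult1 W1_const_cmult W1_cnj assms)

lemma nl_W2:
  assumes "W1 Q v (%_. 1)" "W1 Q w (%_. 1)" "W1 Q w' (%_. 1)" "W2 Q (%q y. w' q y - w q y) s"
  shows "W2 Q (%q y. nl (v q) (w' q) y - nl (v q) (w q) y) s"
  unfolding nl_diff by (intro W2_add W2_mult1 W1_add W1_mult1 W1_const_cmult W1_cnj W2_cnj assms)

text \<open>The increment is linear in \<open>w' - w\<close> and its conjugate with regular coefficients.\<close>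

lemma nl_brk:
  assumes "WZ Q v" "WZ Q w" "WZ Q w'" "WD Q (%q y. w' q y - w q y) s" "!!q. q \<in> Q ==> 0 <= s q"
  shows "bnd2 Q (%q k. brk k * norm (FC (%y. nl (v q) (w' q) y - nl (v q) (w q) y) k)) s"
proof -
  have z: "WZ Q (%q y. v q y + of_real \<theta> * (w' q y * cnj (w' q y) + w q y * cnj (w q y)))"
    "WZ Q (%q y. of_real \<theta> * (w q y * w' q y))"
    by (intro WZ_add WZ_mult WZ_const_cmult WZ_cnj assms)+
  show ?thesis
    unfolding nl_diff
    by (rule brk_add[OF wiener_mult(1) wiener_mult(1) WZ_mult_WD_brk[OF z(1) assms(4,5)] WZ_mult_WD_brk[OF z(2) WD_cnj[OF assms(4)] assms(5)]])
      (use WZD[OF z(1)] WZD[OF z(2)] WDD[OF assms(4)] WDD[OF WD_cnj[OF assms(4)]] in auto)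
qed

lemma nl_expand:
  assumes "w' y = w y + h"
  shows "nl v w' y - nl v w y = (v y + 2 * of_real \<theta> * (w y * cnj (w y))) * h + of_real \<theta> * (w y * w y) * cnj h
    + of_real \<theta> * ((2 * w y + h) * (h * cnj h) + cnj (w y) * (h * h))"
  using assms by (simp add: nl_def pot_def algebra_simps)

lemma W2_linearized:
  assumes "W1 Q v (%_. 1)" "W1 Q w (%_. 1)" "W2 Q h s"
  shows "W2 Q (%q y. (v q y + 2 * of_real \<theta> * (w q y * cnj (w q y))) * h q y + of_real \<theta> * (w q y * w q y) * cnj (h q y)) s"
  using assms by (intro W2_add W2_mult1 W1_add W1_mult1 W1_const_cmult W1_cnj W2_cnj) auto

lemma W2_quadratic:
  assumes "W1 Q w (%_. 1)" "W1 Q h (%_. 1)" "W2 Q (%q y. h q y * h q y) s" "W2 Q (%q y. h q y * cnj (h q y)) s"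
  shows "W2 Q (%q y. of_real \<theta> * ((2 * w q y + h q y) * (h q y * cnj (h q y)) + cnj (w q y) * (h q y * h q y))) s"
  by (rule W2_const_cmult, rule W2_add; rule W2_mult1; (intro assms W1_add W1_const_cmult W1_cnj)?)

text \<open>The linear part of the expansion acts on the second difference of \<open>w\<close>; the rest is quadratic in increments.\<close>

lemma nl_second_difference:
  assumes "W1 Q v (%_. 1)" "W1 Q w (%_. 1)" "W1 Q w1 (%_. 1)" "W1 Q w2 (%_. 1)"
    and d: "WD Q (%q y. w1 q y - w q y) s" "WD Q (%q y. w2 q y - w q y) s" and s: "!!q. q \<in> Q ==> 0 <= s q"
    and sd: "W2 Q (%q y. (w1 q y - w q y) + (w2 q y - w q y)) (%q. (s q)\<^sup>2)"
  shows "W2 Q (%q y. (nl (v q) (w1 q) y - nl (v q) (w q) y) + (nl (v q) (w2 q) y - nl (v q) (w q) y)) (%q. (s q)\<^sup>2)"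
proof -
  let ?h1 = "%q y. w1 q y - w q y" and ?h2 = "%q y. w2 q y - w q y"
  have q1: "W2 Q (%q y. ?h1 q y * ?h1 q y) (%q. (s q)\<^sup>2)" "W2 Q (%q y. ?h1 q y * cnj (?h1 q y)) (%q. (s q)\<^sup>2)"
    "W2 Q (%q y. ?h2 q y * ?h2 q y) (%q. (s q)\<^sup>2)" "W2 Q (%q y. ?h2 q y * cnj (?h2 q y)) (%q. (s q)\<^sup>2)"
    using WD_mult_WD[OF d(1) d(1) s s] WD_mult_WD[OF d(1) WD_cnj[OF d(1)] s s]
      WD_mult_WD[OF d(2) d(2) s s] WD_mult_WD[OF d(2) WD_cnj[OF d(2)] s s] by (simp_all add: power2_eq_square)
  have h1: "W1 Q ?h1 (%_. 1)" "W1 Q ?h2 (%_. 1)" by (intro W1_diff assms)+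
  have e: "(nl (v q) (w1 q) y - nl (v q) (w q) y) + (nl (v q) (w2 q) y - nl (v q) (w q) y) =
     ((v q y + 2 * of_real \<theta> * (w q y * cnj (w q y))) * (?h1 q y + ?h2 q y) + of_real \<theta> * (w q y * w q y) * cnj (?h1 q y + ?h2 q y))
     + (of_real \<theta> * ((2 * w q y + ?h1 q y) * (?h1 q y * cnj (?h1 q y)) + cnj (w q y) * (?h1 q y * ?h1 q y))
     + of_real \<theta> * ((2 * w q y + ?h2 q y) * (?h2 q y * cnj (?h2 q y)) + cnj (w q y) * (?h2 q y * ?h2 q y)))" for q y
    unfolding nl_expand[of "w1 q" y "w q" "?h1 q y", simplified] nl_expand[of "w2 q" y "w q" "?h2 q y", simplified]
    by (simp add: algebra_simps)
  show ?thesis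
    unfolding e by (intro W2_add[OF W2_linearized[OF assms(1,2) sd]] W2_add W2_quadratic q1 h1 assms)
qed

lemma W1_integral:
  fixes X :: "'q => real => real^'n => complex"
  assumes X: "W1 {z. fst z \<in> Q \<and> snd z \<in> {a (fst z)..b (fst z)}} (%z. X (fst z) (snd z)) (%z. s (fst z))"
    and ab: "!!q. q \<in> Q ==> a q <= b q" and Y: "!!q. q \<in> Q ==> wiener (Y q)"
    and int: "!!q k. q \<in> Q ==> ((%t. FC (X q t) k) has_integral FC (Y q) k) {a q..b q}"
  shows "W1 Q Y (%q. (b q - a q) * s q)"
proof -
  obtain C where C: "C >= 0" "!!z. z \<in> {z. fst z \<in> Q \<and> snd z \<in> {a (fst z)..b (fst z)}} ==>
      l1_le (FC (X (fst z) (snd z))) (C * s (fst z))" using W1_bnd[OF X] by (rule bnd1E) (rule that)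
  have "bnd1 Q (%q. FC (Y q)) (%q. (b q - a q) * s q)"
  proof (rule bnd1I[OF C(1)])
    fix q assume q: "q \<in> Q"
    have "l1_le (FC (Y q)) ((b q - a q) * (C * s q))"
      by (rule l1_le_integral[where x = "%t. FC (X q t)", OF ab[OF q] _ int[OF q]]) (use C(2)[of "(q, _)"] q in auto)
    then show "l1_le (FC (Y q)) (C * ((b q - a q) * s q))" by (simp add: ac_simps)
  qed
  then show ?thesis using Y by (simp add: W1_def)
qed

lemma W2_integral:
  fixes X :: "'q => real => real^'n => complex"
  assumes X: "W2 {z. fst z \<in> Q \<and> snd z \<in> {a (fst z)..b (fst z)}} (%z. X (fst z) (snd z)) (%z. s (fst z))"
    and ab: "!!q. q \<in> Q ==> a q <= b q" and Y: "!!q. q \<in> Q ==> wiener (Y q)"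
    and int: "!!q k. q \<in> Q ==> ((%t. FC (X q t) k) has_integral FC (Y q) k) {a q..b q}"
  shows "W2 Q Y (%q. (b q - a q) * s q)"
proof -
  obtain C where C: "C >= 0" "!!z. z \<in> {z. fst z \<in> Q \<and> snd z \<in> {a (fst z)..b (fst z)}} ==>
      l2_le (FC (X (fst z) (snd z))) (C * s (fst z))" using W2_bnd[OF X] by (rule bnd2E) (rule that)
  have "bnd2 Q (%q. FC (Y q)) (%q. (b q - a q) * s q)"
  proof (rule bnd2I[OF C(1)])
    fix q assume q: "q \<in> Q"
    have "l2_le (FC (Y q)) ((b q - a q) * (C * s q))"
      by (rule l2_le_integral[where x = "%t. FC (X q t)", OF ab[OF q] _ int[OF q]]) (use C(2)[of "(q, _)"] q in auto)
    then show "l2_le (FC (Y q)) (C * ((b q - a q) * s q))" by (simp add: ac_simps)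
  qed
  then show ?thesis using Y by (simp add: W2_def)
qed

end

section \<open>The local error of the time discretization\<close>

locale nls_family = nls_setting P \<alpha> \<theta> T for P :: "real^'n^'d" and \<alpha> :: nat and \<theta> T :: real +
  fixes A :: "'p set" and v :: "'p => real^'n => complex" and u :: "'p => real => real^'n => complex" and Cv Cu :: real
  assumes v_wiener: "!!p. p \<in> A ==> wiener (v p)"
    and v_bound: "0 <= Cv" "!!p. p \<in> A ==> l2_le (%k. zw \<alpha> k * norm (FC (v p) k)) Cv"
    and v_real: "!!p y. p \<in> A ==> cnj (v p y) = v p y"
    and u_wiener: "!!p s. p \<in> A ==> s \<in> {0..T} ==> wiener (u p s)"
    and u_bound: "0 <= Cu" "!!p s. p \<in> A ==> s \<in> {0..T} ==> l2_le (%k. zw \<alpha> k * norm (FC (u p s) k)) Cu"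
    and ode: "!!p t k. p \<in> A ==> t \<in> {0..T} ==>
      ((%s. - \<i> * (of_real (lam k) * FC (u p s) k + FC (nl (v p) (u p s)) k)) has_integral (FC (u p t) k - FC (u p 0) k)) {0..t}"
begin

lemma WZ_v: "(!!q. q \<in> Q ==> \<pi> q \<in> A) ==> WZ Q (%q. v (\<pi> q))"
  unfolding WZ_def bndz_def by (intro conjI ballI bnd2I[OF v_bound(1)]) (auto intro: v_wiener v_bound)

lemma WZ_u: "(!!q. q \<in> Q ==> \<pi> q \<in> A) ==> (!!q. q \<in> Q ==> t q \<in> {0..T}) ==> WZ Q (%q. u (\<pi> q) (t q))"
  unfolding WZ_def bndz_def by (intro conjI ballI bnd2I[OF u_bound(1)]) (auto intro: u_wiener u_bound)

lemma WZ_nlu: "(!!q. q \<in> Q ==> \<pi> q \<in> A) ==> (!!q. q \<in> Q ==> t q \<in> {0..T}) ==> WZ Q (%q. nl (v (\<pi> q)) (u (\<pi> q) (t q)))"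
  by (intro WZ_nl WZ_v WZ_u)

text \<open>The increment is an integral of the right-hand side of the equation, which is bounded in \<open>X\<^sub>\<alpha>\<close> after
  division by \<open>brk\<close>.\<close>

lemma u_increment:
  fixes \<pi> :: "'q => 'p"
  assumes p: "!!q. q \<in> Q ==> \<pi> q \<in> A" and t: "!!q. q \<in> Q ==> a q \<in> {0..T}" "!!q. q \<in> Q ==> b q \<in> {0..T}"
    and s: "!!q. q \<in> Q ==> \<bar>b q - a q\<bar> <= s q"
  shows "WD Q (%q y. u (\<pi> q) (b q) y - u (\<pi> q) (a q) y) s"
proof -
  define R where "R = A \<times> {0..T}"
  let ?w = "%p s k. - \<i> * (of_real (lam k) * FC (u p s) k + FC (nl (v p) (u p s)) k)"
  have "WZ R (%z. u (fst z) (snd z))" "WZ R (%z. nl (v (fst z)) (u (fst z) (snd z)))"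
    by (rule WZ_u WZ_nlu; auto simp: R_def)+
  then obtain C D where C: "C >= 0" "!!z. z \<in> R ==> l2_le (%k. zw \<alpha> k * norm (FC (u (fst z) (snd z)) k)) (C * 1)"
    and D: "D >= 0" "!!z. z \<in> R ==> l2_le (%k. zw \<alpha> k * norm (FC (nl (v (fst z)) (u (fst z) (snd z))) k)) (D * 1)"
    using WZ_bnd unfolding bndz_def by (auto elim!: bnd2E dest!: WZ_bnd simp: bndz_def)
  define K where "K = cP * C + D"
  have K: "K >= 0" using C D cP_nonneg by (simp add: K_def)
  have wb: "l2_le (%k. of_real (zw \<alpha> k / brk k) * ?w p s k) K" if "p \<in> A" "s \<in> {0..T}" for p s
  proof -
    have z: "(p, s) \<in> R" using that by (simp add: R_def)
    have "l2_le (%k. cP * (zw \<alpha> k * norm (FC (u p s) k)) + zw \<alpha> k * norm (FC (nl (v p) (u p s)) k)) (norm cP * (C * 1) + D * 1)"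
      by (rule l2_le_add[OF l2_le_cmult]) (use C(2)[OF z] D(2)[OF z] in auto)
    then show ?thesis
    proof (rule l2_le_mono)
      fix k :: "int^'n"
      have "norm (?w p s k) <= lam k * norm (FC (u p s) k) + norm (FC (nl (v p) (u p s)) k)"
        using norm_triangle_ineq[of "of_real (lam k) * FC (u p s) k" "FC (nl (v p) (u p s)) k"] lam_nonneg[of k] by (simp add: norm_mult)
      also have "... <= cP * brk k * norm (FC (u p s) k) + brk k * norm (FC (nl (v p) (u p s)) k)"
        using mult_right_mono[OF brk_ge_1[of k], of "norm (FC (nl (v p) (u p s)) k)"] mult_right_mono[OF lam_le[of k], of "norm (FC (u p s) k)"] by simp
      finally have "(zw \<alpha> k / brk k) * norm (?w p s k) <= (zw \<alpha> k / brk k) * (cP * brk k * norm (FC (u p s) k) + brk k * norm (FC (nl (v p) (u p s)) k))"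
        using zw_pos[of \<alpha> k] brk_pos[of k] by (intro mult_left_mono) auto
      also have "... = cP * (zw \<alpha> k * norm (FC (u p s) k)) + zw \<alpha> k * norm (FC (nl (v p) (u p s)) k)"
        using brk_pos(1)[of k] by (simp add: field_simps)
      finally show "norm (of_real (zw \<alpha> k / brk k) * ?w p s k) <= norm (cP * (zw \<alpha> k * norm (FC (u p s) k)) + zw \<alpha> k * norm (FC (nl (v p) (u p s)) k))"
        using zw_pos(2)[of \<alpha> k] brk_pos(2)[of k] unfolding norm_mult[of "of_real (zw \<alpha> k / brk k)"] norm_of_real by simp
    qed (use cP_nonneg in \<open>simp add: K_def\<close>)
  qed
  have ordered: "l2_le (%k. of_real (zw \<alpha> k / brk k) * (FC (u p t2) k - FC (u p t1) k)) ((t2 - t1) * K)"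
    if "p \<in> A" "0 <= t1" "t1 <= t2" "t2 <= T" for p t1 t2
  proof (rule l2_le_integral[OF \<open>t1 <= t2\<close>])
    show "l2_le (%k. of_real (zw \<alpha> k / brk k) * ?w p s k) K" if "s \<in> {t1..t2}" for s
      using wb[of p s] that \<open>p \<in> A\<close> \<open>0 <= t1\<close> \<open>t2 <= T\<close> by auto
    show "((%s. of_real (zw \<alpha> k / brk k) * ?w p s k) has_integral of_real (zw \<alpha> k / brk k) * (FC (u p t2) k - FC (u p t1) k)) {t1..t2}" for k
      by (intro has_integral_mult_right has_integral_between[where F = "%t. FC (u p t) k", OF ode]) (use that in auto)
  qed
  have any: "l2_le (%k. of_real (zw \<alpha> k / brk k) * (FC (u p t2) k - FC (u p t1) k)) (\<bar>t2 - t1\<bar> * K)"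
    if "p \<in> A" "t1 \<in> {0..T}" "t2 \<in> {0..T}" for p t1 t2
  proof (cases "t1 <= t2")
    case True then show ?thesis using ordered[of p t1 t2] that by simp
  next
    case False
    then have "l2_le (%k. of_real (zw \<alpha> k / brk k) * (FC (u p t1) k - FC (u p t2) k)) (\<bar>t2 - t1\<bar> * K)"
      using ordered[of p t2 t1] that by simp
    then show ?thesis by (rule l2_le_mono) (simp_all add: norm_mult norm_divide norm_minus_commute)
  qed
  define \<beta> where "\<beta> q k = norm (FC (u (\<pi> q) (b q)) k - FC (u (\<pi> q) (a q)) k) / (s q * brk k)" for q k
  have fc: "FC (%y. u (\<pi> q) (b q) y - u (\<pi> q) (a q) y) = (%k. FC (u (\<pi> q) (b q)) k - FC (u (\<pi> q) (a q)) k)" if "q \<in> Q" for q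
    by (rule wiener_diff(2)) (use u_wiener p t that in auto)
  show ?thesis
  proof (rule WDI[where \<beta> = \<beta>])
    fix q and k :: "int^'n" assume q: "q \<in> Q"
    have s0: "0 <= s q" using s[OF q] by linarith
    show "wiener (%y. u (\<pi> q) (b q) y - u (\<pi> q) (a q) y)" by (rule wiener_diff(1)) (use u_wiener p t q in auto)
    show "0 <= \<beta> q k" using s0 brk_pos(2)[of k] by (simp add: \<beta>_def)
    show "norm (FC (%y. u (\<pi> q) (b q) y - u (\<pi> q) (a q) y) k) <= s q * (brk k * \<beta> q k)"
      unfolding fc[OF q] using s[OF q] s0 brk_pos(1)[of k] by (cases "s q = 0") (auto simp: \<beta>_def)
  next
    show "bndz Q \<beta> (%_. 1)"
      unfolding bndz_def
    proof (rule bnd2I[OF K])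
      fix q assume q: "q \<in> Q"
      have s0: "0 <= s q" using s[OF q] by linarith
      show "l2_le (%k. zw \<alpha> k * norm (\<beta> q k)) (K * 1)"
      proof (cases "s q = 0")
        case True
        then show ?thesis using K by (auto simp: \<beta>_def l2_le_def L2_set_def)
      next
        case False
        have "l2_le (%k. (1 / s q) * norm (of_real (zw \<alpha> k / brk k) * (FC (u (\<pi> q) (b q)) k - FC (u (\<pi> q) (a q)) k))) (norm (1 / s q) * (\<bar>b q - a q\<bar> * K))"
          by (rule l2_le_cmult) (simp only: l2_le_norm any[OF p[OF q] t(1)[OF q] t(2)[OF q]])
        then show ?thesis
        proof (rule l2_le_mono)
          fix k :: "int^'n"
          show "norm (zw \<alpha> k * norm (\<beta> q k)) <= norm ((1 / s q) * norm (of_real (zw \<alpha> k / brk k) * (FC (u (\<pi> q) (b q)) k - FC (u (\<pi> q) (a q)) k)))"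
            using zw_pos[of \<alpha> k] brk_pos[of k] s0 by (simp add: \<beta>_def norm_mult norm_divide abs_mult)
          show "norm (1 / s q) * (\<bar>b q - a q\<bar> * K) <= K * 1"
            using s[OF q] s0 False K mult_right_mono[OF s[OF q] K] by (simp add: field_simps)
        qed
      qed
    qed
  qed
qed

lemma nlu_increment:
  fixes \<pi> :: "'q => 'p"
  assumes p: "!!q. q \<in> Q ==> \<pi> q \<in> A" and t: "!!q. q \<in> Q ==> a q \<in> {0..T}" "!!q. q \<in> Q ==> b q \<in> {0..T}"
    and s: "!!q. q \<in> Q ==> \<bar>b q - a q\<bar> <= s q"
  shows "bnd2 Q (%q k. brk k * norm (FC (%y. nl (v (\<pi> q)) (u (\<pi> q) (b q)) y - nl (v (\<pi> q)) (u (\<pi> q) (a q)) y) k)) s"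
    and "W2 Q (%q y. nl (v (\<pi> q)) (u (\<pi> q) (b q)) y - nl (v (\<pi> q)) (u (\<pi> q) (a q)) y) s"
proof -
  have s0: "0 <= s q" if "q \<in> Q" for q using s[OF that] by linarith
  note inc = u_increment[OF p t s]
  note z = WZ_v[of Q \<pi>, OF p] WZ_u[of Q \<pi> a, OF p t(1)] WZ_u[of Q \<pi> b, OF p t(2)]
  show "bnd2 Q (%q k. brk k * norm (FC (%y. nl (v (\<pi> q)) (u (\<pi> q) (b q)) y - nl (v (\<pi> q)) (u (\<pi> q) (a q)) y) k)) s"
    by (rule nl_brk[OF z inc s0])
  show "W2 Q (%q y. nl (v (\<pi> q)) (u (\<pi> q) (b q)) y - nl (v (\<pi> q)) (u (\<pi> q) (a q)) y) s"
    by (rule nl_W2[OF z(1)[THEN WZ_W1] z(2)[THEN WZ_W1] z(3)[THEN WZ_W1] WD_W2[OF inc s0]])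
qed

lemma continuous_FC_nlu:
  assumes p: "p \<in> A" shows "continuous_on {0..T} (%s. FC (nl (v p) (u p s)) k)"
proof -
  define Q where "Q = {0..T} \<times> {0..T}"
  have "W2 Q (%q y. nl (v p) (u p (snd q)) y - nl (v p) (u p (fst q)) y) (%q. \<bar>snd q - fst q\<bar>)"
    by (rule nlu_increment(2)[where \<pi> = "%_. p"]) (use p in \<open>auto simp: Q_def\<close>)
  then obtain C where C: "C >= 0" "!!q. q \<in> Q ==>
      l2_le (FC (%y. nl (v p) (u p (snd q)) y - nl (v p) (u p (fst q)) y)) (C * \<bar>snd q - fst q\<bar>)"
    by (auto elim!: bnd2E dest!: W2_bnd)
  have "norm (FC (nl (v p) (u p b)) k - FC (nl (v p) (u p a)) k) <= C * \<bar>b - a\<bar>" if "a \<in> {0..T}" "b \<in> {0..T}" for a b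
  proof -
    have q: "(a, b) \<in> Q" using that by (simp add: Q_def)
    have w: "wiener (nl (v p) (u p a))" "wiener (nl (v p) (u p b))" by (intro wiener_nl v_wiener u_wiener p that)+
    show ?thesis using l2_le_norm_le[OF C(2)[OF q], of k] by (simp add: wiener_diff(2)[OF w(2,1)])
  qed
  then have "C-lipschitz_on {0..T} (%s. FC (nl (v p) (u p s)) k)"
    by (intro lipschitz_onI C(1)) (auto simp: dist_norm dist_real_def)
  then show ?thesis by (rule lipschitz_on_continuous_on)
qed

lemma duhamel:
  assumes "p \<in> A" "0 <= t0" "t0 <= t1" "t1 <= T"
  shows "((%s. - \<i> * FC (flow (t1 - s) (nl (v p) (u p s))) k) has_integral
    (FC (u p t1) k - FC (flow (t1 - t0) (u p t0)) k)) {t0..t1}"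
proof -
  have d: "((%s. - \<i> * cis (- (t1 - s) * lam k) * FC (nl (v p) (u p s)) k) has_integral
    (FC (u p t1) k - cis (- (t1 - t0) * lam k) * FC (u p t0) k)) {t0..t1}"
    by (rule duhamel_scalar[OF ode continuous_FC_nlu]) (use assms in auto)
  have w: "wiener (u p s)" if "s \<in> {t0..t1}" for s using u_wiener[of p s] assms that by auto
  have e1: "FC (flow (t1 - t0) (u p t0)) k = cis (- (t1 - t0) * lam k) * FC (u p t0) k"
    using FC_flow[OF w[of t0], of "t1 - t0"] assms(3) by simp
  have e2: "- \<i> * cis (- (t1 - s) * lam k) * FC (nl (v p) (u p s)) k = - \<i> * FC (flow (t1 - s) (nl (v p) (u p s))) k"
    if "s \<in> {t0..t1}" for s
    by (simp only: FC_flow[OF wiener_nl[OF v_wiener[OF assms(1)] w[OF that]]] mult.assoc)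
  show ?thesis unfolding e1 by (rule has_integral_eq[OF e2 d])
qed

lemma u_increment_W1:
  fixes \<pi> :: "'q => 'p"
  assumes p: "!!q. q \<in> Q ==> \<pi> q \<in> A" and t: "!!q. q \<in> Q ==> 0 <= a q" "!!q. q \<in> Q ==> a q <= b q" "!!q. q \<in> Q ==> b q <= T"
  shows "W1 Q (%q y. u (\<pi> q) (b q) y - flow (b q - a q) (u (\<pi> q) (a q)) y) (%q. b q - a q)"
proof -
  let ?X = "%q s y. - \<i> * flow (b q - s) (nl (v (\<pi> q)) (u (\<pi> q) s)) y"
  have "W1 Q (%q y. u (\<pi> q) (b q) y - flow (b q - a q) (u (\<pi> q) (a q)) y) (%q. (b q - a q) * 1)"
  proof (rule W1_integral[where X = ?X])
    let ?R = "{z. fst z \<in> Q \<and> snd z \<in> {a (fst z)..b (fst z)}}"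
    have "WZ ?R (%z. nl (v (\<pi> (fst z))) (u (\<pi> (fst z)) (snd z)))"
      by (rule WZ_nlu) (use p t in force)+
    then show "W1 ?R (%z. ?X (fst z) (snd z)) (%z. 1)"
      by (intro W1_const_cmult W1_flow WZ_W1)
    fix q assume q: "q \<in> Q"
    show "a q <= b q" by (rule t(2)[OF q])
    have w: "wiener (u (\<pi> q) (b q))" "wiener (u (\<pi> q) (a q))" using u_wiener p[OF q] t[OF q] by auto
    show "wiener (%y. u (\<pi> q) (b q) y - flow (b q - a q) (u (\<pi> q) (a q)) y)"
      by (intro wiener_diff wiener_flow w)
    fix k
    have e: "FC (?X q s) k = - \<i> * FC (flow (b q - s) (nl (v (\<pi> q)) (u (\<pi> q) s))) k" if "s \<in> {a q..b q}" for s
      by (subst wiener_cmult(2)[OF wiener_flow[OF wiener_nl[OF v_wiener u_wiener]]]) (use p[OF q] t[OF q] that in auto)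
    show "((%s. FC (?X q s) k) has_integral FC (%y. u (\<pi> q) (b q) y - flow (b q - a q) (u (\<pi> q) (a q)) y) k) {a q..b q}"
      unfolding wiener_diff(2)[OF w(1) wiener_flow[OF w(2)]]
      by (rule has_integral_eq[OF e[symmetric] duhamel]) (use p[OF q] t[OF q] in auto)
  qed
  then show ?thesis by simp
qed

text \<open>Second differences in time, bounded without differentiating twice in time: the first derivative
  is expressed by the equation, and its increments have been bounded.\<close>

lemma u_second_difference:
  fixes \<pi> :: "'q => 'p"
  assumes p: "!!q. q \<in> Q ==> \<pi> q \<in> A"
    and t: "!!q. q \<in> Q ==> 0 <= m q - s q" "!!q. q \<in> Q ==> 0 <= s q" "!!q. q \<in> Q ==> m q + s q <= T"
  shows "W2 Q (%q y. (u (\<pi> q) (m q + s q) y - u (\<pi> q) (m q) y) + (u (\<pi> q) (m q - s q) y - u (\<pi> q) (m q) y)) (%q. (s q)\<^sup>2)"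
proof -
  let ?R = "{z. fst z \<in> Q \<and> snd z \<in> {0..s (fst z)}}"
  let ?w = "%q r k. - \<i> * (of_real (lam k) * FC (u (\<pi> q) r) k + FC (nl (v (\<pi> q)) (u (\<pi> q) r)) k)"
  let ?x = "%q r k. ?w q (m q + r) k - ?w q (m q - r) k"
  let ?Y = "%q y. (u (\<pi> q) (m q + s q) y - u (\<pi> q) (m q) y) + (u (\<pi> q) (m q - s q) y - u (\<pi> q) (m q) y)"
  let ?du = "%z. FC (%y. u (\<pi> (fst z)) (m (fst z) + snd z) y - u (\<pi> (fst z)) (m (fst z) - snd z) y)"
  let ?df = "%z. FC (%y. nl (v (\<pi> (fst z))) (u (\<pi> (fst z)) (m (fst z) + snd z)) y - nl (v (\<pi> (fst z))) (u (\<pi> (fst z)) (m (fst z) - snd z)) y)"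
  have pR: "\<pi> (fst z) \<in> A" "m (fst z) - snd z \<in> {0..T}" "m (fst z) + snd z \<in> {0..T}"
    "\<bar>(m (fst z) + snd z) - (m (fst z) - snd z)\<bar> <= 2 * s (fst z)" "0 <= 2 * s (fst z)" if "z \<in> ?R" for z
    using that p[of "fst z"] t[of "fst z"] by auto
  have b1: "bnd2 ?R (%z k. brk k * norm (?du z k)) (%z. 2 * s (fst z))"
    by (rule WD_brk[OF u_increment]) (fact pR)+
  have b2: "bnd2 ?R (%z. ?df z) (%z. 2 * s (fst z))"
    by (rule W2_bnd[OF nlu_increment(2)]) (fact pR)+
  have "bnd2 ?R (%z k. ?x (fst z) (snd z) k) (%z. 2 * s (fst z))"
  proof -
    have "bnd2 ?R (%z k. of_real cP * of_real (brk k * norm (?du z k)) + 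
       of_real (norm (?df z k)) :: complex) (%z. 2 * s (fst z))"
    proof (rule bnd2_add)
      have "bnd2 ?R (%z k. of_real cP * of_real (brk k * norm (?du z k)) :: complex) (%z. cP * (2 * s (fst z)))"
        by (rule bnd2_dom[OF b1]) (use cP_nonneg in \<open>auto simp: norm_mult abs_mult\<close>)
      then show "bnd2 ?R (%z k. of_real cP * of_real (brk k * norm (?du z k)) :: complex) (%z. 2 * s (fst z))"
        by (rule bnd2_mono[where K = cP]) (use cP_nonneg in auto)
    qed (rule bnd2_le[OF b2], simp)
    then show ?thesis
    proof (rule bnd2_le)
      fix z and k :: "int^'n" assume z: "z \<in> ?R"
      define q r where "q = fst z" and "r = snd z"
      have wu: "wiener (u (\<pi> q) (m q + r))" "wiener (u (\<pi> q) (m q - r))"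
        unfolding q_def r_def by (rule u_wiener; use pR[OF z] in simp)+
      have wn: "wiener (nl (v (\<pi> q)) (u (\<pi> q) (m q + r)))" "wiener (nl (v (\<pi> q)) (u (\<pi> q) (m q - r)))"
        by (intro wiener_nl wu v_wiener; use pR(1)[OF z] in \<open>simp add: q_def\<close>)+
      let ?d = "FC (%y. u (\<pi> q) (m q + r) y - u (\<pi> q) (m q - r) y) k"
      let ?e = "FC (%y. nl (v (\<pi> q)) (u (\<pi> q) (m q + r)) y - nl (v (\<pi> q)) (u (\<pi> q) (m q - r)) y) k"
      have "?x q r k = - \<i> * (of_real (lam k) * ?d + ?e)"
        unfolding wiener_diff(2)[OF wu] wiener_diff(2)[OF wn] by (simp add: algebra_simps)
      then have "norm (?x q r k) <= lam k * norm ?d + norm ?e"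
        using norm_triangle_ineq[of "of_real (lam k) * ?d" ?e] lam_nonneg[of k] by (simp add: norm_mult)
      also have "... <= cP * (brk k * norm ?d) + norm ?e"
        using mult_right_mono[OF lam_le[of k], of "norm ?d"] by simp
      also have "... = norm (of_real cP * of_real (brk k * norm ?d) + of_real (norm ?e) :: complex)"
      proof -
        have "of_real cP * of_real (brk k * norm ?d) + of_real (norm ?e) = complex_of_real (cP * (brk k * norm ?d) + norm ?e)" by simp
        then show ?thesis using cP_nonneg brk_pos(2)[of k] by (simp only: norm_of_real) simp
      qed
      finally show "norm (?x (fst z) (snd z) k) <= norm (of_real cP * of_real (brk k * norm (?du z k)) + 
       of_real (norm (?df z k)) :: complex)"
        unfolding q_def r_def .
    qed
  qed
  then obtain C where C: "C >= 0" "!!z. z \<in> ?R ==> l2_le (%k. ?x (fst z) (snd z) k) (C * (2 * s (fst z)))"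
    by (rule bnd2E) (rule that)
  have w: "wiener (u (\<pi> q) (m q + s q))" "wiener (u (\<pi> q) (m q - s q))" "wiener (u (\<pi> q) (m q))" if "q \<in> Q" for q
    by (rule u_wiener; use p[OF that] t[OF that] in simp)+
  have "bnd2 Q (%q. FC (?Y q)) (%q. (s q)\<^sup>2)"
  proof (rule bnd2I)
    fix q assume q: "q \<in> Q"
    have "l2_le (FC (?Y q)) ((s q - 0) * (C * (2 * s q)))"
    proof (rule l2_le_integral[OF t(2)[OF q]])
      show "l2_le (%k. ?x q r k) (C * (2 * s q))" if "r \<in> {0..s q}" for r using C(2)[of "(q, r)"] that q by simp
      fix k
      have "((%r. ?w q (m q + r) k) has_integral (FC (u (\<pi> q) (m q + s q)) k - FC (u (\<pi> q) (m q)) k)) {0..s q}"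
        by (rule has_integral_shift_from, rule has_integral_between[where F = "%t. FC (u (\<pi> q) t) k", OF ode]) (use p[OF q] t[OF q] in auto)
      moreover have "((%r. ?w q (m q - r) k) has_integral (FC (u (\<pi> q) (m q)) k - FC (u (\<pi> q) (m q - s q)) k)) {0..s q}"
        by (rule has_integral_reflect_from, rule has_integral_between[where F = "%t. FC (u (\<pi> q) t) k", OF ode]) (use p[OF q] t[OF q] in auto)
      ultimately have "((%r. ?x q r k) has_integral ((FC (u (\<pi> q) (m q + s q)) k - FC (u (\<pi> q) (m q)) k) - (FC (u (\<pi> q) (m q)) k - FC (u (\<pi> q) (m q - s q)) k))) {0..s q}"
        by (rule has_integral_diff)
      then show "((%r. ?x q r k) has_integral FC (?Y q) k) {0..s q}"
        unfolding wiener_add(2)[OF wiener_diff(1)[OF w(1)[OF q] w(3)[OF q]] wiener_diff(1)[OF w(2)[OF q] w(3)[OF q]]]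
          wiener_diff(2)[OF w(1)[OF q] w(3)[OF q]] wiener_diff(2)[OF w(2)[OF q] w(3)[OF q]]
        by (simp add: algebra_simps)
    qed
    then show "l2_le (FC (?Y q)) (2 * C * (s q)\<^sup>2)" by (simp add: power2_eq_square ac_simps)
  qed (use C in simp)
  moreover have "wiener (?Y q)" if "q \<in> Q" for q by (intro wiener_add wiener_diff w[OF that])
  ultimately show ?thesis by (simp add: W2_def)
qed

end

text \<open>A perturbation \<open>\<i> c W w\<close> of \<open>w\<close> along the potential \<open>W = a + b |w|\<^sup>2\<close> does not change \<open>|w|\<^sup>2\<close> to first
  order, so that the linearized nonlinearity reduces to multiplication by \<open>W\<close>.\<close>

lemma real_potential_cancellation:
  assumes "cnj a = a" "cnj c = c" "cnj b = b"
  shows "(a + 2 * b * (w * cnj w)) * (h + (\<i> * c) * ((a + b * (w * cnj w)) * w)) + b * (w * w) * cnj (h + (\<i> * c) * ((a + b * (w * cnj w)) * w)) =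
    (a + 2 * b * (w * cnj w)) * h + b * (w * w) * cnj h + (\<i> * c) * ((a + b * (w * cnj w)) * ((a + b * (w * cnj w)) * w))"
  using assms by (simp add: algebra_simps)

context nls_family begin

text \<open>One time step from \<open>t\<close> to \<open>t + \<tau>\<close>, for all data, starting times and step sizes at once.\<close>

context
  fixes Q :: "'q set" and \<pi> :: "'q => 'p" and t \<tau> :: "'q => real"
  assumes p: "!!q. q \<in> Q ==> \<pi> q \<in> A" and t: "!!q. q \<in> Q ==> 0 <= t q" and \<tau>: "!!q. q \<in> Q ==> 0 <= \<tau> q"
    and fin: "!!q. q \<in> Q ==> t q + \<tau> q <= T"
begin

definition half :: "'q => real^'n => complex" where
  "half q = flow (\<tau> q / 2) (u (\<pi> q) (t q))"

definition bwd :: "'q => real^'n => complex" where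
  "bwd q = flow (- (\<tau> q / 2)) (u (\<pi> q) (t q + \<tau> q))"

lemma tau_le_T: "q \<in> Q ==> \<tau> q <= T"
  using t[of q] fin[of q] by simp

lemma time_in: "q \<in> Q ==> s \<in> {t q..t q + \<tau> q} ==> s \<in> {0..T}"
  using t[of q] fin[of q] by simp

lemma t_in: "q \<in> Q ==> t q \<in> {0..T}" and end_in: "q \<in> Q ==> t q + \<tau> q \<in> {0..T}"
  and mid_in: "q \<in> Q ==> t q + \<tau> q / 2 \<in> {0..T}"
  using t[of q] \<tau>[of q] fin[of q] by auto

lemma WZ_half: "WZ Q half"
  unfolding half_def[abs_def] by (rule WZ_flow[OF WZ_u[OF p t_in]])

lemma WZ_bwd: "WZ Q bwd"
  unfolding bwd_def[abs_def] by (rule WZ_flow[OF WZ_u[OF p end_in]])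

lemma WZ_v': "WZ Q (%q. v (\<pi> q))"
  by (rule WZ_v[OF p])

lemma step_coeff:
  assumes q: "q \<in> Q"
  shows "FC (bwd q) k - FC (half q) k =
    cis (\<tau> q / 2 * lam k) * (FC (u (\<pi> q) (t q + \<tau> q)) k - FC (flow (t q + \<tau> q - t q) (u (\<pi> q) (t q))) k)"
proof -
  have "cis (\<tau> q / 2 * lam k) * cis (- \<tau> q * lam k) = cis (- (\<tau> q / 2) * lam k)"
    by (simp add: cis_mult algebra_simps)
  then show ?thesis
    unfolding bwd_def half_def FC_flow[OF u_wiener[OF p[OF q] end_in[OF q]]] FC_flow[OF u_wiener[OF p[OF q] t_in[OF q]]]
    by (simp add: right_diff_distrib flip: mult.assoc del: mult_minus_left)
qed

lemma u_minus_half_W2: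
  assumes R: "!!z. z \<in> R ==> fst z \<in> Q" "!!z. z \<in> R ==> s z \<in> {t (fst z)..t (fst z) + \<tau> (fst z)}"
  shows "W2 R (%z y. u (\<pi> (fst z)) (s z) y - half (fst z) y) (%z. \<tau> (fst z))"
proof -
  have "WZ R (%z. u (\<pi> (fst z)) (t (fst z)))"
    by (rule WZ_u[OF p[OF R(1)] t_in[OF R(1)]])
  from flow_diff_W2[OF this, where t = "%z. \<tau> (fst z) / 2"]
  have 1: "W2 R (%z y. half (fst z) y - u (\<pi> (fst z)) (t (fst z)) y) (%z. \<tau> (fst z))"
    unfolding half_def by (rule W2_mono[where K = 1]) (use \<tau>[OF R(1)] in auto)
  have "WD R (%z y. u (\<pi> (fst z)) (s z) y - u (\<pi> (fst z)) (t (fst z)) y) (%z. \<tau> (fst z))"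
  proof (rule u_increment[OF p[OF R(1)] t_in[OF R(1)] time_in[OF R]])
    fix z assume z: "z \<in> R"
    show "\<bar>s z - t (fst z)\<bar> <= \<tau> (fst z)" using R(2)[OF z] by auto
  qed
  from W2_diff[OF WD_W2[OF this] 1] show ?thesis using \<tau>[OF R(1)] by simp
qed

lemma u_minus_half_W1:
  assumes R: "!!z. z \<in> R ==> fst z \<in> Q" "!!z. z \<in> R ==> s z \<in> {t (fst z)..t (fst z) + \<tau> (fst z)}"
  shows "W1 R (%z y. u (\<pi> (fst z)) (s z) y - half (fst z) y) (%z. \<tau> (fst z) powr (1/8))"
proof -
  let ?t = "%z. t (fst z)"
  have Z: "WZ R (%z. u (\<pi> (fst z)) (?t z))"
    by (rule WZ_u[OF p[OF R(1)] t_in[OF R(1)]])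
  have 1: "W1 R (%z y. half (fst z) y - u (\<pi> (fst z)) (?t z) y) (%z. \<tau> (fst z) powr (1/8))"
    unfolding half_def
    by (rule W1_mono[OF flow_diff_W1[OF Z], where K = 1]) (use \<tau>[OF R(1)] in \<open>auto intro: powr_mono2\<close>)
  have 2: "W1 R (%z y. flow (s z - ?t z) (u (\<pi> (fst z)) (?t z)) y - u (\<pi> (fst z)) (?t z) y) (%z. \<tau> (fst z) powr (1/8))"
  proof (rule W1_mono[OF flow_diff_W1[OF Z], where K = 1])
    fix z assume z: "z \<in> R"
    show "\<bar>s z - ?t z\<bar> powr (1/8) <= 1 * \<tau> (fst z) powr (1/8)"
      using R(2)[OF z] by (simp add: powr_mono2)
  qed simp
  have "W1 R (%z y. u (\<pi> (fst z)) (s z) y - flow (s z - ?t z) (u (\<pi> (fst z)) (?t z)) y) (%z. s z - ?t z)"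
  proof (rule u_increment_W1[OF p[OF R(1)] t[OF R(1)]])
    fix z assume z: "z \<in> R"
    show "?t z <= s z" "s z <= T" using R(2)[OF z] time_in[OF R(1)[OF z] R(2)[OF z]] by auto
  qed
  then have 3: "W1 R (%z y. u (\<pi> (fst z)) (s z) y - flow (s z - ?t z) (u (\<pi> (fst z)) (?t z)) y) (%z. \<tau> (fst z) powr (1/8))"
  proof (rule W1_mono[where K = "T powr (7/8)"])
    fix z assume z: "z \<in> R"
    have "s z - ?t z <= \<tau> (fst z)" using R(2)[OF z] by auto
    also have "... = \<tau> (fst z) powr (7/8) * \<tau> (fst z) powr (1/8)"
      using \<tau>[OF R(1)[OF z]] by (cases "\<tau> (fst z) = 0") (simp_all flip: powr_add)
    also have "... <= T powr (7/8) * \<tau> (fst z) powr (1/8)"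
      using tau_le_T[OF R(1)[OF z]] \<tau>[OF R(1)[OF z]] by (intro mult_right_mono powr_mono2) auto
    finally show "s z - ?t z <= T powr (7/8) * \<tau> (fst z) powr (1/8)" .
  qed simp
  from W1_diff[OF W1_add[OF 3 2] 1] show ?thesis by simp
qed

abbreviation (input) "mid q \<equiv> t q + \<tau> q / 2"

text \<open>The value at the midpoint is needed only up to \<open>\<tau>\<^sup>2\<close>, because the midpoint rule multiplies the nonlinearity
  by \<open>\<tau>\<close>. The rectangle rule suffices.\<close>

lemma mid_value:
  "W2 Q (%q y. u (\<pi> q) (mid q) y - half q y + (\<i> * of_real (\<tau> q / 2)) * nl (v (\<pi> q)) (half q) y) (%q. (\<tau> q)\<^sup>2)"
proof -
  let ?R = "{z. fst z \<in> Q \<and> snd z \<in> {t (fst z)..mid (fst z)}}"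
  let ?f = "%q s. nl (v (\<pi> q)) (u (\<pi> q) s)"
  let ?X = "%q s y. - \<i> * ((flow (mid q - s) (?f q s) y - ?f q s y) + (?f q s y - nl (v (\<pi> q)) (half q) y))"
  let ?Y = "%q y. u (\<pi> q) (mid q) y - half q y + (\<i> * of_real (\<tau> q / 2)) * nl (v (\<pi> q)) (half q) y"
  have R: "fst z \<in> Q" "snd z \<in> {t (fst z)..t (fst z) + \<tau> (fst z)}" "snd z \<in> {0..T}" "0 <= \<tau> (fst z)"
    "\<bar>mid (fst z) - snd z\<bar> <= \<tau> (fst z)" if "z \<in> ?R" for z
    using that t[of "fst z"] \<tau>[of "fst z"] fin[of "fst z"] by auto
  have Zf: "WZ ?R (%z. ?f (fst z) (snd z))" by (rule WZ_nlu[OF p[OF R(1)] R(3)])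
  have Zu: "WZ ?R (%z. u (\<pi> (fst z)) (snd z))" by (rule WZ_u[OF p[OF R(1)] R(3)])
  have Zh: "WZ ?R (%z. half (fst z))" and Zv: "WZ ?R (%z. v (\<pi> (fst z)))"
    by (rule WZ_reindex[OF WZ_half] WZ_reindex[OF WZ_v'], simp)+
  have "W2 Q ?Y (%q. (mid q - t q) * \<tau> q)"
  proof (rule W2_integral[where X = ?X])
    have a: "W2 ?R (%z y. flow (mid (fst z) - snd z) (?f (fst z) (snd z)) y - ?f (fst z) (snd z) y) (%z. \<tau> (fst z))"
      by (rule W2_mono[OF flow_diff_W2[OF Zf], where K = 1]) (auto dest: R(5))
    have b: "W2 ?R (%z y. ?f (fst z) (snd z) y - nl (v (\<pi> (fst z))) (half (fst z)) y) (%z. \<tau> (fst z))"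
      by (rule nl_W2[OF Zv[THEN WZ_W1] Zh[THEN WZ_W1] Zu[THEN WZ_W1] u_minus_half_W2[OF R(1,2)]])
    show "W2 ?R (%z. ?X (fst z) (snd z)) (%z. \<tau> (fst z))"
      by (rule W2_const_cmult[OF W2_add[OF a b]])
    fix q assume q: "q \<in> Q"
    show "t q <= mid q" using \<tau>[OF q] by simp
    have w: "wiener (u (\<pi> q) (mid q))" by (rule u_wiener[OF p[OF q] mid_in[OF q]])
    have wh: "wiener (half q)" by (rule WZD[OF WZ_half q])
    have wn: "wiener (nl (v (\<pi> q)) (half q))" by (intro wiener_nl v_wiener p q wh)
    show "wiener (?Y q)" by (intro wiener_add wiener_diff wiener_cmult w wh wn)
    fix k
    have e: "FC (?X q s) k = - \<i> * FC (flow (mid q - s) (?f q s)) k - - \<i> * FC (nl (v (\<pi> q)) (half q)) k" if "s \<in> {t q..mid q}" for s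
    proof -
      have z: "(q, s) \<in> ?R" using that q by simp
      have w1: "wiener (?f q s)" using WZD[OF Zf z] by simp
      have Xe: "?X q s = (%y. - \<i> * (flow (mid q - s) (?f q s) y - nl (v (\<pi> q)) (half q) y))" by (simp add: fun_eq_iff)
      show ?thesis
        unfolding Xe wiener_cmult(2)[OF wiener_diff(1)[OF wiener_flow[OF w1] wn]] wiener_diff(2)[OF wiener_flow[OF w1] wn]
        by (rule right_diff_distrib)
    qed
    have c: "((%s. - \<i> * FC (nl (v (\<pi> q)) (half q)) k) has_integral (mid q - t q) *\<^sub>R (- \<i> * FC (nl (v (\<pi> q)) (half q)) k)) {t q..mid q}"
      using has_integral_const_real[of "- \<i> * FC (nl (v (\<pi> q)) (half q)) k" "t q" "mid q"] \<tau>[OF q] by simp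
    have d: "((%s. - \<i> * FC (flow (mid q - s) (?f q s)) k) has_integral
        (FC (u (\<pi> q) (mid q)) k - FC (flow (mid q - t q) (u (\<pi> q) (t q))) k)) {t q..mid q}"
      by (rule duhamel[OF p[OF q] t[OF q]]) (use \<tau>[OF q] mid_in[OF q] in auto)
    have y: "FC (?Y q) k = (FC (u (\<pi> q) (mid q)) k - FC (flow (mid q - t q) (u (\<pi> q) (t q))) k) - (mid q - t q) *\<^sub>R (- \<i> * FC (nl (v (\<pi> q)) (half q)) k)"
      unfolding wiener_add(2)[OF wiener_diff(1)[OF w wh] wiener_cmult(1)[OF wn]] wiener_diff(2)[OF w wh] wiener_cmult(2)[OF wn]
      by (simp add: scaleR_conv_of_real half_def)
    show "((%s. FC (?X q s) k) has_integral FC (?Y q) k) {t q..mid q}"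
      unfolding y by (rule has_integral_eq[OF e[symmetric] has_integral_diff[OF d c]])
  qed
  then show ?thesis by (rule W2_mono[where K = 1]) (use \<tau> in \<open>auto simp: power2_eq_square intro: mult_right_mono\<close>)
qed

text \<open>Folding Duhamel's integral at its midpoint leaves a symmetric second difference of the integrand. It has
  size \<open>\<sigma>\<^sup>2\<close> for three reasons: an increment of the phase meets an increment of the nonlinearity, or the
  phase has a second difference, or the nonlinearity has one.\<close>

lemma midpoint_rule:
  "W2 Q (%q y. bwd q y - half q y + (\<i> * of_real (\<tau> q)) * nl (v (\<pi> q)) (u (\<pi> q) (mid q)) y) (%q. (\<tau> q) ^ 3)"
proof -
  let ?R = "{z. fst z \<in> Q \<and> snd z \<in> {0..\<tau> (fst z) / 2}}"
  let ?f = "%q s. nl (v (\<pi> q)) (u (\<pi> q) s)"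
  let ?dp = "%q s y. ?f q (mid q + s) y - ?f q (mid q) y" and ?dm = "%q s y. ?f q (mid q - s) y - ?f q (mid q) y"
  let ?X1 = "%q s y. flow (- s) (?dp q s) y - ?dp q s y" and ?X2 = "%q s y. flow s (?dm q s) y - ?dm q s y"
  let ?X3 = "%q s y. (flow s (?f q (mid q)) y - ?f q (mid q) y) + (flow (- s) (?f q (mid q)) y - ?f q (mid q) y)"
  let ?X = "%q s y. - \<i> * ((?X1 q s y + ?X2 q s y) + (?X3 q s y + (?dp q s y + ?dm q s y)))"
  let ?Y = "%q y. bwd q y - half q y + (\<i> * of_real (\<tau> q)) * ?f q (mid q) y"
  have R: "fst z \<in> Q" "\<pi> (fst z) \<in> A" "mid (fst z) + snd z \<in> {0..T}" "mid (fst z) - snd z \<in> {0..T}" "mid (fst z) \<in> {0..T}"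
    "0 <= snd z" "snd z <= \<tau> (fst z)" "0 <= mid (fst z) - snd z" "mid (fst z) + snd z <= T"
    "\<bar>mid (fst z) + snd z - mid (fst z)\<bar> <= snd z" "\<bar>mid (fst z) - snd z - mid (fst z)\<bar> <= snd z"
    if "z \<in> ?R" for z
    using that t[of "fst z"] \<tau>[of "fst z"] fin[of "fst z"] p[of "fst z"] by (auto simp: field_simps)
  have Zf: "WZ ?R (%z. ?f (fst z) (mid (fst z)))" "WZ ?R (%z. ?f (fst z) (mid (fst z) + snd z))" "WZ ?R (%z. ?f (fst z) (mid (fst z) - snd z))"
    by (rule WZ_nlu; fact R)+
  have Zu: "WZ ?R (%z. u (\<pi> (fst z)) (mid (fst z)))" "WZ ?R (%z. u (\<pi> (fst z)) (mid (fst z) + snd z))" "WZ ?R (%z. u (\<pi> (fst z)) (mid (fst z) - snd z))"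
    by (rule WZ_u; fact R)+
  have Zv: "WZ ?R (%z. v (\<pi> (fst z)))" by (rule WZ_v; fact R)
  have wd: "wiener (?dp (fst z) (snd z))" "wiener (?dm (fst z) (snd z))" if "z \<in> ?R" for z
    by (intro wiener_diff WZD[OF Zf(1) that] WZD[OF Zf(2) that] WZD[OF Zf(3) that])+
  have X: "W2 ?R (%z. ?X (fst z) (snd z)) (%z. (snd z)\<^sup>2)"
  proof -
    have "W2 ?R (%z. ?X1 (fst z) (snd z)) (%z. \<bar>- snd z\<bar> * snd z)"
      by (rule flow_diff_brk[OF wd(1) nlu_increment(1)]) (assumption | fact R)+
    then have 1: "W2 ?R (%z. ?X1 (fst z) (snd z)) (%z. (snd z)\<^sup>2)"
      by (rule W2_mono[where K = 1]) (auto simp: power2_eq_square)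
    have "W2 ?R (%z. ?X2 (fst z) (snd z)) (%z. \<bar>snd z\<bar> * snd z)"
      by (rule flow_diff_brk[OF wd(2) nlu_increment(1)]) (assumption | fact R)+
    then have 2: "W2 ?R (%z. ?X2 (fst z) (snd z)) (%z. (snd z)\<^sup>2)"
      by (rule W2_mono[where K = 1]) (auto simp: power2_eq_square)
    have 3: "W2 ?R (%z. ?X3 (fst z) (snd z)) (%z. (snd z)\<^sup>2)" by (rule flow_second_difference[OF Zf(1)])
    have 4: "W2 ?R (%z y. ?dp (fst z) (snd z) y + ?dm (fst z) (snd z) y) (%z. (snd z)\<^sup>2)"
    proof (rule nl_second_difference[OF Zv[THEN WZ_W1] Zu[THEN WZ_W1]])
      show "WD ?R (%z y. u (\<pi> (fst z)) (mid (fst z) + snd z) y - u (\<pi> (fst z)) (mid (fst z)) y) snd"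
        "WD ?R (%z y. u (\<pi> (fst z)) (mid (fst z) - snd z) y - u (\<pi> (fst z)) (mid (fst z)) y) snd"
        by (rule u_increment; fact R)+
      show "W2 ?R (%z y. (u (\<pi> (fst z)) (mid (fst z) + snd z) y - u (\<pi> (fst z)) (mid (fst z)) y) +
        (u (\<pi> (fst z)) (mid (fst z) - snd z) y - u (\<pi> (fst z)) (mid (fst z)) y)) (%z. (snd z)\<^sup>2)"
        by (rule u_second_difference; fact R)
    qed (fact R)
    show ?thesis by (rule W2_const_cmult[OF W2_add[OF W2_add[OF 1 2] W2_add[OF 3 4]]])
  qed
  have "W2 Q ?Y (%q. (\<tau> q / 2 - 0) * (\<tau> q)\<^sup>2)"
  proof (rule W2_integral[where X = ?X])
    show "W2 ?R (%z. ?X (fst z) (snd z)) (%z. (\<tau> (fst z))\<^sup>2)"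
    proof (rule W2_mono[OF X, where K = 1])
      fix z assume z: "z \<in> ?R"
      show "(snd z)\<^sup>2 <= 1 * (\<tau> (fst z))\<^sup>2" using R(6)[OF z] R(7)[OF z] by (simp add: power_mono)
    qed simp
    fix q assume q: "q \<in> Q"
    show "0 <= \<tau> q / 2" using \<tau>[OF q] by simp
    have w: "wiener (u (\<pi> q) (t q + \<tau> q))" "wiener (u (\<pi> q) (t q))"
      by (rule u_wiener; use p[OF q] t[OF q] \<tau>[OF q] fin[OF q] in simp)+
    have wf: "wiener (?f q s)" if "s \<in> {0..T}" for s by (intro wiener_nl v_wiener u_wiener p[OF q] that)
    have m: "mid q \<in> {0..T}" using t[OF q] \<tau>[OF q] fin[OF q] by simp
    have wh: "wiener (half q)" "wiener (bwd q)" by (rule WZD[OF WZ_half q] WZD[OF WZ_bwd q])+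
    show "wiener (?Y q)" by (intro wiener_add wiener_diff wiener_cmult wf m wh)
    fix k
    let ?w = "%s. - \<i> * (cis ((s - mid q) * lam k) * FC (?f q s) k)"
    have w0: "((%s. cis (\<tau> q / 2 * lam k) * (- \<i> * FC (flow (t q + \<tau> q - s) (?f q s)) k)) has_integral
        cis (\<tau> q / 2 * lam k) * (FC (u (\<pi> q) (t q + \<tau> q)) k - FC (flow (t q + \<tau> q - t q) (u (\<pi> q) (t q))) k)) {t q..t q + \<tau> q}"
      by (rule has_integral_mult_right[OF duhamel[OF p[OF q] t[OF q]]]) (use \<tau>[OF q] fin[OF q] in auto)
    have w1: "cis (\<tau> q / 2 * lam k) * (- \<i> * FC (flow (t q + \<tau> q - s) (?f q s)) k) = ?w s" if s: "s \<in> {t q..t q + \<tau> q}" for s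
    proof -
      have c: "cis (\<tau> q / 2 * lam k) * cis (- (t q + \<tau> q - s) * lam k) = cis ((s - mid q) * lam k)"
        by (simp add: cis_mult algebra_simps)
      have "cis (\<tau> q / 2 * lam k) * (- \<i> * (cis (- (t q + \<tau> q - s) * lam k) * FC (?f q s) k)) =
          - \<i> * ((cis (\<tau> q / 2 * lam k) * cis (- (t q + \<tau> q - s) * lam k)) * FC (?f q s) k)"
        by (simp only: ac_simps)
      then show ?thesis unfolding FC_flow[OF wf[OF time_in[OF q s]]] c .
    qed
    have "(?w has_integral (FC (bwd q) k - FC (half q) k)) {t q..t q + \<tau> q}"
      using has_integral_eq[OF w1 w0] unfolding step_coeff[OF q, symmetric] .
    moreover have "{t q..t q + \<tau> q} = {mid q - \<tau> q / 2..mid q + \<tau> q / 2}" by simp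
    ultimately have I: "(?w has_integral (FC (bwd q) k - FC (half q) k)) {mid q - \<tau> q / 2..mid q + \<tau> q / 2}"
      by (simp only:)
    have "((%s. ?w (mid q + s) + ?w (mid q - s)) has_integral (FC (bwd q) k - FC (half q) k)) {0..\<tau> q / 2}"
      by (rule has_integral_fold[OF I]) (use \<tau>[OF q] in simp)
    from has_integral_diff[OF this has_integral_const_real[of "2 * (- \<i> * FC (?f q (mid q)) k)" 0 "\<tau> q / 2"]]
    have g: "((%s. ?w (mid q + s) + ?w (mid q - s) - 2 * (- \<i> * FC (?f q (mid q)) k)) has_integral
        (FC (bwd q) k - FC (half q) k - (\<tau> q / 2) *\<^sub>R (2 * (- \<i> * FC (?f q (mid q)) k)))) {0..\<tau> q / 2}"
      using \<tau>[OF q] by simp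
    have y: "FC (?Y q) k = FC (bwd q) k - FC (half q) k - (\<tau> q / 2) *\<^sub>R (2 * (- \<i> * FC (?f q (mid q)) k))"
      unfolding wiener_add(2)[OF wiener_diff(1)[OF wh(2,1)] wiener_cmult(1)[OF wf[OF m]]] wiener_diff(2)[OF wh(2,1)] wiener_cmult(2)[OF wf[OF m]]
      by (simp add: scaleR_conv_of_real)
    have e: "?w (mid q + s) + ?w (mid q - s) - 2 * (- \<i> * FC (?f q (mid q)) k) = FC (?X q s) k" if "s \<in> {0..\<tau> q / 2}" for s
    proof -
      have z: "(q, s) \<in> ?R" using that q by simp
      have ws: "wiener (?f q (mid q))" "wiener (?f q (mid q + s))" "wiener (?f q (mid q - s))"
        using R(3-5)[OF z] by (auto intro: wf)
      have wdd: "wiener (?dp q s)" "wiener (?dm q s)" by (intro wiener_diff ws)+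
      have Xe: "?X q s = (%y. - \<i> * ((flow (- s) (?dp q s) y + flow s (?dm q s) y) + ((flow s (?f q (mid q)) y + flow (- s) (?f q (mid q)) y) - 2 * ?f q (mid q) y)))"
        by (simp add: fun_eq_iff)
      show ?thesis
        unfolding Xe
          wiener_cmult(2)[OF wiener_add(1)[OF wiener_add(1)[OF wiener_flow[OF wdd(1)] wiener_flow[OF wdd(2)]]
            wiener_diff(1)[OF wiener_add(1)[OF wiener_flow[OF ws(1)] wiener_flow[OF ws(1)]] wiener_cmult(1)[OF ws(1)]]]]
          wiener_add(2)[OF wiener_add(1)[OF wiener_flow[OF wdd(1)] wiener_flow[OF wdd(2)]]
            wiener_diff(1)[OF wiener_add(1)[OF wiener_flow[OF ws(1)] wiener_flow[OF ws(1)]] wiener_cmult(1)[OF ws(1)]]]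
          wiener_add(2)[OF wiener_flow[OF wdd(1)] wiener_flow[OF wdd(2)]]
          wiener_diff(2)[OF wiener_add(1)[OF wiener_flow[OF ws(1)] wiener_flow[OF ws(1)]] wiener_cmult(1)[OF ws(1)]]
          wiener_add(2)[OF wiener_flow[OF ws(1)] wiener_flow[OF ws(1)]] wiener_cmult(2)[OF ws(1)]
          FC_flow[OF wdd(1)] FC_flow[OF wdd(2)] FC_flow[OF ws(1)] wiener_diff(2)[OF ws(2,1)] wiener_diff(2)[OF ws(3,1)]
        by (simp add: algebra_simps)
    qed
    show "((%s. FC (?X q s) k) has_integral FC (?Y q) k) {0..\<tau> q / 2}"
      unfolding y by (rule has_integral_eq[OF e g])
  qed
  then show ?thesis
    by (rule W2_mono[where K = 1]) (use \<tau> in \<open>auto simp: power2_eq_square power3_eq_cube intro: mult_right_mono\<close>)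
qed

text \<open>The second-order expansion of one exact step. The two Taylor coefficients are those of
  \<open>exp (- \<i> \<tau> W)\<close> with the potential \<open>W\<close> frozen at the half step; this agreement uses that \<open>W\<close> is real.\<close>

lemma exact_step_expansion:
  "W2 Q (%q y. bwd q y - (half q y - \<i> * of_real (\<tau> q) * nl (v (\<pi> q)) (half q) y
    - of_real ((\<tau> q)\<^sup>2 / 2) * (pot (v (\<pi> q)) (half q) y * nl (v (\<pi> q)) (half q) y))) (%q. (\<tau> q) ^ 3)"
proof -
  let ?m = "%q. u (\<pi> q) (mid q)" and ?v = "%q. v (\<pi> q)"
  let ?h = "%q y. ?m q y - half q y"
  let ?r = "%q y. ?h q y + (\<i> * of_real (\<tau> q / 2)) * nl (?v q) (half q) y"
  have v1: "W1 Q ?v (%_. 1)" and h1: "W1 Q half (%_. 1)" by (rule WZ_W1[OF WZ_v'] WZ_W1[OF WZ_half])+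
  have m1: "W1 Q ?m (%_. 1)" by (rule WZ_W1[OF WZ_u[OF p mid_in]])
  have ht: "W1 Q ?h \<tau>"
  proof -
    have "W1 Q (%q y. u (\<pi> q) (mid q) y - flow (mid q - t q) (u (\<pi> q) (t q)) y) (%q. mid q - t q)"
    proof (rule u_increment_W1[OF p t])
      fix q assume q: "q \<in> Q"
      show "t q <= mid q" "mid q <= T" using \<tau>[OF q] mid_in[OF q] by auto
    qed
    then have "W1 Q ?h (%q. mid q - t q)" by (simp add: half_def[abs_def])
    then show ?thesis by (rule W1_mono[where K = 1]) (use \<tau> in auto)
  qed
  have hh: "W2 Q (%q y. ?h q y * ?h q y) (%q. (\<tau> q)\<^sup>2)" "W2 Q (%q y. ?h q y * cnj (?h q y)) (%q. (\<tau> q)\<^sup>2)"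
    using W1_W2[OF W1_mult[OF ht ht]] W1_W2[OF W1_mult[OF ht W1_cnj[OF ht]]] by (simp_all add: power2_eq_square)
  have "W2 Q (%q y. nl (?v q) (?m q) y - nl (?v q) (half q) y + (\<i> * of_real (\<tau> q / 2)) * (pot (?v q) (half q) y * nl (?v q) (half q) y)) (%q. (\<tau> q)\<^sup>2)"
  proof -
    have *: "W2 Q (%q y. ((?v q y + 2 * of_real \<theta> * (half q y * cnj (half q y))) * ?r q y + of_real \<theta> * (half q y * half q y) * cnj (?r q y))
      + of_real \<theta> * ((2 * half q y + ?h q y) * (?h q y * cnj (?h q y)) + cnj (half q y) * (?h q y * ?h q y))) (%q. (\<tau> q)\<^sup>2)"
      by (rule W2_add[OF W2_linearized[OF v1 h1 mid_value] W2_quadratic[OF h1 W1_diff[OF m1 h1] hh]])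
    show ?thesis
    proof (rule W2I[OF _ _ W2_bnd[OF *]])
      fix q assume q: "q \<in> Q"
      have e: "((?v q y + 2 * of_real \<theta> * (half q y * cnj (half q y))) * ?r q y + of_real \<theta> * (half q y * half q y) * cnj (?r q y))
        + of_real \<theta> * ((2 * half q y + ?h q y) * (?h q y * cnj (?h q y)) + cnj (half q y) * (?h q y * ?h q y))
        = nl (?v q) (?m q) y - nl (?v q) (half q) y + (\<i> * of_real (\<tau> q / 2)) * (pot (?v q) (half q) y * nl (?v q) (half q) y)" for y
      proof -
        have "(?v q y + 2 * of_real \<theta> * (half q y * cnj (half q y))) * ?r q y + of_real \<theta> * (half q y * half q y) * cnj (?r q y) =
          (?v q y + 2 * of_real \<theta> * (half q y * cnj (half q y))) * ?h q y + of_real \<theta> * (half q y * half q y) * cnj (?h q y)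
          + (\<i> * of_real (\<tau> q / 2)) * (pot (?v q) (half q) y * nl (?v q) (half q) y)"
          unfolding nl_def pot_def by (rule real_potential_cancellation) (simp_all add: v_real[OF p[OF q]])
        then show ?thesis
          unfolding nl_expand[of "?m q" y "half q" "?h q y", simplified] by simp
      qed
      show "wiener (%y. nl (?v q) (?m q) y - nl (?v q) (half q) y + (\<i> * of_real (\<tau> q / 2)) * (pot (?v q) (half q) y * nl (?v q) (half q) y))"
        using W2D[OF * q] unfolding e .
      show "FC (%y. nl (?v q) (?m q) y - nl (?v q) (half q) y + (\<i> * of_real (\<tau> q / 2)) * (pot (?v q) (half q) y * nl (?v q) (half q) y)) =
        FC (%y. ((?v q y + 2 * of_real \<theta> * (half q y * cnj (half q y))) * ?r q y + of_real \<theta> * (half q y * half q y) * cnj (?r q y))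
        + of_real \<theta> * ((2 * half q y + ?h q y) * (?h q y * cnj (?h q y)) + cnj (half q y) * (?h q y * ?h q y)))"
        unfolding e ..
    qed
  qed
  from W2_cmult[OF this, where c = "%q. \<i> * of_real (\<tau> q)"]
  have "W2 Q (%q y. (\<i> * of_real (\<tau> q)) * (nl (?v q) (?m q) y - nl (?v q) (half q) y + (\<i> * of_real (\<tau> q / 2)) * (pot (?v q) (half q) y * nl (?v q) (half q) y))) (%q. (\<tau> q) ^ 3)"
    by (rule W2_mono[where K = 1]) (use \<tau> in \<open>auto simp: norm_mult power2_eq_square power3_eq_cube\<close>)
  from W2_diff[OF midpoint_rule this] show ?thesis
    by (simp add: algebra_simps power2_eq_square)
qed

text \<open>The same comparison in the Wiener norm. A rate just better than \<open>\<tau>\<close> makes the local errors add up to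
  something small.\<close>

lemma exact_step_W1:
  "W1 Q (%q y. bwd q y - half q y + (\<i> * of_real (\<tau> q)) * nl (v (\<pi> q)) (half q) y) (%q. \<tau> q * \<tau> q powr (1/8))"
proof -
  let ?R = "{z. fst z \<in> Q \<and> snd z \<in> {t (fst z)..t (fst z) + \<tau> (fst z)}}"
  let ?f = "%q s. nl (v (\<pi> q)) (u (\<pi> q) s)"
  let ?X = "%q s y. - \<i> * ((flow (mid q - s) (?f q s) y - ?f q s y) + (?f q s y - nl (v (\<pi> q)) (half q) y))"
  let ?Y = "%q y. bwd q y - half q y + (\<i> * of_real (\<tau> q)) * nl (v (\<pi> q)) (half q) y"
  have R: "fst z \<in> Q" "snd z \<in> {t (fst z)..t (fst z) + \<tau> (fst z)}" "snd z \<in> {0..T}" "0 <= \<tau> (fst z)"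
    "\<bar>mid (fst z) - snd z\<bar> <= \<tau> (fst z)" if "z \<in> ?R" for z
    using that t[of "fst z"] \<tau>[of "fst z"] fin[of "fst z"] by auto
  have Zf: "WZ ?R (%z. ?f (fst z) (snd z))" by (rule WZ_nlu[OF p[OF R(1)] R(3)])
  have Zu: "WZ ?R (%z. u (\<pi> (fst z)) (snd z))" by (rule WZ_u[OF p[OF R(1)] R(3)])
  have Zh: "WZ ?R (%z. half (fst z))" and Zv: "WZ ?R (%z. v (\<pi> (fst z)))"
    by (rule WZ_reindex[OF WZ_half] WZ_reindex[OF WZ_v'], simp)+
  have "W1 Q ?Y (%q. (t q + \<tau> q - t q) * \<tau> q powr (1/8))"
  proof (rule W1_integral[where X = ?X])
    have a: "W1 ?R (%z y. flow (mid (fst z) - snd z) (?f (fst z) (snd z)) y - ?f (fst z) (snd z) y) (%z. \<tau> (fst z) powr (1/8))"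
    proof (rule W1_mono[OF flow_diff_W1[OF Zf], where K = 1])
      fix z assume z: "z \<in> ?R"
      show "\<bar>mid (fst z) - snd z\<bar> powr (1/8) <= 1 * \<tau> (fst z) powr (1/8)" using R(5)[OF z] by (simp add: powr_mono2)
    qed simp
    have b: "W1 ?R (%z y. ?f (fst z) (snd z) y - nl (v (\<pi> (fst z))) (half (fst z)) y) (%z. \<tau> (fst z) powr (1/8))"
      by (rule nl_W1[OF Zv[THEN WZ_W1] Zh[THEN WZ_W1] Zu[THEN WZ_W1] u_minus_half_W1[OF R(1,2)]])
    show "W1 ?R (%z. ?X (fst z) (snd z)) (%z. \<tau> (fst z) powr (1/8))"
      by (rule W1_const_cmult[OF W1_add[OF a b]])
    fix q assume q: "q \<in> Q"
    show "t q <= t q + \<tau> q" using \<tau>[OF q] by simp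
    have w: "wiener (u (\<pi> q) (t q + \<tau> q))" "wiener (u (\<pi> q) (t q))"
      by (rule u_wiener; use p[OF q] t[OF q] \<tau>[OF q] fin[OF q] in simp)+
    have wh: "wiener (half q)" "wiener (bwd q)" by (rule WZD[OF WZ_half q] WZD[OF WZ_bwd q])+
    have wn: "wiener (nl (v (\<pi> q)) (half q))" by (intro wiener_nl v_wiener p q wh)
    show "wiener (?Y q)" by (intro wiener_add wiener_diff wiener_cmult wh wn)
    fix k
    let ?c = "cis (\<tau> q / 2 * lam k)"
    have e: "FC (?X q s) k = ?c * (- \<i> * FC (flow (t q + \<tau> q - s) (?f q s)) k) - - \<i> * FC (nl (v (\<pi> q)) (half q)) k" if "s \<in> {t q..t q + \<tau> q}" for s
    proof -
      have z: "(q, s) \<in> ?R" using that q by simp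
      have w1: "wiener (?f q s)" using WZD[OF Zf z] by simp
      have Xe: "?X q s = (%y. - \<i> * (flow (mid q - s) (?f q s) y - nl (v (\<pi> q)) (half q) y))" by (simp add: fun_eq_iff)
      have c: "?c * cis (- (t q + \<tau> q - s) * lam k) = cis (- (mid q - s) * lam k)"
        by (simp add: cis_mult algebra_simps)
      have "?c * (- \<i> * (cis (- (t q + \<tau> q - s) * lam k) * FC (?f q s) k)) = - \<i> * ((?c * cis (- (t q + \<tau> q - s) * lam k)) * FC (?f q s) k)"
        by (simp only: ac_simps)
      then show ?thesis
        unfolding Xe wiener_cmult(2)[OF wiener_diff(1)[OF wiener_flow[OF w1] wn]] wiener_diff(2)[OF wiener_flow[OF w1] wn] FC_flow[OF w1] c
        by (simp only: right_diff_distrib)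
    qed
    have c: "((%s. - \<i> * FC (nl (v (\<pi> q)) (half q)) k) has_integral (t q + \<tau> q - t q) *\<^sub>R (- \<i> * FC (nl (v (\<pi> q)) (half q)) k)) {t q..t q + \<tau> q}"
      using has_integral_const_real[of "- \<i> * FC (nl (v (\<pi> q)) (half q)) k" "t q" "t q + \<tau> q"] \<tau>[OF q] by simp
    have d: "((%s. ?c * (- \<i> * FC (flow (t q + \<tau> q - s) (?f q s)) k)) has_integral
        ?c * (FC (u (\<pi> q) (t q + \<tau> q)) k - FC (flow (t q + \<tau> q - t q) (u (\<pi> q) (t q))) k)) {t q..t q + \<tau> q}"
      by (rule has_integral_mult_right[OF duhamel[OF p[OF q] t[OF q]]]) (use \<tau>[OF q] fin[OF q] in auto)
    have y: "FC (?Y q) k = ?c * (FC (u (\<pi> q) (t q + \<tau> q)) k - FC (flow (t q + \<tau> q - t q) (u (\<pi> q) (t q))) k) - (t q + \<tau> q - t q) *\<^sub>R (- \<i> * FC (nl (v (\<pi> q)) (half q)) k)"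
      unfolding wiener_add(2)[OF wiener_diff(1)[OF wh(2,1)] wiener_cmult(1)[OF wn]] wiener_diff(2)[OF wh(2,1)] wiener_cmult(2)[OF wn] step_coeff[OF q]
      by (simp add: scaleR_conv_of_real)
    show "((%s. FC (?X q s) k) has_integral FC (?Y q) k) {t q..t q + \<tau> q}"
      unfolding y by (rule has_integral_eq[OF e[symmetric] has_integral_diff[OF d c]])
  qed
  then show ?thesis by simp
qed

end

end

section \<open>Exponentials in the Wiener algebra\<close>

definition wiener_le :: "(real^'n => complex) => real => bool" where
  "wiener_le U r \<longleftrightarrow> wiener U \<and> l1_le (fourier_coeff U) r"

lemma wiener_leD: "wiener_le U r ==> wiener U" "wiener_le U r ==> l1_le (fourier_coeff U) r"
  by (simp_all add: wiener_le_def)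

lemma wiener_le_nonneg: "wiener_le U r ==> 0 <= r"
  by (auto simp: wiener_le_def dest: l1_le_nonneg)

lemma wiener_le_norm: "wiener_le U r ==> norm (U y) <= r"
  by (auto simp: wiener_le_def intro: wiener_norm_le)

lemma wiener_le_mono: "wiener_le U r ==> r <= s ==> wiener_le U s"
  by (auto simp: wiener_le_def intro: l1_le_le)

lemma wiener_le_trig_series: "l1_le a r ==> wiener_le (trig_series a) r"
  by (simp add: wiener_le_def wiener_trig_series)

lemma wiener_le_const: "wiener_le (%_. c) (norm c)"
  by (simp add: wiener_le_def wiener_const const_l1_le)

lemma wiener_le_add: "wiener_le U r ==> wiener_le W s ==> wiener_le (%y. U y + W y) (r + s)"
  by (auto simp: wiener_le_def wiener_add intro: l1_le_add)

lemma wiener_le_cmult: "wiener_le U r ==> wiener_le (%y. c * U y) (norm c * r)"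
  by (auto simp: wiener_le_def wiener_cmult intro: l1_le_cmult)

lemma wiener_le_mult: "wiener_le U r ==> wiener_le W s ==> wiener_le (%y. U y * W y) (r * s)"
  by (auto simp: wiener_le_def wiener_mult intro: conv_l1_le)

lemma wiener_le_cnj: "wiener_le U r ==> wiener_le (%y. cnj (U y)) r"
proof -
  assume U: "wiener_le U r"
  have "l1_le (%k. cnj (fourier_coeff U (- k))) r"
    by (rule l1_le_mono[OF l1_le_inj[OF wiener_leD(2)[OF U], of uminus]]) (auto intro: injI)
  then show ?thesis using U by (simp add: wiener_le_def wiener_cnj)
qed

lemma wiener_le_power: "wiener_le U r ==> wiener_le (%y. U y ^ j) (r ^ j)"
  by (induction j) (use wiener_le_const[of 1] in \<open>auto intro: wiener_le_mult\<close>)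

lemma wiener_le_sum:
  "finite J ==> (!!j. j \<in> J ==> wiener_le (f j) (r j)) ==> wiener_le (%y. \<Sum>j\<in>J. f j y) (\<Sum>j\<in>J. r j)"
proof (induction J rule: finite_induct)
  case empty
  show ?case using wiener_le_const[of 0] by simp
next
  case (insert j J)
  then show ?case using wiener_le_add[of "f j" "r j"] by auto
qed

text \<open>The bound passes to uniform limits, because finitely many Fourier coefficients converge.\<close>

lemma wiener_le_limit:
  fixes U :: "real^'n => complex"
  assumes le: "!!n. wiener_le (S n) r" and U: "torus_continuous U"
    and lim: "!!n y. norm (U y - S n y) <= e n" "e \<longlonglongrightarrow> 0"
  shows "wiener_le U r"
proof -
  have c: "(%n. fourier_coeff (S n) k) \<longlonglongrightarrow> fourier_coeff U k" for k
  proof (rule LIM_zero_cancel, rule Lim_null_comparison[OF _ lim(2)], rule always_eventually, rule allI)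
    fix n
    have S: "torus_continuous (S n)" by (rule wiener_torus_continuous[OF wiener_leD(1)[OF le]])
    have "norm (fourier_coeff (%y. U y - S n y) k) <= e n"
      by (rule fourier_coeff_norm_le[OF torus_continuous_diff[OF U S] lim(1)])
    then show "norm (fourier_coeff (S n) k - fourier_coeff U k) <= e n"
      by (simp add: fourier_coeff_diff[OF U S] norm_minus_commute)
  qed
  have "l1_le (fourier_coeff U) r"
    unfolding l1_le_def
  proof (intro allI impI)
    fix F :: "(int^'n) set" assume F: "finite F"
    have "(%n. \<Sum>k\<in>F. norm (fourier_coeff (S n) k)) \<longlonglongrightarrow> (\<Sum>k\<in>F. norm (fourier_coeff U k))"
      by (intro tendsto_sum tendsto_norm c)
    then show "(\<Sum>k\<in>F. norm (fourier_coeff U k)) <= r"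
      by (rule LIMSEQ_le_const2) (use l1_leD[OF wiener_leD(2)[OF le] F] in auto)
  qed
  then show ?thesis using U by (auto simp: wiener_le_def wiener_def)
qed

text \<open>The partial sums of the exponential series obey the bound by submultiplicativity, and they converge
  uniformly since \<open>g\<close> is bounded.\<close>

lemma wiener_le_exp_tail:
  fixes g :: "real^'n => complex"
  assumes g: "wiener_le g r"
  shows "wiener_le (%y. exp (g y) - (\<Sum>j<m. g y ^ j / fact j)) (exp r - (\<Sum>j<m. r ^ j / fact j))"
proof (rule wiener_le_limit)
  let ?S = "%n y. \<Sum>j\<in>{m..m + n}. g y ^ j / fact j"
  have r: "0 <= r" by (rule wiener_le_nonneg[OF g])
  have split: "(\<Sum>j\<le>m + n. f j) = (\<Sum>j<m. f j) + (\<Sum>j\<in>{m..m + n}. f j)" for n and f :: "nat => 'a::comm_monoid_add"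
    by (subst sum.union_disjoint[symmetric]) (auto intro!: sum.cong)
  show "wiener_le (?S n) (exp r - (\<Sum>j<m. r ^ j / fact j))" for n
  proof -
    have "wiener_le (%y. \<Sum>j\<in>{m..m + n}. (1 / fact j) * g y ^ j) (\<Sum>j\<in>{m..m + n}. norm (1 / fact j :: complex) * r ^ j)"
      by (intro wiener_le_sum wiener_le_cmult wiener_le_power g) auto
    moreover have "(\<Sum>j\<in>{m..m + n}. norm (1 / fact j :: complex) * r ^ j) <= exp r - (\<Sum>j<m. r ^ j / fact j)"
    proof -
      have s: "(%j. r ^ j / fact j) sums exp r" using exp_converges[of r] by (simp add: divide_inverse ac_simps)
      have "(\<Sum>j\<le>m + n. r ^ j / fact j) <= exp r"
        using sum_le_suminf[OF sums_summable[OF s], of "{..m + n}"] sums_unique[OF s] r by simp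
      then show ?thesis unfolding split by (simp add: norm_divide)
    qed
    ultimately show ?thesis by (simp add: wiener_le_mono)
  qed
  have tg: "torus_continuous g" by (rule wiener_torus_continuous[OF wiener_leD(1)[OF g]])
  show "torus_continuous (%y. exp (g y) - (\<Sum>j<m. g y ^ j / fact j))"
    by (rule torus_continuous_compose[OF tg, of "%z. exp z - (\<Sum>j<m. z ^ j / fact j)"]) (intro continuous_intros, auto)
  show "norm (exp (g y) - (\<Sum>j<m. g y ^ j / fact j) - ?S n y) <= exp r * r ^ Suc (m + n) / fact (m + n)" for n y
  proof -
    have "norm (exp (g y) - (\<Sum>j\<le>m + n. g y ^ j / fact j)) <= exp (norm (g y)) * norm (g y) ^ Suc (m + n) / fact (m + n)"
      by (rule Taylor_exp_field)
    also have "... <= exp r * r ^ Suc (m + n) / fact (m + n)"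
      using wiener_le_norm[OF g, of y] by (intro divide_right_mono mult_mono power_mono) auto
    finally show ?thesis unfolding split by (simp add: algebra_simps)
  qed
  have "(%n. inverse (fact n) * r ^ n) \<longlonglongrightarrow> 0" by (rule summable_LIMSEQ_zero[OF summable_exp])
  from LIMSEQ_ignore_initial_segment[OF tendsto_mult_left[OF this, of "exp r * r"], of m]
  show "(%n. exp r * r ^ Suc (m + n) / fact (m + n)) \<longlonglongrightarrow> 0"
    by (simp add: divide_inverse ac_simps)
qed

lemma exp_minus_1_le: "exp r - 1 <= r * exp r" for r :: real
proof -
  have "1 - r <= exp (- r)" using exp_ge_add_one_self[of "- r"] by simp
  from mult_right_mono[OF this, of "exp r"] show ?thesis by (simp add: algebra_simps flip: exp_add)
qed

lemma wiener_le_exp: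
  assumes g: "wiener_le g r"
  shows "wiener_le (%y. exp (g y)) (exp r)" "wiener_le (%y. exp (g y) - 1) (r * exp r)"
    "wiener_le (%y. exp (g y) - 1 - g y) (r\<^sup>2 * exp r)"
proof -
  have r: "0 <= r" by (rule wiener_le_nonneg[OF g])
  show "wiener_le (%y. exp (g y)) (exp r)" using wiener_le_exp_tail[OF g, of 0] by simp
  show "wiener_le (%y. exp (g y) - 1) (r * exp r)"
    by (rule wiener_le_mono[OF _ exp_minus_1_le]) (use wiener_le_exp_tail[OF g, of 1] in simp)
  have "exp r - 1 - r <= r * (exp r - 1)" using exp_minus_1_le[of r] by (simp add: algebra_simps)
  also have "... <= r * (r * exp r)" by (rule mult_left_mono[OF exp_minus_1_le r])
  finally have b: "exp r - (1 + r) <= r\<^sup>2 * exp r" by (simp add: power2_eq_square)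
  show "wiener_le (%y. exp (g y) - 1 - g y) (r\<^sup>2 * exp r)"
    by (rule wiener_le_mono[OF _ b]) (use wiener_le_exp_tail[OF g, of 2] in \<open>simp add: numeral_2_eq_2 diff_diff_eq\<close>)
qed

section \<open>Stability of one numerical step\<close>

context nls_setting begin

lemma wiener_le_pot:
  assumes "wiener_le v K" "wiener_le U R" shows "wiener_le (pot v U) (K + \<bar>\<theta>\<bar> * (R * R))"
  using wiener_le_add[OF assms(1) wiener_le_cmult[OF wiener_le_mult[OF assms(2) wiener_le_cnj[OF assms(2)]], of "of_real \<theta>"]]
  by (simp add: pot_def[abs_def])

lemma wiener_le_pot_diff:
  assumes "wiener_le U R" "wiener_le W R" "wiener_le (%y. U y - W y) \<delta>"
  shows "wiener_le (%y. pot v U y - pot v W y) (2 * \<bar>\<theta>\<bar> * R * \<delta>)"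
  using wiener_le_add[OF wiener_le_cmult[OF wiener_le_mult[OF assms(1) wiener_le_cnj[OF assms(3)]], of "of_real \<theta>"]
      wiener_le_cmult[OF wiener_le_mult[OF wiener_le_cnj[OF assms(2)] assms(3)], of "of_real \<theta>"]]
  unfolding pot_diff by (simp add: algebra_simps)

text \<open>The Strang scheme in terms of coefficients: \<open>drift\<close> is the linear flow, \<open>kick\<close> the pointwise solution
  operator of the potential part, whose modulus is constant in time.\<close>

definition kick :: "real => (real^'n => complex) => (real^'n => complex) => real^'n => complex" where
  "kick \<tau> v \<phi> y = exp (- \<i> * of_real \<tau> * pot v \<phi> y) * \<phi> y"

definition drift :: "real => (int^'n => complex) => int^'n => complex" where
  "drift t a k = cis (- t * lam k) * a k"

definition step :: "nat => real => (real^'n => complex) => (int^'n => complex) => int^'n => complex" where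
  "step N \<tau> v a = drift (\<tau> / 2) (interp_coeff N (kick \<tau> v (trig_series (drift (\<tau> / 2) a))))"

primrec num :: "nat => real => (real^'n => complex) => (real^'n => complex) => nat => int^'n => complex" where
  "num N \<tau> v U 0 = interp_coeff N U"
| "num N \<tau> v U (Suc m) = step N \<tau> v (num N \<tau> v U m)"

lemma norm_drift: "norm (drift t a k) = norm (a k)"
  by (simp add: drift_def norm_mult)

lemma drift_diff: "drift t a k - drift t b k = drift t (%k. a k - b k) k"
  by (simp add: drift_def right_diff_distrib)

lemma l1_le_drift: "l1_le (drift t a) r \<longleftrightarrow> l1_le a r" and l2_le_drift: "l2_le (drift t a) r \<longleftrightarrow> l2_le a r"
  by (simp_all add: l1_le_def l2_le_def norm_drift)

lemma cutoff_cutoff: "cutoff N (cutoff N a) = cutoff N a"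
  by (auto simp: cutoff_def)

lemma cutoff_drift: "cutoff N (drift t a) = drift t (cutoff N a)"
  by (auto simp: cutoff_def drift_def)

lemma cutoff_interp_coeff: "cutoff N (interp_coeff N U) = interp_coeff N U"
  by (auto simp: cutoff_def interp_coeff_def)

lemma cutoff_num: "cutoff N (num N \<tau> v U m) = num N \<tau> v U m"
  by (cases m) (simp_all add: step_def cutoff_drift cutoff_interp_coeff)

lemma wiener_le_imp_interp_coeff: "N >= 1 ==> wiener_le U r ==> l1_le (interp_coeff N U) r"
  using interp_coeff_l1_le[of N "fourier_coeff U" r] by (simp add: wiener_le_def flip: wiener_eq_trig_series)

lemma trig_series_diff:
  assumes "l1_le a r" "l1_le b s"
  shows "trig_series (%k. a k - b k) y = trig_series a y - trig_series b y"
proof -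
  have "wiener (%y. trig_series a y - trig_series b y)"
    by (intro wiener_diff wiener_trig_series(1)[OF assms(1)] wiener_trig_series(1)[OF assms(2)])
  from wiener_eq_trig_series[OF this]
  have "(%y. trig_series a y - trig_series b y) = trig_series (%k. a k - b k)"
    by (simp add: wiener_diff(2)[OF wiener_trig_series(1)[OF assms(1)] wiener_trig_series(1)[OF assms(2)]] wiener_trig_series(2)[OF assms(1)] wiener_trig_series(2)[OF assms(2)])
  then show ?thesis by (simp add: fun_eq_iff)
qed

text \<open>The factor \<open>exp z\<^sub>U - exp z\<^sub>W = exp z\<^sub>W (exp (z\<^sub>U - z\<^sub>W) - 1)\<close> is of order \<open>\<tau>\<close> times the difference. The bound
  \<open>\<delta> \<le> 1\<close> keeps its exponent bounded.\<close>

lemma step_diff_l1: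
  assumes K: "0 <= K" and R: "0 <= R"
  obtains L where "L >= 0"
    "!!N \<tau> v a b \<delta>. N >= 1 ==> 0 <= \<tau> ==> \<tau> <= T ==> wiener_le v K ==> l1_le a R ==> l1_le b R ==> \<delta> <= 1 ==>
      l1_le (%k. a k - b k) \<delta> ==> l1_le (%k. step N \<tau> v a k - step N \<tau> v b k) ((1 + L * \<tau>) * \<delta>)"
proof
  define B where "B = K + \<bar>\<theta>\<bar> * (R * R)"
  define D where "D = 2 * \<bar>\<theta>\<bar> * R"
  have B: "0 <= B" and D: "0 <= D" using K R by (simp_all add: B_def D_def)
  let ?L = "B * exp (T * B) + exp (T * B) * (D * exp (T * D)) * R"
  show "?L >= 0" using B D R by simp
  fix N :: nat and \<tau> \<delta> :: real and v :: "real^'n => complex" and a b :: "int^'n => complex"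
  assume N: "N >= 1" and \<tau>: "0 <= \<tau>" "\<tau> <= T" and v: "wiener_le v K" and a: "l1_le a R" and b: "l1_le b R" and \<delta>: "\<delta> <= 1"
    and ab: "l1_le (%k. a k - b k) \<delta>"
  define U W where "U = trig_series (drift (\<tau> / 2) a)" and "W = trig_series (drift (\<tau> / 2) b)"
  have \<delta>0: "0 <= \<delta>" by (rule l1_le_nonneg[OF ab])
  have U: "wiener_le U R" and W: "wiener_le W R" unfolding U_def W_def using a b by (auto intro: wiener_le_trig_series simp: l1_le_drift)
  have ad: "l1_le (drift (\<tau> / 2) a) R" "l1_le (drift (\<tau> / 2) b) R" using a b by (simp_all add: l1_le_drift)
  have UW: "wiener_le (%y. U y - W y) \<delta>"
  proof -
    have "(%y. U y - W y) = trig_series (drift (\<tau> / 2) (%k. a k - b k))"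
      by (rule ext) (simp add: U_def W_def drift_diff flip: trig_series_diff[OF ad])
    then show ?thesis using wiener_le_trig_series[of "drift (\<tau> / 2) (%k. a k - b k)" \<delta>] ab by (simp add: l1_le_drift)
  qed
  let ?z = "%U y. (- \<i> * of_real \<tau>) * pot v U y"
  have nz: "norm (- \<i> * complex_of_real \<tau>) = \<tau>" using \<tau> by (simp add: norm_mult)
  have zU: "wiener_le (?z U) (\<tau> * B)" and zW: "wiener_le (?z W) (\<tau> * B)"
    using wiener_le_cmult[OF wiener_le_pot[OF v U], of "- \<i> * of_real \<tau>"] wiener_le_cmult[OF wiener_le_pot[OF v W], of "- \<i> * of_real \<tau>"]
    unfolding nz B_def by auto
  have zd: "wiener_le (%y. ?z U y - ?z W y) (\<tau> * (D * \<delta>))"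
    using wiener_le_cmult[OF wiener_le_pot_diff[OF U W UW], of "- \<i> * of_real \<tau>" v]
    unfolding nz D_def by (simp only: right_diff_distrib)
  have e: "kick \<tau> v U y - kick \<tau> v W y = exp (?z U y) * (U y - W y) + exp (?z W y) * (exp (?z U y - ?z W y) - 1) * W y" for y
  proof -
    have "exp (?z U y) = exp (?z W y) * exp (?z U y - ?z W y)" by (simp flip: exp_add)
    then show ?thesis by (simp add: kick_def algebra_simps)
  qed
  have "wiener_le (%y. kick \<tau> v U y - kick \<tau> v W y) (exp (\<tau> * B) * \<delta> + exp (\<tau> * B) * (\<tau> * (D * \<delta>) * exp (\<tau> * (D * \<delta>))) * R)"
    unfolding e by (intro wiener_le_add wiener_le_mult wiener_le_exp zU zW UW zd W)
  then have "wiener_le (%y. kick \<tau> v U y - kick \<tau> v W y) ((1 + ?L * \<tau>) * \<delta>)"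
  proof (rule wiener_le_mono)
    have "exp (\<tau> * B) - 1 <= (\<tau> * B) * exp (\<tau> * B)" by (rule exp_minus_1_le)
    also have "... <= (\<tau> * B) * exp (T * B)" using \<tau> B by (intro mult_left_mono) (auto intro: mult_right_mono)
    finally have 1: "exp (\<tau> * B) * \<delta> <= (1 + B * exp (T * B) * \<tau>) * \<delta>"
      using \<delta>0 by (intro mult_right_mono) (auto simp: ac_simps)
    have "\<tau> * (D * \<delta>) <= T * (D * 1)" using \<tau> D \<delta> \<delta>0 by (intro mult_mono) auto
    then have "exp (\<tau> * B) * (\<tau> * (D * \<delta>) * exp (\<tau> * (D * \<delta>))) * R <= exp (T * B) * (\<tau> * (D * \<delta>) * exp (T * (D * 1))) * R"
      using \<tau> B D R \<delta>0 by (intro mult_right_mono mult_mono mult_left_mono) (auto intro: mult_right_mono)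
    with 1 show "exp (\<tau> * B) * \<delta> + exp (\<tau> * B) * (\<tau> * (D * \<delta>) * exp (\<tau> * (D * \<delta>))) * R <= (1 + ?L * \<tau>) * \<delta>"
      by (simp add: algebra_simps)
  qed
  from wiener_le_imp_interp_coeff[OF N this]
  show "l1_le (%k. step N \<tau> v a k - step N \<tau> v b k) ((1 + ?L * \<tau>) * \<delta>)"
    by (simp add: step_def drift_diff l1_le_drift U_def W_def interp_coeff_diff[abs_def])
qed

lemma norm_exp_real: "cnj z = z ==> norm (exp (- \<i> * of_real \<tau> * z)) = 1"
  by (simp add: complex_eq_iff)

lemma norm_exp_real_diff:
  assumes "cnj z = z" "cnj w = w" "0 <= \<tau>"
  shows "norm (exp (- \<i> * of_real \<tau> * z) - exp (- \<i> * of_real \<tau> * w)) <= \<tau> * norm (z - w)"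
proof -
  obtain x y where xy: "z = of_real x" "w = of_real y"
    using assms by (metis Reals_cnj_iff Reals_cases)
  have "exp (- \<i> * of_real \<tau> * z) - exp (- \<i> * of_real \<tau> * w) = cis (- \<tau> * y) * (cis (- \<tau> * (x - y)) - 1)"
    by (simp add: xy cis_conv_exp exp_add[symmetric] algebra_simps)
  then have "norm (exp (- \<i> * of_real \<tau> * z) - exp (- \<i> * of_real \<tau> * w)) <= \<bar>- \<tau> * (x - y)\<bar>"
    using cis_diff_le[of "- \<tau> * (x - y)"] by (simp add: norm_mult)
  also have "... = \<tau> * norm (z - w)" using assms(3) by (simp add: xy abs_mult flip: of_real_diff)
  finally show ?thesis .
qed

lemma kick_diff_le:
  assumes v: "cnj (v y) = v y" and UW: "norm (U y) <= R" "norm (W y) <= R" and \<tau>: "0 <= \<tau>"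
  shows "norm (kick \<tau> v U y - kick \<tau> v W y) <= (1 + 2 * \<bar>\<theta>\<bar> * R * R * \<tau>) * norm (U y - W y)"
proof -
  have R: "0 <= R" using UW(1) norm_ge_zero order_trans by blast
  have c: "cnj (pot v U y) = pot v U y" "cnj (pot v W y) = pot v W y" by (simp_all add: pot_def v mult.commute)
  have "norm (pot v U y - pot v W y) <= \<bar>\<theta>\<bar> * (norm (U y) * norm (U y - W y)) + \<bar>\<theta>\<bar> * (norm (W y) * norm (U y - W y))"
    unfolding pot_diff by (rule order_trans[OF norm_triangle_ineq]) (simp add: norm_mult flip: complex_cnj_diff)
  also have "... <= \<bar>\<theta>\<bar> * (R * norm (U y - W y)) + \<bar>\<theta>\<bar> * (R * norm (U y - W y))"
    by (intro add_mono mult_left_mono mult_right_mono UW) auto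
  finally have d: "norm (pot v U y - pot v W y) <= 2 * \<bar>\<theta>\<bar> * R * norm (U y - W y)" by (simp add: algebra_simps)
  let ?e = "%U. exp (- \<i> * of_real \<tau> * pot v U y)"
  have "kick \<tau> v U y - kick \<tau> v W y = ?e U * (U y - W y) + (?e U - ?e W) * W y"
    by (simp add: kick_def algebra_simps)
  then have "norm (kick \<tau> v U y - kick \<tau> v W y) <= norm (?e U) * norm (U y - W y) + norm (?e U - ?e W) * norm (W y)"
    using norm_triangle_ineq[of "?e U * (U y - W y)" "(?e U - ?e W) * W y"] by (simp add: norm_mult)
  also have "... <= 1 * norm (U y - W y) + (\<tau> * (2 * \<bar>\<theta>\<bar> * R * norm (U y - W y))) * R"
  proof (intro add_mono mult_mono UW)
    show "norm (?e U) <= 1" by (simp only: norm_exp_real[OF c(1)] order_refl)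
    show "norm (?e U - ?e W) <= \<tau> * (2 * \<bar>\<theta>\<bar> * R * norm (U y - W y))"
      using norm_exp_real_diff[OF c \<tau>] mult_left_mono[OF d \<tau>] by linarith
  qed (use \<tau> R in auto)
  finally show ?thesis by (simp add: algebra_simps)
qed

text \<open>In mean square the step is estimated on the grid points, where the phase factors have modulus one.\<close>

lemma step_diff_l2:
  assumes N: "N >= 1" and \<tau>: "0 <= \<tau>" and v: "!!y. cnj (v y) = v y" and a: "l1_le a R" "cutoff N a = a" and b: "l1_le b R" "cutoff N b = b"
    and ab: "l2_le (%k. a k - b k) \<delta>"
  shows "l2_le (%k. step N \<tau> v a k - step N \<tau> v b k) ((1 + 2 * \<bar>\<theta>\<bar> * R * R * \<tau>) * \<delta>)"
proof -
  define U W where "U = trig_series (drift (\<tau> / 2) a)" and "W = trig_series (drift (\<tau> / 2) b)"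
  let ?L = "1 + 2 * \<bar>\<theta>\<bar> * R * R * \<tau>"
  have L: "0 <= ?L" using l1_le_nonneg[OF a(1)] \<tau> by simp
  have ad: "l1_le (drift (\<tau> / 2) a) R" "l1_le (drift (\<tau> / 2) b) R" using a b by (simp_all add: l1_le_drift)
  have UW: "norm (U y) <= R" "norm (W y) <= R" for y
    unfolding U_def W_def using wiener_le_norm[OF wiener_le_trig_series] ad by blast+
  have d: "l2_le (drift (\<tau> / 2) (%k. a k - b k)) \<delta>" using ab by (simp add: l2_le_drift)
  have "drift (\<tau> / 2) (%k. a k - b k) = cutoff N (drift (\<tau> / 2) (%k. a k - b k))"
  proof (rule ext)
    fix k
    show "drift (\<tau> / 2) (%k. a k - b k) k = cutoff N (drift (\<tau> / 2) (%k. a k - b k)) k"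
      using fun_cong[OF a(2), of k] fun_cong[OF b(2), of k] by (auto simp: cutoff_def drift_def)
  qed
  then have UWd: "U y - W y = trig_series (cutoff N (drift (\<tau> / 2) (%k. a k - b k))) y" for y
    by (simp add: U_def W_def drift_diff flip: trig_series_diff[OF ad])
  have "l2_le (interp_coeff N (%y. kick \<tau> v U y - kick \<tau> v W y)) (?L * \<delta>)"
  proof (rule interp_coeff_l2_le[OF N])
    have "grid_mean N (%y. (norm (kick \<tau> v U y - kick \<tau> v W y))\<^sup>2) <= grid_mean N (%y. ?L\<^sup>2 * (norm (U y - W y))\<^sup>2)"
    proof (rule grid_mean_mono)
      fix l
      have "(norm (kick \<tau> v U (grid_point N l) - kick \<tau> v W (grid_point N l)))\<^sup>2 <= (?L * norm (U (grid_point N l) - W (grid_point N l)))\<^sup>2"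
        by (rule power_mono[OF kick_diff_le[OF v UW \<tau>] norm_ge_zero])
      then show "(norm (kick \<tau> v U (grid_point N l) - kick \<tau> v W (grid_point N l)))\<^sup>2 <= ?L\<^sup>2 * (norm (U (grid_point N l) - W (grid_point N l)))\<^sup>2"
        by (simp only: power_mult_distrib)
    qed
    also have "... <= ?L\<^sup>2 * \<delta>\<^sup>2"
      unfolding grid_mean_cmult UWd by (rule mult_left_mono[OF grid_mean_cutoff[OF N d]]) simp
    finally show "grid_mean N (%y. (norm (kick \<tau> v U y - kick \<tau> v W y))\<^sup>2) <= (?L * \<delta>)\<^sup>2" by (simp only: power_mult_distrib)
  qed (use L l2_le_nonneg[OF ab] in simp)
  then show ?thesis
    by (simp only: step_def drift_diff l2_le_drift U_def W_def interp_coeff_diff[abs_def])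
qed

text \<open>The potential is real, so the numerical mass does not grow.\<close>

lemma num_l2_le:
  assumes N: "N >= 1" and v: "!!y. cnj (v y) = v y" and U: "!!y. norm (U y) <= r"
  shows "l2_le (num N \<tau> v U m) r"
proof (induction m)
  case 0
  show ?case using interp_coeff_sup[OF N U] by simp
next
  case (Suc m)
  let ?a = "num N \<tau> v U m"
  define W where "W = trig_series (drift (\<tau> / 2) ?a)"
  have W: "W = trig_series (cutoff N (drift (\<tau> / 2) ?a))" by (simp add: W_def cutoff_drift cutoff_num)
  have "cnj (pot v W y) = pot v W y" for y by (simp add: pot_def v mult.commute)
  then have "norm (kick \<tau> v W y) = norm (W y)" for y by (simp only: kick_def norm_mult norm_exp_real mult_1)
  then have "grid_mean N (%y. (norm (kick \<tau> v W y))\<^sup>2) <= r\<^sup>2"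
    using grid_mean_cutoff[OF N, of "drift (\<tau> / 2) ?a" r] Suc by (simp add: l2_le_drift W)
  then have "l2_le (interp_coeff N (kick \<tau> v W)) r" by (rule interp_coeff_l2_le[OF N]) (rule l2_le_nonneg[OF Suc])
  then show ?case by (simp add: step_def l2_le_drift W_def)
qed

end

section \<open>The local error of the full discretization\<close>

context nls_setting begin

lemma bnd1_cutoff: "bnd1 Q a s ==> bnd1 Q (%q. cutoff (N q) (a q)) s"
  by (rule bnd1_le) (auto simp: cutoff_def)

lemma bnd2_cutoff: "bnd2 Q a s ==> bnd2 Q (%q. cutoff (N q) (a q)) s"
  by (rule bnd2_le) (auto simp: cutoff_def)

context
  fixes Q :: "'q set" and g :: "'q => real^'n => complex" and N :: "'q => nat"
  assumes g: "WZ Q g" and N: "!!q. q \<in> Q ==> N q >= 1"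
begin

lemma bnd2_interp_error:
  "bnd2 Q (%q k. interp_coeff (N q) (g q) k - cutoff (N q) (FC (g q)) k) (%q. 1 / real (N q) ^ (2 * \<alpha>))"
proof -
  obtain E where E: "E > 0" "!!N (a :: int^'n => complex) s r. N >= 1 ==> l1_le a s ==> l2_le (%k. zw \<alpha> k * norm (a k)) r ==>
      l2_le (%k. interp_coeff N (trig_series a) k - cutoff N a k) (E * r / real N ^ (2 * \<alpha>))"
    by (rule interp_error_l2[OF alpha_quarter]) (rule that)
  obtain C where C: "C >= 0" "!!q. q \<in> Q ==> l2_le (%k. zw \<alpha> k * norm (FC (g q) k)) (C * 1)"
    using WZ_bnd[OF g] unfolding bndz_def by (rule bnd2E) (rule that)
  show ?thesis
  proof (rule bnd2I)
    fix q assume q: "q \<in> Q"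
    obtain r where r: "l1_le (FC (g q)) r" using WZD[OF g q] by (auto simp: wiener_def)
    show "l2_le (%k. interp_coeff (N q) (g q) k - cutoff (N q) (FC (g q)) k) (E * C * (1 / real (N q) ^ (2 * \<alpha>)))"
      using E(2)[OF N[OF q] r C(2)[OF q]] by (simp flip: wiener_eq_trig_series[OF WZD[OF g q]])
  qed (use E C in simp)
qed

lemma bnd1_interp_error:
  "bnd1 Q (%q k. interp_coeff (N q) (g q) k - cutoff (N q) (FC (g q)) k) (%q. real (N q) powr (- 1/4))"
proof -
  obtain C where C: "C >= 0" "!!q. q \<in> Q ==> l1_le (%k. brk k powr (1/8) * norm (FC (g q) k)) (C * 1)"
    using bndz_brk_powr[OF WZ_bnd[OF g]] by (rule bnd1E) (rule that)
  show ?thesis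
  proof (rule bnd1I[OF C(1)])
    fix q assume q: "q \<in> Q"
    obtain r where r: "l1_le (FC (g q)) r" using WZD[OF g q] by (auto simp: wiener_def)
    show "l1_le (%k. interp_coeff (N q) (g q) k - cutoff (N q) (FC (g q)) k) (C * real (N q) powr (- 1/4))"
      using interp_error_l1[OF N[OF q] r C(2)[OF q]] by (simp flip: wiener_eq_trig_series[OF WZD[OF g q]])
  qed
qed

definition trunc :: "'q => real^'n => complex" where
  "trunc q = trig_series (cutoff (N q) (FC (g q)))"

lemma trunc: assumes "q \<in> Q" shows "wiener (trunc q)" "FC (trunc q) = cutoff (N q) (FC (g q))"
proof -
  obtain r where r: "l1_le (FC (g q)) r" using WZD[OF g assms] by (auto simp: wiener_def)
  from wiener_trig_series[OF l1_le_cutoff[OF r]] show "wiener (trunc q)" "FC (trunc q) = cutoff (N q) (FC (g q))"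
    by (simp_all add: trunc_def)
qed

lemma WZ_trunc: "WZ Q trunc"
proof (rule WZI[OF trunc])
  show "bndz Q (%q. cutoff (N q) (FC (g q))) (%_. 1)"
    unfolding bndz_def
    by (rule bnd2_le[OF WZ_bnd[OF g, unfolded bndz_def]]) (use zw_pos in \<open>auto simp: cutoff_def abs_mult\<close>)
qed

lemma FC_trunc_diff: "q \<in> Q ==> FC (%y. trunc q y - g q y) = (%k. - (if k \<in> freq_box (N q) then 0 else FC (g q) k))"
  by (simp add: wiener_diff(2)[OF trunc(1) WZD[OF g]] trunc(2) cutoff_def fun_eq_iff)

lemma trunc_W2: "W2 Q (%q y. trunc q y - g q y) (%q. 1 / real (N q) ^ (2 * \<alpha>))"
proof (rule W2I[OF wiener_diff(1)[OF trunc(1) WZD[OF g]] FC_trunc_diff])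
  obtain C where C: "C >= 0" "!!q. q \<in> Q ==> l2_le (%k. zw \<alpha> k * norm (FC (g q) k)) (C * 1)"
    using WZ_bnd[OF g] unfolding bndz_def by (rule bnd2E) (rule that)
  show "bnd2 Q (%q k. - (if k \<in> freq_box (N q) then 0 else FC (g q) k)) (%q. 1 / real (N q) ^ (2 * \<alpha>))"
  proof (rule bnd2I[OF C(1)])
    fix q assume q: "q \<in> Q"
    show "l2_le (%k. - (if k \<in> freq_box (N q) then 0 else FC (g q) k)) (C * (1 / real (N q) ^ (2 * \<alpha>)))"
      unfolding l2_le_uminus using tail_l2_le[OF N[OF q] C(2)[OF q]] by simp
  qed
qed

lemma trunc_W1: "W1 Q (%q y. trunc q y - g q y) (%q. real (N q) powr (- 1/4))"
proof (rule W1I[OF wiener_diff(1)[OF trunc(1) WZD[OF g]] FC_trunc_diff])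
  obtain C where C: "C >= 0" "!!q. q \<in> Q ==> l1_le (%k. brk k powr (1/8) * norm (FC (g q) k)) (C * 1)"
    using bndz_brk_powr[OF WZ_bnd[OF g]] by (rule bnd1E) (rule that)
  show "bnd1 Q (%q k. - (if k \<in> freq_box (N q) then 0 else FC (g q) k)) (%q. real (N q) powr (- 1/4))"
  proof (rule bnd1I[OF C(1)])
    fix q assume q: "q \<in> Q"
    show "l1_le (%k. - (if k \<in> freq_box (N q) then 0 else FC (g q) k)) (C * real (N q) powr (- 1/4))"
      unfolding l1_le_uminus using tail_l1_le[OF N[OF q] C(2)[OF q]] by simp
  qed
qed

end

lemma bnd1_cmult:
  fixes a :: "'q => 'i => complex"
  assumes "bnd1 Q a s" "!!q. q \<in> Q ==> norm (c q) * s q <= K * s' q" "0 <= K"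
  shows "bnd1 Q (%q k. c q * a q k) s'"
  by (rule bnd1_mono[OF bnd1_dom[OF assms(1), of _ "%q. norm (c q)"] assms(2,3)]) (auto simp: norm_mult)

lemma bnd2_cmult:
  fixes a :: "'q => 'i => complex"
  assumes "bnd2 Q a s" "!!q. q \<in> Q ==> norm (c q) * s q <= K * s' q" "0 <= K"
  shows "bnd2 Q (%q k. c q * a q k) s'"
  by (rule bnd2_mono[OF bnd2_dom[OF assms(1), of _ "%q. norm (c q)"] assms(2,3)]) (auto simp: norm_mult)

lemma pot_nl_W2:
  assumes "W1 Q v (%_. 1)" "W1 Q w (%_. 1)" "W1 Q w' (%_. 1)" "W2 Q (%q y. w' q y - w q y) s"
  shows "W2 Q (%q y. pot (v q) (w' q) y * nl (v q) (w' q) y - pot (v q) (w q) y * nl (v q) (w q) y) s"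
proof -
  have e: "pot (v q) (w' q) y * nl (v q) (w' q) y - pot (v q) (w q) y * nl (v q) (w q) y =
     pot (v q) (w' q) y * (nl (v q) (w' q) y - nl (v q) (w q) y) + nl (v q) (w q) y * (pot (v q) (w' q) y - pot (v q) (w q) y)" for q y
    by (simp add: algebra_simps)
  have n: "W1 Q (%q. nl (v q) (w q)) (%_. 1)"
    unfolding nl_def[abs_def] by (intro W1_mult1 W1_pot assms)
  have p: "W2 Q (%q y. pot (v q) (w' q) y - pot (v q) (w q) y) s"
    unfolding pot_diff by (intro W2_add W2_const_cmult W2_mult1 W1_cnj W2_cnj assms)
  show ?thesis
    unfolding e by (rule W2_add[OF W2_mult1[OF W1_pot[OF assms(1,3)] nl_W2[OF assms]] W2_mult1[OF n p]])
qed

text \<open>Taylor remainders of the nonlinear substep: in the sup norm for the error in mean square, and in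
  the Wiener algebra for the a priori bound.\<close>

lemma kick_taylor_sup:
  assumes v: "wiener_le v K" and U: "wiener_le U R" and \<tau>: "0 <= \<tau>" "\<tau> <= T"
  shows "norm (kick \<tau> v U y - (U y - \<i> * of_real \<tau> * nl v U y - of_real (\<tau>\<^sup>2 / 2) * (pot v U y * nl v U y)))
    <= exp (T * (K + \<bar>\<theta>\<bar> * (R * R))) * (K + \<bar>\<theta>\<bar> * (R * R)) ^ 3 * R * \<tau> ^ 3"
proof -
  define B where "B = K + \<bar>\<theta>\<bar> * (R * R)"
  define z where "z = - \<i> * of_real \<tau> * pot v U y"
  have p: "norm (pot v U y) <= B" unfolding B_def by (rule wiener_le_norm[OF wiener_le_pot[OF v U]])
  have B: "0 <= B" using p norm_ge_zero order_trans by blast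
  have Uy: "norm (U y) <= R" by (rule wiener_le_norm[OF U])
  have z: "norm z <= \<tau> * B" using mult_left_mono[OF p \<tau>(1)] \<tau> by (simp add: z_def norm_mult)
  have TB: "\<tau> * B <= T * B" by (rule mult_right_mono[OF \<tau>(2) B])
  have zz: "z * z = - (of_real (\<tau>\<^sup>2) * (pot v U y * pot v U y))"
    by (simp add: z_def power2_eq_square algebra_simps)
  have "kick \<tau> v U y - (U y - \<i> * of_real \<tau> * nl v U y - of_real (\<tau>\<^sup>2 / 2) * (pot v U y * nl v U y))
      = (exp z - (\<Sum>i\<le>2. z ^ i / fact i)) * U y"
    by (simp add: kick_def nl_def z_def[symmetric] numeral_2_eq_2 zz) (simp add: z_def algebra_simps)
  also have "norm \<dots> <= (exp (norm z) * norm z ^ Suc 2 / fact 2) * R"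
    unfolding norm_mult by (intro mult_mono Taylor_exp_field Uy) auto
  also have "... <= (exp (T * B) * (\<tau> * B) ^ Suc 2 / 1) * R"
    using z TB B \<tau> order_trans[OF norm_ge_zero Uy] by (intro mult_right_mono frac_le mult_mono power_mono) auto
  also have "... = exp (T * B) * B ^ 3 * R * \<tau> ^ 3" by (simp add: power_mult_distrib numeral_eq_Suc)
  finally show ?thesis unfolding B_def .
qed

lemma kick_taylor_wiener:
  assumes v: "wiener_le v K" and U: "wiener_le U R" and \<tau>: "0 <= \<tau>" "\<tau> <= T"
  shows "wiener_le (%y. kick \<tau> v U y - U y + \<i> * of_real \<tau> * nl v U y)
    (((K + \<bar>\<theta>\<bar> * (R * R))\<^sup>2 * exp (T * (K + \<bar>\<theta>\<bar> * (R * R))) * R) * \<tau>\<^sup>2)"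
proof -
  define B where "B = K + \<bar>\<theta>\<bar> * (R * R)"
  have p: "wiener_le (pot v U) B" unfolding B_def by (rule wiener_le_pot[OF v U])
  have B: "0 <= B" by (rule wiener_le_nonneg[OF p])
  have z: "wiener_le (%y. (- \<i> * of_real \<tau>) * pot v U y) (\<tau> * B)"
    using wiener_le_cmult[OF p, of "- \<i> * of_real \<tau>"] \<tau> by (simp add: norm_mult)
  have e: "kick \<tau> v U y - U y + \<i> * of_real \<tau> * nl v U y =
      (exp ((- \<i> * of_real \<tau>) * pot v U y) - 1 - (- \<i> * of_real \<tau>) * pot v U y) * U y" for y
    by (simp add: kick_def nl_def algebra_simps)
  have "wiener_le (%y. kick \<tau> v U y - U y + \<i> * of_real \<tau> * nl v U y) (((\<tau> * B)\<^sup>2 * exp (\<tau> * B)) * R)"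
    unfolding e by (rule wiener_le_mult[OF wiener_le_exp(3)[OF z] U])
  moreover have "((\<tau> * B)\<^sup>2 * exp (\<tau> * B)) * R <= ((\<tau> * B)\<^sup>2 * exp (T * B)) * R"
    using \<tau> B wiener_le_nonneg[OF U] by (intro mult_right_mono mult_left_mono) (auto intro: mult_right_mono)
  ultimately show ?thesis unfolding B_def[symmetric] by (rule wiener_le_mono[OF _ order_trans]) (simp add: power_mult_distrib)
qed

end

context nls_family begin

context
  fixes Q :: "'q set" and \<pi> :: "'q => 'p" and t \<tau> :: "'q => real" and N :: "'q => nat"
  assumes p: "!!q. q \<in> Q ==> \<pi> q \<in> A" and t: "!!q. q \<in> Q ==> 0 <= t q" and \<tau>: "!!q. q \<in> Q ==> 0 <= \<tau> q"
    and fin: "!!q. q \<in> Q ==> t q + \<tau> q <= T" and N: "!!q. q \<in> Q ==> N q >= 1"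
begin

abbreviation (input) "\<phi> \<equiv> half \<pi> t \<tau>"
abbreviation (input) "\<phi>N \<equiv> trunc (half \<pi> t \<tau>) N"
abbreviation (input) "Y \<equiv> bwd \<pi> t \<tau>"
abbreviation (input) "n1 w q \<equiv> nl (v (\<pi> q)) (w q)"
abbreviation (input) "n2 w q y \<equiv> pot (v (\<pi> q)) (w q) y * nl (v (\<pi> q)) (w q) y"

lemma Z: "WZ Q \<phi>" "WZ Q \<phi>N" "WZ Q (%q. v (\<pi> q))" "WZ Q Y"
proof -
  show h: "WZ Q \<phi>" by (rule WZ_half[OF p t \<tau> fin])
  show "WZ Q \<phi>N" by (rule WZ_trunc[OF h N])
  show "WZ Q (%q. v (\<pi> q))" by (rule WZ_v[OF p])
  show "WZ Q Y" by (rule WZ_bwd[OF p t \<tau> fin])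
qed

lemma tau_T: "q \<in> Q ==> \<tau> q <= T"
  using t[of q] fin[of q] by simp

lemma uniform_bounds:
  obtains K R where "K >= 0" "R >= 0" "!!q. q \<in> Q ==> wiener_le (v (\<pi> q)) K" "!!q. q \<in> Q ==> wiener_le (\<phi>N q) R"
proof -
  obtain K where K: "K >= 0" "!!q. q \<in> Q ==> l1_le (FC (v (\<pi> q))) (K * 1)" using W1_bnd[OF WZ_W1[OF Z(3)]] by (rule bnd1E) (rule that)
  obtain R where R: "R >= 0" "!!q. q \<in> Q ==> l1_le (FC (\<phi>N q)) (R * 1)" using W1_bnd[OF WZ_W1[OF Z(2)]] by (rule bnd1E) (rule that)
  show ?thesis
    by (rule that[OF K(1) R(1)]) (use K(2) R(2) WZD[OF Z(3)] WZD[OF Z(2)] in \<open>simp_all add: wiener_le_def\<close>)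
qed

lemma interp_trunc: "q \<in> Q ==> interp_coeff (N q) (\<phi>N q) = cutoff (N q) (FC (\<phi> q))"
  using interp_coeff_trig_cutoff[OF N] by (simp add: trunc_def[OF Z(1) N])

text \<open>Taylor expansion of the numerical step matches the expansion of the exact step term by term. Interpolation
  and truncation errors carry a factor \<open>\<tau>\<close>, except for the leading term, which interpolation reproduces
  exactly.\<close>

lemma local_error_l2:
  "bnd2 Q (%q k. interp_coeff (N q) (kick (\<tau> q) (v (\<pi> q)) (\<phi>N q)) k - cutoff (N q) (FC (Y q)) k)
    (%q. \<tau> q * ((\<tau> q)\<^sup>2 + 1 / real (N q) ^ \<alpha>))"
proof -
  let ?s = "%q. \<tau> q * ((\<tau> q)\<^sup>2 + 1 / real (N q) ^ \<alpha>)"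
  obtain K R where KR: "K >= 0" "R >= 0" "!!q. q \<in> Q ==> wiener_le (v (\<pi> q)) K" "!!q. q \<in> Q ==> wiener_le (\<phi>N q) R"
    by (rule uniform_bounds) (rule that)
  let ?B = "K + \<bar>\<theta>\<bar> * (R * R)"
  have N2: "1 / real (N q) ^ (2 * \<alpha>) <= 1 / real (N q) ^ \<alpha>" if "q \<in> Q" for q
    using N[OF that] by (intro divide_left_mono power_increasing) auto
  have s3: "(\<tau> q) ^ 3 <= 1 * ?s q" if "q \<in> Q" for q
    using \<tau>[OF that] by (simp add: power3_eq_cube power2_eq_square distrib_left)
  have s1: "\<tau> q * (1 / real (N q) ^ (2 * \<alpha>)) <= 1 * ?s q" if "q \<in> Q" for q
    unfolding mult_1 using \<tau>[OF that] N2[OF that] by (intro mult_left_mono) (simp_all add: add_increasing)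
  have s2: "(\<tau> q)\<^sup>2 / 2 * (1 / real (N q) ^ (2 * \<alpha>)) <= T * ?s q" if "q \<in> Q" for q
  proof -
    have "(\<tau> q)\<^sup>2 / 2 * (1 / real (N q) ^ (2 * \<alpha>)) <= T * \<tau> q * (1 / real (N q) ^ (2 * \<alpha>))"
    proof (rule mult_right_mono)
      show "(\<tau> q)\<^sup>2 / 2 <= T * \<tau> q"
        using mult_right_mono[OF tau_T[OF that] \<tau>[OF that]] mult_nonneg_nonneg[OF less_imp_le[OF T] \<tau>[OF that]]
        unfolding power2_eq_square by linarith
    qed simp
    also have "... <= T * ?s q" using mult_left_mono[OF s1[OF that], of T] T by (simp add: mult.assoc)
    finally show ?thesis .
  qed
  have Tay: "bnd2 Q (%q. interp_coeff (N q) (%y. kick (\<tau> q) (v (\<pi> q)) (\<phi>N q) y -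
      (\<phi>N q y - \<i> * of_real (\<tau> q) * n1 \<phi>N q y - of_real ((\<tau> q)\<^sup>2 / 2) * n2 \<phi>N q y))) (%q. (\<tau> q) ^ 3)"
    (is "bnd2 Q ?E0 _")
  proof (rule bnd2I)
    fix q assume q: "q \<in> Q"
    show "l2_le (?E0 q) (exp (T * ?B) * ?B ^ 3 * R * \<tau> q ^ 3)"
      by (rule interp_coeff_sup[OF N[OF q] kick_taylor_sup[OF KR(3)[OF q] KR(4)[OF q] \<tau>[OF q] tau_T[OF q]]])
  qed (use KR in simp)
  have Zn: "WZ Q (n1 \<phi>N)" "WZ Q (n2 \<phi>N)" "WZ Q (n1 \<phi>)" "WZ Q (n2 \<phi>)" by (intro WZ_nl WZ_mult WZ_pot Z)+
  note tr = trunc_W2[OF Z(1) N]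
  note W = WZ_W1[OF Z(3)] WZ_W1[OF Z(1)] WZ_W1[OF Z(2)]
  have d1: "bnd2 Q (%q. FC (%y. n1 \<phi>N q y - n1 \<phi> q y)) (%q. 1 / real (N q) ^ (2 * \<alpha>))" (is "bnd2 Q ?D1 _")
    by (rule W2_bnd[OF nl_W2[OF W tr]])
  have d2: "bnd2 Q (%q. FC (%y. n2 \<phi>N q y - n2 \<phi> q y)) (%q. 1 / real (N q) ^ (2 * \<alpha>))" (is "bnd2 Q ?D2 _")
    by (rule W2_bnd[OF pot_nl_W2[OF W tr]])
  let ?I1 = "%q k. interp_coeff (N q) (n1 \<phi>N q) k - cutoff (N q) (FC (n1 \<phi>N q)) k"
  let ?I2 = "%q k. interp_coeff (N q) (n2 \<phi>N q) k - cutoff (N q) (FC (n2 \<phi>N q)) k"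
  let ?X = "%q y. Y q y - (\<phi> q y - \<i> * of_real (\<tau> q) * n1 \<phi> q y - of_real ((\<tau> q)\<^sup>2 / 2) * n2 \<phi> q y)"
  let ?c1 = "%q. - \<i> * complex_of_real (\<tau> q)" and ?c2 = "%q. - complex_of_real ((\<tau> q)\<^sup>2 / 2)"
  have c1: "norm (?c1 q) * (1 / real (N q) ^ (2 * \<alpha>)) <= 1 * ?s q" if "q \<in> Q" for q
    using s1[OF that] \<tau>[OF that] by (simp add: norm_mult)
  have c2: "norm (?c2 q) * (1 / real (N q) ^ (2 * \<alpha>)) <= T * ?s q" if "q \<in> Q" for q
    using s2[OF that] by (simp only: norm_minus_cancel norm_of_real) simp
  \<comment> \<open>Taylor remainder, interpolation and truncation errors of the two Taylor terms, remainder of the exact step.\<close>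
  have "bnd2 Q (%q k. (?E0 q k + (?c1 q * ?I1 q k + ?c1 q * cutoff (N q) (?D1 q) k)) +
      ((?c2 q * ?I2 q k + ?c2 q * cutoff (N q) (?D2 q) k) + (- 1) * cutoff (N q) (FC (?X q)) k)) ?s"
    (is "bnd2 Q ?sum _")
  proof (intro bnd2_add)
    show "bnd2 Q ?E0 ?s" by (rule bnd2_mono[OF Tay s3]) auto
    show "bnd2 Q (%q k. ?c1 q * ?I1 q k) ?s" by (rule bnd2_cmult[OF bnd2_interp_error[OF Zn(1) N] c1]) auto
    show "bnd2 Q (%q k. ?c2 q * ?I2 q k) ?s" by (rule bnd2_cmult[OF bnd2_interp_error[OF Zn(2) N] c2]) (use T in auto)
    show "bnd2 Q (%q k. ?c1 q * cutoff (N q) (?D1 q) k) ?s" by (rule bnd2_cmult[OF bnd2_cutoff[OF d1] c1]) auto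
    show "bnd2 Q (%q k. ?c2 q * cutoff (N q) (?D2 q) k) ?s" by (rule bnd2_cmult[OF bnd2_cutoff[OF d2] c2]) (use T in auto)
    show "bnd2 Q (%q k. (- 1) * cutoff (N q) (FC (?X q)) k) ?s"
      by (rule bnd2_cmult[OF bnd2_cutoff[OF W2_bnd[OF exact_step_expansion[OF p t \<tau> fin]]], where K = 1 and c = "%_. - 1"]) (use s3 in auto)
  qed
  then show ?thesis
  proof (rule bnd2_le)
    fix q and k :: "int^'n" assume q: "q \<in> Q"
    note w = WZD[OF Z(1) q] WZD[OF Z(4) q] WZD[OF Zn(1) q] WZD[OF Zn(2) q] WZD[OF Zn(3) q] WZD[OF Zn(4) q]
    note wc = wiener_cmult[OF w(5), of "\<i> * of_real (\<tau> q)"] wiener_cmult[OF w(6), of "of_real ((\<tau> q)\<^sup>2 / 2)"]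
    have X: "FC (?X q) k = FC (Y q) k - (FC (\<phi> q) k - \<i> * of_real (\<tau> q) * FC (n1 \<phi> q) k - of_real ((\<tau> q)\<^sup>2 / 2) * FC (n2 \<phi> q) k)"
      unfolding wiener_diff(2)[OF w(2) wiener_diff(1)[OF wiener_diff(1)[OF w(1) wc(1)] wc(3)]]
        wiener_diff(2)[OF wiener_diff(1)[OF w(1) wc(1)] wc(3)] wiener_diff(2)[OF w(1) wc(1)] wc(2) wc(4) ..
    have E0: "?E0 q k = interp_coeff (N q) (kick (\<tau> q) (v (\<pi> q)) (\<phi>N q)) k - (cutoff (N q) (FC (\<phi> q)) k
        - \<i> * of_real (\<tau> q) * interp_coeff (N q) (n1 \<phi>N q) k - of_real ((\<tau> q)\<^sup>2 / 2) * interp_coeff (N q) (n2 \<phi>N q) k)"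
      unfolding interp_coeff_diff interp_coeff_cmult interp_trunc[OF q] ..
    have "?sum q k = interp_coeff (N q) (kick (\<tau> q) (v (\<pi> q)) (\<phi>N q)) k - cutoff (N q) (FC (Y q)) k"
      unfolding E0 wiener_diff(2)[OF w(3,5)] wiener_diff(2)[OF w(4,6)] cutoff_def X
      by (simp add: algebra_simps del: of_real_divide of_real_power)
    then show "norm (interp_coeff (N q) (kick (\<tau> q) (v (\<pi> q)) (\<phi>N q)) k - cutoff (N q) (FC (Y q)) k) <= norm (?sum q k)"
      by simp
  qed
qed

lemma local_error_l1:
  "bnd1 Q (%q k. interp_coeff (N q) (kick (\<tau> q) (v (\<pi> q)) (\<phi>N q)) k - cutoff (N q) (FC (Y q)) k)
    (%q. \<tau> q * (\<tau> q powr (1/8) + real (N q) powr (- 1/4)))"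
proof -
  let ?s = "%q. \<tau> q * (\<tau> q powr (1/8) + real (N q) powr (- 1/4))"
  obtain K R where KR: "K >= 0" "R >= 0" "!!q. q \<in> Q ==> wiener_le (v (\<pi> q)) K" "!!q. q \<in> Q ==> wiener_le (\<phi>N q) R"
    by (rule uniform_bounds) (rule that)
  let ?B = "K + \<bar>\<theta>\<bar> * (R * R)"
  have s1: "\<tau> q * real (N q) powr (- 1/4) <= 1 * ?s q" if "q \<in> Q" for q
    unfolding mult_1 using \<tau>[OF that] by (intro mult_left_mono) auto
  have s8: "\<tau> q * \<tau> q powr (1/8) <= 1 * ?s q" if "q \<in> Q" for q
    unfolding mult_1 using \<tau>[OF that] by (intro mult_left_mono) auto
  have s2: "(\<tau> q)\<^sup>2 <= T powr (7/8) * ?s q" if "q \<in> Q" for q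
  proof -
    have "\<tau> q = \<tau> q powr (7/8) * \<tau> q powr (1/8)"
      using \<tau>[OF that] by (cases "\<tau> q = 0") (simp_all flip: powr_add)
    also have "... <= T powr (7/8) * \<tau> q powr (1/8)"
      using tau_T[OF that] \<tau>[OF that] by (intro mult_right_mono powr_mono2) auto
    finally have "\<tau> q * \<tau> q <= \<tau> q * (T powr (7/8) * \<tau> q powr (1/8))" by (rule mult_left_mono[OF _ \<tau>[OF that]])
    also have "... <= T powr (7/8) * ?s q"
      using mult_left_mono[OF s8[OF that], of "T powr (7/8)"] by (simp add: ac_simps)
    finally show ?thesis by (simp add: power2_eq_square)
  qed
  have Tay: "bnd1 Q (%q. interp_coeff (N q) (%y. kick (\<tau> q) (v (\<pi> q)) (\<phi>N q) y - \<phi>N q y + \<i> * of_real (\<tau> q) * n1 \<phi>N q y)) (%q. (\<tau> q)\<^sup>2)"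
    (is "bnd1 Q ?E0 _")
  proof (rule bnd1I)
    fix q assume q: "q \<in> Q"
    show "l1_le (?E0 q) ((?B\<^sup>2 * exp (T * ?B) * R) * (\<tau> q)\<^sup>2)"
      by (rule wiener_le_imp_interp_coeff[OF N[OF q] kick_taylor_wiener[OF KR(3)[OF q] KR(4)[OF q] \<tau>[OF q] tau_T[OF q]]])
  qed (use KR in simp)
  have Zn: "WZ Q (n1 \<phi>N)" "WZ Q (n1 \<phi>)" by (intro WZ_nl Z)+
  have d1: "bnd1 Q (%q. FC (%y. n1 \<phi>N q y - n1 \<phi> q y)) (%q. real (N q) powr (- 1/4))" (is "bnd1 Q ?D1 _")
    by (rule W1_bnd[OF nl_W1[OF WZ_W1[OF Z(3)] WZ_W1[OF Z(1)] WZ_W1[OF Z(2)] trunc_W1[OF Z(1) N]]])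
  let ?I1 = "%q k. interp_coeff (N q) (n1 \<phi>N q) k - cutoff (N q) (FC (n1 \<phi>N q)) k"
  let ?X = "%q y. Y q y - \<phi> q y + (\<i> * of_real (\<tau> q)) * n1 \<phi> q y"
  let ?c1 = "%q. - \<i> * complex_of_real (\<tau> q)"
  have c1: "norm (?c1 q) * real (N q) powr (- 1/4) <= 1 * ?s q" if "q \<in> Q" for q
    using s1[OF that] \<tau>[OF that] by (simp add: norm_mult)
  \<comment> \<open>Taylor remainder, interpolation and truncation error of the linear term, remainder of the exact step.\<close>
  have "bnd1 Q (%q k. (?E0 q k + (?c1 q * ?I1 q k + ?c1 q * cutoff (N q) (?D1 q) k)) + (- 1) * cutoff (N q) (FC (?X q)) k) ?s"
    (is "bnd1 Q ?sum _")
  proof (intro bnd1_add)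
    show "bnd1 Q ?E0 ?s" by (rule bnd1_mono[OF Tay s2]) auto
    show "bnd1 Q (%q k. ?c1 q * ?I1 q k) ?s" by (rule bnd1_cmult[OF bnd1_interp_error[OF Zn(1) N] c1]) auto
    show "bnd1 Q (%q k. ?c1 q * cutoff (N q) (?D1 q) k) ?s" by (rule bnd1_cmult[OF bnd1_cutoff[OF d1] c1]) auto
    show "bnd1 Q (%q k. (- 1) * cutoff (N q) (FC (?X q)) k) ?s"
      by (rule bnd1_cmult[OF bnd1_cutoff[OF W1_bnd[OF exact_step_W1[OF p t \<tau> fin]]], where K = 1 and c = "%_. - 1"]) (use s8 in auto)
  qed
  then show ?thesis
  proof (rule bnd1_le)
    fix q and k :: "int^'n" assume q: "q \<in> Q"
    note w = WZD[OF Z(1) q] WZD[OF Z(4) q] WZD[OF Zn(1) q] WZD[OF Zn(2) q]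
    note wc = wiener_cmult[OF w(4), of "\<i> * of_real (\<tau> q)"]
    have X: "FC (?X q) k = FC (Y q) k - FC (\<phi> q) k + \<i> * of_real (\<tau> q) * FC (n1 \<phi> q) k"
      unfolding wiener_add(2)[OF wiener_diff(1)[OF w(2,1)] wc(1)] wiener_diff(2)[OF w(2,1)] wc(2) ..
    have E0: "?E0 q k = interp_coeff (N q) (kick (\<tau> q) (v (\<pi> q)) (\<phi>N q)) k - cutoff (N q) (FC (\<phi> q)) k
        + \<i> * of_real (\<tau> q) * interp_coeff (N q) (n1 \<phi>N q) k"
      unfolding interp_coeff_add interp_coeff_diff interp_coeff_cmult interp_trunc[OF q] ..
    have "?sum q k = interp_coeff (N q) (kick (\<tau> q) (v (\<pi> q)) (\<phi>N q)) k - cutoff (N q) (FC (Y q)) k"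
      unfolding E0 wiener_diff(2)[OF w(3,4)] cutoff_def X
      by (simp add: algebra_simps)
    then show "norm (interp_coeff (N q) (kick (\<tau> q) (v (\<pi> q)) (\<phi>N q)) k - cutoff (N q) (FC (Y q)) k) <= norm (?sum q k)"
      by simp
  qed
qed

lemma step_exact:
  assumes q: "q \<in> Q"
  shows "step (N q) (\<tau> q) (v (\<pi> q)) (cutoff (N q) (FC (u (\<pi> q) (t q)))) k - cutoff (N q) (FC (u (\<pi> q) (t q + \<tau> q))) k
    = drift (\<tau> q / 2) (%k. interp_coeff (N q) (kick (\<tau> q) (v (\<pi> q)) (\<phi>N q)) k - cutoff (N q) (FC (Y q)) k) k"
proof -
  have w: "wiener (u (\<pi> q) (t q))" "wiener (u (\<pi> q) (t q + \<tau> q))"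
    by (rule u_wiener; use p[OF q] t[OF q] \<tau>[OF q] fin[OF q] in simp)+
  have h: "trig_series (drift (\<tau> q / 2) (cutoff (N q) (FC (u (\<pi> q) (t q))))) = \<phi>N q"
  proof -
    have "\<phi>N q = trig_series (cutoff (N q) (FC (\<phi> q)))" by (simp add: trunc_def[OF Z(1) N])
    also have "FC (\<phi> q) = drift (\<tau> q / 2) (FC (u (\<pi> q) (t q)))"
      by (simp add: half_def[OF p t \<tau> fin] FC_flow[OF w(1)] drift_def[abs_def])
    finally show ?thesis by (simp add: cutoff_drift)
  qed
  have b: "drift (\<tau> q / 2) (cutoff (N q) (FC (Y q))) k = cutoff (N q) (FC (u (\<pi> q) (t q + \<tau> q))) k"
  proof -
    have "FC (Y q) = drift (- (\<tau> q / 2)) (FC (u (\<pi> q) (t q + \<tau> q)))"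
      by (simp add: bwd_def[OF p t \<tau> fin] FC_flow[OF w(2)] drift_def[abs_def])
    then show ?thesis by (auto simp: drift_def cutoff_def cis_mult simp flip: mult.assoc)
  qed
  show ?thesis by (simp only: step_def h b[symmetric] drift_diff)
qed

lemma step_exact_l2:
  "bnd2 Q (%q k. step (N q) (\<tau> q) (v (\<pi> q)) (cutoff (N q) (FC (u (\<pi> q) (t q)))) k - cutoff (N q) (FC (u (\<pi> q) (t q + \<tau> q))) k)
    (%q. \<tau> q * ((\<tau> q)\<^sup>2 + 1 / real (N q) ^ \<alpha>))"
  by (rule bnd2_le[OF local_error_l2]) (simp add: step_exact norm_drift)

lemma step_exact_l1:
  "bnd1 Q (%q k. step (N q) (\<tau> q) (v (\<pi> q)) (cutoff (N q) (FC (u (\<pi> q) (t q)))) k - cutoff (N q) (FC (u (\<pi> q) (t q + \<tau> q))) k)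
    (%q. \<tau> q * (\<tau> q powr (1/8) + real (N q) powr (- 1/4)))"
  by (rule bnd1_le[OF local_error_l1]) (simp add: step_exact norm_drift)

end

end

section \<open>Convergence of the numerical Fourier coefficients\<close>

text \<open>The step estimate may be restricted to errors at most \<open>Z\<close>: the bound itself guarantees that this range is
  never left.\<close>

lemma gronwall_steps:
  fixes B :: "nat => real => bool"
  assumes start: "B 0 e"
    and step: "!!m E. m < M ==> B m E ==> E <= Z ==> B (Suc m) ((1 + L * \<tau>) * E + \<tau> * \<epsilon>)"
    and mono: "!!m E E'. B m E ==> E <= E' ==> B m E'"
    and pos: "0 <= L" "0 <= \<tau>" "0 <= e" "0 <= \<epsilon>"
    and Z: "exp (L * (real M * \<tau>)) * (e + real M * \<tau> * \<epsilon>) <= Z" and m: "m <= M"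
  shows "B m (exp (L * (real M * \<tau>)) * (e + real M * \<tau> * \<epsilon>))"
proof -
  let ?E = "%m. exp (L * (real m * \<tau>)) * (e + real m * \<tau> * \<epsilon>)"
  have le: "?E m <= ?E M" if "m <= M" for m
    using that pos by (intro mult_mono add_mono) (auto intro!: mult_left_mono mult_right_mono)
  have "B m (?E m)" using m
  proof (induction m)
    case 0
    then show ?case using start by simp
  next
    case (Suc m)
    have "B (Suc m) ((1 + L * \<tau>) * ?E m + \<tau> * \<epsilon>)"
    proof (rule step)
      show "?E m <= Z" using le[of m] Z Suc.prems by linarith
    qed (use Suc in auto)
    moreover have "(1 + L * \<tau>) * ?E m + \<tau> * \<epsilon> <= ?E (Suc m)"
    proof -
      have "(1 + L * \<tau>) * ?E m <= exp (L * \<tau>) * ?E m"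
        using pos by (intro mult_right_mono exp_ge_add_one_self) auto
      also have "... = exp (L * (real (Suc m) * \<tau>)) * (e + real m * \<tau> * \<epsilon>)"
        by (simp add: algebra_simps flip: exp_add)
      finally have 1: "(1 + L * \<tau>) * ?E m <= exp (L * (real (Suc m) * \<tau>)) * (e + real m * \<tau> * \<epsilon>)" .
      have "1 * (\<tau> * \<epsilon>) <= exp (L * (real (Suc m) * \<tau>)) * (\<tau> * \<epsilon>)"
        using pos by (intro mult_right_mono) auto
      with 1 have "(1 + L * \<tau>) * ?E m + \<tau> * \<epsilon> <= exp (L * (real (Suc m) * \<tau>)) * (e + real m * \<tau> * \<epsilon>) + exp (L * (real (Suc m) * \<tau>)) * (\<tau> * \<epsilon>)"
        by linarith
      also have "... = ?E (Suc m)" by (simp add: distrib_left distrib_right)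
      finally show ?thesis .
    qed
    ultimately show ?case by (rule mono)
  qed
  then show ?thesis by (rule mono[OF _ le[OF m]])
qed

lemma powr_eighth_power: "x > 0 ==> (x powr (1/8)) ^ 16 = x\<^sup>2" for x :: real
proof -
  assume x: "x > 0"
  have "(x powr (1/8)) ^ 16 = x powr (1/8 * real 16)" using x by (subst powr_power) auto
  also have "... = x powr real 2" by simp
  also have "... = x\<^sup>2" by (rule powr_realpow[OF x])
  finally show ?thesis .
qed

lemma powr_minus_quarter_power: "x > 0 ==> (x powr (- 1/4)) ^ (4 * a) = 1 / x ^ a" for x :: real
proof -
  assume x: "x > 0"
  have "(x powr (- 1/4)) ^ (4 * a) = x powr (- 1/4 * real (4 * a))" using x by (subst powr_power) auto
  also have "... = x powr (- real a)" by simp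
  also have "... = 1 / x ^ a" using x by (simp only: powr_minus_divide powr_realpow)
  finally show ?thesis .
qed

context nls_family begin

text \<open>The Wiener norm of the numerical solution is controlled first, with a low rate: then the
  mean-square error can be propagated with a Lipschitz constant that is uniform in all steps. Where
  the low rate gives nothing, \<open>\<tau>\<^sup>2 + N\<^sup>-\<^sup>\<alpha>\<close> is bounded below and it suffices that
  the numerical mass does not grow.\<close>

theorem num_converges:
  "\<exists>C\<ge>0. \<forall>p\<in>A. \<forall>M\<ge>1. \<forall>N\<ge>1. \<forall>m\<le>M.
    l2_le (%k. num N (T / real M) (v p) (u p 0) m k - FC (u p (real m * (T / real M))) k)
      (C * ((T / real M)\<^sup>2 + 1 / real N ^ \<alpha>))"
proof -
  define Q where "Q = {(p, M, N, m). p \<in> A \<and> M >= (1::nat) \<and> N >= (1::nat) \<and> m < (M::nat)}"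
  define Mq Nq mq :: "'p \<times> nat \<times> nat \<times> nat => nat" where "Mq q = fst (snd q)" and "Nq q = fst (snd (snd q))" and "mq q = snd (snd (snd q))" for q
  define \<tau>q where "\<tau>q q = T / real (Mq q)" for q
  define tq where "tq q = real (mq q) * \<tau>q q" for q
  have Q: "fst q \<in> A" "0 <= tq q" "0 <= \<tau>q q" "tq q + \<tau>q q <= T" "Nq q >= 1" if "q \<in> Q" for q
  proof -
    obtain p M N m where q: "q = (p, M, N, m)" by (cases q)
    have M: "M >= 1" "m < M" and "p \<in> A" "N >= 1" using that by (auto simp: Q_def q)
    then show "fst q \<in> A" "Nq q >= 1" by (simp_all add: q Nq_def)
    show "0 <= tq q" "0 <= \<tau>q q" using T by (simp_all add: tq_def \<tau>q_def)
    have "tq q + \<tau>q q = real (Suc m) * T / real M" by (simp add: tq_def \<tau>q_def q Mq_def mq_def algebra_simps add_divide_distrib)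
    also have "... <= T" using M T by (simp add: divide_le_eq mult_right_mono)
    finally show "tq q + \<tau>q q <= T" .
  qed
  obtain C2 where C2: "C2 >= 0" "!!q. q \<in> Q ==> l2_le (%k. step (Nq q) (\<tau>q q) (v (fst q)) (cutoff (Nq q) (FC (u (fst q) (tq q)))) k - cutoff (Nq q) (FC (u (fst q) (tq q + \<tau>q q))) k)
      (C2 * (\<tau>q q * ((\<tau>q q)\<^sup>2 + 1 / real (Nq q) ^ \<alpha>)))"
    using step_exact_l2[of Q fst tq \<tau>q Nq, OF Q] by (rule bnd2E) (assumption | rule that)+
  obtain C1 where C1: "C1 >= 0" "!!q. q \<in> Q ==> l1_le (%k. step (Nq q) (\<tau>q q) (v (fst q)) (cutoff (Nq q) (FC (u (fst q) (tq q)))) k - cutoff (Nq q) (FC (u (fst q) (tq q + \<tau>q q))) k)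
      (C1 * (\<tau>q q * (\<tau>q q powr (1/8) + real (Nq q) powr (- 1/4))))"
    using step_exact_l1[of Q fst tq \<tau>q Nq, OF Q] by (rule bnd1E) (assumption | rule that)+
  define Q0 where "Q0 = A \<times> {N :: nat. N >= 1}"
  have Z0: "WZ Q0 (%q. u (fst q) 0)" by (rule WZ_u) (use T in \<open>auto simp: Q0_def\<close>)
  have N0: "snd q >= 1" if "q \<in> Q0" for q using that by (auto simp: Q0_def)
  obtain D2 where D2: "D2 >= 0" "!!q. q \<in> Q0 ==> l2_le (%k. interp_coeff (snd q) (u (fst q) 0) k - cutoff (snd q) (FC (u (fst q) 0)) k) (D2 * (1 / real (snd q) ^ (2 * \<alpha>)))"
    using bnd2_interp_error[OF Z0 N0] by (rule bnd2E) (auto intro: that)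
  obtain D1 where D1: "D1 >= 0" "!!q. q \<in> Q0 ==> l1_le (%k. interp_coeff (snd q) (u (fst q) 0) k - cutoff (snd q) (FC (u (fst q) 0)) k) (D1 * real (snd q) powr (- 1/4))"
    using bnd1_interp_error[OF Z0 N0] by (rule bnd1E) (auto intro: that)
  have "WZ (A \<times> {0..T}) (%z. u (fst z) (snd z))" "WZ A v" by (rule WZ_u WZ_v; auto)+
  then obtain R0 K where R0: "R0 >= 0" "!!z. z \<in> A \<times> {0..T} ==> l1_le (FC (u (fst z) (snd z))) (R0 * 1)"
    and K: "K >= 0" "!!p. p \<in> A ==> l1_le (FC (v p)) (K * 1)"
    by (auto elim!: bnd1E dest!: WZ_W1 W1_bnd)
  \<comment> \<open>The numerical solution will stay within distance \<open>1\<close> of the truncated exact one.\<close>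
  define R where "R = R0 + 1"
  have R: "0 <= R" using R0 by (simp add: R_def)
  obtain L1 where L1: "L1 >= 0" "!!N \<tau> v a b \<delta>. N >= 1 ==> 0 <= \<tau> ==> \<tau> <= T ==> wiener_le v K ==> l1_le a R ==> l1_le b R ==> \<delta> <= 1 ==>
      l1_le (%k. a k - b k) \<delta> ==> l1_le (%k. step N \<tau> v a k - step N \<tau> v b k) ((1 + L1 * \<tau>) * \<delta>)"
    by (rule step_diff_l1[OF K(1) R]) (rule that)
  define L2 where "L2 = 2 * \<bar>\<theta>\<bar> * R * R"
  have L2: "0 <= L2" using R by (simp add: L2_def)
  define G where "G = exp (L1 * T) * (D1 + T * C1) + 1"
  have G: "G > 0" using C1 D1 T by (simp add: G_def add_nonneg_pos)
  \<comment> \<open>If the a priori bound fails, one of the two terms of the low rate is at least \<open>c\<close>; then \<open>\<tau>\<^sup>2 + N\<^sup>-\<^sup>\<alpha>\<close> is at least \<open>\<omega>\<close>.\<close>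
  define c where "c = 1 / (2 * G)"
  have c: "c > 0" using G by (simp add: c_def)
  define \<omega> where "\<omega> = min (c ^ 16) (c ^ (4 * \<alpha>))"
  have \<omega>: "\<omega> > 0" using c by (simp add: \<omega>_def)
  define C where "C = exp (L2 * T) * (D2 + T * C2) + Cu + 2 * R0 / \<omega>"
  have parts: "0 <= exp (L2 * T) * (D2 + T * C2)" "0 <= Cu" "0 <= 2 * R0 / \<omega>"
    using C2 D2 T R0 \<omega> u_bound by simp_all
  show ?thesis
  proof (intro exI[of _ C] conjI ballI allI impI)
    show "0 <= C" using parts by (simp add: C_def)
    fix p and M N m :: nat assume p: "p \<in> A" and M: "M >= 1" and N: "N >= 1" and m: "m <= M"
    define \<tau> where "\<tau> = T / real M"
    define g where "g = \<tau>\<^sup>2 + 1 / real N ^ \<alpha>"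
    define a where "a = num N \<tau> (v p) (u p 0)"
    define b where "b i = cutoff N (FC (u p (real i * \<tau>)))" for i
    have \<tau>: "0 < \<tau>" "\<tau> <= T" "real M * \<tau> = T" using T M by (simp_all add: \<tau>_def divide_le_eq)
    have g: "0 <= g" "\<tau>\<^sup>2 <= g" "1 / real N ^ \<alpha> <= g" using N by (simp_all add: g_def)
    have N2: "1 / real N ^ (2 * \<alpha>) <= g"
      using N by (intro order_trans[OF _ g(3)] divide_left_mono power_increasing) auto
    have time: "real i * \<tau> \<in> {0..T}" if "i <= M" for i
      using that \<tau> mult_right_mono[of "real i" "real M" \<tau>] by auto
    have uR: "l1_le (FC (u p s)) R0" if "s \<in> {0..T}" for s using R0(2)[of "(p, s)"] p that by simp
    have bR: "l1_le (b i) R0" if "i <= M" for i unfolding b_def by (rule l1_le_cutoff[OF uR[OF time[OF that]]])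
    have vK: "wiener_le (v p) K" using K(2)[OF p] v_wiener[OF p] by (simp add: wiener_le_def)
    have u0: "norm (u p 0 y) <= R0" for y by (rule wiener_norm_le[OF u_wiener[OF p] uR]) (use T in auto)
    have init1: "l1_le (%k. a 0 k - b 0 k) (D1 * real N powr (- 1/4))"
      and init2: "l2_le (%k. a 0 k - b 0 k) (D2 * (1 / real N ^ (2 * \<alpha>)))"
      using D1(2)[of "(p, N)"] D2(2)[of "(p, N)"] p N by (simp_all add: Q0_def a_def b_def)
    have loc: "l1_le (%k. step N \<tau> (v p) (b i) k - b (Suc i) k) (\<tau> * (C1 * (\<tau> powr (1/8) + real N powr (- 1/4))))"
      "l2_le (%k. step N \<tau> (v p) (b i) k - b (Suc i) k) (\<tau> * (C2 * g))" if "i < M" for i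
    proof -
      have q: "(p, M, N, i) \<in> Q" using p M N that by (simp add: Q_def)
      have "real i * \<tau> + \<tau> = real (Suc i) * \<tau>" by (simp add: distrib_right)
      moreover have "\<tau>q (p, M, N, i) = \<tau>" "tq (p, M, N, i) = real i * \<tau>" "Nq (p, M, N, i) = N"
        by (simp_all add: tq_def \<tau>q_def Mq_def mq_def Nq_def \<tau>_def)
      ultimately have e: "real i * \<tau> + \<tau> = real (Suc i) * \<tau>" "\<tau>q (p, M, N, i) = \<tau>" "tq (p, M, N, i) = real i * \<tau>" "Nq (p, M, N, i) = N" by auto
      show "l1_le (%k. step N \<tau> (v p) (b i) k - b (Suc i) k) (\<tau> * (C1 * (\<tau> powr (1/8) + real N powr (- 1/4))))"
        using C1(2)[OF q] unfolding e fst_conv b_def by (simp only: mult.left_commute)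
      show "l2_le (%k. step N \<tau> (v p) (b i) k - b (Suc i) k) (\<tau> * (C2 * g))"
        using C2(2)[OF q] unfolding e fst_conv b_def g_def by (simp only: mult.left_commute)
    qed
    have split: "a (Suc i) k - b (Suc i) k = (step N \<tau> (v p) (a i) k - step N \<tau> (v p) (b i) k) + (step N \<tau> (v p) (b i) k - b (Suc i) k)" for i k
      by (simp add: a_def)
    have tail: "l2_le (%k. b m k - FC (u p (real m * \<tau>)) k) (Cu * g)"
    proof -
      have "l2_le (%k. - (if k \<in> freq_box N then 0 else FC (u p (real m * \<tau>)) k)) (Cu / real N ^ (2 * \<alpha>))"
        unfolding l2_le_uminus by (rule tail_l2_le[OF N u_bound(2)[OF p time[OF m]]])
      then show ?thesis
        by (rule l2_le_mono) (use mult_left_mono[OF N2 u_bound(1)] in \<open>simp_all add: b_def cutoff_def\<close>)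
    qed
    have "l2_le (%k. a m k - b m k) ((exp (L2 * T) * (D2 + T * C2) + 2 * R0 / \<omega>) * g)"
    proof (cases "G * (\<tau> powr (1/8) + real N powr (- 1/4)) <= 1")
      case True
      let ?r = "\<tau> powr (1/8) + real N powr (- 1/4)"
      have r: "0 <= ?r" by simp
      have small: "exp (L1 * (real M * \<tau>)) * (D1 * real N powr (- 1/4) + real M * \<tau> * (C1 * ?r)) <= 1"
      proof -
        have "exp (L1 * T) * (D1 * real N powr (- 1/4) + T * (C1 * ?r)) <= exp (L1 * T) * (D1 * ?r + T * (C1 * ?r))"
          using D1 by (intro mult_left_mono add_right_mono) auto
        also have "... <= G * ?r" using r by (simp add: G_def algebra_simps)
        also have "... <= 1" by (rule True)
        finally show ?thesis by (simp add: \<tau>)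
      qed
      have close: "l1_le (a i) R" if "i <= M" "l1_le (%k. a i k - b i k) E" "E <= 1" for i E
        using l1_le_add[OF l1_le_le[OF that(2,3)] bR[OF that(1)]] by (simp add: R_def add.commute)
      have l1: "l1_le (%k. a i k - b i k) 1" if "i <= M" for i
      proof (rule l1_le_le[OF _ small])
        show "l1_le (%k. a i k - b i k) (exp (L1 * (real M * \<tau>)) * (D1 * real N powr (- 1/4) + real M * \<tau> * (C1 * ?r)))"
        proof (rule gronwall_steps[where B = "%i. l1_le (%k. a i k - b i k)", OF init1 _ _ _ _ _ _ small that])
          fix i E assume i: "i < M" and E: "l1_le (%k. a i k - b i k) E" "E <= 1"
          have "l1_le (%k. step N \<tau> (v p) (a i) k - step N \<tau> (v p) (b i) k) ((1 + L1 * \<tau>) * E)"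
            by (rule L1(2)[OF N _ \<tau>(2) vK close[OF _ E] _ E(2) E(1)]) (use \<tau> i l1_le_le[OF bR[of i]] in \<open>auto simp: R_def\<close>)
          from l1_le_add[OF this loc(1)[OF i]]
          show "l1_le (%k. a (Suc i) k - b (Suc i) k) ((1 + L1 * \<tau>) * E + \<tau> * (C1 * ?r))" by (simp only: split)
        qed (use L1 \<tau> D1 C1 in \<open>auto intro: l1_le_le\<close>)
      qed
      have "l2_le (%k. a m k - b m k) (exp (L2 * (real M * \<tau>)) * (D2 * (1 / real N ^ (2 * \<alpha>)) + real M * \<tau> * (C2 * g)))"
      proof (rule gronwall_steps[where B = "%i. l2_le (%k. a i k - b i k)", OF init2 _ _ _ _ _ _ order_refl m])
        fix i E assume i: "i < M" and E: "l2_le (%k. a i k - b i k) E"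
        have i': "i <= M" using i by simp
        have "l2_le (%k. step N \<tau> (v p) (a i) k - step N \<tau> (v p) (b i) k) ((1 + L2 * \<tau>) * E)"
          unfolding L2_def
        proof (rule step_diff_l2[OF N _ v_real[OF p] close[OF i' l1[OF i'] order_refl] _ _ _ E])
          show "cutoff N (a i) = a i" "cutoff N (b i) = b i" by (simp_all add: a_def b_def cutoff_num cutoff_cutoff)
          show "l1_le (b i) R" by (rule l1_le_le[OF bR[OF i']]) (simp add: R_def)
        qed (use \<tau> in simp)
        from l2_le_add[OF this loc(2)[OF i]]
        show "l2_le (%k. a (Suc i) k - b (Suc i) k) ((1 + L2 * \<tau>) * E + \<tau> * (C2 * g))" by (simp only: split)
      qed (use L2 \<tau> D2 C2 g in \<open>auto intro: l2_le_le\<close>)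
      then show ?thesis
      proof (rule l2_le_le)
        have "exp (L2 * T) * (D2 * (1 / real N ^ (2 * \<alpha>)) + T * (C2 * g)) <= exp (L2 * T) * (D2 * g + T * (C2 * g))"
          using D2 N2 by (intro mult_left_mono add_right_mono) auto
        also have "... <= (exp (L2 * T) * (D2 + T * C2) + 2 * R0 / \<omega>) * g"
          using mult_nonneg_nonneg[OF parts(3) g(1)] by (simp add: algebra_simps)
        finally show "exp (L2 * (real M * \<tau>)) * (D2 * (1 / real N ^ (2 * \<alpha>)) + real M * \<tau> * (C2 * g)) <= (exp (L2 * T) * (D2 + T * C2) + 2 * R0 / \<omega>) * g"
          by (simp only: \<tau>)
      qed
    next
      case False
      then have "2 * c < \<tau> powr (1/8) + real N powr (- 1/4)" using G by (simp add: c_def field_simps)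
      then consider "c <= \<tau> powr (1/8)" | "c <= real N powr (- 1/4)" by linarith
      then have "\<omega> <= g"
      proof cases
        case 1
        have "c ^ 16 <= (\<tau> powr (1/8)) ^ 16" using c by (intro power_mono 1) simp
        then have "c ^ 16 <= g" unfolding powr_eighth_power[OF \<tau>(1)] using g(2) by linarith
        then show ?thesis unfolding \<omega>_def by linarith
      next
        case 2
        have "c ^ (4 * \<alpha>) <= (real N powr (- 1/4)) ^ (4 * \<alpha>)" using c by (intro power_mono 2) simp
        then have "c ^ (4 * \<alpha>) <= g" using powr_minus_quarter_power[of "real N" \<alpha>] N g(3) by simp
        then show ?thesis unfolding \<omega>_def by linarith
      qed
      then have "2 * R0 / \<omega> * \<omega> <= 2 * R0 / \<omega> * g" by (rule mult_left_mono[OF _ parts(3)])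
      then have le: "2 * R0 <= 2 * R0 / \<omega> * g" using \<omega> by simp
      have "l2_le (a m) R0" unfolding a_def by (rule num_l2_le[OF N v_real[OF p] u0])
      from l2_le_diff[OF this l1_le_imp_l2_le[OF bR[OF m]]]
      show ?thesis
      proof (rule l2_le_le)
        show "R0 + R0 <= (exp (L2 * T) * (D2 + T * C2) + 2 * R0 / \<omega>) * g"
          using le mult_nonneg_nonneg[OF parts(1) g(1)] by (simp add: distrib_right)
      qed
    qed
    from l2_le_add[OF this tail] show "l2_le (%k. num N (T / real M) (v p) (u p 0) m k - FC (u p (real m * (T / real M))) k)
        (C * ((T / real M)\<^sup>2 + 1 / real N ^ \<alpha>))"
      by (simp add: a_def \<tau>_def[symmetric] g_def[symmetric] C_def algebra_simps)
  qed
qed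

end

section \<open>From Fourier coefficients to the quasiperiodic problem\<close>

lemma X_norm_l2_le:
  assumes U: "U \<in> X_space \<alpha>" and C: "X_norm \<alpha> U <= C"
  shows "l2_le (%k. zw \<alpha> k * norm (fourier_coeff U k)) C"
proof (rule l2_le_sumI)
  let ?f = "%k. (1 + norm (rvec k) ^ (4 * \<alpha>)) * (cmod (fourier_coeff U k))\<^sup>2"
  have s: "?f summable_on UNIV" using U by (simp add: X_space_def)
  have n: "0 <= infsum ?f UNIV" by (intro infsum_nonneg mult_nonneg_nonneg) auto
  have "0 <= X_norm \<alpha> U" using n by (simp add: X_norm_def)
  then show "C >= 0" using C by linarith
  fix F :: "(int^'a) set" assume F: "finite F"
  have "(\<Sum>k\<in>F. (norm (zw \<alpha> k * norm (fourier_coeff U k)))\<^sup>2) = (\<Sum>k\<in>F. ?f k)"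
    by (intro sum.cong) (simp_all add: power_mult_distrib zw_square)
  also have "... <= infsum ?f UNIV" by (rule finite_sum_le_infsum[OF s F]) auto
  also have "... = (X_norm \<alpha> U)\<^sup>2" using n by (simp add: X_norm_def)
  also have "... <= C\<^sup>2" using C n by (intro power_mono) (auto simp: X_norm_def)
  finally show "(\<Sum>k\<in>F. (norm (zw \<alpha> k * norm (fourier_coeff U k)))\<^sup>2) <= C\<^sup>2" .
qed

text \<open>Conjugating the parent gives another parent of the same real function.\<close>

lemma parent_real:
  assumes P: "projection_matrix P" and V: "quasiperiodic P V" "!!x. V x \<in> \<real>"
  shows "cnj (parent P V y) = parent P V y"
proof -
  note qp = quasiperiodic_parent[OF P V(1)]
  have "is_parent P (%y. cnj (parent P V y)) V"
  proof (rule is_parentI[OF torus_continuous_cnj[OF qp(1)]])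
    show "V x = cnj (parent P V (transpose P *v x))" for x
      using V(2)[of x] qp(2)[of x] by (simp add: Reals_cnj_iff)
  qed
  from parent_eq[OF P this] show ?thesis by (simp add: fun_eq_iff)
qed

lemma cutoff_l1: "\<exists>r. l1_le (cutoff N a) r"
  unfolding cutoff_def[abs_def] by (rule exI, rule finite_support_l1_le, rule finite_freq_box)

lemma torus_interp_trig_series: "torus_interp N U y = trig_series (interp_coeff N U) y"
  using wiener_eq_trig_series[OF wiener_torus_interp(1), of N U] by (simp add: wiener_torus_interp(2))

context nls_setting begin

lemma free_flow_trig_series:
  assumes "l1_le b r"
  shows "free_flow P t (%x. trig_series b (transpose P *v x)) x = trig_series (drift t b) (transpose P *v x)"
proof -
  have "parent P (%x. trig_series b (transpose P *v x)) = trig_series b"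
    by (rule parent_orbit[OF proj torus_continuous_trig_series[OF assms]])
  then show ?thesis
    unfolding free_flow_def trig_series_def[of "drift t b"]
    by (simp add: wiener_trig_series(2)[OF assms] drift_def lam_def chr_orbit)
qed

text \<open>All intermediate functions of the scheme are continuous functions on the torus restricted to the orbit, so
  each \<open>parent\<close> in it can be evaluated by uniqueness.\<close>

lemma strang_eq_num:
  assumes V: "quasiperiodic P V" and N: "N >= 1"
  shows "strang P \<theta> V \<psi>0 \<tau> N m = (%x. trig_series (num N \<tau> (parent P V) (parent P \<psi>0) m) (transpose P *v x))"
proof (induction m)
  case 0
  show ?case by (rule ext) (simp add: interp_eq_torus_interp torus_interp_trig_series)
next
  case (Suc m)
  define v a where "v = parent P V" and "a = num N \<tau> (parent P V) (parent P \<psi>0) m"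
  define W where "W = trig_series (drift (\<tau> / 2) a)"
  have ca: "cutoff N a = a" by (simp add: a_def cutoff_num)
  obtain r where r: "l1_le a r" using cutoff_l1[of N a] unfolding ca by blast
  have I: "interp P N (strang P \<theta> V \<psi>0 \<tau> N m) = (%x. trig_series a (transpose P *v x))"
  proof (rule ext)
    fix x
    have "parent P (strang P \<theta> V \<psi>0 \<tau> N m) = trig_series a"
      unfolding Suc a_def[symmetric] by (rule parent_orbit[OF proj torus_continuous_trig_series[OF r]])
    then show "interp P N (strang P \<theta> V \<psi>0 \<tau> N m) x = trig_series a (transpose P *v x)"
      using interp_coeff_trig_cutoff[OF N, of a] by (simp add: interp_eq_torus_interp torus_interp_trig_series ca)
  qed
  define \<phi> where "\<phi> = free_flow P (\<tau> / 2) (interp P N (strang P \<theta> V \<psi>0 \<tau> N m))"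
  have \<phi>: "\<phi> x = W (transpose P *v x)" for x
    unfolding \<phi>_def I W_def by (rule free_flow_trig_series[OF r])
  have tW: "torus_continuous W" unfolding W_def by (rule torus_continuous_trig_series[of _ r]) (simp add: l1_le_drift r)
  have tv: "torus_continuous v" "V x = v (transpose P *v x)" for x
    unfolding v_def by (rule quasiperiodic_parent[OF proj V])+
  have tk: "torus_continuous (kick \<tau> v W)"
  proof -
    have "torus_continuous (%y. exp ((- \<i> * of_real \<tau>) * (v y + of_real \<theta> * (W y * cnj (W y)))))"
      by (rule torus_continuous_compose[of _ exp])
        (intro torus_continuous_mult torus_continuous_add torus_continuous_const torus_continuous_cnj tW tv(1) continuous_intros)+
    then show ?thesis unfolding kick_def[abs_def] pot_def by (rule torus_continuous_mult[OF _ tW])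
  qed
  let ?h = "%x. exp (- \<i> * of_real \<tau> * (V x + of_real (\<theta> * (cmod (\<phi> x))\<^sup>2))) * \<phi> x"
  have h: "?h = (%x. kick \<tau> v W (transpose P *v x))"
    by (rule ext) (simp add: kick_def pot_def \<phi> tv(2) complex_norm_square[symmetric])
  have "interp P N ?h = (%x. trig_series (interp_coeff N (kick \<tau> v W)) (transpose P *v x))"
    unfolding h by (rule ext) (simp add: interp_eq_torus_interp torus_interp_trig_series parent_orbit[OF proj tk])
  moreover obtain s where s: "l1_le (interp_coeff N (kick \<tau> v W)) s"
    using cutoff_l1[of N "interp_coeff N (kick \<tau> v W)"] unfolding cutoff_interp_coeff by blast
  ultimately have "free_flow P (\<tau> / 2) (interp P N ?h) x = trig_series (drift (\<tau> / 2) (interp_coeff N (kick \<tau> v W))) (transpose P *v x)" for x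
    using free_flow_trig_series[OF s] by simp
  then show ?case
    by (simp add: fun_eq_iff Let_def \<phi>_def[symmetric] step_def W_def v_def a_def)
qed

lemma wiener_if_zw:
  assumes "torus_continuous U" "l2_le (%k. zw \<alpha> k * norm (FC U k)) r" shows "wiener U"
proof -
  have "bndz {()} (%_. FC U) (%_. 1)"
    unfolding bndz_def by (rule bnd2I[OF l2_le_nonneg[OF assms(2)]]) (simp add: assms(2))
  from bndz_imp_bnd1[OF this] obtain C where "l1_le (FC U) (C * 1)" by (auto elim: bnd1E)
  then show ?thesis by (rule wienerI[OF assms(1)])
qed

lemma NLS_fourier_ode:
  assumes V: "quasiperiodic P V" "l2_le (%k. zw \<alpha> k * norm (FC (parent P V) k)) Cv"
    and \<psi>: "!!s. s \<in> {0..T} ==> quasiperiodic P (\<psi> s)"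
      "!!s. s \<in> {0..T} ==> l2_le (%k. zw \<alpha> k * norm (FC (parent P (\<psi> s)) k)) Cu" "0 <= Cu"
    and nls: "NLS_solution \<theta> T V \<psi>0 \<psi>" and t: "t \<in> {0..T}"
  shows "((%s. - \<i> * (of_real (lam k) * FC (parent P (\<psi> s)) k + FC (nl (parent P V) (parent P (\<psi> s))) k))
    has_integral (FC (parent P (\<psi> t)) k - FC (parent P (\<psi> 0)) k)) {0..t}"
proof -
  let ?v = "parent P V" and ?u = "%s. parent P (\<psi> s)"
  note pV = quasiperiodic_parent[OF proj V(1)]
  note pu = quasiperiodic_parent[OF proj \<psi>(1)]
  have wv: "wiener ?v" by (rule wiener_if_zw[OF pV(1) V(2)])
  have wu: "wiener (?u s)" if "s \<in> {0..T}" for s by (rule wiener_if_zw[OF pu(1)[OF that] \<psi>(2)[OF that]])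
  have "bndz {0..T} (%s. FC (?u s)) (%_. 1)" unfolding bndz_def by (rule bnd2I[OF \<psi>(3)]) (simp add: \<psi>(2))
  from bndz_imp_bnd1[OF this] obtain B where B: "B >= 0" "!!s. s \<in> {0..T} ==> l1_le (FC (?u s)) (B * 1)"
    by (rule bnd1E) (rule that)
  have uB: "wiener_le (?u s) B" if "s \<in> {0..T}" for s using B(2)[OF that] wu[OF that] by (simp add: wiener_le_def)
  obtain K where K: "wiener_le ?v K" using wv by (auto simp: wiener_le_def wiener_def)
  have nB: "wiener_le (nl ?v (?u s)) ((K + \<bar>\<theta>\<bar> * (B * B)) * B)" if "s \<in> {0..T}" for s
    unfolding nl_def[abs_def] by (rule wiener_le_mult[OF wiener_le_pot[OF K uB[OF that]] uB[OF that]])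
  have cont: "continuous_on UNIV (partial j (partial j (\<psi> s)))" if "s \<in> {0..T}" for j s
  proof -
    have c: "continuous_on ({0..T} \<times> UNIV) (%(t, x). partial j (partial j (\<psi> t)) x)"
      using nls by (simp add: NLS_solution_def)
    have "continuous_on UNIV (%x. (case (s, x) of (t, x) => partial j (partial j (\<psi> t)) x))"
      by (rule continuous_on_compose2[OF c]) (use that in \<open>auto intro: continuous_intros\<close>)
    then show ?thesis by simp
  qed
  show ?thesis
    unfolding lam_def
  proof (rule fourier_ode[OF proj, where \<psi> = \<psi> and u = ?u and g = "%s. nl ?v (?u s)"])
    show "torus_continuous (?u s)" "\<psi> s x = ?u s (transpose P *v x)" "norm (?u s y) <= B" if "s \<in> {0..T}" for s x y
      using pu[OF that] wiener_le_norm[OF uB[OF that]] by auto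
    show "torus_continuous (nl ?v (?u s))" "norm (nl ?v (?u s) y) <= (K + \<bar>\<theta>\<bar> * (B * B)) * B" if "s \<in> {0..T}" for s y
      using wiener_le_norm[OF nB[OF that]] wiener_torus_continuous[OF wiener_leD(1)[OF nB[OF that]]] by auto
    show "(%s. \<psi> s x) differentiable (at s within {0..T})" "partial_differentiable j (\<psi> s)"
      "partial_differentiable j (partial j (\<psi> s))" if "s \<in> {0..T}" for x s j
      using nls that by (auto simp: NLS_solution_def)
    show "continuous_on ({0..T} \<times> UNIV) (%(t, x). vector_derivative (%s. \<psi> s x) (at t within {0..T}))"
      using nls by (simp add: NLS_solution_def)
    show "continuous_on UNIV (partial j (partial j (\<psi> s)))" if "s \<in> {0..T}" for j s by (rule cont[OF that])
    show "\<i> * vector_derivative (%s. \<psi> s x) (at s within {0..T}) = - laplacian (\<psi> s) x + nl ?v (?u s) (transpose P *v x)"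
      if "s \<in> {0..T}" for x s
    proof -
      have "\<i> * vector_derivative (%s. \<psi> s x) (at s within {0..T}) =
          - laplacian (\<psi> s) x + V x * \<psi> s x + of_real (\<theta> * (cmod (\<psi> s x))\<^sup>2) * \<psi> s x"
        using nls that by (simp add: NLS_solution_def)
      also have "... = - laplacian (\<psi> s) x + (V x + of_real \<theta> * (\<psi> s x * cnj (\<psi> s x))) * \<psi> s x"
        by (simp add: distrib_right flip: complex_norm_square)
      finally show ?thesis by (simp add: nl_def pot_def flip: pV(2) pu(2)[OF that])
    qed
  qed (rule t)
qed

end

theorem theorem3p1:
  fixes P :: "real^'n^'d" and \<theta> T C\<^sub>V C\<^sub>p :: real and \<alpha> :: nat
  assumes "projection_matrix P"
    and "T > 0"
    and "real \<alpha> > max 4 (real CARD('n) / 4)"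
  shows "\<exists>C>0. \<forall>(V :: real^'d \<Rightarrow> complex) (\<psi>0 :: real^'d \<Rightarrow> complex)
            (\<psi> :: real \<Rightarrow> real^'d \<Rightarrow> complex) (M :: nat) (N :: nat).
      (\<forall>x. V x \<in> \<real>) \<longrightarrow>
      quasiperiodic P V \<longrightarrow>
      V \<in> C1_QP P \<longrightarrow>
      parent P V \<in> X_space \<alpha> \<longrightarrow>
      X_norm \<alpha> (parent P V) \<le> C\<^sub>V \<longrightarrow>
      NLS_solution \<theta> T V \<psi>0 \<psi> \<longrightarrow>
      (\<forall>t\<in>{0..T}. quasiperiodic P (\<psi> t)) \<longrightarrow>
      (\<forall>t\<in>{0..T}. parent P (\<psi> t) \<in> X_space \<alpha>) \<longrightarrow>
      (\<forall>t\<in>{0..T}. X_norm \<alpha> (parent P (\<psi> t)) \<le> C\<^sub>p) \<longrightarrow>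
      M \<ge> 1 \<longrightarrow> N \<ge> 1 \<longrightarrow>
      (let \<tau> = T / real M in
        \<forall>m\<le>M. qp_norm (\<lambda>x. strang P \<theta> V \<psi>0 \<tau> N m x - \<psi> (real m * \<tau>) x)
                 \<le> C * (\<tau>\<^sup>2 + 1 / real N ^ \<alpha>))"
proof -
  interpret S: nls_setting P \<alpha> \<theta> T by unfold_locales (fact assms)+
  define A where "A = {(V, \<psi>). (\<forall>x. V x \<in> \<real>) \<and> quasiperiodic P V \<and> parent P V \<in> X_space \<alpha> \<and> X_norm \<alpha> (parent P V) \<le> C\<^sub>V \<and>
    (\<exists>\<psi>0. NLS_solution \<theta> T V \<psi>0 \<psi>) \<and> (\<forall>t\<in>{0..T}. quasiperiodic P (\<psi> t) \<and> parent P (\<psi> t) \<in> X_space \<alpha> \<and> X_norm \<alpha> (parent P (\<psi> t)) \<le> C\<^sub>p)}"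
  have A: "quasiperiodic P (fst p)" "l2_le (\<lambda>k. zw \<alpha> k * norm (fourier_coeff (parent P (fst p)) k)) \<bar>C\<^sub>V\<bar>" "\<And>x. fst p x \<in> \<real>"
    "\<And>s. s \<in> {0..T} \<Longrightarrow> quasiperiodic P (snd p s)"
    "\<And>s. s \<in> {0..T} \<Longrightarrow> l2_le (\<lambda>k. zw \<alpha> k * norm (fourier_coeff (parent P (snd p s)) k)) \<bar>C\<^sub>p\<bar>"
    "\<exists>\<psi>0. NLS_solution \<theta> T (fst p) \<psi>0 (snd p)" if "p \<in> A" for p
    using that by (auto simp: A_def intro!: X_norm_l2_le intro: order_trans[OF _ abs_ge_self])
  interpret F: nls_family P \<alpha> \<theta> T A "\<lambda>p. parent P (fst p)" "\<lambda>p s. parent P (snd p s)" "\<bar>C\<^sub>V\<bar>" "\<bar>C\<^sub>p\<bar>"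
  proof
    fix p assume p: "p \<in> A"
    show "wiener (parent P (fst p))" by (rule S.wiener_if_zw[OF quasiperiodic_parent(1)[OF assms(1) A(1)[OF p]] A(2)[OF p]])
    show "l2_le (\<lambda>k. zw \<alpha> k * norm (fourier_coeff (parent P (fst p)) k)) \<bar>C\<^sub>V\<bar>" by (rule A(2)[OF p])
    show "cnj (parent P (fst p) y) = parent P (fst p) y" for y by (rule parent_real[OF assms(1) A(1)[OF p] A(3)[OF p]])
    fix s assume s: "s \<in> {0..T}"
    show "wiener (parent P (snd p s))" by (rule S.wiener_if_zw[OF quasiperiodic_parent(1)[OF assms(1) A(4)[OF p s]] A(5)[OF p s]])
    show "l2_le (\<lambda>k. zw \<alpha> k * norm (fourier_coeff (parent P (snd p s)) k)) \<bar>C\<^sub>p\<bar>" by (rule A(5)[OF p s])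
    obtain \<psi>0 where nls: "NLS_solution \<theta> T (fst p) \<psi>0 (snd p)" using A(6)[OF p] by auto
    show "((\<lambda>r. - \<i> * (of_real (S.lam k) * fourier_coeff (parent P (snd p r)) k +
        fourier_coeff (S.nl (parent P (fst p)) (parent P (snd p r))) k))
      has_integral (fourier_coeff (parent P (snd p s)) k - fourier_coeff (parent P (snd p 0)) k)) {0..s}" for k
      by (rule S.NLS_fourier_ode[OF A(1)[OF p] A(2)[OF p] A(4)[OF p] A(5)[OF p] _ nls s]) auto
  qed auto
  obtain C where C: "C \<ge> 0" and conv: "\<forall>p\<in>A. \<forall>M\<ge>1. \<forall>N\<ge>1. \<forall>m\<le>M.
    l2_le (\<lambda>k. S.num N (T / real M) (parent P (fst p)) (parent P (snd p 0)) m k - fourier_coeff (parent P (snd p (real m * (T / real M)))) k)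
      (C * ((T / real M)\<^sup>2 + 1 / real N ^ \<alpha>))"
    using F.num_converges by blast
  show ?thesis
    unfolding Let_def
  proof (intro exI[of _ "C + 1"] conjI allI impI)
    show "C + 1 > 0" using C by simp
    fix V \<psi>0 :: "real^'d \<Rightarrow> complex" and \<psi> :: "real \<Rightarrow> real^'d \<Rightarrow> complex" and M N m :: nat
    assume V: "\<forall>x. V x \<in> \<real>" "quasiperiodic P V" "parent P V \<in> X_space \<alpha>" "X_norm \<alpha> (parent P V) \<le> C\<^sub>V"
      and nls: "NLS_solution \<theta> T V \<psi>0 \<psi>" and \<psi>: "\<forall>t\<in>{0..T}. quasiperiodic P (\<psi> t)" "\<forall>t\<in>{0..T}. parent P (\<psi> t) \<in> X_space \<alpha>"
        "\<forall>t\<in>{0..T}. X_norm \<alpha> (parent P (\<psi> t)) \<le> C\<^sub>p" and M: "M \<ge> 1" and N: "N \<ge> 1" and m: "m \<le> M"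
    define \<tau> where "\<tau> = T / real M"
    have p: "(V, \<psi>) \<in> A" unfolding A_def using V nls \<psi> by auto
    have s: "real m * \<tau> \<in> {0..T}" using m M assms(2) by (auto simp: \<tau>_def divide_le_eq mult_right_mono)
    have "\<psi> 0 = \<psi>0" using nls by (auto simp: NLS_solution_def)
    let ?a = "S.num N \<tau> (parent P V) (parent P \<psi>0) m" and ?u = "parent P (\<psi> (real m * \<tau>))"
    let ?W = "\<lambda>y. trig_series ?a y - ?u y"
    obtain r where r: "l1_le ?a r" using cutoff_l1[of N ?a] unfolding S.cutoff_num by blast
    have wu: "wiener ?u" using F.u_wiener[OF p s] by simp
    have W: "wiener ?W" "fourier_coeff ?W = (\<lambda>k. ?a k - fourier_coeff ?u k)"
      using wiener_diff[OF wiener_trig_series(1)[OF r] wu] by (simp_all add: wiener_trig_series(2)[OF r])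
    have "l2_le (fourier_coeff ?W) (C * (\<tau>\<^sup>2 + 1 / real N ^ \<alpha>))"
      using conv[rule_format, OF p M N m] unfolding W(2) unfolding \<tau>_def fst_conv snd_conv \<open>\<psi> 0 = \<psi>0\<close> .
    from qp_norm_le[OF assms(1) W(1) this]
    have "qp_norm (\<lambda>x. strang P \<theta> V \<psi>0 \<tau> N m x - \<psi> (real m * \<tau>) x) \<le> C * (\<tau>\<^sup>2 + 1 / real N ^ \<alpha>)"
      using quasiperiodic_parent(2)[OF assms(1) \<psi>(1)[rule_format, OF s]] by (simp add: S.strang_eq_num[OF V(2) N])
    also have "\<dots> \<le> (C + 1) * (\<tau>\<^sup>2 + 1 / real N ^ \<alpha>)" by (intro mult_right_mono) auto
    finally show "qp_norm (\<lambda>x. strang P \<theta> V \<psi>0 (T / real M) N m x - \<psi> (real m * (T / real M)) x) \<le> (C + 1) * ((T / real M)\<^sup>2 + 1 / real N ^ \<alpha>)"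
      unfolding \<tau>_def .
  qed
qed

end
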